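(* Let $p\geq 3$ be an integer. Let $\mu$ be a centered probability measure (i.e. $\int a\,\mu(da)=0$) on the Borel $\sigma$-field of a bounded set $\Lambda\subset\mathbb{R}$, with $\mu\neq\delta_0$. For each $N\geq1$ let $W$ be the symmetric Gaussian $p$-tensor of size $N^p$, let $u=(u_1,\dots,u_N)$ have i.i.d. entries with law $\mu$, independent of $W$, and for $\beta>0$ let $$T=W+\frac{\beta}{N^{(p-1)/2}}u^{\otimes p}.$$ Then there exists a constant $\beta_c>0$ such that (i) if $0<\beta<\beta_c$, then $\lim_{N\to\infty}d_{TV}(W,T)=0$ (detection is impossible); (ii) if $\beta>\beta_c$, then $\lim_{N\to\infty}d_{TV}(W,T)=1$ (detection is possible).
   Context: A $p$-tensor of size $N^p$ is an array $(Y_{i_1,\dots,i_p})_{1\le i_1,\dots,i_p\le N}$; for $u\in\mathbb{R}^N$, $(u^{\otimes p})_{i_1,\dots,i_p}=u_{i_1}\cdots u_{i_p}$. Let $Y$ be a random $p$-tensor with i.i.d. standard Gaussian entries; the symmetric Gaussian $p$-tensor is $W=\frac{1}{p!}\sum_{\pi}Y^{\pi}$, where the sum runs over all permutations $\pi$ of $\{1,\dots,p\}$ and $Y^\pi_{i_1,\dots,i_p}=Y_{i_{\pi(1)},\dots,i_{\pi(p)}}$. For random $p$-tensors $U,V$, $d_{TV}(U,V)=\sup_A|\mathbb{P}(U\in A)-\mathbb{P}(V\in A)|$, the supremum over sets $A$ in the Borel $\sigma$-algebra generated by symmetric $p$-tensors. *)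

theory Defs
  imports "HOL-Probability.Probability" "HOL-Combinatorics.Permutations"
begin

definition tidx :: "nat \<Rightarrow> nat \<Rightarrow> nat list set" where
  "tidx p N = {xs. length xs = p \<and> set xs \<subseteq> {..<N}}"

definition gauss :: "real measure" where
  "gauss = density lborel std_normal_density"

text \<open>Y^pi_{i_1..i_p} = Y_{i_{pi(1)},...,i_{pi(p)}}.\<close>
definition tperm :: "nat \<Rightarrow> (nat \<Rightarrow> nat) \<Rightarrow> nat list \<Rightarrow> nat list" where
  "tperm p \<pi> xs = map (\<lambda>k. xs ! \<pi> k) [0..<p]"

definition symmetrize :: "nat \<Rightarrow> nat \<Rightarrow> (nat list \<Rightarrow> real) \<Rightarrow> (nat list \<Rightarrow> real)" where
  "symmetrize p N Y = (\<lambda>xs\<in>tidx p N.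
      (1 / fact p) * (\<Sum>\<pi>\<in>{\<pi>. \<pi> permutes {..<p}}. Y (tperm p \<pi> xs)))"

definition tensor_space :: "nat \<Rightarrow> nat \<Rightarrow> (nat list \<Rightarrow> real) measure" where
  "tensor_space p N = PiM (tidx p N) (\<lambda>_. borel)"

definition law_W :: "nat \<Rightarrow> nat \<Rightarrow> (nat list \<Rightarrow> real) measure" where
  "law_W p N = distr (PiM (tidx p N) (\<lambda>_. gauss)) (tensor_space p N) (symmetrize p N)"

definition law_T :: "nat \<Rightarrow> real measure \<Rightarrow> real \<Rightarrow> nat \<Rightarrow> (nat list \<Rightarrow> real) measure" where
  "law_T p \<mu> \<beta> N = distr (PiM (tidx p N) (\<lambda>_. gauss) \<Otimes>\<^sub>M PiM {..<N} (\<lambda>_. \<mu>))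
      (tensor_space p N)
      (\<lambda>(Y, u). \<lambda>xs\<in>tidx p N.
          symmetrize p N Y xs + \<beta> / real N powr ((real p - 1) / 2) * (\<Prod>k<p. u (xs ! k)))"

definition dTV :: "'a measure \<Rightarrow> 'a measure \<Rightarrow> real" where
  "dTV P Q = (SUP A\<in>sets P. \<bar>measure P A - measure Q A\<bar>)"

end

theory Submission
  imports Defs
begin

text \<open>
  Since the spike is symmetric, symmetrisation loses no information and one may compare the
  unsymmetrised Gaussian tensor with and without the spike. After scaling the entries into \<open>[-1, 1]\<close> the
  signal-to-noise ratio per entry is \<open>\<lambda> / N\<^sup>p\<^sup>-\<^sup>1\<close>. Let \<open>K N \<lambda>\<close> be the relative entropy of the observation with
  respect to pure noise; its derivative in the signal-to-noise ratio is half the expected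
  sum of the squared posterior means of the entries.

  If \<open>K N \<lambda> / N\<close> tends to \<open>0\<close>, then at every smaller \<open>\<lambda>\<close> the overlap of two posterior samples tends to \<open>0\<close>, and
  the second moment of the likelihood ratio restricted to small overlaps is \<open>1 + o(1)\<close>, because
  \<open>N * R\<^sup>p\<close> is dominated by a small multiple of \<open>N * R\<^sup>2\<close>, which has exponential moments as \<open>\<mu>\<close> is centered;
  so the total variation distance tends to \<open>0\<close>. If \<open>K N \<lambda> \<ge> g * N\<close> with \<open>g > 0\<close>, the log-likelihood ratio, whose
  variance under the alternative is of order \<open>N\<close> by Efron--Stein, separates the two laws. Guerra--Toninelli
  interpolation bounds \<open>K N \<lambda>' / N\<close> by \<open>K n \<lambda> / n + o(1)\<close> for \<open>\<lambda>' < \<lambda>\<close> and \<open>n \<le> N\<close>, so there is no intermediate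
  case and the threshold is \<open>Sup {\<lambda>. K N \<lambda> / N \<longlonglongrightarrow> 0}\<close>. It is positive by a second moment bound and finite by
  Gibbs' inequality with a mixture over sign vectors.

  All increments of \<open>\<lambda>\<close> are finite: an observation at ratio \<open>s + h\<close> is a rotation of two independent ones at ratios
  \<open>s\<close> and \<open>h\<close>, so the second one may be analysed for an arbitrary prior, namely the posterior given the first.
\<close>

section \<open>Product Gaussian measures\<close>

text \<open>Each estimate holds only after \<lambda> has been lowered by a positive amount; a
  threshold defined as a supremum absorbs every such loss. The delicate point is the gap between
  \<open>K N \<lambda> / N\<close> tending to 0 and linear growth: failure of convergence gives
  linear growth only along a subsequence of N, whereas detection is claimed for all large N.
  Interpolation between sizes has to close this gap, and it needs convexity of the p-th power of the
  overlap, which for odd p fails at negative overlaps. Posterior mean overlaps are sums of squares,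
  hence nonnegative, so negative overlaps can only be fluctuations. Fluctuations are measured by
  squared posterior covariances, and the same covariances drive the growth of the posterior
  accuracy, which never exceeds 1. Hence their sum over n slightly perturbed problems is bounded,
  and their average is of order 1/n. The same mechanism, run between two nearby values of \<lambda>,
  bounds the second moment of the overlap when detection is impossible; there the mean overlap alone
  would leave room for cancellation when p is odd.\<close>

lemma sets_gauss [simp, measurable_cong]: "sets gauss = sets borel"
  by (simp add: gauss_def)

lemma space_gauss [simp]: "space gauss = UNIV"
  by (simp add: gauss_def)

lemma prob_space_gauss: "prob_space gauss"
  unfolding gauss_def by (rule prob_space_normal_density) simp

interpretation gauss: prob_space gauss by (rule prob_space_gauss)

interpretation gaussP: product_sigma_finite "\<lambda>_. gauss" by unfold_locales

abbreviation gaussian :: "'i set \<Rightarrow> ('i \<Rightarrow> real) measure"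
  where "gaussian I \<equiv> PiM I (\<lambda>_. gauss)"

lemma prob_space_gaussian: "prob_space (gaussian I)"
  by (intro prob_space_PiM prob_space_gauss)

lemma sets_gaussian [measurable_cong]: "sets (gaussian I) = sets (PiM I (\<lambda>_. borel))"
  by (rule sets_PiM_cong) auto

lemma std_normal_density_shift:
  "std_normal_density (y - t) = std_normal_density y * exp (t * y - t\<^sup>2 / 2)"
  by (simp add: std_normal_density_def exp_add[symmetric] power2_eq_square field_simps)

lemma nn_integral_gauss:
  fixes f :: "real \<Rightarrow> ennreal"
  assumes [measurable]: "f \<in> borel_measurable borel"
  shows "(\<integral>\<^sup>+y. f y \<partial>gauss) = (\<integral>\<^sup>+y. std_normal_density y * f y \<partial>lborel)"
  unfolding gauss_def by (subst nn_integral_density) auto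

lemma gauss_shift:
  fixes f :: "real \<Rightarrow> ennreal"
  assumes [measurable]: "f \<in> borel_measurable borel"
  shows "(\<integral>\<^sup>+y. f (y + t) \<partial>gauss) = (\<integral>\<^sup>+y. exp (t * y - t\<^sup>2 / 2) * f y \<partial>gauss)"
proof -
  have "(\<integral>\<^sup>+y. f (y + t) \<partial>gauss) = (\<integral>\<^sup>+y. std_normal_density y * f (y + t) \<partial>lborel)"
    by (rule nn_integral_gauss) auto
  also have "\<dots> = (\<integral>\<^sup>+y. std_normal_density (y - t) * f y \<partial>lborel)"
    by (subst nn_integral_real_affine[where c=1 and t="-t"]) auto
  also have "\<dots> = (\<integral>\<^sup>+y. std_normal_density y * (exp (t * y - t\<^sup>2 / 2) * f y) \<partial>lborel)"
    by (intro nn_integral_cong) (simp add: std_normal_density_shift ennreal_mult mult.assoc)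
  also have "\<dots> = (\<integral>\<^sup>+y. exp (t * y - t\<^sup>2 / 2) * f y \<partial>gauss)"
    by (rule nn_integral_gauss[symmetric]) auto
  finally show ?thesis .
qed

text \<open>Substituting v = a y + b y' for y' turns the joint density of (y, y') into the standard
  density of v times the conditional density of y given v, which integrates to 1. The substitution
  divides by b, so b = 0 is treated apart; there \<open>0 \<le> a\<close> forces a = 1.\<close>

lemma gauss_rotate:
  fixes f :: "real \<Rightarrow> ennreal"
  assumes [measurable]: "f \<in> borel_measurable borel" and ab: "0 \<le> a" "a\<^sup>2 + b\<^sup>2 = 1"
  shows "(\<integral>\<^sup>+y. \<integral>\<^sup>+y'. f (a * y + b * y') \<partial>gauss \<partial>gauss) = (\<integral>\<^sup>+y. f y \<partial>gauss)"
proof (cases "b = 0")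
  case True
  with ab have "a = 1" by (metis abs_of_nonneg add.right_neutral power_zero_numeral real_sqrt_abs real_sqrt_one)
  with True show ?thesis by (simp add: gauss.emeasure_space_1[unfolded space_gauss])
next
  case b: False
  have norm: "(\<integral>\<^sup>+y. std_normal_density ((y - a * v) / b) / \<bar>b\<bar> \<partial>lborel) = 1" for v
  proof -
    have "(\<integral>\<^sup>+y. std_normal_density ((y - a * v) / b) / \<bar>b\<bar> \<partial>lborel)
        = \<bar>b\<bar> * (\<integral>\<^sup>+y. std_normal_density y / \<bar>b\<bar> \<partial>lborel)"
      using b by (subst nn_integral_real_affine[where c=b and t="a * v"]) auto
    also have "\<dots> = (\<integral>\<^sup>+y. std_normal_density y \<partial>lborel)"
      using b by (subst nn_integral_cmult[symmetric]) (auto simp: ennreal_mult'[symmetric])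
    also have "\<dots> = 1"
      using gauss.emeasure_space_1 nn_integral_gauss[of "\<lambda>_. 1"] by simp
    finally show ?thesis .
  qed
  \<comment> \<open>The form y^2 + y'^2 written in the coordinates (y, v) equals v^2 + ((y - a v) /
    b)^2, by a^2 + b^2 = 1. This exchanges the roles of y and v.\<close>
  have swap: "std_normal_density y * (std_normal_density ((v - a * y) / b) / \<bar>b\<bar>)
      = std_normal_density v * (std_normal_density ((y - a * v) / b) / \<bar>b\<bar>)" for y v
  proof -
    have "y\<^sup>2 + ((v - a * y) / b)\<^sup>2 = v\<^sup>2 + ((y - a * v) / b)\<^sup>2"
    proof -
      have "b\<^sup>2 * y\<^sup>2 + (v - a * y)\<^sup>2 = b\<^sup>2 * v\<^sup>2 + (y - a * v)\<^sup>2"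
      proof -
        have b2: "b\<^sup>2 = 1 - a\<^sup>2" using ab by simp
        show ?thesis unfolding b2 by algebra
      qed
      thus ?thesis using b by (simp add: field_simps power_divide)
    qed
    hence "- y\<^sup>2 / 2 - ((v - a * y) / b)\<^sup>2 / 2 = - v\<^sup>2 / 2 - ((y - a * v) / b)\<^sup>2 / 2" by linarith
    hence "exp (- y\<^sup>2 / 2) * exp (- ((v - a * y) / b)\<^sup>2 / 2) = exp (- v\<^sup>2 / 2) * exp (- ((y - a * v) / b)\<^sup>2 / 2)"
      by (simp add: exp_add[symmetric])
    thus ?thesis by (simp add: std_normal_density_def)
  qed
  have "(\<integral>\<^sup>+y. \<integral>\<^sup>+y'. f (a * y + b * y') \<partial>gauss \<partial>gauss)
      = (\<integral>\<^sup>+y. std_normal_density y * (\<integral>\<^sup>+y'. std_normal_density y' * f (a * y + b * y') \<partial>lborel) \<partial>lborel)"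
    by (subst nn_integral_gauss, measurable) (subst nn_integral_gauss, auto)
  also have "\<dots> = (\<integral>\<^sup>+y. std_normal_density y * (\<integral>\<^sup>+v. (std_normal_density ((v - a * y) / b) / \<bar>b\<bar>) * f v \<partial>lborel) \<partial>lborel)"
  proof (rule nn_integral_cong, rule arg_cong2[where f="(*)"], rule refl)
    fix y
    have "(\<integral>\<^sup>+v. (std_normal_density ((v - a * y) / b) / \<bar>b\<bar>) * f v \<partial>lborel)
       = \<bar>b\<bar> * (\<integral>\<^sup>+y'. (std_normal_density y' / \<bar>b\<bar>) * f (a * y + b * y') \<partial>lborel)"
      using b by (subst nn_integral_real_affine[where c=b and t="a * y"]) auto
    also have "\<dots> = (\<integral>\<^sup>+y'. std_normal_density y' * f (a * y + b * y') \<partial>lborel)"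
      using b by (subst nn_integral_cmult[symmetric]) (auto simp: ennreal_mult'[symmetric] mult.assoc[symmetric])
    finally show "(\<integral>\<^sup>+y'. std_normal_density y' * f (a * y + b * y') \<partial>lborel)
      = (\<integral>\<^sup>+v. (std_normal_density ((v - a * y) / b) / \<bar>b\<bar>) * f v \<partial>lborel)" by (rule sym)
  qed
  also have "\<dots> = (\<integral>\<^sup>+y. \<integral>\<^sup>+v. ennreal (std_normal_density v * (std_normal_density ((y - a * v) / b) / \<bar>b\<bar>)) * f v \<partial>lborel \<partial>lborel)"
    by (subst nn_integral_cmult[symmetric], measurable)
       (simp add: ennreal_mult'[symmetric] mult.assoc[symmetric] swap[symmetric] del: times_divide_eq_right)
  also have "\<dots> = (\<integral>\<^sup>+v. \<integral>\<^sup>+y. ennreal (std_normal_density v * (std_normal_density ((y - a * v) / b) / \<bar>b\<bar>)) * f v \<partial>lborel \<partial>lborel)"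
    by (rule lborel_pair.Fubini') measurable
  also have "\<dots> = (\<integral>\<^sup>+v. std_normal_density v * f v * (\<integral>\<^sup>+y. std_normal_density ((y - a * v) / b) / \<bar>b\<bar> \<partial>lborel) \<partial>lborel)"
    by (subst nn_integral_cmult[symmetric], measurable)
       (simp add: ennreal_mult mult_ac del: times_divide_eq_right times_divide_eq_left)
  also have "\<dots> = (\<integral>\<^sup>+y. f y \<partial>gauss)"
    by (simp add: norm nn_integral_gauss)
  finally show ?thesis .
qed

lemma measurable_insert_upd [measurable (raw)]:
  assumes "u \<in> M \<rightarrow>\<^sub>M PiM I (\<lambda>_. borel)" and "w \<in> M \<rightarrow>\<^sub>M borel"
  shows "(\<lambda>z. (u z)(i := w z)) \<in> M \<rightarrow>\<^sub>M PiM (insert i I) (\<lambda>_. borel)"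
  using assms by (intro measurable_fun_upd[where J=I]) auto

text \<open>The noise coordinates are independent, so the one-dimensional shift formula
  \<open>gauss_shift\<close> is applied to one coordinate at a time and the exponents add
  up.\<close>

lemma cameron_martin:
  fixes t :: "'i \<Rightarrow> real" and f :: "('i \<Rightarrow> real) \<Rightarrow> ennreal"
  assumes "finite I" and "f \<in> borel_measurable (PiM I (\<lambda>_. borel))"
  shows "(\<integral>\<^sup>+y. f (\<lambda>j\<in>I. y j + t j) \<partial>gaussian I)
       = (\<integral>\<^sup>+y. exp (\<Sum>j\<in>I. t j * y j - (t j)\<^sup>2 / 2) * f y \<partial>gaussian I)"
  using assms
proof (induction I arbitrary: f rule: finite_induct)
  case empty
  show ?case by (simp add: gaussP.nn_integral_empty prob_space.emeasure_space_1[OF prob_space_gaussian])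
next
  case (insert i I)
  note [measurable] = insert.prems
  note [simp] = insert.hyps
  have [measurable]: "(\<lambda>x. f (x(i := v))) \<in> borel_measurable (PiM I (\<lambda>_. borel))" for v
    by measurable
  have [measurable]: "case_prod (\<lambda>x v. f (x(i := v))) \<in> borel_measurable (PiM I (\<lambda>_. borel) \<Otimes>\<^sub>M borel)"
    by measurable
  have upd: "(\<lambda>j\<in>insert i I. (x(i := v)) j + t j) = (\<lambda>j\<in>I. x j + t j)(i := v + t i)" for x v
    using insert.hyps by (auto simp: fun_eq_iff)
  have ex: "(\<Sum>j\<in>insert i I. t j * (x(i := v)) j - (t j)\<^sup>2 / 2)
     = (\<Sum>j\<in>I. t j * x j - (t j)\<^sup>2 / 2) + (t i * v - (t i)\<^sup>2 / 2)" for x v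
  proof -
    have "(\<Sum>j\<in>I. t j * (x(i := v)) j - (t j)\<^sup>2 / 2) = (\<Sum>j\<in>I. t j * x j - (t j)\<^sup>2 / 2)"
      using insert.hyps by (intro sum.cong) auto
    thus ?thesis using insert.hyps by simp
  qed
  have "(\<integral>\<^sup>+y. f (\<lambda>j\<in>insert i I. y j + t j) \<partial>gaussian (insert i I))
     = (\<integral>\<^sup>+x. \<integral>\<^sup>+v. f ((\<lambda>j\<in>I. x j + t j)(i := v + t i)) \<partial>gauss \<partial>gaussian I)"
    by (subst gaussP.product_nn_integral_insert) (simp_all only: upd insert.hyps, measurable)
  also have "\<dots> = (\<integral>\<^sup>+x. \<integral>\<^sup>+v. exp (t i * v - (t i)\<^sup>2 / 2) * f ((\<lambda>j\<in>I. x j + t j)(i := v)) \<partial>gauss \<partial>gaussian I)"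
  proof (rule nn_integral_cong)
    fix x :: "'i \<Rightarrow> real"
    have "(\<lambda>j\<in>I. x j + t j) \<in> space (PiM I (\<lambda>_. borel))" by (simp add: space_PiM)
    thus "(\<integral>\<^sup>+v. f ((\<lambda>j\<in>I. x j + t j)(i := v + t i)) \<partial>gauss)
      = (\<integral>\<^sup>+v. exp (t i * v - (t i)\<^sup>2 / 2) * f ((\<lambda>j\<in>I. x j + t j)(i := v)) \<partial>gauss)"
      by (intro gauss_shift[where f="\<lambda>v. f ((\<lambda>j\<in>I. x j + t j)(i := v))"]) measurable
  qed
  also have "\<dots> = (\<integral>\<^sup>+x. exp (\<Sum>j\<in>I. t j * x j - (t j)\<^sup>2 / 2) *
      (\<integral>\<^sup>+v. exp (t i * v - (t i)\<^sup>2 / 2) * f (x(i := v)) \<partial>gauss) \<partial>gaussian I)"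
    by (rule insert.IH) measurable
  also have "\<dots> = (\<integral>\<^sup>+x. \<integral>\<^sup>+v. exp (\<Sum>j\<in>insert i I. t j * (x(i := v)) j - (t j)\<^sup>2 / 2) * f (x(i := v)) \<partial>gauss \<partial>gaussian I)"
  proof (rule nn_integral_cong)
    fix x assume "x \<in> space (gaussian I)"
    hence [measurable]: "x \<in> space (PiM I (\<lambda>_. borel))" by (simp add: space_PiM)
    show "exp (\<Sum>j\<in>I. t j * x j - (t j)\<^sup>2 / 2) *
        (\<integral>\<^sup>+v. exp (t i * v - (t i)\<^sup>2 / 2) * f (x(i := v)) \<partial>gauss)
      = (\<integral>\<^sup>+v. exp (\<Sum>j\<in>insert i I. t j * (x(i := v)) j - (t j)\<^sup>2 / 2) * f (x(i := v)) \<partial>gauss)"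
      unfolding ex by (subst nn_integral_cmult[symmetric]) (measurable, simp add: exp_add ennreal_mult mult.assoc)
  qed
  also have "\<dots> = (\<integral>\<^sup>+y. exp (\<Sum>j\<in>insert i I. t j * y j - (t j)\<^sup>2 / 2) * f y \<partial>gaussian (insert i I))"
    by (subst gaussP.product_nn_integral_insert) (simp_all only: insert.hyps, measurable)
  finally show ?case .
qed

section \<open>Rotations of pairs of independent noise vectors\<close>

definition comb :: "'i set \<Rightarrow> ('i \<Rightarrow> real) \<Rightarrow> ('i \<Rightarrow> real) \<Rightarrow> ('i \<Rightarrow> real) \<Rightarrow> ('i \<Rightarrow> real) \<Rightarrow> 'i \<Rightarrow> real"
  where "comb I a b y y' = (\<lambda>j\<in>I. a j * y j + b j * y' j)"

lemma measurable_comb [measurable (raw)]: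
  assumes "f \<in> M \<rightarrow>\<^sub>M PiM I (\<lambda>_. borel)" and "g \<in> M \<rightarrow>\<^sub>M PiM I (\<lambda>_. borel)"
  shows "(\<lambda>x. comb I a b (f x) (g x)) \<in> M \<rightarrow>\<^sub>M PiM I (\<lambda>_. borel)"
  unfolding comb_def using assms by measurable

text \<open>Induction on the coordinates with \<open>gauss_rotate\<close>. In the step the two
  noises of the new coordinate are separated by the integral over the old coordinates of the second
  vector; Fubini brings them together.\<close>

lemma nn_integral_gaussian_rotate:
  fixes a b :: "'i \<Rightarrow> real" and f :: "('i \<Rightarrow> real) \<Rightarrow> ennreal"
  assumes "finite I" and "f \<in> borel_measurable (PiM I (\<lambda>_. borel))"
    and ab: "\<And>j. 0 \<le> a j" "\<And>j. (a j)\<^sup>2 + (b j)\<^sup>2 = 1"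
  shows "(\<integral>\<^sup>+y. \<integral>\<^sup>+y'. f (comb I a b y y') \<partial>gaussian I \<partial>gaussian I) = (\<integral>\<^sup>+y. f y \<partial>gaussian I)"
  using assms(1,2)
proof (induction I arbitrary: f rule: finite_induct)
  case empty
  show ?case by (simp add: gaussP.nn_integral_empty prob_space.emeasure_space_1[OF prob_space_gaussian] comb_def)
next
  case (insert i I)
  note [measurable] = insert.prems
  note [simp] = insert.hyps
  have [measurable]: "case_prod (\<lambda>x v. f (x(i := v))) \<in> borel_measurable (PiM I (\<lambda>_. borel) \<Otimes>\<^sub>M borel)"
    by measurable
  have upd: "comb (insert i I) a b (x(i := v)) (x'(i := v')) = (comb I a b x x')(i := a i * v + b i * v')" for x v x' v'
    using insert.hyps by (auto simp: fun_eq_iff comb_def)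
  have 1: "(\<integral>\<^sup>+y'. f (comb (insert i I) a b y y') \<partial>gaussian (insert i I))
     = (\<integral>\<^sup>+x'. \<integral>\<^sup>+v'. f (comb (insert i I) a b y (x'(i := v'))) \<partial>gauss \<partial>gaussian I)"
    if y: "y \<in> space (PiM (insert i I) (\<lambda>_. borel))" for y
    by (rule gaussP.product_nn_integral_insert[OF insert.hyps]) (use y in measurable)
  interpret gI: prob_space "gaussian I" by (rule prob_space_gaussian)
  have m1[measurable]: "(\<lambda>(x,v). \<integral>\<^sup>+x'. \<integral>\<^sup>+v'. f ((comb I a b x x')(i := a i * v + b i * v')) \<partial>gauss \<partial>gaussian I)
      \<in> borel_measurable (gaussian I \<Otimes>\<^sub>M gauss)"
    by measurable
  have "(\<integral>\<^sup>+y. \<integral>\<^sup>+y'. f (comb (insert i I) a b y y') \<partial>gaussian (insert i I) \<partial>gaussian (insert i I))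
     = (\<integral>\<^sup>+y. \<integral>\<^sup>+x'. \<integral>\<^sup>+v'. f (comb (insert i I) a b y (x'(i := v'))) \<partial>gauss \<partial>gaussian I \<partial>gaussian (insert i I))"
    by (intro nn_integral_cong 1) (simp add: space_PiM)
  also have "\<dots> = (\<integral>\<^sup>+x. \<integral>\<^sup>+v. \<integral>\<^sup>+x'. \<integral>\<^sup>+v'. f ((comb I a b x x')(i := a i * v + b i * v')) \<partial>gauss \<partial>gaussian I \<partial>gauss \<partial>gaussian I)"
    by (subst gaussP.product_nn_integral_insert) (simp_all only: insert.hyps upd, measurable)
  also have "\<dots> = (\<integral>\<^sup>+x. \<integral>\<^sup>+x'. \<integral>\<^sup>+v. \<integral>\<^sup>+v'. f ((comb I a b x x')(i := a i * v + b i * v')) \<partial>gauss \<partial>gauss \<partial>gaussian I \<partial>gaussian I)"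
  proof (rule nn_integral_cong)
    fix x assume "x \<in> space (gaussian I)"
    hence [measurable]: "x \<in> space (PiM I (\<lambda>_. borel))" by (simp add: space_PiM)
    interpret pair_sigma_finite gauss "gaussian I" by unfold_locales
    show "(\<integral>\<^sup>+v. \<integral>\<^sup>+x'. \<integral>\<^sup>+v'. f ((comb I a b x x')(i := a i * v + b i * v')) \<partial>gauss \<partial>gaussian I \<partial>gauss)
        = (\<integral>\<^sup>+x'. \<integral>\<^sup>+v. \<integral>\<^sup>+v'. f ((comb I a b x x')(i := a i * v + b i * v')) \<partial>gauss \<partial>gauss \<partial>gaussian I)"
      by (intro Fubini'[symmetric]) measurable
  qed
  also have "\<dots> = (\<integral>\<^sup>+x. \<integral>\<^sup>+x'. \<integral>\<^sup>+v. f ((comb I a b x x')(i := v)) \<partial>gauss \<partial>gaussian I \<partial>gaussian I)"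
  proof (rule nn_integral_cong, rule nn_integral_cong)
    fix x x' :: "'i \<Rightarrow> real"
    assume x: "x \<in> space (gaussian I)" "x' \<in> space (gaussian I)"
    hence "comb I a b x x' \<in> space (PiM I (\<lambda>_. borel))" by (simp add: comb_def space_PiM)
    thus "(\<integral>\<^sup>+v. \<integral>\<^sup>+v'. f ((comb I a b x x')(i := a i * v + b i * v')) \<partial>gauss \<partial>gauss)
      = (\<integral>\<^sup>+v. f ((comb I a b x x')(i := v)) \<partial>gauss)"
      by (intro gauss_rotate[where f="\<lambda>v. f ((comb I a b x x')(i := v))"] ab) measurable
  qed
  also have "\<dots> = (\<integral>\<^sup>+x. \<integral>\<^sup>+v. f (x(i := v)) \<partial>gauss \<partial>gaussian I)"
    by (rule insert.IH[where f="\<lambda>z. \<integral>\<^sup>+v. f (z(i := v)) \<partial>gauss"]) measurable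
  also have "\<dots> = (\<integral>\<^sup>+y. f y \<partial>gaussian (insert i I))"
    by (rule gaussP.product_nn_integral_insert[symmetric]) auto
  finally show ?case .
qed


lemma distr_comb:
  fixes a b :: "'i \<Rightarrow> real"
  assumes "finite I" and ab: "\<And>j. 0 \<le> a j" "\<And>j. (a j)\<^sup>2 + (b j)\<^sup>2 = 1"
  shows "distr (gaussian I \<Otimes>\<^sub>M gaussian I) (gaussian I) (\<lambda>(y, y'). comb I a b y y') = gaussian I"
proof (rule measure_eqI)
  interpret gI: prob_space "gaussian I" by (rule prob_space_gaussian)
  fix A assume "A \<in> sets (distr (gaussian I \<Otimes>\<^sub>M gaussian I) (gaussian I) (\<lambda>(y, y'). comb I a b y y'))"
  hence A[measurable]: "A \<in> sets (gaussian I)" by simp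
  hence A'[measurable]: "A \<in> sets (PiM I (\<lambda>_. borel))" by (simp add: sets_gaussian)
  have m[measurable]: "(\<lambda>(y, y'). comb I a b y y') \<in> gaussian I \<Otimes>\<^sub>M gaussian I \<rightarrow>\<^sub>M gaussian I"
    by (subst measurable_cong_sets[OF refl sets_gaussian]) measurable
  have "emeasure (distr (gaussian I \<Otimes>\<^sub>M gaussian I) (gaussian I) (\<lambda>(y, y'). comb I a b y y')) A
    = (\<integral>\<^sup>+p. indicator A (case p of (y, y') \<Rightarrow> comb I a b y y') \<partial>(gaussian I \<Otimes>\<^sub>M gaussian I))"
    by (subst nn_integral_indicator[symmetric], simp, subst nn_integral_distr) auto
  also have "\<dots> = (\<integral>\<^sup>+y. \<integral>\<^sup>+y'. indicator A (comb I a b y y') \<partial>gaussian I \<partial>gaussian I)"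
    using measurable_compose[OF m borel_measurable_indicator[OF A, where 'b=ennreal]]
    by (subst gI.nn_integral_fst[symmetric]) auto
  also have "\<dots> = (\<integral>\<^sup>+y. indicator A y \<partial>gaussian I)"
    by (rule nn_integral_gaussian_rotate) (use assms in auto)
  also have "\<dots> = emeasure (gaussian I) A" by simp
  finally show "emeasure (distr (gaussian I \<Otimes>\<^sub>M gaussian I) (gaussian I) (\<lambda>(y, y'). comb I a b y y')) A
    = emeasure (gaussian I) A" .
qed simp

lemma integral_comb:
  fixes g :: "('i \<Rightarrow> real) \<Rightarrow> real"
  assumes "finite I" and ab: "\<And>j. 0 \<le> a j" "\<And>j. (a j)\<^sup>2 + (b j)\<^sup>2 = 1"
    and g: "integrable (gaussian I) g"
  shows "integrable (gaussian I) (\<lambda>y. \<integral>y'. g (comb I a b y y') \<partial>gaussian I)"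
    and "(\<integral>y. \<integral>y'. g (comb I a b y y') \<partial>gaussian I \<partial>gaussian I) = (\<integral>y. g y \<partial>gaussian I)"
proof -
  interpret gI: prob_space "gaussian I" by (rule prob_space_gaussian)
  interpret gII: pair_sigma_finite "gaussian I" "gaussian I" by unfold_locales
  have m[measurable]: "(\<lambda>(y, y'). comb I a b y y') \<in> gaussian I \<Otimes>\<^sub>M gaussian I \<rightarrow>\<^sub>M gaussian I"
    by (subst measurable_cong_sets[OF refl sets_gaussian]) measurable
  note d = distr_comb[OF assms(1,2,3)]
  have int: "integrable (gaussian I \<Otimes>\<^sub>M gaussian I) (\<lambda>p. g (case p of (y, y') \<Rightarrow> comb I a b y y'))"
    using g by (subst integrable_distr_eq[symmetric, where N="gaussian I"]) (auto simp: d)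
  have "(\<integral>p. g (case p of (y, y') \<Rightarrow> comb I a b y y') \<partial>(gaussian I \<Otimes>\<^sub>M gaussian I)) = (\<integral>y. g y \<partial>gaussian I)"
    using g by (subst integral_distr[symmetric, where N="gaussian I"]) (auto simp: d)
  thus "(\<integral>y. \<integral>y'. g (comb I a b y y') \<partial>gaussian I \<partial>gaussian I) = (\<integral>y. g y \<partial>gaussian I)"
    using gII.integral_fst'[OF int] by simp
  show "integrable (gaussian I) (\<lambda>y. \<integral>y'. g (comb I a b y y') \<partial>gaussian I)"
    using gII.integrable_fst'[OF int] by simp
qed

text \<open>Growth at most exponential in the l1 norm. The class contains likelihoods, evidences,
  their logarithms and posterior means, is closed under sums, products and powers, and implies
  integrability for the Gaussian product measure; most integrability conditions below are discharged
  through it.\<close>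

definition exp_bounded :: "'i set \<Rightarrow> (('i \<Rightarrow> real) \<Rightarrow> real) \<Rightarrow> bool"
  where "exp_bounded I g \<longleftrightarrow> g \<in> borel_measurable (PiM I (\<lambda>_. borel)) \<and>
    (\<exists>C\<ge>0. \<exists>c\<ge>0. \<forall>y\<in>space (PiM I (\<lambda>_. borel)). \<bar>g y\<bar> \<le> C * exp (c * (\<Sum>j\<in>I. \<bar>y j\<bar>)))"

lemma exp_boundedI:
  assumes "g \<in> borel_measurable (PiM I (\<lambda>_. borel))"
    and "\<And>y. y \<in> space (PiM I (\<lambda>_. borel)) \<Longrightarrow> \<bar>g y\<bar> \<le> C * exp (c * (\<Sum>j\<in>I. \<bar>y j\<bar>))"
  shows "exp_bounded I g"
proof -
  have "\<bar>g y\<bar> \<le> max C 0 * exp (max c 0 * (\<Sum>j\<in>I. \<bar>y j\<bar>))" if "y \<in> space (PiM I (\<lambda>_. borel))" for y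
  proof (rule order_trans[OF assms(2)[OF that]], rule mult_mono)
    show "exp (c * (\<Sum>j\<in>I. \<bar>y j\<bar>)) \<le> exp (max c 0 * (\<Sum>j\<in>I. \<bar>y j\<bar>))"
      by (simp add: mult_right_mono sum_nonneg)
  qed auto
  moreover have "0 \<le> max C 0" "0 \<le> max c 0" by auto
  ultimately show ?thesis unfolding exp_bounded_def using assms(1) by blast
qed

lemma exp_boundedE:
  assumes "exp_bounded I g"
  obtains C c where "0 \<le> C" "0 \<le> c"
    "\<And>y. y \<in> space (PiM I (\<lambda>_. borel)) \<Longrightarrow> \<bar>g y\<bar> \<le> C * exp (c * (\<Sum>j\<in>I. \<bar>y j\<bar>))"
  using assms unfolding exp_bounded_def by blast

lemma exp_bounded_measurable [measurable_dest]:
  "exp_bounded I g \<Longrightarrow> g \<in> borel_measurable (PiM I (\<lambda>_. borel))"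
  by (simp add: exp_bounded_def)

lemma exp_bounded_const: "exp_bounded I (\<lambda>_. k)"
  by (rule exp_boundedI[where C="\<bar>k\<bar>" and c=0]) auto

lemma exp_bounded_component:
  assumes "finite I" "j \<in> I" shows "exp_bounded I (\<lambda>y. y j)"
proof (rule exp_boundedI[where C=1 and c=1])
  fix y :: "'a \<Rightarrow> real"
  have "\<bar>y j\<bar> \<le> (\<Sum>j\<in>I. \<bar>y j\<bar>)" using assms by (intro member_le_sum) auto
  also have "\<dots> \<le> exp (\<Sum>j\<in>I. \<bar>y j\<bar>)" using exp_ge_add_one_self[of "\<Sum>j\<in>I. \<bar>y j\<bar>"] by linarith
  finally show "\<bar>y j\<bar> \<le> 1 * exp (1 * (\<Sum>j\<in>I. \<bar>y j\<bar>))" by simp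
qed (use assms in measurable)

lemma exp_bounded_mult:
  assumes f: "exp_bounded I f" and g: "exp_bounded I g" shows "exp_bounded I (\<lambda>y. f y * g y)"
proof -
  note [measurable] = f g
  obtain C c where 1: "0 \<le> C" "0 \<le> c" "\<And>y. y \<in> space (PiM I (\<lambda>_. borel)) \<Longrightarrow> \<bar>f y\<bar> \<le> C * exp (c * (\<Sum>j\<in>I. \<bar>y j\<bar>))"
    by (rule exp_boundedE[OF f]) blast
  obtain D d where 2: "0 \<le> D" "0 \<le> d" "\<And>y. y \<in> space (PiM I (\<lambda>_. borel)) \<Longrightarrow> \<bar>g y\<bar> \<le> D * exp (d * (\<Sum>j\<in>I. \<bar>y j\<bar>))"
    by (rule exp_boundedE[OF g]) blast
  show ?thesis
  proof (rule exp_boundedI[where C="C * D" and c="c + d"])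
    fix y assume y: "y \<in> space (PiM I (\<lambda>_. borel :: real measure))"
    have "\<bar>f y * g y\<bar> \<le> (C * exp (c * (\<Sum>j\<in>I. \<bar>y j\<bar>))) * (D * exp (d * (\<Sum>j\<in>I. \<bar>y j\<bar>)))"
      unfolding abs_mult by (intro mult_mono 1 2 y) (use 1(1) in auto)
    thus "\<bar>f y * g y\<bar> \<le> C * D * exp ((c + d) * (\<Sum>j\<in>I. \<bar>y j\<bar>))"
      by (simp add: ring_distribs exp_add mult_ac)
  qed measurable
qed

lemma exp_bounded_add:
  assumes f: "exp_bounded I f" and g: "exp_bounded I g" shows "exp_bounded I (\<lambda>y. f y + g y)"
proof -
  note [measurable] = f g
  obtain C c where 1: "0 \<le> C" "0 \<le> c" "\<And>y. y \<in> space (PiM I (\<lambda>_. borel)) \<Longrightarrow> \<bar>f y\<bar> \<le> C * exp (c * (\<Sum>j\<in>I. \<bar>y j\<bar>))"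
    by (rule exp_boundedE[OF f]) blast
  obtain D d where 2: "0 \<le> D" "0 \<le> d" "\<And>y. y \<in> space (PiM I (\<lambda>_. borel)) \<Longrightarrow> \<bar>g y\<bar> \<le> D * exp (d * (\<Sum>j\<in>I. \<bar>y j\<bar>))"
    by (rule exp_boundedE[OF g]) blast
  show ?thesis
  proof (rule exp_boundedI[where C="C + D" and c="c + d"])
    fix y assume y: "y \<in> space (PiM I (\<lambda>_. borel :: real measure))"
    have "0 \<le> (\<Sum>j\<in>I. \<bar>y j\<bar>)" by (simp add: sum_nonneg)
    hence "C * exp (c * (\<Sum>j\<in>I. \<bar>y j\<bar>)) \<le> C * exp ((c + d) * (\<Sum>j\<in>I. \<bar>y j\<bar>))"
      "D * exp (d * (\<Sum>j\<in>I. \<bar>y j\<bar>)) \<le> D * exp ((c + d) * (\<Sum>j\<in>I. \<bar>y j\<bar>))"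
      using 1 2 by (auto intro!: mult_left_mono mult_right_mono)
    thus "\<bar>f y + g y\<bar> \<le> (C + D) * exp ((c + d) * (\<Sum>j\<in>I. \<bar>y j\<bar>))"
      using 1(3)[OF y] 2(3)[OF y] by (simp add: ring_distribs)
  qed measurable
qed

lemma exp_bounded_uminus:
  assumes f: "exp_bounded I f" shows "exp_bounded I (\<lambda>y. - f y)"
  using exp_bounded_mult[OF exp_bounded_const[of I "-1"] f] by simp

lemma exp_bounded_diff:
  assumes f: "exp_bounded I f" and g: "exp_bounded I g" shows "exp_bounded I (\<lambda>y. f y - g y)"
  using exp_bounded_add[OF f exp_bounded_uminus[OF g]] by simp

lemma exp_bounded_power:
  assumes f: "exp_bounded I f" shows "exp_bounded I (\<lambda>y. f y ^ k)"
  by (induction k) (use f in \<open>auto intro: exp_bounded_const exp_bounded_mult\<close>)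

lemma exp_bounded_sum:
  "(\<And>k. k \<in> K \<Longrightarrow> exp_bounded I (f k)) \<Longrightarrow> exp_bounded I (\<lambda>y. \<Sum>k\<in>K. f k y)"
  by (induction K rule: infinite_finite_induct) (auto intro: exp_bounded_const exp_bounded_add)

lemma exp_bounded_mono:
  assumes "f \<in> borel_measurable (PiM I (\<lambda>_. borel))" and g: "exp_bounded I g"
    and "\<And>y. y \<in> space (PiM I (\<lambda>_. borel)) \<Longrightarrow> \<bar>f y\<bar> \<le> \<bar>g y\<bar>"
  shows "exp_bounded I f"
  using g assms(3) unfolding exp_bounded_def
  by (intro conjI assms(1)) (meson order_trans)

lemma exp_bounded_exp_linear:
  assumes "finite I" shows "exp_bounded I (\<lambda>y. exp (\<Sum>j\<in>I. t j * y j - r j))"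
proof (rule exp_boundedI[where C="exp (\<Sum>j\<in>I. \<bar>r j\<bar>)" and c="\<Sum>j\<in>I. \<bar>t j\<bar>"])
  fix y :: "'a \<Rightarrow> real"
  have "(\<Sum>j\<in>I. t j * y j - r j) \<le> (\<Sum>j\<in>I. (\<Sum>j\<in>I. \<bar>t j\<bar>) * \<bar>y j\<bar> + \<bar>r j\<bar>)"
  proof (rule sum_mono)
    fix j assume "j \<in> I"
    hence "\<bar>t j\<bar> \<le> (\<Sum>j\<in>I. \<bar>t j\<bar>)" using assms by (intro member_le_sum) auto
    hence "\<bar>t j\<bar> * \<bar>y j\<bar> \<le> (\<Sum>j\<in>I. \<bar>t j\<bar>) * \<bar>y j\<bar>" by (intro mult_right_mono) auto
    moreover have "t j * y j \<le> \<bar>t j\<bar> * \<bar>y j\<bar>" by (metis abs_ge_self abs_mult)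
    ultimately show "t j * y j - r j \<le> (\<Sum>j\<in>I. \<bar>t j\<bar>) * \<bar>y j\<bar> + \<bar>r j\<bar>" by linarith
  qed
  hence "exp (\<Sum>j\<in>I. t j * y j - r j) \<le> exp ((\<Sum>j\<in>I. \<bar>r j\<bar>) + (\<Sum>j\<in>I. \<bar>t j\<bar>) * (\<Sum>j\<in>I. \<bar>y j\<bar>))"
    by (simp add: sum.distrib sum_distrib_left[symmetric] add.commute)
  thus "\<bar>exp (\<Sum>j\<in>I. t j * y j - r j)\<bar> \<le> exp (\<Sum>j\<in>I. \<bar>r j\<bar>) * exp ((\<Sum>j\<in>I. \<bar>t j\<bar>) * (\<Sum>j\<in>I. \<bar>y j\<bar>))"
    by (simp add: exp_add)
qed (use assms in measurable)

text \<open>The exponential factor turns the standard normal density into the normal density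
  centered at t, so centered moments are those of the standard normal law.\<close>

lemma gauss_tilt_moment:
  "has_bochner_integral gauss (\<lambda>y. exp (t * y - t\<^sup>2 / 2) * (y - t) ^ k) (\<integral>y. std_normal_density y * y ^ k \<partial>lborel)"
proof -
  have eq: "normal_density t 1 y = std_normal_density y * exp (t * y - t\<^sup>2 / 2)" for y
    using std_normal_density_shift[of y t] by (simp add: normal_density_def)
  have int: "integrable lborel (\<lambda>y. std_normal_density y * (exp (t * y - t\<^sup>2 / 2) * (y - t) ^ k))"
    using integrable_normal_moment[of 1 t k] by (simp add: eq mult.assoc)
  have "(\<integral>y. std_normal_density y * (exp (t * y - t\<^sup>2 / 2) * (y - t) ^ k) \<partial>lborel)
     = (\<integral>y. std_normal_density (y - t) * (y - t) ^ k \<partial>lborel)"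
    by (simp add: std_normal_density_shift mult.assoc)
  also have "\<dots> = (\<integral>y. std_normal_density y * y ^ k \<partial>lborel)"
    using lborel_integral_real_affine[of 1 "\<lambda>y. std_normal_density (y - t) * (y - t) ^ k" t] by simp
  finally show ?thesis
    using int unfolding gauss_def has_bochner_integral_iff
    by (auto simp: integrable_density integral_density)
qed

lemma gauss_tilt_0: "has_bochner_integral gauss (\<lambda>y. exp (t * y - t\<^sup>2 / 2)) 1"
  using gauss_tilt_moment[of t 0] integral_std_normal_moment_even[of 0] by simp

lemma gauss_tilt_1: "has_bochner_integral gauss (\<lambda>y. exp (t * y - t\<^sup>2 / 2) * (y - t)) 0"
  using gauss_tilt_moment[of t 1] integral_std_normal_moment_odd[of 0] by simp

lemma gauss_tilt_2: "has_bochner_integral gauss (\<lambda>y. exp (t * y - t\<^sup>2 / 2) * (y - t)\<^sup>2) 1"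
  using gauss_tilt_moment[of t 2] integral_std_normal_moment_even[of 1] by simp

lemma integrable_exp_abs_gauss: "integrable gauss (\<lambda>y. exp (c * \<bar>y\<bar>))"
proof (rule Bochner_Integration.integrable_bound)
  have "integrable gauss (\<lambda>y. exp (t\<^sup>2 / 2) * exp (t * y - t\<^sup>2 / 2))" for t
    using gauss_tilt_0[of t] by (auto simp: has_bochner_integral_iff)
  hence i: "integrable gauss (\<lambda>y. exp (t * y))" for t by (simp add: exp_add[symmetric])
  show "integrable gauss (\<lambda>y. exp (c * y) + exp ((- c) * y))"
    using i[of c] i[of "-c"] by (rule Bochner_Integration.integrable_add)
  show "AE y in gauss. norm (exp (c * \<bar>y\<bar>)) \<le> norm (exp (c * y) + exp ((- c) * y))"
  proof (rule AE_I2)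
    fix y show "norm (exp (c * \<bar>y\<bar>)) \<le> norm (exp (c * y) + exp ((- c) * y))"
      using exp_gt_zero[of "c * y"] exp_gt_zero[of "- c * y"]
      by (cases "y < 0") (auto simp: abs_if not_less simp del: exp_gt_zero)
  qed
qed (simp add: measurable_cong_sets[OF sets_gauss refl])

lemma exp_bounded_integrable:
  assumes I: "finite I" and g: "exp_bounded I g"
  shows "integrable (gaussian I) g"
proof -
  note [measurable] = g
  obtain C c where 1: "0 \<le> C" "0 \<le> c" "\<And>y. y \<in> space (PiM I (\<lambda>_. borel)) \<Longrightarrow> \<bar>g y\<bar> \<le> C * exp (c * (\<Sum>j\<in>I. \<bar>y j\<bar>))"
    by (rule exp_boundedE[OF g]) blast
  have "integrable (gaussian I) (\<lambda>y. \<Prod>j\<in>I. exp (c * \<bar>y j\<bar>))"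
    by (rule gaussP.product_integrable_prod[OF I]) (rule integrable_exp_abs_gauss)
  hence "integrable (gaussian I) (\<lambda>y. C * exp (c * (\<Sum>j\<in>I. \<bar>y j\<bar>)))"
    using I by (simp add: exp_sum sum_distrib_left)
  thus ?thesis
  proof (rule Bochner_Integration.integrable_bound)
    show "AE y in gaussian I. norm (g y) \<le> norm (C * exp (c * (\<Sum>j\<in>I. \<bar>y j\<bar>)))"
      using 1 by (intro AE_I2) (auto simp: space_PiM abs_mult)
  qed measurable
qed

lemmas exp_bounded_intros = exp_bounded_const exp_bounded_component exp_bounded_mult
  exp_bounded_add exp_bounded_diff exp_bounded_power exp_bounded_sum

section \<open>Densities of shifted Gaussian measures and their first two moments\<close>

definition tilt :: "'i set \<Rightarrow> ('i \<Rightarrow> real) \<Rightarrow> ('i \<Rightarrow> real) \<Rightarrow> real"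
  where "tilt I t y = exp (\<Sum>j\<in>I. t j * y j - (t j)\<^sup>2 / 2)"

lemma exp_bounded_tilt: "finite I \<Longrightarrow> exp_bounded I (tilt I t)"
  unfolding tilt_def[abs_def] by (rule exp_bounded_exp_linear)

lemma tilt_prod: "finite I \<Longrightarrow> tilt I t y = (\<Prod>j\<in>I. exp (t j * y j - (t j)\<^sup>2 / 2))"
  by (simp add: tilt_def exp_sum)

lemma integral_tilt:
  assumes "finite I" shows "(\<integral>y. tilt I t y \<partial>gaussian I) = 1"
proof -
  have "(\<integral>y. (\<Prod>j\<in>I. exp (t j * y j - (t j)\<^sup>2 / 2)) \<partial>gaussian I)
      = (\<Prod>j\<in>I. \<integral>y. exp (t j * y - (t j)\<^sup>2 / 2) \<partial>gauss)"
    using gauss_tilt_0 by (intro gaussP.product_integral_prod assms) (auto simp: has_bochner_integral_iff)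
  thus ?thesis using gauss_tilt_0 by (simp add: tilt_prod[OF assms] has_bochner_integral_iff)
qed

lemma integral_tilt_moments:
  assumes I: "finite I" and k: "k \<in> I" "l \<in> I"
  shows "(\<integral>y. tilt I t y * (y k - t k) \<partial>gaussian I) = 0"
    and "(\<integral>y. tilt I t y * ((y k - t k) * (y l - t l)) \<partial>gaussian I) = (if k = l then 1 else 0)"
proof -
  \<comment> \<open>The standard normal moments of orders 0, 1 and 2 are 1, 0 and 1. Both claims are
    instances of one product formula, with exponents e j at most 2.\<close>
  define m where "m e = (if e = 1 then 0 else 1 :: real)" for e :: nat
  have m: "has_bochner_integral gauss (\<lambda>y. exp (t j * y - (t j)\<^sup>2 / 2) * (y - t j) ^ e) (m e)" if "e \<le> 2" for e j
  proof -
    have "e = 0 \<or> e = 1 \<or> e = 2" using that by linarith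
    thus ?thesis using gauss_tilt_0[of "t j"] gauss_tilt_1[of "t j"] gauss_tilt_2[of "t j"]
      by (auto simp: m_def)
  qed
  have gen: "(\<integral>y. tilt I t y * (\<Prod>j\<in>I. (y j - t j) ^ e j) \<partial>gaussian I) = (\<Prod>j\<in>I. m (e j))"
    if e: "\<And>j. e j \<le> 2" for e
  proof -
    have "(\<integral>y. tilt I t y * (\<Prod>j\<in>I. (y j - t j) ^ e j) \<partial>gaussian I)
      = (\<integral>y. (\<Prod>j\<in>I. exp (t j * y j - (t j)\<^sup>2 / 2) * (y j - t j) ^ e j) \<partial>gaussian I)"
      using I by (simp add: tilt_prod prod.distrib)
    also have "\<dots> = (\<Prod>j\<in>I. \<integral>y. exp (t j * y - (t j)\<^sup>2 / 2) * (y - t j) ^ e j \<partial>gauss)"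
      using m[OF e] by (intro gaussP.product_integral_prod I) (auto simp: has_bochner_integral_iff)
    also have "\<dots> = (\<Prod>j\<in>I. m (e j))"
      using m[OF e] by (intro prod.cong) (auto simp: has_bochner_integral_iff)
    finally show ?thesis .
  qed
  have pw: "(\<Prod>j\<in>I. (y j - t j) ^ (if j = k then 1 else 0)) = y k - t k" if "k \<in> I" for y k
    using I that by (simp add: if_distrib[where f="\<lambda>e. _ ^ e"] prod.delta cong: if_cong)
  show "(\<integral>y. tilt I t y * (y k - t k) \<partial>gaussian I) = 0"
    using gen[of "\<lambda>j. if j = k then 1 else 0"] I k pw[OF k(1)]
    by (simp add: m_def)
  have pw2: "(\<Prod>j\<in>I. (y j - t j) ^ ((if j = k then 1 else 0) + (if j = l then 1 else 0))) = (y k - t k) * (y l - t l)" for y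
    unfolding power_add prod.distrib pw[OF k(1)] pw[OF k(2)] ..
  have "(\<Prod>j\<in>I. m ((if j = k then 1 else 0) + (if j = l then 1 else 0))) = (if k = l then 1 else 0)"
  proof (cases "k = l")
    case False
    hence "m ((if k = k then 1 else 0) + (if k = l then 1 else 0)) = 0" by (simp add: m_def)
    hence "(\<Prod>j\<in>I. m ((if j = k then 1 else 0) + (if j = l then 1 else 0))) = 0"
      using I k(1) by (intro prod_zero) auto
    thus ?thesis using False by simp
  qed (auto intro!: prod.neutral simp: m_def)
  thus "(\<integral>y. tilt I t y * ((y k - t k) * (y l - t l)) \<partial>gaussian I) = (if k = l then 1 else 0)"
    using gen[of "\<lambda>j. (if j = k then 1 else 0) + (if j = l then 1 else 0)"] unfolding pw2 by simp
qed

text \<open>Under the density \<open>tilt I t\<close> the variables y j - t j are uncorrelated,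
  centered and of variance 1.\<close>

lemma integral_tilt_affine:
  assumes I: "finite I"
  shows "(\<integral>y. tilt I t y * (d + (\<Sum>j\<in>I. c j * (y j - t j))) \<partial>gaussian I) = d"
    and "(\<integral>y. tilt I t y * (d + (\<Sum>j\<in>I. c j * (y j - t j)))\<^sup>2 \<partial>gaussian I) = d\<^sup>2 + (\<Sum>j\<in>I. (c j)\<^sup>2)"
proof -
  note int = exp_bounded_integrable[OF I]
  have i1: "integrable (gaussian I) (\<lambda>y. tilt I t y * (y j - t j))" if "j \<in> I" for j
    using I that by (intro int exp_bounded_tilt exp_bounded_intros)
  have i2: "integrable (gaussian I) (\<lambda>y. tilt I t y * ((y j - t j) * (y k - t k)))" if "j \<in> I" "k \<in> I" for j k
    using I that by (intro int exp_bounded_tilt exp_bounded_intros)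
  have i0: "integrable (gaussian I) (tilt I t)" using I by (intro int exp_bounded_tilt exp_bounded_intros)
  have L: "(\<integral>y. tilt I t y * (\<Sum>j\<in>I. c j * (y j - t j)) \<partial>gaussian I) = 0"
  proof -
    have "(\<integral>y. tilt I t y * (\<Sum>j\<in>I. c j * (y j - t j)) \<partial>gaussian I)
      = (\<integral>y. (\<Sum>j\<in>I. c j * (tilt I t y * (y j - t j))) \<partial>gaussian I)"
      by (simp add: sum_distrib_left mult_ac)
    also have "\<dots> = (\<Sum>j\<in>I. c j * (\<integral>y. tilt I t y * (y j - t j) \<partial>gaussian I))"
      using i1 by (subst Bochner_Integration.integral_sum) auto
    also have "\<dots> = 0" using I by (intro sum.neutral) (simp add: integral_tilt_moments)
    finally show ?thesis .
  qed
  have iL: "integrable (gaussian I) (\<lambda>y. tilt I t y * (\<Sum>j\<in>I. c j * (y j - t j)))"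
    using I by (intro int exp_bounded_tilt exp_bounded_intros)
  have iQ: "integrable (gaussian I) (\<lambda>y. tilt I t y * (\<Sum>j\<in>I. c j * (y j - t j))\<^sup>2)"
    using I by (intro int exp_bounded_tilt exp_bounded_intros)
  have Q: "(\<integral>y. tilt I t y * (\<Sum>j\<in>I. c j * (y j - t j))\<^sup>2 \<partial>gaussian I) = (\<Sum>j\<in>I. (c j)\<^sup>2)"
  proof -
    have "(\<integral>y. tilt I t y * (\<Sum>j\<in>I. c j * (y j - t j))\<^sup>2 \<partial>gaussian I)
      = (\<integral>y. (\<Sum>j\<in>I. \<Sum>k\<in>I. (c j * c k) * (tilt I t y * ((y j - t j) * (y k - t k)))) \<partial>gaussian I)"
      by (intro Bochner_Integration.integral_cong refl)
         (simp add: power2_eq_square sum_product sum_distrib_left mult_ac)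
    also have "\<dots> = (\<Sum>j\<in>I. \<Sum>k\<in>I. (c j * c k) * (\<integral>y. tilt I t y * ((y j - t j) * (y k - t k)) \<partial>gaussian I))"
    proof (subst Bochner_Integration.integral_sum)
      show "integrable (gaussian I) (\<lambda>y. \<Sum>k\<in>I. (c j * c k) * (tilt I t y * ((y j - t j) * (y k - t k))))" if "j \<in> I" for j
        using i2 that by (intro Bochner_Integration.integrable_sum) auto
      show "(\<Sum>j\<in>I. \<integral>y. (\<Sum>k\<in>I. (c j * c k) * (tilt I t y * ((y j - t j) * (y k - t k)))) \<partial>gaussian I)
        = (\<Sum>j\<in>I. \<Sum>k\<in>I. (c j * c k) * (\<integral>y. tilt I t y * ((y j - t j) * (y k - t k)) \<partial>gaussian I))"
        using i2 by (intro sum.cong refl) (subst Bochner_Integration.integral_sum, auto)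
    qed
    also have "\<dots> = (\<Sum>j\<in>I. \<Sum>k\<in>I. if j = k then c j * c k else 0)"
      using I by (intro sum.cong refl) (simp add: integral_tilt_moments)
    also have "\<dots> = (\<Sum>j\<in>I. (c j)\<^sup>2)" using I by (simp add: power2_eq_square sum.delta)
    finally show ?thesis .
  qed
  show "(\<integral>y. tilt I t y * (d + (\<Sum>j\<in>I. c j * (y j - t j))) \<partial>gaussian I) = d"
    using i0 iL L by (simp add: ring_distribs integral_tilt[OF I])
  have "(\<integral>y. tilt I t y * (d + (\<Sum>j\<in>I. c j * (y j - t j)))\<^sup>2 \<partial>gaussian I)
    = (\<integral>y. d\<^sup>2 * tilt I t y + (2 * d) * (tilt I t y * (\<Sum>j\<in>I. c j * (y j - t j)))
        + tilt I t y * (\<Sum>j\<in>I. c j * (y j - t j))\<^sup>2 \<partial>gaussian I)"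
    by (intro Bochner_Integration.integral_cong refl) (simp add: power2_eq_square algebra_simps)
  also have "\<dots> = d\<^sup>2 + (\<Sum>j\<in>I. (c j)\<^sup>2)"
    using i0 iL iQ L Q by (simp add: integral_tilt[OF I])
  finally show "(\<integral>y. tilt I t y * (d + (\<Sum>j\<in>I. c j * (y j - t j)))\<^sup>2 \<partial>gaussian I) = d\<^sup>2 + (\<Sum>j\<in>I. (c j)\<^sup>2)" .
qed

section \<open>Gaussian channels\<close>

text \<open>A signal \<open>u\<close> with law \<open>P\<close> is observed through \<open>y j = sqrt (s j) * x j u + noise\<close>, \<open>j \<in> I\<close>.
  Relative to the law of the noise, \<open>lik\<close> is the density of the observation given \<open>u\<close>, \<open>evid\<close> its
  unconditional density, \<open>post\<close> the law of \<open>u\<close> given the observation and \<open>KL\<close> a relative entropy;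
  \<open>acc s f\<close> is the second moment of the conditional expectation of \<open>f\<close>.\<close>

definition lik :: "'i set \<Rightarrow> ('i \<Rightarrow> 'u \<Rightarrow> real) \<Rightarrow> ('i \<Rightarrow> real) \<Rightarrow> ('i \<Rightarrow> real) \<Rightarrow> 'u \<Rightarrow> real"
  where "lik I x s y u = tilt I (\<lambda>j. sqrt (s j) * x j u) y"

definition evid :: "'u measure \<Rightarrow> 'i set \<Rightarrow> ('i \<Rightarrow> 'u \<Rightarrow> real) \<Rightarrow> ('i \<Rightarrow> real) \<Rightarrow> ('i \<Rightarrow> real) \<Rightarrow> real"
  where "evid P I x s y = (\<integral>u. lik I x s y u \<partial>P)"

definition post :: "'u measure \<Rightarrow> 'i set \<Rightarrow> ('i \<Rightarrow> 'u \<Rightarrow> real) \<Rightarrow> ('i \<Rightarrow> real) \<Rightarrow> ('i \<Rightarrow> real) \<Rightarrow> 'u measure"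
  where "post P I x s y = density P (\<lambda>u. ennreal (lik I x s y u / evid P I x s y))"

definition KL :: "'u measure \<Rightarrow> 'i set \<Rightarrow> ('i \<Rightarrow> 'u \<Rightarrow> real) \<Rightarrow> ('i \<Rightarrow> real) \<Rightarrow> real"
  where "KL P I x s = (\<integral>y. evid P I x s y * ln (evid P I x s y) \<partial>gaussian I)"

definition acc :: "'u measure \<Rightarrow> 'i set \<Rightarrow> ('i \<Rightarrow> 'u \<Rightarrow> real) \<Rightarrow> ('i \<Rightarrow> real) \<Rightarrow> ('u \<Rightarrow> real) \<Rightarrow> real"
  where "acc P I x s f = (\<integral>y. evid P I x s y * (\<integral>u. f u \<partial>post P I x s y)\<^sup>2 \<partial>gaussian I)"

definition cov :: "'u measure \<Rightarrow> ('u \<Rightarrow> real) \<Rightarrow> ('u \<Rightarrow> real) \<Rightarrow> real"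
  where "cov Q f g = (\<integral>u. f u * g u \<partial>Q) - (\<integral>u. f u \<partial>Q) * (\<integral>u. g u \<partial>Q)"

text \<open>A bound for the absolute log-likelihood that is the same for all signals in [-1, 1], and
  therefore also bounds the logarithm of the evidence. The summand is sqrt (s j) * |y j| + s j /
  2.\<close>

definition lbound :: "'i set \<Rightarrow> ('i \<Rightarrow> real) \<Rightarrow> ('i \<Rightarrow> real) \<Rightarrow> real"
  where "lbound I s y = (\<Sum>j\<in>I. sqrt (s j) * \<bar>y j\<bar> - (- (s j / 2)))"

lemma tilt_pos: "0 < tilt I t y"
  by (simp add: tilt_def)

lemma ln_tilt: "ln (tilt I t y) = (\<Sum>j\<in>I. t j * y j - (t j)\<^sup>2 / 2)"
  by (simp add: tilt_def)

text \<open>For negative z the product (1 + z + z^2) (1 - z) = 1 - z^3 is at least 1, and 1 - z is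
  at most exp (- z).\<close>

lemma exp_le_quadratic:
  fixes z :: real assumes "z \<le> 1" shows "exp z \<le> 1 + z + z\<^sup>2"
proof (cases "0 \<le> z")
  case True thus ?thesis using assms exp_bound by simp
next
  case False
  have "1 \<le> (1 + z + z\<^sup>2) * (1 - z)"
  proof -
    have "(1 + z + z\<^sup>2) * (1 - z) = 1 + (- z) * z\<^sup>2" by (simp add: power2_eq_square algebra_simps)
    thus ?thesis using False by (simp add: mult_nonpos_nonneg)
  qed
  also have "\<dots> \<le> (1 + z + z\<^sup>2) * exp (- z)"
  proof (rule mult_left_mono)
    show "1 - z \<le> exp (- z)" using exp_ge_add_one_self[of "- z"] by simp
    have "1 + z + z\<^sup>2 = (z + 1 / 2)\<^sup>2 + 3 / 4" by (simp add: power2_eq_square algebra_simps)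
    thus "0 \<le> 1 + z + z\<^sup>2" by (metis add_nonneg_nonneg zero_le_power2 zero_le_divide_iff zero_le_numeral)
  qed
  finally have "1 * exp z \<le> (1 + z + z\<^sup>2) * exp (- z) * exp z" by (rule mult_right_mono) simp
  thus ?thesis by (simp add: mult.assoc exp_add[symmetric])
qed

text \<open>The signal bound is required everywhere and not just almost surely. It then holds for
  every prior, in particular for the posterior laws that replace P below.\<close>

locale channel = prob_space P for P :: "'u measure" +
  fixes I :: "'i set" and x :: "'i \<Rightarrow> 'u \<Rightarrow> real"
  assumes finite_I: "finite I"
    and signal_measurable: "\<And>j. j \<in> I \<Longrightarrow> x j \<in> borel_measurable P"
    and signal_bound: "\<And>j u. j \<in> I \<Longrightarrow> \<bar>x j u\<bar> \<le> 1"
begin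

section \<open>Bounds on likelihood and evidence, and exchange of integrals\<close>

lemmas exp_bounded_integrable' = exp_bounded_integrable[OF finite_I]

lemma lik_pos: "0 < lik I x s y u"
  by (simp add: lik_def tilt_pos)

lemma lik_nonneg: "0 \<le> lik I x s y u"
  using lik_pos by (rule less_imp_le)

lemma lik_measurable_pair [measurable]:
  "(\<lambda>(y, u). lik I x s y u) \<in> borel_measurable (PiM I (\<lambda>_. borel) \<Otimes>\<^sub>M P)"
proof -
  have [measurable]: "j \<in> I \<Longrightarrow> (\<lambda>p. x j (snd p)) \<in> borel_measurable (PiM I (\<lambda>_. borel) \<Otimes>\<^sub>M P)" for j
    using signal_measurable by measurable
  show ?thesis unfolding lik_def tilt_def split_beta by measurable
qed

lemma lik_measurable [measurable]:
  assumes "y \<in> space (PiM I (\<lambda>_. borel))"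
  shows "lik I x s y \<in> borel_measurable P"
  using measurable_Pair2[OF lik_measurable_pair assms] by simp

lemma exp_bounded_lik: "exp_bounded I (\<lambda>y. lik I x s y u)"
  unfolding lik_def using finite_I by (rule exp_bounded_tilt)

lemma abs_ln_lik: 
  assumes s: "\<forall>j. 0 \<le> s j" shows "\<bar>ln (lik I x s y u)\<bar> \<le> lbound I s y"
  unfolding lik_def ln_tilt lbound_def
proof (rule order_trans[OF sum_abs], rule sum_mono)
  fix j assume j: "j \<in> I"
  have "\<bar>x j u\<bar> \<le> 1" using j signal_bound by blast
  hence 1: "\<bar>sqrt (s j) * x j u\<bar> \<le> sqrt (s j)" using s[rule_format, of j] by (simp add: abs_mult mult_left_le)
  hence "\<bar>sqrt (s j) * x j u\<bar>\<^sup>2 \<le> (sqrt (s j))\<^sup>2" by (intro power_mono) auto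
  hence 2: "(sqrt (s j) * x j u)\<^sup>2 \<le> s j" using s[rule_format, of j] by simp
  have 3: "\<bar>sqrt (s j) * x j u * y j\<bar> \<le> sqrt (s j) * \<bar>y j\<bar>"
    using mult_right_mono[OF 1, where c="\<bar>y j\<bar>"] by (simp add: abs_mult)
  have "0 \<le> (sqrt (s j) * x j u)\<^sup>2" by simp
  with 2 3 show "\<bar>sqrt (s j) * x j u * y j - (sqrt (s j) * x j u)\<^sup>2 / 2\<bar> \<le> sqrt (s j) * \<bar>y j\<bar> - (- (s j / 2))"
    by linarith
qed

lemma lik_le: 
  assumes "\<forall>j. 0 \<le> s j" shows "lik I x s y u \<le> exp (lbound I s y)"
proof -
  have "ln (lik I x s y u) \<le> lbound I s y" using abs_ln_lik[OF assms] by (rule abs_le_D1)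
  thus ?thesis using lik_pos exp_le_cancel_iff[of "ln (lik I x s y u)"] by simp
qed

lemma lik_ge: 
  assumes "\<forall>j. 0 \<le> s j" shows "exp (- lbound I s y) \<le> lik I x s y u"
proof -
  have "- lbound I s y \<le> ln (lik I x s y u)" using abs_ln_lik[OF assms, of y u] by linarith
  thus ?thesis using lik_pos exp_le_cancel_iff[of _ "ln (lik I x s y u)"] by simp
qed

lemma integrable_bounded:
  fixes f :: "'u \<Rightarrow> real"
  assumes "f \<in> borel_measurable P" "\<And>u. \<bar>f u\<bar> \<le> K" shows "integrable P f"
  using assms by (intro integrable_const_bound[of _ K]) auto

lemma integrable_lik_mult:
  assumes s: "\<forall>j. 0 \<le> s j" and y: "y \<in> space (PiM I (\<lambda>_. borel))"
    and f: "f \<in> borel_measurable P" "\<And>u. \<bar>f u\<bar> \<le> K"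
  shows "integrable P (\<lambda>u. f u * lik I x s y u)"
proof (rule integrable_bounded)
  note [measurable] = y f(1)
  show "(\<lambda>u. f u * lik I x s y u) \<in> borel_measurable P" by measurable
  show "\<bar>f u * lik I x s y u\<bar> \<le> K * exp (lbound I s y)" for u
    unfolding abs_mult using f(2)[of u] lik_le[OF s] lik_nonneg by (intro mult_mono) auto
qed

lemma integrable_lik:
  assumes s: "\<forall>j. 0 \<le> s j" and y: "y \<in> space (PiM I (\<lambda>_. borel))"
  shows "integrable P (lik I x s y)"
  using integrable_lik_mult[OF s y, of "\<lambda>_. 1" 1] by simp

lemma evid_le:
  assumes s: "\<forall>j. 0 \<le> s j" and y: "y \<in> space (PiM I (\<lambda>_. borel))"
  shows "evid P I x s y \<le> exp (lbound I s y)"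
  unfolding evid_def using integrable_lik[OF s y] lik_le[OF s] by (intro integral_le_const) auto

lemma evid_ge:
  assumes s: "\<forall>j. 0 \<le> s j" and y: "y \<in> space (PiM I (\<lambda>_. borel))"
  shows "exp (- lbound I s y) \<le> evid P I x s y"
  unfolding evid_def using integrable_lik[OF s y] lik_ge[OF s] by (intro integral_ge_const) auto

lemma evid_pos:
  assumes s: "\<forall>j. 0 \<le> s j" and y: "y \<in> space (PiM I (\<lambda>_. borel))"
  shows "0 < evid P I x s y"
  using evid_ge[OF assms] exp_gt_zero less_le_trans by blast

lemma abs_ln_evid:
  assumes s: "\<forall>j. 0 \<le> s j" and y: "y \<in> space (PiM I (\<lambda>_. borel))"
  shows "\<bar>ln (evid P I x s y)\<bar> \<le> lbound I s y"
proof -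
  have "ln (evid P I x s y) \<le> ln (exp (lbound I s y))"
    using evid_le[OF s y] evid_pos[OF s y] by (subst ln_le_cancel_iff) auto
  moreover have "ln (exp (- lbound I s y)) \<le> ln (evid P I x s y)"
    using evid_ge[OF s y] evid_pos[OF s y] by (subst ln_le_cancel_iff) auto
  ultimately show ?thesis by simp
qed

lemma evid_measurable [measurable]: "evid P I x s \<in> borel_measurable (PiM I (\<lambda>_. borel))"
  unfolding evid_def[abs_def] using lik_measurable_pair
  by (intro borel_measurable_lebesgue_integral) simp

lemma exp_bounded_lbound: "exp_bounded I (lbound I s)"
proof -
  have "exp_bounded I (\<lambda>y. \<bar>y j\<bar>)" if "j \<in> I" for j
    using that finite_I by (intro exp_bounded_mono[OF _ exp_bounded_component[OF finite_I that]]) auto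
  thus ?thesis unfolding lbound_def[abs_def] by (intro exp_bounded_intros)
qed

lemma exp_bounded_exp_lbound: "exp_bounded I (\<lambda>y. exp (lbound I s y))"
proof (rule exp_boundedI[where C="exp (\<Sum>j\<in>I. \<bar>s j\<bar> / 2)" and c="\<Sum>j\<in>I. \<bar>sqrt (s j)\<bar>"])
  fix y :: "'i \<Rightarrow> real"
  have "lbound I s y \<le> (\<Sum>j\<in>I. (\<Sum>j\<in>I. \<bar>sqrt (s j)\<bar>) * \<bar>y j\<bar> + \<bar>s j\<bar> / 2)"
    unfolding lbound_def
  proof (rule sum_mono)
    fix j assume "j \<in> I"
    hence "\<bar>sqrt (s j)\<bar> \<le> (\<Sum>j\<in>I. \<bar>sqrt (s j)\<bar>)"
      using finite_I by (intro member_le_sum) auto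
    hence "sqrt (s j) \<le> (\<Sum>j\<in>I. \<bar>sqrt (s j)\<bar>)" by linarith
    hence "sqrt (s j) * \<bar>y j\<bar> \<le> (\<Sum>j\<in>I. \<bar>sqrt (s j)\<bar>) * \<bar>y j\<bar>" by (intro mult_right_mono) auto
    thus "sqrt (s j) * \<bar>y j\<bar> - (- (s j / 2)) \<le> (\<Sum>j\<in>I. \<bar>sqrt (s j)\<bar>) * \<bar>y j\<bar> + \<bar>s j\<bar> / 2" by linarith
  qed
  thus "\<bar>exp (lbound I s y)\<bar> \<le> exp (\<Sum>j\<in>I. \<bar>s j\<bar> / 2) * exp ((\<Sum>j\<in>I. \<bar>sqrt (s j)\<bar>) * (\<Sum>j\<in>I. \<bar>y j\<bar>))"
    by (simp add: sum.distrib sum_distrib_left[symmetric] exp_add[symmetric] add.commute)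
qed (use exp_bounded_measurable[OF exp_bounded_lbound] in measurable)

lemma exp_bounded_evid:
  assumes s: "\<forall>j. 0 \<le> s j" shows "exp_bounded I (evid P I x s)"
proof (rule exp_bounded_mono[OF _ exp_bounded_exp_lbound[of s]])
  show "\<bar>evid P I x s y\<bar> \<le> \<bar>exp (lbound I s y)\<bar>" if "y \<in> space (PiM I (\<lambda>_. borel))" for y
    using evid_le[OF s that] evid_pos[OF s that] by simp
qed measurable

lemma exp_bounded_ln_evid:
  assumes s: "\<forall>j. 0 \<le> s j" shows "exp_bounded I (\<lambda>y. ln (evid P I x s y))"
proof (rule exp_bounded_mono[OF _ exp_bounded_lbound[of s]])
  show "\<bar>ln (evid P I x s y)\<bar> \<le> \<bar>lbound I s y\<bar>" if "y \<in> space (PiM I (\<lambda>_. borel))" for y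
    using abs_ln_evid[OF s that] by simp
qed measurable

text \<open>Fubini with the integrable envelope \<open>b\<close>. For f = 1 it says that integrating
  against the evidence means averaging over the observation given u and then over u, which is the
  form (\<open>evid_swap\<close>) in which it mostly enters.\<close>

lemma channel_swap:
  assumes s: "\<forall>j. 0 \<le> s j" and f: "f \<in> borel_measurable P" "\<And>u. \<bar>f u\<bar> \<le> K" and g: "exp_bounded I g"
  shows "(\<integral>y. (\<integral>u. f u * lik I x s y u \<partial>P) * g y \<partial>gaussian I)
       = (\<integral>u. f u * (\<integral>y. lik I x s y u * g y \<partial>gaussian I) \<partial>P)"
    and "integrable P (\<lambda>u. f u * (\<integral>y. lik I x s y u * g y \<partial>gaussian I))"
proof -
  interpret G: prob_space "gaussian I" by (rule prob_space_gaussian)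
  interpret GP: pair_sigma_finite "gaussian I" P by unfold_locales
  note [measurable] = f(1) exp_bounded_measurable[OF g]
  define b where "b y = K * exp (lbound I s y) * \<bar>g y\<bar>" for y
  have "exp_bounded I (\<lambda>y. \<bar>g y\<bar>)" by (rule exp_bounded_mono[OF _ g]) auto
  hence b: "exp_bounded I b"
    unfolding b_def[abs_def] by (intro exp_bounded_intros exp_bounded_exp_lbound)
  note [measurable] = exp_bounded_measurable[OF b]
  have "integrable (gaussian I \<Otimes>\<^sub>M P) (\<lambda>p. b (fst p) * 1)"
    using exp_bounded_integrable'[OF b] by (intro GP.Fubini_integrable) auto
  hence int: "integrable (gaussian I \<Otimes>\<^sub>M P) (\<lambda>(y, u). f u * lik I x s y u * g y)"
  proof (rule Bochner_Integration.integrable_bound)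
    show "AE p in gaussian I \<Otimes>\<^sub>M P. norm (case p of (y, u) \<Rightarrow> f u * lik I x s y u * g y) \<le> norm (b (fst p) * 1)"
    proof (rule AE_I2, clarsimp)
      fix y u
      have "\<bar>f u\<bar> * lik I x s y u * \<bar>g y\<bar> \<le> K * exp (lbound I s y) * \<bar>g y\<bar>"
        using f(2)[of u] lik_le[OF s] lik_nonneg by (intro mult_mono) auto
      thus "\<bar>f u * lik I x s y u * g y\<bar> \<le> \<bar>b y\<bar>"
        by (simp add: b_def abs_mult lik_nonneg) (smt (verit) abs_ge_zero f(2))
    qed
  qed measurable
  have e1: "(\<integral>u. f u * lik I x s y u * g y \<partial>P) = (\<integral>u. f u * lik I x s y u \<partial>P) * g y" for y
    by simp
  have e2: "(\<integral>y. f u * lik I x s y u * g y \<partial>gaussian I) = f u * (\<integral>y. lik I x s y u * g y \<partial>gaussian I)" for u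
    by (simp add: mult.assoc)
  show "(\<integral>y. (\<integral>u. f u * lik I x s y u \<partial>P) * g y \<partial>gaussian I)
       = (\<integral>u. f u * (\<integral>y. lik I x s y u * g y \<partial>gaussian I) \<partial>P)"
    using GP.Fubini_integral[OF int] by (simp only: e1 e2)
  show "integrable P (\<lambda>u. f u * (\<integral>y. lik I x s y u * g y \<partial>gaussian I))"
    using GP.integrable_snd[OF int] by (simp only: e2)
qed

lemma evid_swap:
  assumes s: "\<forall>j. 0 \<le> s j" and g: "exp_bounded I g"
  shows "(\<integral>y. evid P I x s y * g y \<partial>gaussian I) = (\<integral>u. (\<integral>y. lik I x s y u * g y \<partial>gaussian I) \<partial>P)"
  using channel_swap(1)[OF s, of "\<lambda>_. 1" 1 g] g by (simp add: evid_def)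

lemma integral_lik: "(\<integral>y. lik I x s y u \<partial>gaussian I) = 1"
  by (simp add: lik_def integral_tilt finite_I)

lemma integral_evid:
  assumes s: "\<forall>j. 0 \<le> s j" shows "(\<integral>y. evid P I x s y \<partial>gaussian I) = 1"
  using evid_swap[OF s exp_bounded_const[of I 1]] by (simp add: integral_lik prob_space)

text \<open>Nonnegativity of the relative entropy of the evidence with respect to the subprobability
  density exp g, from ln z \<le> z - 1. Lower bounds on \<open>KL\<close> are obtained by choosing
  g.\<close>

lemma gibbs_inequality:
  assumes s: "\<forall>j. 0 \<le> s j" and g: "exp_bounded I g" and e: "exp_bounded I (\<lambda>y. exp (g y))"
    and 1: "(\<integral>y. exp (g y) \<partial>gaussian I) \<le> 1"
  shows "(\<integral>y. evid P I x s y * g y \<partial>gaussian I) \<le> KL P I x s"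
proof -
  note int = exp_bounded_integrable'
  note ev = exp_bounded_evid[OF s] exp_bounded_ln_evid[OF s]
  have "(\<integral>y. evid P I x s y * g y \<partial>gaussian I) - KL P I x s
     = (\<integral>y. evid P I x s y * g y - evid P I x s y * ln (evid P I x s y) \<partial>gaussian I)"
    unfolding KL_def using ev g by (intro Bochner_Integration.integral_diff[symmetric] int exp_bounded_intros)
  also have "\<dots> \<le> (\<integral>y. exp (g y) - evid P I x s y \<partial>gaussian I)"
  proof (rule integral_mono)
    show "integrable (gaussian I) (\<lambda>y. evid P I x s y * g y - evid P I x s y * ln (evid P I x s y))"
      using ev g by (intro int exp_bounded_intros)
    show "integrable (gaussian I) (\<lambda>y. exp (g y) - evid P I x s y)"
      using ev e by (intro int exp_bounded_intros)
    fix y assume "y \<in> space (gaussian I)"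
    hence p: "0 < evid P I x s y" by (intro evid_pos s) (simp add: space_PiM)
    have "evid P I x s y * (g y - ln (evid P I x s y)) = evid P I x s y * ln (exp (g y) / evid P I x s y)"
      using p by (simp add: ln_div)
    also have "\<dots> \<le> evid P I x s y * (exp (g y) / evid P I x s y - 1)"
      using p by (intro mult_left_mono ln_le_minus_one) auto
    also have "\<dots> = exp (g y) - evid P I x s y" using p by (simp add: field_simps)
    finally show "evid P I x s y * g y - evid P I x s y * ln (evid P I x s y) \<le> exp (g y) - evid P I x s y"
      by (simp add: algebra_simps)
  qed
  also have "\<dots> \<le> 0"
    using 1 int[OF e] int[OF ev(1)] by (simp add: integral_evid[OF s])
  finally show ?thesis by simp
qed

section \<open>First-order expansion of the relative entropy at small ratios\<close>

lemma integral_lik_linear: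
  "(\<integral>y. lik I x s y u * (d + (\<Sum>j\<in>I. c j * y j)) \<partial>gaussian I) = d + (\<Sum>j\<in>I. c j * (sqrt (s j) * x j u))"
proof -
  have "d + (\<Sum>j\<in>I. c j * y j) = (d + (\<Sum>j\<in>I. c j * (sqrt (s j) * x j u))) + (\<Sum>j\<in>I. c j * (y j - sqrt (s j) * x j u))" for y
    by (simp add: right_diff_distrib sum_subtractf)
  note eq = this
  show ?thesis unfolding lik_def by (subst eq) (rule integral_tilt_affine(1)[OF finite_I])
qed

lemma integral_lik_quadratic:
  "(\<integral>y. lik I x s y u * (d + (\<Sum>j\<in>I. c j * y j))\<^sup>2 \<partial>gaussian I)
   = (d + (\<Sum>j\<in>I. c j * (sqrt (s j) * x j u)))\<^sup>2 + (\<Sum>j\<in>I. (c j)\<^sup>2)"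
proof -
  have "d + (\<Sum>j\<in>I. c j * y j) = (d + (\<Sum>j\<in>I. c j * (sqrt (s j) * x j u))) + (\<Sum>j\<in>I. c j * (y j - sqrt (s j) * x j u))" for y
    by (simp add: right_diff_distrib sum_subtractf)
  note eq = this
  show ?thesis unfolding lik_def by (subst eq) (rule integral_tilt_affine(2)[OF finite_I])
qed

lemma exp_bounded_linear: "exp_bounded I (\<lambda>y. d + (\<Sum>j\<in>I. c j * y j))"
  by (intro exp_bounded_intros finite_I)

lemma signal_integrable: "j \<in> I \<Longrightarrow> integrable P (x j)"
  using signal_measurable signal_bound by (intro integrable_bounded[of _ 1]) auto

lemma integral_evid_linear:
  assumes s: "\<forall>j. 0 \<le> s j"
  shows "(\<integral>y. evid P I x s y * (d + (\<Sum>j\<in>I. c j * y j)) \<partial>gaussian I)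
       = d + (\<Sum>j\<in>I. c j * (sqrt (s j) * (\<integral>u. x j u \<partial>P)))"
  using signal_integrable
  by (subst evid_swap[OF s exp_bounded_linear]) (simp add: integral_lik_linear Bochner_Integration.integral_sum prob_space)

text \<open>Gibbs' inequality with the Gaussian density whose shift is the mean of the signal; its
  logarithm is affine in y, so the left side is explicit.\<close>

lemma KL_lower:
  assumes h: "\<forall>j. 0 \<le> h j"
  shows "(\<Sum>j\<in>I. h j * (\<integral>u. x j u \<partial>P)\<^sup>2) / 2 \<le> KL P I x h"
proof -
  define m where "m j = sqrt (h j) * (\<integral>u. x j u \<partial>P)" for j
  define l where "l y = - (\<Sum>j\<in>I. (m j)\<^sup>2 / 2) + (\<Sum>j\<in>I. m j * y j)" for y
  have el: "exp (l y) = tilt I m y" for y by (simp add: l_def tilt_def sum_subtractf)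
  have "(\<integral>y. evid P I x h y * l y \<partial>gaussian I) \<le> KL P I x h"
  proof (rule gibbs_inequality[OF h])
    show "exp_bounded I l" unfolding l_def[abs_def] by (rule exp_bounded_linear)
    show "exp_bounded I (\<lambda>y. exp (l y))" using exp_bounded_tilt[OF finite_I] by (simp add: el)
    show "(\<integral>y. exp (l y) \<partial>gaussian I) \<le> 1" by (simp add: el integral_tilt finite_I)
  qed
  moreover have "(\<integral>y. evid P I x h y * l y \<partial>gaussian I) = (\<Sum>j\<in>I. (m j)\<^sup>2) / 2"
    unfolding l_def integral_evid_linear[OF h] m_def[symmetric]
    by (simp add: power2_eq_square sum_divide_distrib[symmetric])
  moreover have "(m j)\<^sup>2 = h j * (\<integral>u. x j u \<partial>P)\<^sup>2" for j
    using h[rule_format, of j] by (simp add: m_def power_mult_distrib)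
  ultimately show ?thesis by simp
qed

text \<open>Completing the square: relative to noise shifted by m, the likelihoods of the shifts a
  and b have as inner product the exponential of the scalar product of a - m and b - m. The
  remaining factor is again a tilt and integrates to 1.\<close>

lemma tilt_product:
  "tilt I a y * (tilt I b y * exp (- (\<Sum>j\<in>I. m j * y j - (m j)\<^sup>2 / 2)))
   = exp (\<Sum>j\<in>I. (a j - m j) * (b j - m j)) * tilt I (\<lambda>j. a j + b j - m j) y"
proof -
  have "(\<Sum>j\<in>I. (a j * y j - (a j)\<^sup>2 / 2) + (b j * y j - (b j)\<^sup>2 / 2) - (m j * y j - (m j)\<^sup>2 / 2))
      = (\<Sum>j\<in>I. (a j - m j) * (b j - m j) + ((a j + b j - m j) * y j - (a j + b j - m j)\<^sup>2 / 2))"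
    by (intro sum.cong refl) (simp add: power2_eq_square field_simps)
  hence "(\<Sum>j\<in>I. a j * y j - (a j)\<^sup>2 / 2) + ((\<Sum>j\<in>I. b j * y j - (b j)\<^sup>2 / 2)
      + - (\<Sum>j\<in>I. m j * y j - (m j)\<^sup>2 / 2)) = (\<Sum>j\<in>I. (a j - m j) * (b j - m j))
      + (\<Sum>j\<in>I. (a j + b j - m j) * y j - (a j + b j - m j)\<^sup>2 / 2)"
    by (simp only: sum.distrib sum_subtractf)
  thus ?thesis unfolding tilt_def exp_add[symmetric] by simp
qed

text \<open>The relative entropy with respect to the noise shifted by the mean signal is at most the
  corresponding chi-square divergence. The latter is the mean of exp z - 1, where z is the scalar
  product of the centered signals of two independent replicas. As z is centered and |z| \<le> 4 *
  (\<Sum>j\<in>I. h j) \<le> 1, only the quadratic term of \<open>exp_le_quadratic\<close> survives;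
  this gives the constant 16.\<close>

lemma KL_upper:
  assumes h: "\<forall>j. 0 \<le> h j" and H: "4 * (\<Sum>j\<in>I. h j) \<le> 1"
  shows "KL P I x h \<le> (\<Sum>j\<in>I. h j * (\<integral>u. x j u \<partial>P)\<^sup>2) / 2 + 16 * (\<Sum>j\<in>I. h j)\<^sup>2"
proof -
  define m where "m j = sqrt (h j) * (\<integral>u. x j u \<partial>P)" for j
  define w where "w u j = sqrt (h j) * x j u" for u j
  define z where "z u u' = (\<Sum>j\<in>I. (w u j - m j) * (w u' j - m j))" for u u'
  define l where "l y = - (\<Sum>j\<in>I. (m j)\<^sup>2 / 2) + (\<Sum>j\<in>I. m j * y j)" for y
  have l_alt: "l y = (\<Sum>j\<in>I. m j * y j - (m j)\<^sup>2 / 2)" for y by (simp add: l_def sum_subtractf)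
  have bl: "exp_bounded I l" unfolding l_def[abs_def] by (rule exp_bounded_linear)
  have be: "exp_bounded I (\<lambda>y. exp (- l y))"
    using exp_bounded_exp_linear[OF finite_I, of "\<lambda>j. - m j" "\<lambda>j. - ((m j)\<^sup>2 / 2)"]
    by (simp add: l_alt sum_negf[symmetric] sum_subtractf)
  note int = exp_bounded_integrable'
  note ev = exp_bounded_evid[OF h] exp_bounded_ln_evid[OF h]
  have lin: "(\<integral>y. evid P I x h y * l y \<partial>gaussian I) = (\<Sum>j\<in>I. h j * (\<integral>u. x j u \<partial>P)\<^sup>2) / 2"
  proof -
    have "(m j)\<^sup>2 = h j * (\<integral>u. x j u \<partial>P)\<^sup>2" for j
      using h[rule_format, of j] by (simp add: m_def power_mult_distrib)
    moreover have "(\<integral>y. evid P I x h y * l y \<partial>gaussian I) = (\<Sum>j\<in>I. (m j)\<^sup>2) / 2"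
      unfolding l_def integral_evid_linear[OF h] m_def[symmetric]
      by (simp add: power2_eq_square sum_divide_distrib[symmetric])
    ultimately show ?thesis by simp
  qed
  have xm: "\<bar>\<integral>u. x j u \<partial>P\<bar> \<le> 1" if "j \<in> I" for j
  proof -
    have "\<bar>\<integral>u. x j u \<partial>P\<bar> \<le> (\<integral>u. \<bar>x j u\<bar> \<partial>P)" by (rule integral_abs_bound)
    also have "\<dots> \<le> 1" using signal_integrable[OF that] signal_bound[OF that] by (intro integral_le_const) auto
    finally show ?thesis .
  qed
  have wm: "\<bar>w u j - m j\<bar> \<le> 2 * sqrt (h j)" if "j \<in> I" for u j
  proof -
    have "\<bar>w u j - m j\<bar> = sqrt (h j) * \<bar>x j u - (\<integral>u. x j u \<partial>P)\<bar>"
      using h[rule_format, of j] by (simp add: w_def m_def right_diff_distrib[symmetric] abs_mult)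
    also have "\<dots> \<le> sqrt (h j) * 2"
      using xm[OF that] signal_bound[OF that, of u] h[rule_format, of j] by (intro mult_left_mono) auto
    finally show ?thesis by simp
  qed
  have zb: "\<bar>z u u'\<bar> \<le> 4 * (\<Sum>j\<in>I. h j)" for u u'
  proof -
    have "\<bar>z u u'\<bar> \<le> (\<Sum>j\<in>I. (2 * sqrt (h j)) * (2 * sqrt (h j)))"
      unfolding z_def by (rule order_trans[OF sum_abs]) (intro sum_mono, simp only: abs_mult, intro mult_mono wm, auto simp: h)
    also have "\<dots> = 4 * (\<Sum>j\<in>I. h j)"
      by (subst sum_distrib_left, intro sum.cong refl) (use h in \<open>simp add: mult_ac\<close>)
    finally show ?thesis .
  qed
  have w_meas[measurable]: "(\<lambda>u. w u j) \<in> borel_measurable P" if "j \<in> I" for j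
    unfolding w_def using signal_measurable[OF that] by measurable
  have z_meas[measurable]: "z u \<in> borel_measurable P" for u
    unfolding z_def[abs_def] by measurable
  have z_int: "integrable P (z u)" for u by (rule integrable_bounded[OF z_meas zb])
  \<comment> \<open>The linear term of the expansion of exp z vanishes, so the error is quadratic in
    the ratios. A smaller order could not be summed over many small steps.\<close>
  have z0: "(\<integral>u'. z u u' \<partial>P) = 0" for u
  proof -
    have "(\<integral>u'. z u u' \<partial>P) = (\<Sum>j\<in>I. (w u j - m j) * ((\<integral>u'. w u' j \<partial>P) - m j))"
      unfolding z_def using signal_integrable
      by (subst Bochner_Integration.integral_sum) (auto simp: w_def prob_space)
    also have "\<dots> = 0" by (intro sum.neutral) (simp add: w_def m_def)
    finally show ?thesis .
  qed
  have inner: "(\<integral>y. lik I x h y u' * (lik I x h y u * exp (- l y)) \<partial>gaussian I) = exp (z u u')" for u u'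
    unfolding lik_def l_alt w_def[symmetric] tilt_product
    by (simp add: integral_tilt finite_I z_def mult.commute)
  have blu: "exp_bounded I (\<lambda>y. lik I x h y u * exp (- l y))" for u
    by (intro exp_bounded_mult exp_bounded_lik be)
  have mid: "(\<integral>y. lik I x h y u * (evid P I x h y * exp (- l y)) \<partial>gaussian I) \<le> 1 + (4 * (\<Sum>j\<in>I. h j))\<^sup>2" for u
  proof -
    have "(\<integral>y. lik I x h y u * (evid P I x h y * exp (- l y)) \<partial>gaussian I)
      = (\<integral>y. evid P I x h y * (lik I x h y u * exp (- l y)) \<partial>gaussian I)"
      by (simp add: mult_ac)
    also have "\<dots> = (\<integral>u'. exp (z u u') \<partial>P)" unfolding evid_swap[OF h blu] inner ..
    also have "\<dots> \<le> (\<integral>u'. 1 + z u u' + (4 * (\<Sum>j\<in>I. h j))\<^sup>2 \<partial>P)"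
    proof (rule integral_mono)
      show "integrable P (\<lambda>u'. exp (z u u'))"
      proof (rule integrable_bounded[where K="exp 1"])
        show "\<bar>exp (z u u')\<bar> \<le> exp 1" for u' using zb[of u u'] H by simp
      qed measurable
      show "integrable P (\<lambda>u'. 1 + z u u' + (4 * (\<Sum>j\<in>I. h j))\<^sup>2)" using z_int by simp
      fix u'
      have "z u u' \<le> 1" using zb[of u u'] H by linarith
      moreover have "\<bar>z u u'\<bar>\<^sup>2 \<le> (4 * (\<Sum>j\<in>I. h j))\<^sup>2" using zb by (intro power_mono) auto
      ultimately show "exp (z u u') \<le> 1 + z u u' + (4 * (\<Sum>j\<in>I. h j))\<^sup>2"
        using exp_le_quadratic[of "z u u'"] by simp
    qed
    also have "\<dots> = 1 + (4 * (\<Sum>j\<in>I. h j))\<^sup>2" using z_int by (simp add: z0 prob_space)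
    finally show ?thesis .
  qed
  have bel: "exp_bounded I (\<lambda>y. evid P I x h y * exp (- l y))"
    by (intro exp_bounded_mult ev be)
  have chi: "(\<integral>y. evid P I x h y * (evid P I x h y * exp (- l y)) \<partial>gaussian I) \<le> 1 + (4 * (\<Sum>j\<in>I. h j))\<^sup>2"
    unfolding evid_swap[OF h bel]
    using channel_swap(2)[OF h, of "\<lambda>_. 1" 1, OF _ _ bel] mid by (intro integral_le_const) auto
  have "KL P I x h - (\<integral>y. evid P I x h y * l y \<partial>gaussian I)
     = (\<integral>y. evid P I x h y * ln (evid P I x h y) - evid P I x h y * l y \<partial>gaussian I)"
    unfolding KL_def using ev bl by (intro Bochner_Integration.integral_diff[symmetric] int exp_bounded_intros)
  also have "\<dots> \<le> (\<integral>y. evid P I x h y * (evid P I x h y * exp (- l y)) - evid P I x h y \<partial>gaussian I)"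
  proof (rule integral_mono)
    show "integrable (gaussian I) (\<lambda>y. evid P I x h y * ln (evid P I x h y) - evid P I x h y * l y)"
      using ev bl by (intro int exp_bounded_intros)
    show "integrable (gaussian I) (\<lambda>y. evid P I x h y * (evid P I x h y * exp (- l y)) - evid P I x h y)"
      using ev be by (intro int exp_bounded_intros)
    fix y assume "y \<in> space (gaussian I)"
    hence p: "0 < evid P I x h y" by (intro evid_pos h) (simp add: space_PiM)
    have "evid P I x h y * (ln (evid P I x h y) - l y) = evid P I x h y * ln (evid P I x h y * exp (- l y))"
      using p by (simp add: ln_mult)
    also have "\<dots> \<le> evid P I x h y * (evid P I x h y * exp (- l y) - 1)"
      using p by (intro mult_left_mono ln_le_minus_one) auto
    finally show "evid P I x h y * ln (evid P I x h y) - evid P I x h y * l y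
        \<le> evid P I x h y * (evid P I x h y * exp (- l y)) - evid P I x h y"
      by (simp add: algebra_simps)
  qed
  also have "\<dots> = (\<integral>y. evid P I x h y * (evid P I x h y * exp (- l y)) \<partial>gaussian I) - 1"
    using ev be by (subst Bochner_Integration.integral_diff) (auto intro!: int exp_bounded_intros simp: integral_evid[OF h])
  finally show ?thesis using chi lin by (simp add: power_mult_distrib)
qed

end

section \<open>Posterior laws and increments of the signal-to-noise ratio\<close>

definition ecov :: "'u measure \<Rightarrow> 'i set \<Rightarrow> ('i \<Rightarrow> 'u \<Rightarrow> real) \<Rightarrow> ('i \<Rightarrow> real) \<Rightarrow> ('u \<Rightarrow> real) \<Rightarrow> ('u \<Rightarrow> real) \<Rightarrow> real"
  where "ecov P I x s f g = (\<integral>y. evid P I x s y * (cov (post P I x s y) f g)\<^sup>2 \<partial>gaussian I)"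

text \<open>\<open>mix1\<close> and \<open>mix2\<close> are cosine and sine of the rotation that
  merges observations at ratios s and h. The orthogonal combination contains no signal. Where both
  ratios vanish the values 1 and 0 keep the sum of squares equal to 1.\<close>

definition mix1 :: "('i \<Rightarrow> real) \<Rightarrow> ('i \<Rightarrow> real) \<Rightarrow> 'i \<Rightarrow> real"
  where "mix1 s h j = (if s j + h j = 0 then 1 else sqrt (s j / (s j + h j)))"

definition mix2 :: "('i \<Rightarrow> real) \<Rightarrow> ('i \<Rightarrow> real) \<Rightarrow> 'i \<Rightarrow> real"
  where "mix2 s h j = (if s j + h j = 0 then 0 else sqrt (h j / (s j + h j)))"

lemma mix_squares:
  assumes "\<forall>j. 0 \<le> s j" "\<forall>j. 0 \<le> h j"
  shows "0 \<le> mix1 s h j" "(mix1 s h j)\<^sup>2 + (mix2 s h j)\<^sup>2 = 1"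
proof -
  have "0 \<le> s j" "0 \<le> h j" using assms by auto
  thus "0 \<le> mix1 s h j" "(mix1 s h j)\<^sup>2 + (mix2 s h j)\<^sup>2 = 1"
    by (auto simp: mix1_def mix2_def add_divide_distrib[symmetric])
qed

text \<open>The angles satisfy sqrt (s + h) * mix1 = sqrt s and sqrt (s + h) * mix2 = sqrt h, so the
  linear terms of the log-likelihoods add up, and the quadratic terms are proportional to the
  ratios.\<close>

lemma lik_comb:
  assumes s: "\<forall>j. 0 \<le> s j" and h: "\<forall>j. 0 \<le> h j"
  shows "lik I x (\<lambda>j. s j + h j) (comb I (mix1 s h) (mix2 s h) y y') u = lik I x s y u * lik I x h y' u"
proof -
  have "sqrt (s j + h j) * x j u * comb I (mix1 s h) (mix2 s h) y y' j - (sqrt (s j + h j) * x j u)\<^sup>2 / 2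
    = (sqrt (s j) * x j u * y j - (sqrt (s j) * x j u)\<^sup>2 / 2) + (sqrt (h j) * x j u * y' j - (sqrt (h j) * x j u)\<^sup>2 / 2)"
    if j: "j \<in> I" for j
  proof -
    have p: "0 \<le> s j" "0 \<le> h j" using s h by auto
    have 1: "sqrt (s j + h j) * mix1 s h j = sqrt (s j)" "sqrt (s j + h j) * mix2 s h j = sqrt (h j)"
      using p by (auto simp: mix1_def mix2_def real_sqrt_mult[symmetric] add_nonneg_eq_0_iff)
    have 2: "(sqrt (s j + h j) * x j u)\<^sup>2 = (sqrt (s j) * x j u)\<^sup>2 + (sqrt (h j) * x j u)\<^sup>2"
      using p by (simp add: power_mult_distrib distrib_right)
    have "sqrt (s j + h j) * x j u * comb I (mix1 s h) (mix2 s h) y y' j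
      = (sqrt (s j + h j) * mix1 s h j) * x j u * y j + (sqrt (s j + h j) * mix2 s h j) * x j u * y' j"
      using j by (simp add: comb_def algebra_simps)
    thus ?thesis unfolding 1 2 by (simp add: add_divide_distrib)
  qed
  thus ?thesis by (simp add: lik_def tilt_def exp_add[symmetric] sum.distrib[symmetric])
qed

lemma space_comb: "comb I a b y y' \<in> space (PiM I (\<lambda>_. borel))"
  by (simp add: comb_def space_PiM)

context channel
begin

section \<open>Bayes' rule, and the posterior law as a new prior\<close>

lemma integral_post:
  fixes f :: "'u \<Rightarrow> real"
  assumes s: "\<forall>j. 0 \<le> s j" and y: "y \<in> space (PiM I (\<lambda>_. borel))" and f: "f \<in> borel_measurable P"
  shows "(\<integral>u. f u \<partial>post P I x s y) = (\<integral>u. f u * lik I x s y u \<partial>P) / evid P I x s y"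
proof -
  note [measurable] = y f
  have "(\<integral>u. f u \<partial>post P I x s y) = (\<integral>u. (lik I x s y u / evid P I x s y) *\<^sub>R f u \<partial>P)"
    unfolding post_def using evid_pos[OF s y] lik_nonneg by (intro integral_density) auto
  also have "\<dots> = (\<integral>u. (f u * lik I x s y u) / evid P I x s y \<partial>P)" by (simp add: mult.commute)
  finally show ?thesis by simp
qed

text \<open>Everything proved for an arbitrary prior becomes available for the posterior law;
  estimates at ratio zero thereby become estimates of increments at ratio s.\<close>

lemma channel_post:
  assumes s: "\<forall>j. 0 \<le> s j" and y: "y \<in> space (PiM I (\<lambda>_. borel))"
  shows "channel (post P I x s y) I x"
proof -
  note [measurable] = y
  have "emeasure (post P I x s y) (space (post P I x s y)) = (\<integral>\<^sup>+u. ennreal (lik I x s y u / evid P I x s y) \<partial>P)"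
    unfolding post_def space_density by (subst emeasure_density) (auto intro!: nn_integral_cong)
  also have "\<dots> = ennreal (\<integral>u. lik I x s y u / evid P I x s y \<partial>P)"
    using integrable_lik[OF s y] lik_nonneg evid_pos[OF s y] by (intro nn_integral_eq_integral) auto
  also have "(\<integral>u. lik I x s y u / evid P I x s y \<partial>P) = 1"
    using evid_pos[OF s y] by (simp add: evid_def)
  finally have "prob_space (post P I x s y)" by (intro prob_spaceI) simp
  moreover have "x j \<in> borel_measurable (post P I x s y)" if "j \<in> I" for j
    using signal_measurable[OF that] by (simp add: post_def)
  ultimately show ?thesis
    using finite_I signal_bound by (intro channel.intro channel_axioms.intro) auto
qed

lemma prob_space_post:
  assumes "\<forall>j. 0 \<le> s j" and "y \<in> space (PiM I (\<lambda>_. borel))"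
  shows "prob_space (post P I x s y)"
  using channel_post[OF assms] by (simp add: channel_def)

lemma sets_post [simp, measurable_cong]: "sets (post P I x s y) = sets P"
  by (simp add: post_def)

lemma integrable_post:
  assumes "\<forall>j. 0 \<le> s j" and "y \<in> space (PiM I (\<lambda>_. borel))"
    and "f \<in> borel_measurable P" "\<And>u. \<bar>f u\<bar> \<le> (K::real)"
  shows "integrable (post P I x s y) f"
proof -
  interpret Q: prob_space "post P I x s y" by (rule prob_space_post[OF assms(1,2)])
  show ?thesis using assms(3,4) by (intro Q.integrable_const_bound[of _ K]) (auto simp: post_def)
qed

lemma integral_post_bound:
  assumes "\<forall>j. 0 \<le> s j" and "y \<in> space (PiM I (\<lambda>_. borel))"
    and "f \<in> borel_measurable P" "\<And>u. \<bar>f u\<bar> \<le> (K::real)"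
  shows "\<bar>\<integral>u. f u \<partial>post P I x s y\<bar> \<le> K"
proof -
  interpret Q: prob_space "post P I x s y" by (rule prob_space_post[OF assms(1,2)])
  have "\<bar>\<integral>u. f u \<partial>post P I x s y\<bar> \<le> (\<integral>u. \<bar>f u\<bar> \<partial>post P I x s y)" by (rule integral_abs_bound)
  also have "\<dots> \<le> K" using integrable_post[OF assms] assms(4) by (intro Q.integral_le_const) auto
  finally show ?thesis .
qed

lemma exp_bounded_post:
  assumes s: "\<forall>j. 0 \<le> s j" and f: "f \<in> borel_measurable P" "\<And>u. \<bar>f u\<bar> \<le> (K::real)"
  shows "exp_bounded I (\<lambda>y. \<integral>u. f u \<partial>post P I x s y)"
proof (rule exp_boundedI[where C=K and c=0])
  note [measurable] = f(1)
  have "(\<lambda>y. \<integral>u. f u * lik I x s y u \<partial>P) \<in> borel_measurable (PiM I (\<lambda>_. borel))"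
    by (intro borel_measurable_lebesgue_integral) measurable
  hence "(\<lambda>y. (\<integral>u. f u * lik I x s y u \<partial>P) / evid P I x s y) \<in> borel_measurable (PiM I (\<lambda>_. borel))"
    by measurable
  thus "(\<lambda>y. \<integral>u. f u \<partial>post P I x s y) \<in> borel_measurable (PiM I (\<lambda>_. borel))"
    using integral_post[OF s _ f(1)] by (subst measurable_cong) auto
  show "\<bar>\<integral>u. f u \<partial>post P I x s y\<bar> \<le> K * exp (0 * (\<Sum>j\<in>I. \<bar>y j\<bar>))" if "y \<in> space (PiM I (\<lambda>_. borel))" for y
    using integral_post_bound[OF s that f] by simp
qed

lemma exp_bounded_cov_post:
  assumes s: "\<forall>j. 0 \<le> s j" and f: "f \<in> borel_measurable P" "\<And>u. \<bar>f u\<bar> \<le> (K::real)"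
    and g: "g \<in> borel_measurable P" "\<And>u. \<bar>g u\<bar> \<le> (L::real)"
  shows "exp_bounded I (\<lambda>y. cov (post P I x s y) f g)"
proof -
  have "\<bar>f u * g u\<bar> \<le> K * L" for u
    unfolding abs_mult using f(2)[of u] g(2)[of u] by (intro mult_mono) auto
  hence "exp_bounded I (\<lambda>y. \<integral>u. f u * g u \<partial>post P I x s y)"
    using f(1) g(1) by (intro exp_bounded_post[OF s]) measurable
  thus ?thesis unfolding cov_def
    by (intro exp_bounded_diff exp_bounded_mult exp_bounded_post[OF s f] exp_bounded_post[OF s g])
qed

lemma evid_mult_post:
  assumes s: "\<forall>j. 0 \<le> s j" and y: "y \<in> space (PiM I (\<lambda>_. borel))" and f: "f \<in> borel_measurable P"
  shows "evid P I x s y * (\<integral>u. f u \<partial>post P I x s y) = (\<integral>u. f u * lik I x s y u \<partial>P)"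
  using evid_pos[OF s y] by (simp add: integral_post[OF s y f])

lemma integral_signal_bound: "j \<in> I \<Longrightarrow> \<bar>\<integral>u. x j u \<partial>P\<bar> \<le> 1"
proof -
  assume j: "j \<in> I"
  have "\<bar>\<integral>u. x j u \<partial>P\<bar> \<le> (\<integral>u. \<bar>x j u\<bar> \<partial>P)" by (rule integral_abs_bound)
  also have "\<dots> \<le> 1" using signal_integrable[OF j] signal_bound[OF j] by (intro integral_le_const) auto
  finally show ?thesis .
qed

text \<open>The lower bound is the Cauchy--Schwarz inequality with the affine function of \<open>y\<close> that best predicts \<open>f\<close>
  up to a factor \<open>1 + (\<Sum>j\<in>J. h j)\<close>.\<close>

lemma acc_lower:
  assumes h: "\<forall>j. 0 \<le> h j" and f: "f \<in> borel_measurable P" "\<And>u. \<bar>f u\<bar> \<le> (K::real)" and J: "J \<subseteq> I"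
  shows "(\<integral>u. f u \<partial>P)\<^sup>2 + (\<Sum>j\<in>J. h j * (cov P f (x j))\<^sup>2) / (1 + (\<Sum>j\<in>J. h j)) \<le> acc P I x h f"
proof -
  note int = exp_bounded_integrable'
  note [measurable] = f(1)
  define H where "H = (\<Sum>j\<in>J. h j)"
  have H0: "0 \<le> H" unfolding H_def using h by (simp add: sum_nonneg)
  define q where "q j = (if j \<in> J then sqrt (h j) else 0)" for j
  \<comment> \<open>The covariance of f with y j is q j * cov P f (x j). The covariance matrix of
    the observations in J is the identity plus a matrix of trace at most H, so instead of inverting
    it the regression coefficients are divided by the bound 1 + H for its norm.\<close>
  define c where "c j = q j * cov P f (x j) / (1 + H)" for j
  define a where "a = (\<integral>u. f u \<partial>P)"
  define e where "e j = (\<integral>u. x j u \<partial>P)" for j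
  \<comment> \<open>The intercept gives the predictor \<open>g\<close> the same mean a as f.\<close>
  define d where "d = a - (\<Sum>j\<in>I. c j * (q j * e j))"
  define g where "g y = d + (\<Sum>j\<in>I. c j * y j)" for y
  define X where "X y = (\<integral>u. f u \<partial>post P I x h y)" for y
  define S where "S = (\<Sum>j\<in>J. h j * (cov P f (x j))\<^sup>2) / (1 + H)"
  have finJ: "finite J" using J finite_I finite_subset by blast
  have IJ: "(\<Sum>j\<in>I. if j \<in> J then F j else 0) = (\<Sum>j\<in>J. F j)" for F :: "'i \<Rightarrow> real"
    using J finite_I by (simp add: sum.If_cases Int_absorb1)
  have q2: "(\<Sum>j\<in>I. (q j)\<^sup>2) = H"
    unfolding H_def IJ[symmetric] using h by (intro sum.cong) (auto simp: q_def)
  have cq: "c j * sqrt (h j) = c j * q j" for j by (simp add: c_def q_def)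
  have c2: "(\<Sum>j\<in>I. (c j)\<^sup>2) * (1 + H) = S"
  proof -
    have "(\<Sum>j\<in>I. (c j)\<^sup>2) = (\<Sum>j\<in>I. if j \<in> J then h j * (cov P f (x j))\<^sup>2 / (1 + H)\<^sup>2 else 0)"
      using h by (intro sum.cong) (auto simp: c_def q_def power_mult_distrib power_divide)
    also have "\<dots> = (\<Sum>j\<in>J. h j * (cov P f (x j))\<^sup>2) / (1 + H)\<^sup>2"
      unfolding IJ by (simp add: sum_divide_distrib)
    finally show ?thesis using H0 by (simp add: S_def power2_eq_square)
  qed
  have fx: "integrable P (\<lambda>u. f u * x j u)" if "j \<in> I" for j
  proof (rule integrable_bounded[where K="K * 1"])
    show "\<bar>f u * x j u\<bar> \<le> K * 1" for u
      unfolding abs_mult using f(2)[of u] signal_bound[OF that, of u] by (intro mult_mono) auto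
  qed (use signal_measurable[OF that] in measurable)
  have fint: "integrable P f" by (rule integrable_bounded[OF f])
  have bg: "exp_bounded I g" unfolding g_def[abs_def] by (rule exp_bounded_linear)
  have bX: "exp_bounded I X" unfolding X_def[abs_def] by (rule exp_bounded_post[OF h f])
  note bev = exp_bounded_evid[OF h]
  have lg: "(\<integral>y. lik I x h y u * g y \<partial>gaussian I) = d + (\<Sum>j\<in>I. c j * (q j * x j u))" for u
    unfolding g_def integral_lik_linear by (simp add: mult.assoc[symmetric] cq)
  have evXg: "(\<integral>y. evid P I x h y * X y * g y \<partial>gaussian I) = a\<^sup>2 + S"
  proof -
    have "(\<integral>y. evid P I x h y * X y * g y \<partial>gaussian I) = (\<integral>y. (\<integral>u. f u * lik I x h y u \<partial>P) * g y \<partial>gaussian I)"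
      unfolding X_def by (intro Bochner_Integration.integral_cong refl) (simp add: evid_mult_post[OF h _ f(1)] space_PiM)
    also have "\<dots> = (\<integral>u. f u * (d + (\<Sum>j\<in>I. c j * (q j * x j u))) \<partial>P)"
      unfolding channel_swap(1)[OF h f bg] lg ..
    also have "\<dots> = (\<integral>u. d * f u + (\<Sum>j\<in>I. (c j * q j) * (f u * x j u)) \<partial>P)"
      by (intro Bochner_Integration.integral_cong refl) (simp add: distrib_left sum_distrib_left mult_ac)
    also have "\<dots> = d * a + (\<Sum>j\<in>I. (c j * q j) * (\<integral>u. f u * x j u \<partial>P))"
      using fint fx by (simp add: a_def Bochner_Integration.integral_sum)
    also have "\<dots> = a\<^sup>2 + (\<Sum>j\<in>I. (c j * q j) * cov P f (x j))"
      by (simp add: d_def cov_def a_def[symmetric] e_def[symmetric] right_diff_distrib left_diff_distrib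
          sum_subtractf power2_eq_square sum_distrib_left sum_distrib_right mult_ac)
    also have "(\<Sum>j\<in>I. (c j * q j) * cov P f (x j)) = (\<Sum>j\<in>I. if j \<in> J then h j * (cov P f (x j))\<^sup>2 / (1 + H) else 0)"
      using h by (intro sum.cong) (auto simp: c_def q_def power2_eq_square)
    also have "\<dots> = S" unfolding IJ S_def by (simp add: sum_divide_distrib)
    finally show ?thesis .
  qed
  have evg2: "(\<integral>y. evid P I x h y * (g y)\<^sup>2 \<partial>gaussian I) \<le> a\<^sup>2 + S"
  proof -
    \<comment> \<open>The centered part of the predictor that comes from the signal. By
      Cauchy--Schwarz its second moment is at most H times the sum of the squared coefficients, and
      the noise contributes that sum once more; together this is the factor 1 + H that
      \<open>c2\<close> turns into S.\<close>
    define v where "v u = (\<Sum>j\<in>I. c j * (q j * (x j u - e j)))" for u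
    have xm: "integrable P (\<lambda>u. x j u - e j)" if "j \<in> I" for j using signal_integrable[OF that] by simp
    have vint: "integrable P v" unfolding v_def using xm by (intro Bochner_Integration.integrable_sum) auto
    have v0: "(\<integral>u. v u \<partial>P) = 0"
      unfolding v_def using xm signal_integrable by (simp add: Bochner_Integration.integral_sum e_def prob_space)
    have xb: "\<bar>x j u - e j\<bar> \<le> 2" if "j \<in> I" for j u
      using signal_bound[OF that, of u] integral_signal_bound[OF that] by (simp add: e_def)
    have xx: "integrable P (\<lambda>u. (x j u - e j)\<^sup>2)" if "j \<in> I" for j
    proof (rule integrable_bounded[where K="2\<^sup>2"])
      show "\<bar>(x j u - e j)\<^sup>2\<bar> \<le> 2\<^sup>2" for u
        using power_mono[OF xb[OF that, of u], of 2] by simp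
    qed (use signal_measurable[OF that] in measurable)
    have var: "(\<integral>u. (x j u - e j)\<^sup>2 \<partial>P) \<le> 1" if "j \<in> I" for j
    proof -
      have x2: "integrable P (\<lambda>u. (x j u)\<^sup>2)"
      proof (rule integrable_bounded[where K=1])
        show "\<bar>(x j u)\<^sup>2\<bar> \<le> 1" for u using signal_bound[OF that, of u] by (simp add: abs_square_le_1)
      qed (use signal_measurable[OF that] in measurable)
      have "(\<integral>u. (x j u - e j)\<^sup>2 \<partial>P) = (\<integral>u. (x j u)\<^sup>2 - (2 * e j) * x j u + (e j)\<^sup>2 \<partial>P)"
        by (intro Bochner_Integration.integral_cong refl) (simp add: power2_diff)
      also have "\<dots> = (\<integral>u. (x j u)\<^sup>2 \<partial>P) - (e j)\<^sup>2"
        using x2 signal_integrable[OF that] by (simp add: e_def[symmetric] prob_space power2_eq_square)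
      also have "\<dots> \<le> (\<integral>u. (x j u)\<^sup>2 \<partial>P)" by simp
      also have "\<dots> \<le> 1"
        using x2 signal_bound[OF that] by (intro integral_le_const) (auto simp: abs_square_le_1)
      finally show ?thesis .
    qed
    have vb: "(v u)\<^sup>2 \<le> (\<Sum>j\<in>I. (c j)\<^sup>2) * (\<Sum>j\<in>I. (q j)\<^sup>2 * (x j u - e j)\<^sup>2)" for u
      using Cauchy_Schwarz_ineq_sum[of c "\<lambda>j. q j * (x j u - e j)" I] by (simp add: v_def power_mult_distrib)
    have qint: "integrable P (\<lambda>u. (\<Sum>j\<in>I. (c j)\<^sup>2) * (\<Sum>j\<in>I. (q j)\<^sup>2 * (x j u - e j)\<^sup>2))"
      using xx by (intro integrable_mult_right Bochner_Integration.integrable_sum) auto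
    have v_meas: "v \<in> borel_measurable P" using vint by simp
    have v2int: "integrable P (\<lambda>u. (v u)\<^sup>2)"
      by (rule Bochner_Integration.integrable_bound[OF qint]) (use v_meas vb in \<open>auto intro: order_trans[OF _ abs_ge_self]\<close>)
    have v2: "(\<integral>u. (v u)\<^sup>2 \<partial>P) \<le> (\<Sum>j\<in>I. (c j)\<^sup>2) * H"
    proof -
      have "(\<integral>u. (v u)\<^sup>2 \<partial>P) \<le> (\<integral>u. (\<Sum>j\<in>I. (c j)\<^sup>2) * (\<Sum>j\<in>I. (q j)\<^sup>2 * (x j u - e j)\<^sup>2) \<partial>P)"
        using v2int qint vb by (intro integral_mono) auto
      also have "\<dots> = (\<Sum>j\<in>I. (c j)\<^sup>2) * (\<Sum>j\<in>I. (q j)\<^sup>2 * (\<integral>u. (x j u - e j)\<^sup>2 \<partial>P))"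
        using xx by (simp add: Bochner_Integration.integral_sum)
      also have "\<dots> \<le> (\<Sum>j\<in>I. (c j)\<^sup>2) * (\<Sum>j\<in>I. (q j)\<^sup>2 * 1)"
        using var by (intro mult_left_mono sum_mono) (auto simp: sum_nonneg)
      finally show ?thesis by (simp add: q2)
    qed
    have "(\<integral>y. evid P I x h y * (g y)\<^sup>2 \<partial>gaussian I) = (\<integral>u. (\<integral>y. lik I x h y u * (g y)\<^sup>2 \<partial>gaussian I) \<partial>P)"
      by (rule evid_swap[OF h exp_bounded_power[OF bg]])
    also have "\<dots> = (\<integral>u. (a + v u)\<^sup>2 + (\<Sum>j\<in>I. (c j)\<^sup>2) \<partial>P)"
    proof (intro Bochner_Integration.integral_cong refl)
      fix u
      have "d + (\<Sum>j\<in>I. c j * (sqrt (h j) * x j u)) = a + v u"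
        by (simp add: mult.assoc[symmetric] cq d_def v_def right_diff_distrib sum_subtractf)
      thus "(\<integral>y. lik I x h y u * (g y)\<^sup>2 \<partial>gaussian I) = (a + v u)\<^sup>2 + (\<Sum>j\<in>I. (c j)\<^sup>2)"
        unfolding g_def integral_lik_quadratic by simp
    qed
    also have "\<dots> = (\<integral>u. a\<^sup>2 + (2 * a) * v u + (v u)\<^sup>2 + (\<Sum>j\<in>I. (c j)\<^sup>2) \<partial>P)"
      by (intro Bochner_Integration.integral_cong refl) (simp add: power2_sum)
    also have "\<dots> = a\<^sup>2 + (\<integral>u. (v u)\<^sup>2 \<partial>P) + (\<Sum>j\<in>I. (c j)\<^sup>2)"
      using vint v2int by (simp add: v0 prob_space)
    also have "\<dots> \<le> a\<^sup>2 + (\<Sum>j\<in>I. (c j)\<^sup>2) * (1 + H)" using v2 by (simp add: distrib_left)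
    finally show ?thesis by (simp only: c2)
  qed
  \<comment> \<open>Cauchy--Schwarz in the form 2 X g - g^2 \<le> X^2, where X is the posterior mean
    of f: the mean of X g equals a^2 + S and the mean of g^2 is at most a^2 + S.\<close>
  have "2 * (a\<^sup>2 + S) - (a\<^sup>2 + S) \<le> 2 * (\<integral>y. evid P I x h y * X y * g y \<partial>gaussian I) - (\<integral>y. evid P I x h y * (g y)\<^sup>2 \<partial>gaussian I)"
    unfolding evXg using evg2 by simp
  also have "\<dots> = (\<integral>y. 2 * (evid P I x h y * X y * g y) - evid P I x h y * (g y)\<^sup>2 \<partial>gaussian I)"
    by (subst Bochner_Integration.integral_diff)
       (auto intro!: int exp_bounded_intros bev bX bg)
  also have "\<dots> \<le> (\<integral>y. evid P I x h y * (X y)\<^sup>2 \<partial>gaussian I)"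
  proof (rule integral_mono)
    show "integrable (gaussian I) (\<lambda>y. 2 * (evid P I x h y * X y * g y) - evid P I x h y * (g y)\<^sup>2)"
      by (intro int exp_bounded_intros bev bX bg)
    show "integrable (gaussian I) (\<lambda>y. evid P I x h y * (X y)\<^sup>2)"
      by (intro int exp_bounded_intros bev bX)
    fix y assume "y \<in> space (gaussian I)"
    hence "0 < evid P I x h y" by (intro evid_pos h) (simp add: space_PiM)
    hence "0 \<le> evid P I x h y * (X y - g y)\<^sup>2" by simp
    thus "2 * (evid P I x h y * X y * g y) - evid P I x h y * (g y)\<^sup>2 \<le> evid P I x h y * (X y)\<^sup>2"
      by (simp add: power2_diff algebra_simps)
  qed
  finally show ?thesis by (simp add: acc_def X_def a_def S_def H_def)
qed

section \<open>Chain rules for two successive observations\<close>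

lemma evid_comb:
  assumes s: "\<forall>j. 0 \<le> s j" and h: "\<forall>j. 0 \<le> h j"
    and y: "y \<in> space (PiM I (\<lambda>_. borel))" "y' \<in> space (PiM I (\<lambda>_. borel))"
  shows "evid P I x (\<lambda>j. s j + h j) (comb I (mix1 s h) (mix2 s h) y y')
       = evid P I x s y * evid (post P I x s y) I x h y'"
proof -
  have "evid P I x s y * evid (post P I x s y) I x h y' = (\<integral>u. lik I x h y' u * lik I x s y u \<partial>P)"
    unfolding evid_def[of "post P I x s y"] by (rule evid_mult_post[OF s y(1)]) (rule lik_measurable[OF y(2)])
  thus ?thesis by (simp add: evid_def[of P I x "\<lambda>j. s j + h j"] lik_comb[OF s h] mult.commute)
qed

lemma post_comb:
  fixes f :: "'u \<Rightarrow> real"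
  assumes s: "\<forall>j. 0 \<le> s j" and h: "\<forall>j. 0 \<le> h j"
    and y: "y \<in> space (PiM I (\<lambda>_. borel))" "y' \<in> space (PiM I (\<lambda>_. borel))" and f: "f \<in> borel_measurable P"
  shows "(\<integral>u. f u \<partial>post P I x (\<lambda>j. s j + h j) (comb I (mix1 s h) (mix2 s h) y y'))
       = (\<integral>u. f u \<partial>post (post P I x s y) I x h y')"
proof -
  interpret Q: channel "post P I x s y" I x by (rule channel_post[OF s y(1)])
  have sh: "\<forall>j. 0 \<le> s j + h j" using s h by simp
  have m: "(\<lambda>u. f u * lik I x h y' u) \<in> borel_measurable P"
    using lik_measurable[OF y(2), of h] f by measurable
  have "(\<integral>u. f u \<partial>post (post P I x s y) I x h y')
    = (\<integral>u. f u * lik I x h y' u \<partial>post P I x s y) / evid (post P I x s y) I x h y'"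
    using f by (intro Q.integral_post[OF h y(2)]) (simp add: measurable_cong_sets[OF sets_post refl])
  also have "(\<integral>u. f u * lik I x h y' u \<partial>post P I x s y)
     = (\<integral>u. f u * lik I x h y' u * lik I x s y u \<partial>P) / evid P I x s y"
    by (rule integral_post[OF s y(1) m])
  finally show ?thesis
    unfolding integral_post[OF sh space_comb f] evid_comb[OF s h y] lik_comb[OF s h] by (simp add: mult_ac)
qed

text \<open>Chain rule for relative entropy. Writing the noise as a rotation of two independent
  copies factorises the evidence, the logarithm splits, and the evidence of the second observation
  under the posterior integrates to 1.\<close>

lemma KL_add:
  assumes s: "\<forall>j. 0 \<le> s j" and h: "\<forall>j. 0 \<le> h j"
  shows "KL P I x (\<lambda>j. s j + h j) = KL P I x s + (\<integral>y. evid P I x s y * KL (post P I x s y) I x h \<partial>gaussian I)"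
    and "integrable (gaussian I) (\<lambda>y. evid P I x s y * KL (post P I x s y) I x h)"
proof -
  define g where "g z = evid P I x (\<lambda>j. s j + h j) z * ln (evid P I x (\<lambda>j. s j + h j) z)" for z
  have sh: "\<forall>j. 0 \<le> s j + h j" using s h by simp
  have g: "integrable (gaussian I) g" unfolding g_def[abs_def]
    by (intro exp_bounded_integrable' exp_bounded_mult exp_bounded_evid[OF sh] exp_bounded_ln_evid[OF sh])
  note c = integral_comb[OF finite_I, of "mix1 s h" "mix2 s h" g, OF mix_squares(1)[OF s h] mix_squares(2)[OF s h] g]
  define e where "e y = evid P I x s y" for y
  have inner: "(\<integral>y'. g (comb I (mix1 s h) (mix2 s h) y y') \<partial>gaussian I)
      = e y * ln (e y) + e y * KL (post P I x s y) I x h" if "y \<in> space (gaussian I)" for y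
  proof -
    have y: "y \<in> space (PiM I (\<lambda>_. borel))" using that by (simp add: space_PiM)
    interpret Q: channel "post P I x s y" I x by (rule channel_post[OF s y])
    define E where "E y' = evid (post P I x s y) I x h y'" for y'
    have ep: "0 < e y" unfolding e_def by (rule evid_pos[OF s y])
    have "(\<integral>y'. g (comb I (mix1 s h) (mix2 s h) y y') \<partial>gaussian I)
       = (\<integral>y'. (e y * ln (e y)) * E y' + e y * (E y' * ln (E y')) \<partial>gaussian I)"
    proof (intro Bochner_Integration.integral_cong refl)
      fix y' assume "y' \<in> space (gaussian I)"
      hence y': "y' \<in> space (PiM I (\<lambda>_. borel))" by (simp add: space_PiM)
      have "0 < E y'" unfolding E_def by (rule Q.evid_pos[OF h y'])
      thus "g (comb I (mix1 s h) (mix2 s h) y y') = (e y * ln (e y)) * E y' + e y * (E y' * ln (E y'))"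
        unfolding g_def evid_comb[OF s h y y'] e_def[symmetric] E_def[symmetric]
        using ep by (simp add: ln_mult algebra_simps)
    qed
    also have "\<dots> = (e y * ln (e y)) * (\<integral>y'. E y' \<partial>gaussian I) + e y * (\<integral>y'. E y' * ln (E y') \<partial>gaussian I)"
    proof -
      have "integrable (gaussian I) E" "integrable (gaussian I) (\<lambda>y'. E y' * ln (E y'))"
        unfolding E_def[abs_def]
        by (intro exp_bounded_integrable' exp_bounded_mult Q.exp_bounded_evid[OF h] Q.exp_bounded_ln_evid[OF h])+
      thus ?thesis by simp
    qed
    also have "(\<integral>y'. E y' \<partial>gaussian I) = 1" unfolding E_def by (rule Q.integral_evid[OF h])
    finally show ?thesis by (simp add: E_def KL_def)
  qed
  have i1: "integrable (gaussian I) (\<lambda>y. e y * ln (e y) + e y * KL (post P I x s y) I x h)"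
    using c(1) by (subst (asm) Bochner_Integration.integrable_cong[OF refl inner])
  have i2: "integrable (gaussian I) (\<lambda>y. e y * ln (e y))" unfolding e_def
    by (intro exp_bounded_integrable' exp_bounded_mult exp_bounded_evid[OF s] exp_bounded_ln_evid[OF s])
  have i3: "integrable (gaussian I) (\<lambda>y. e y * KL (post P I x s y) I x h)"
    using Bochner_Integration.integrable_diff[OF i1 i2] by simp
  thus "integrable (gaussian I) (\<lambda>y. evid P I x s y * KL (post P I x s y) I x h)" by (simp add: e_def)
  have "KL P I x (\<lambda>j. s j + h j) = (\<integral>y. e y * ln (e y) + e y * KL (post P I x s y) I x h \<partial>gaussian I)"
    unfolding KL_def[of P I x "\<lambda>j. s j + h j"] g_def[symmetric] c(2)[symmetric]
    by (rule Bochner_Integration.integral_cong[OF refl inner])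
  also have "\<dots> = KL P I x s + (\<integral>y. e y * KL (post P I x s y) I x h \<partial>gaussian I)"
    using i2 i3 by (simp add: KL_def[of P I x s] e_def)
  finally show "KL P I x (\<lambda>j. s j + h j) = KL P I x s + (\<integral>y. evid P I x s y * KL (post P I x s y) I x h \<partial>gaussian I)"
    by (simp add: e_def)
qed

lemma acc_add:
  assumes s: "\<forall>j. 0 \<le> s j" and h: "\<forall>j. 0 \<le> h j" and f: "f \<in> borel_measurable P" "\<And>u. \<bar>f u\<bar> \<le> (K::real)"
  shows "acc P I x (\<lambda>j. s j + h j) f = (\<integral>y. evid P I x s y * acc (post P I x s y) I x h f \<partial>gaussian I)"
    and "integrable (gaussian I) (\<lambda>y. evid P I x s y * acc (post P I x s y) I x h f)"
proof -
  define g where "g z = evid P I x (\<lambda>j. s j + h j) z * (\<integral>u. f u \<partial>post P I x (\<lambda>j. s j + h j) z)\<^sup>2" for z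
  have sh: "\<forall>j. 0 \<le> s j + h j" using s h by simp
  have g: "integrable (gaussian I) g" unfolding g_def[abs_def]
    by (intro exp_bounded_integrable' exp_bounded_mult exp_bounded_power exp_bounded_evid[OF sh] exp_bounded_post[OF sh f])
  note c = integral_comb[OF finite_I, of "mix1 s h" "mix2 s h" g, OF mix_squares(1)[OF s h] mix_squares(2)[OF s h] g]
  have inner: "(\<integral>y'. g (comb I (mix1 s h) (mix2 s h) y y') \<partial>gaussian I)
      = evid P I x s y * acc (post P I x s y) I x h f" if "y \<in> space (gaussian I)" for y
  proof -
    have y: "y \<in> space (PiM I (\<lambda>_. borel))" using that by (simp add: space_PiM)
    have "(\<integral>y'. g (comb I (mix1 s h) (mix2 s h) y y') \<partial>gaussian I)
       = (\<integral>y'. evid P I x s y * (evid (post P I x s y) I x h y' * (\<integral>u. f u \<partial>post (post P I x s y) I x h y')\<^sup>2) \<partial>gaussian I)"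
      unfolding g_def
      by (intro Bochner_Integration.integral_cong refl) (simp add: evid_comb[OF s h y] post_comb[OF s h y _ f(1)] space_PiM mult.assoc)
    thus ?thesis by (simp add: acc_def)
  qed
  show "integrable (gaussian I) (\<lambda>y. evid P I x s y * acc (post P I x s y) I x h f)"
    using c(1) by (subst (asm) Bochner_Integration.integrable_cong[OF refl inner])
  show "acc P I x (\<lambda>j. s j + h j) f = (\<integral>y. evid P I x s y * acc (post P I x s y) I x h f \<partial>gaussian I)"
    unfolding acc_def[of P I x "\<lambda>j. s j + h j"] g_def[symmetric] c(2)[symmetric]
    by (rule Bochner_Integration.integral_cong[OF refl inner])
qed

lemma acc_bounds:
  assumes s: "\<forall>j. 0 \<le> s j" and f: "f \<in> borel_measurable P" "\<And>u. \<bar>f u\<bar> \<le> (K::real)"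
  shows "0 \<le> acc P I x s f" "acc P I x s f \<le> K\<^sup>2"
proof -
  note ev = exp_bounded_evid[OF s]
  show "0 \<le> acc P I x s f" unfolding acc_def
    by (intro Bochner_Integration.integral_nonneg_AE AE_I2 mult_nonneg_nonneg less_imp_le[OF evid_pos[OF s]]) (auto simp: space_PiM)
  have "acc P I x s f \<le> (\<integral>y. evid P I x s y * K\<^sup>2 \<partial>gaussian I)"
    unfolding acc_def
  proof (rule integral_mono)
    show "integrable (gaussian I) (\<lambda>y. evid P I x s y * (\<integral>u. f u \<partial>post P I x s y)\<^sup>2)"
      by (intro exp_bounded_integrable' exp_bounded_mult exp_bounded_power exp_bounded_post[OF s f] ev)
    show "integrable (gaussian I) (\<lambda>y. evid P I x s y * K\<^sup>2)"
      by (intro exp_bounded_integrable' exp_bounded_mult exp_bounded_const ev)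
    fix y assume "y \<in> space (gaussian I)"
    hence y: "y \<in> space (PiM I (\<lambda>_. borel))" by (simp add: space_PiM)
    have "\<bar>\<integral>u. f u \<partial>post P I x s y\<bar>\<^sup>2 \<le> K\<^sup>2" using integral_post_bound[OF s y f] by (intro power_mono) auto
    thus "evid P I x s y * (\<integral>u. f u \<partial>post P I x s y)\<^sup>2 \<le> evid P I x s y * K\<^sup>2"
      using evid_pos[OF s y] by (intro mult_left_mono) auto
  qed
  also have "\<dots> = K\<^sup>2" by (simp add: integral_evid[OF s])
  finally show "acc P I x s f \<le> K\<^sup>2" .
qed

text \<open>\<open>acc_lower\<close> with the posterior as prior, averaged over the first
  observation. It is a finite-step form of the fact that the accuracy of f grows at the rate of its
  squared posterior covariances with the signals; the denominator is the price of a finite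
  step.\<close>

lemma acc_increment:
  assumes s: "\<forall>j. 0 \<le> s j" and h: "\<forall>j. 0 \<le> h j" and f: "f \<in> borel_measurable P" "\<And>u. \<bar>f u\<bar> \<le> (K::real)" and J: "J \<subseteq> I"
  shows "acc P I x s f + (\<Sum>j\<in>J. h j * ecov P I x s f (x j)) / (1 + (\<Sum>j\<in>J. h j)) \<le> acc P I x (\<lambda>j. s j + h j) f"
proof -
  define H where "H = (\<Sum>j\<in>J. h j)"
  note ev = exp_bounded_evid[OF s]
  have jI: "j \<in> I" if "j \<in> J" for j using that J by blast
  have b1: "integrable (gaussian I) (\<lambda>y. evid P I x s y * (\<integral>u. f u \<partial>post P I x s y)\<^sup>2)"
    by (intro exp_bounded_integrable' exp_bounded_mult exp_bounded_power exp_bounded_post[OF s f] ev)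
  have b2: "integrable (gaussian I) (\<lambda>y. evid P I x s y * (cov (post P I x s y) f (x j))\<^sup>2)" if "j \<in> J" for j
    by (intro exp_bounded_integrable' exp_bounded_mult exp_bounded_power exp_bounded_cov_post[OF s f, where L=1] ev
        signal_measurable[OF jI[OF that]] signal_bound[OF jI[OF that]])
  have b3: "integrable (gaussian I) (\<lambda>y. \<Sum>j\<in>J. (h j / (1 + H)) * (evid P I x s y * (cov (post P I x s y) f (x j))\<^sup>2))"
    using b2 by (intro Bochner_Integration.integrable_sum integrable_mult_right) auto
  have "acc P I x s f + (\<Sum>j\<in>J. h j * ecov P I x s f (x j)) / (1 + H)
    = (\<integral>y. evid P I x s y * (\<integral>u. f u \<partial>post P I x s y)\<^sup>2 +
        (\<Sum>j\<in>J. (h j / (1 + H)) * (evid P I x s y * (cov (post P I x s y) f (x j))\<^sup>2)) \<partial>gaussian I)"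
    using b1 b2 b3 by (simp add: acc_def ecov_def Bochner_Integration.integral_sum sum_divide_distrib)
  also have "\<dots> \<le> (\<integral>y. evid P I x s y * acc (post P I x s y) I x h f \<partial>gaussian I)"
  proof (rule integral_mono[OF Bochner_Integration.integrable_add[OF b1 b3] acc_add(2)[OF s h f]])
    fix y assume "y \<in> space (gaussian I)"
    hence y: "y \<in> space (PiM I (\<lambda>_. borel))" by (simp add: space_PiM)
    interpret Q: channel "post P I x s y" I x by (rule channel_post[OF s y])
    have "(\<integral>u. f u \<partial>post P I x s y)\<^sup>2 + (\<Sum>j\<in>J. h j * (cov (post P I x s y) f (x j))\<^sup>2) / (1 + H)
       \<le> acc (post P I x s y) I x h f"
      unfolding H_def using f by (intro Q.acc_lower[OF h _ _ J]) auto
    hence "evid P I x s y * ((\<integral>u. f u \<partial>post P I x s y)\<^sup>2 + (\<Sum>j\<in>J. h j * (cov (post P I x s y) f (x j))\<^sup>2) / (1 + H))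
       \<le> evid P I x s y * acc (post P I x s y) I x h f"
      using evid_pos[OF s y] by (intro mult_left_mono) auto
    thus "evid P I x s y * (\<integral>u. f u \<partial>post P I x s y)\<^sup>2 +
        (\<Sum>j\<in>J. (h j / (1 + H)) * (evid P I x s y * (cov (post P I x s y) f (x j))\<^sup>2))
       \<le> evid P I x s y * acc (post P I x s y) I x h f"
      by (simp add: distrib_left sum_divide_distrib sum_distrib_left mult_ac)
  qed
  also have "\<dots> = acc P I x (\<lambda>j. s j + h j) f" by (rule acc_add(1)[OF s h f, symmetric])
  finally show ?thesis by (simp add: H_def)
qed

text \<open>\<open>KL_lower\<close> and \<open>KL_upper\<close> with the posterior as prior.
  Together they replace the derivative of the relative entropy, with an error quadratic in the
  step.\<close>

lemma KL_increment:
  assumes s: "\<forall>j. 0 \<le> s j" and h: "\<forall>j. 0 \<le> h j"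
  shows "KL P I x s + (\<Sum>j\<in>I. h j * acc P I x s (x j)) / 2 \<le> KL P I x (\<lambda>j. s j + h j)"
    and "4 * (\<Sum>j\<in>I. h j) \<le> 1 \<Longrightarrow>
      KL P I x (\<lambda>j. s j + h j) \<le> KL P I x s + (\<Sum>j\<in>I. h j * acc P I x s (x j)) / 2 + 16 * (\<Sum>j\<in>I. h j)\<^sup>2"
proof -
  define A where "A y = (\<Sum>j\<in>I. h j * (\<integral>u. x j u \<partial>post P I x s y)\<^sup>2) / 2" for y
  note ev = exp_bounded_evid[OF s]
  have b1: "integrable (gaussian I) (\<lambda>y. evid P I x s y * (\<integral>u. x j u \<partial>post P I x s y)\<^sup>2)" if "j \<in> I" for j
    by (intro exp_bounded_integrable' exp_bounded_mult exp_bounded_power exp_bounded_post[OF s, where K=1] ev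
        signal_measurable[OF that] signal_bound[OF that])
  have Aeq: "evid P I x s y * A y = (\<Sum>j\<in>I. (h j / 2) * (evid P I x s y * (\<integral>u. x j u \<partial>post P I x s y)\<^sup>2))" for y
    by (simp add: A_def sum_distrib_left sum_divide_distrib mult_ac)
  have iA: "integrable (gaussian I) (\<lambda>y. evid P I x s y * A y)"
    unfolding Aeq using b1 by (intro Bochner_Integration.integrable_sum integrable_mult_right) auto
  have IA: "(\<integral>y. evid P I x s y * A y \<partial>gaussian I) = (\<Sum>j\<in>I. h j * acc P I x s (x j)) / 2"
    unfolding Aeq using b1 by (simp add: Bochner_Integration.integral_sum acc_def sum_divide_distrib)
  have "(\<integral>y. evid P I x s y * A y \<partial>gaussian I) \<le> (\<integral>y. evid P I x s y * KL (post P I x s y) I x h \<partial>gaussian I)"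
  proof (rule integral_mono[OF iA KL_add(2)[OF s h]])
    fix y assume "y \<in> space (gaussian I)"
    hence y: "y \<in> space (PiM I (\<lambda>_. borel))" by (simp add: space_PiM)
    interpret Q: channel "post P I x s y" I x by (rule channel_post[OF s y])
    show "evid P I x s y * A y \<le> evid P I x s y * KL (post P I x s y) I x h"
      unfolding A_def using evid_pos[OF s y] by (intro mult_left_mono Q.KL_lower[OF h]) auto
  qed
  thus "KL P I x s + (\<Sum>j\<in>I. h j * acc P I x s (x j)) / 2 \<le> KL P I x (\<lambda>j. s j + h j)"
    unfolding KL_add(1)[OF s h] IA by simp
  assume H: "4 * (\<Sum>j\<in>I. h j) \<le> 1"
  have iev: "integrable (gaussian I) (evid P I x s)" by (intro exp_bounded_integrable' ev)
  have "(\<integral>y. evid P I x s y * KL (post P I x s y) I x h \<partial>gaussian I)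
      \<le> (\<integral>y. evid P I x s y * A y + (16 * (\<Sum>j\<in>I. h j)\<^sup>2) * evid P I x s y \<partial>gaussian I)"
  proof (rule integral_mono[OF KL_add(2)[OF s h]])
    show "integrable (gaussian I) (\<lambda>y. evid P I x s y * A y + (16 * (\<Sum>j\<in>I. h j)\<^sup>2) * evid P I x s y)"
      using iA iev by simp
    fix y assume "y \<in> space (gaussian I)"
    hence y: "y \<in> space (PiM I (\<lambda>_. borel))" by (simp add: space_PiM)
    interpret Q: channel "post P I x s y" I x by (rule channel_post[OF s y])
    have "evid P I x s y * KL (post P I x s y) I x h \<le> evid P I x s y * (A y + 16 * (\<Sum>j\<in>I. h j)\<^sup>2)"
      unfolding A_def using evid_pos[OF s y] by (intro mult_left_mono Q.KL_upper[OF h H]) auto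
    thus "evid P I x s y * KL (post P I x s y) I x h \<le> evid P I x s y * A y + (16 * (\<Sum>j\<in>I. h j)\<^sup>2) * evid P I x s y"
      by (simp add: algebra_simps)
  qed
  also have "\<dots> = (\<Sum>j\<in>I. h j * acc P I x s (x j)) / 2 + 16 * (\<Sum>j\<in>I. h j)\<^sup>2"
    using iA iev IA by (simp add: integral_evid[OF s])
  finally show "KL P I x (\<lambda>j. s j + h j) \<le> KL P I x s + (\<Sum>j\<in>I. h j * acc P I x s (x j)) / 2 + 16 * (\<Sum>j\<in>I. h j)\<^sup>2"
    unfolding KL_add(1)[OF s h] by simp
qed

lemma KL_mono:
  assumes s: "\<forall>j. 0 \<le> s j" and h: "\<forall>j. s j \<le> h j"
  shows "KL P I x s \<le> KL P I x h"
proof -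
  have "0 \<le> (\<Sum>j\<in>I. (h j - s j) * acc P I x s (x j)) / 2"
    using h signal_measurable signal_bound
    by (intro divide_nonneg_nonneg sum_nonneg mult_nonneg_nonneg acc_bounds(1)[OF s]) auto
  thus ?thesis using KL_increment(1)[OF s, of "\<lambda>j. h j - s j"] h by simp
qed

text \<open>The hypothesis says that the first observation does not change the evidence of the
  second, so the conditional term of the chain rule is the plain relative entropy.\<close>

lemma KL_indep:
  assumes s: "\<forall>j. 0 \<le> s j" and h: "\<forall>j. 0 \<le> h j"
    and ind: "\<And>y y'. y \<in> space (PiM I (\<lambda>_. borel)) \<Longrightarrow> y' \<in> space (PiM I (\<lambda>_. borel)) \<Longrightarrow>
      (\<integral>u. lik I x h y' u * lik I x s y u \<partial>P) = evid P I x h y' * evid P I x s y"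
  shows "KL P I x (\<lambda>j. s j + h j) = KL P I x s + KL P I x h"
proof -
  have "KL (post P I x s y) I x h = KL P I x h" if "y \<in> space (gaussian I)" for y
  proof -
    have y: "y \<in> space (PiM I (\<lambda>_. borel))" using that by (simp add: space_PiM)
    have "evid (post P I x s y) I x h y' = evid P I x h y'" if "y' \<in> space (PiM I (\<lambda>_. borel))" for y'
    proof -
      have "evid (post P I x s y) I x h y' = (\<integral>u. lik I x h y' u * lik I x s y u \<partial>P) / evid P I x s y"
        unfolding evid_def[of "post P I x s y"] by (rule integral_post[OF s y lik_measurable[OF that]])
      thus ?thesis using ind[OF y that] evid_pos[OF s y] by simp
    qed
    thus ?thesis unfolding KL_def by (intro Bochner_Integration.integral_cong refl) (simp add: space_PiM)
  qed
  hence "(\<integral>y. evid P I x s y * KL (post P I x s y) I x h \<partial>gaussian I) = (\<integral>y. evid P I x s y * KL P I x h \<partial>gaussian I)"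
    by (intro Bochner_Integration.integral_cong refl) simp
  also have "\<dots> = KL P I x h" by (simp add: integral_evid[OF s])
  finally show ?thesis by (simp add: KL_add(1)[OF s h])
qed

end

section \<open>Interpolation and overlaps\<close>

context channel
begin

lemma acc_signal_bounds:
  assumes "\<forall>j. 0 \<le> s j" "j \<in> I"
  shows "0 \<le> acc P I x s (x j)" "acc P I x s (x j) \<le> 1"
  using acc_bounds[OF assms(1) signal_measurable[OF assms(2)] signal_bound[OF assms(2)]] by auto

text \<open>The segment from e + b to e + a is cut into M steps. The quadratic errors of
  \<open>KL_increment\<close> sum to order 1 / M and disappear in the limit. The sum over l stands
  inside the hypothesis because the slope will be controlled only on average over the base points e
  l.\<close>

lemma KL_interpolation:
  fixes L :: nat
  assumes e: "\<And>l. \<forall>j. 0 \<le> e l j" and a: "\<forall>j. 0 \<le> a j" and b: "\<forall>j. 0 \<le> b j"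
    and bound: "\<And>t r. 0 \<le> t \<Longrightarrow> 0 \<le> r \<Longrightarrow> t + r \<le> 1 \<Longrightarrow>
      (\<Sum>l<L. \<Sum>j\<in>I. (a j - b j) * acc P I x (\<lambda>j. e l j + (t * a j + r * b j)) (x j)) \<le> \<eta>"
  shows "(\<Sum>l<L. KL P I x (\<lambda>j. e l j + a j) - KL P I x (\<lambda>j. e l j + b j)) \<le> \<eta> / 2"
proof -
  define S where "S = (\<Sum>j\<in>I. a j)"
  define D where "D = (\<Sum>l<L. KL P I x (\<lambda>j. e l j + a j) - KL P I x (\<lambda>j. e l j + b j))"
  have main: "D \<le> \<eta> / 2 + (16 * real L * S\<^sup>2) * inverse (real M)" if M: "M \<ge> 1" "4 * S \<le> real M" for M
  proof -
    have M0: "real M > 0" using M by simp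
    define t where "t i = real i / real M" for i :: nat
    \<comment> \<open>r i = 1 - t i - 1 / M, one step short of completing t i. The point with
      weights t i and r i then lies below both ends of the step: adding b / M gives the left end and
      adding a / M the right end, so both differences are increments from a common base.\<close>
    define r where "r i = (real M - 1 - real i) / real M" for i :: nat
    define F where "F l i = KL P I x (\<lambda>j. e l j + (t i * a j + (1 - t i) * b j))" for l i
    define G where "G l i = (\<Sum>j\<in>I. (a j - b j) * acc P I x (\<lambda>j. e l j + (t i * a j + r i * b j)) (x j))" for l i
    have step: "F l (Suc i) - F l i \<le> G l i / (2 * real M) + 16 * (S / real M)\<^sup>2" if i: "i < M" for l i
    proof -
      define c where "c j = e l j + (t i * a j + r i * b j)" for j
      have tr: "0 \<le> t i" "0 \<le> r i" using i M0 by (auto simp: t_def r_def)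
      have c0: "\<forall>j. 0 \<le> c j" using e a b tr by (auto simp: c_def)
      have a0: "\<forall>j. 0 \<le> a j / real M" and b0: "\<forall>j. 0 \<le> b j / real M" using a b M0 by auto
      have "e l j + (t (Suc i) * a j + (1 - t (Suc i)) * b j) = c j + a j / real M" for j
        using M0 by (simp add: c_def t_def r_def field_simps)
      hence F1: "F l (Suc i) = KL P I x (\<lambda>j. c j + a j / real M)" by (simp add: F_def)
      have "e l j + (t i * a j + (1 - t i) * b j) = c j + b j / real M" for j
        using M0 by (simp add: c_def t_def r_def field_simps)
      hence F0: "F l i = KL P I x (\<lambda>j. c j + b j / real M)" by (simp add: F_def)
      have sM: "(\<Sum>j\<in>I. a j / real M) = S / real M" by (simp add: S_def sum_divide_distrib)
      have "F l (Suc i) \<le> KL P I x c + (\<Sum>j\<in>I. a j / real M * acc P I x c (x j)) / 2 + 16 * (S / real M)\<^sup>2"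
        unfolding F1 sM[symmetric] using M M0 by (intro KL_increment(2)[OF c0 a0]) (simp add: sM divide_le_eq)
      moreover have "KL P I x c + (\<Sum>j\<in>I. b j / real M * acc P I x c (x j)) / 2 \<le> F l i"
        unfolding F0 by (rule KL_increment(1)[OF c0 b0])
      moreover have "(\<Sum>j\<in>I. a j / real M * acc P I x c (x j)) / 2 - (\<Sum>j\<in>I. b j / real M * acc P I x c (x j)) / 2 = G l i / (2 * real M)"
        unfolding G_def c_def[symmetric]
        by (simp add: sum_divide_distrib sum_subtractf[symmetric] diff_divide_distrib[symmetric] left_diff_distrib mult.commute)
      ultimately show ?thesis by linarith
    qed
    have "D = (\<Sum>l<L. \<Sum>i<M. F l (Suc i) - F l i)"
      unfolding D_def
    proof (intro sum.cong refl)
      fix l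
      have "F l M = KL P I x (\<lambda>j. e l j + a j)" "F l 0 = KL P I x (\<lambda>j. e l j + b j)"
        using M0 by (auto simp: F_def t_def)
      thus "KL P I x (\<lambda>j. e l j + a j) - KL P I x (\<lambda>j. e l j + b j) = (\<Sum>i<M. F l (Suc i) - F l i)"
        by (simp add: sum_lessThan_telescope)
    qed
    also have "\<dots> \<le> (\<Sum>l<L. \<Sum>i<M. G l i / (2 * real M) + 16 * (S / real M)\<^sup>2)"
      using step by (intro sum_mono) auto
    also have "\<dots> = (\<Sum>i<M. (\<Sum>l<L. G l i) / (2 * real M)) + real L * (real M * (16 * (S / real M)\<^sup>2))"
      by (subst sum.swap) (simp add: sum.distrib sum_divide_distrib)
    also have "\<dots> \<le> (\<Sum>i<M. \<eta> / (2 * real M)) + real L * (real M * (16 * (S / real M)\<^sup>2))"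
    proof (intro add_right_mono sum_mono divide_right_mono)
      fix i assume "i \<in> {..<M}"
      thus "(\<Sum>l<L. G l i) \<le> \<eta>" unfolding G_def
        using M0 by (intro bound) (auto simp: t_def r_def field_simps)
    qed (use M0 in auto)
    also have "\<dots> = \<eta> / 2 + (16 * real L * S\<^sup>2) * inverse (real M)"
      using M0 by (simp add: power2_eq_square field_simps)
    finally show ?thesis .
  qed
  obtain M0 :: nat where M0: "4 * S \<le> real M0" using real_arch_simple by blast
  have "(\<lambda>M. \<eta> / 2 + (16 * real L * S\<^sup>2) * inverse (real M)) \<longlonglongrightarrow> \<eta> / 2 + (16 * real L * S\<^sup>2) * 0"
    by (intro tendsto_intros LIMSEQ_inverse_real_of_nat lim_inverse_n)
  moreover have "\<forall>M\<ge>max 1 M0. D \<le> \<eta> / 2 + (16 * real L * S\<^sup>2) * inverse (real M)"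
    using M0 by (auto intro!: main)
  ultimately have "D \<le> \<eta> / 2 + (16 * real L * S\<^sup>2) * 0" by (blast intro: LIMSEQ_le_const)
  thus ?thesis by (simp add: D_def)
qed

lemma channel_subset: "J \<subseteq> I \<Longrightarrow> channel P J x"
  using finite_I signal_measurable signal_bound finite_subset
  by (intro channel.intro channel_axioms.intro prob_space_axioms) blast+

text \<open>Raising the signal-to-noise ratio on \<open>J\<close> makes the averages over \<open>J\<close> of \<open>acc\<close> increase by a multiple of the
  posterior covariances; these averages are at most 1.\<close>

lemma ecov_telescope:
  fixes L :: nat
  assumes s: "\<forall>j. 0 \<le> s j" and b: "\<forall>j. 0 \<le> b j" and J: "J \<subseteq> I" "J \<noteq> {}"
    and bJ: "\<And>j. j \<in> J \<Longrightarrow> b j = B" and B: "0 < B"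
  shows "(\<Sum>l<L. (\<Sum>j\<in>J. \<Sum>k\<in>J. ecov P I x (\<lambda>j. s j + real l * b j) (x j) (x k)) / (real (card J))\<^sup>2)
     \<le> 1 + 1 / (B * real (card J))"
proof -
  have finJ: "finite J" using J finite_I finite_subset by blast
  define m where "m = real (card J)"
  have m: "0 < m" using finJ J by (simp add: m_def card_gt_0_iff)
  define sl where "sl l j = s j + real l * b j" for l :: nat and j
  have sl0: "\<forall>j. 0 \<le> sl l j" for l using s b by (auto simp: sl_def)
  define al where "al l = (\<Sum>j\<in>J. acc P I x (sl l) (x j)) / m" for l
  define ka where "ka l = (\<Sum>j\<in>J. \<Sum>k\<in>J. ecov P I x (sl l) (x j) (x k)) / m\<^sup>2" for l
  have step: "B * m / (1 + B * m) * ka l \<le> al (Suc l) - al l" for l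
  proof -
    have "acc P I x (sl l) (x j) + (\<Sum>k\<in>J. B * ecov P I x (sl l) (x j) (x k)) / (1 + B * m) \<le> acc P I x (sl (Suc l)) (x j)"
      if j: "j \<in> J" for j
    proof -
      have "j \<in> I" using j J by blast
      hence "acc P I x (sl l) (x j) + (\<Sum>k\<in>J. b k * ecov P I x (sl l) (x j) (x k)) / (1 + (\<Sum>k\<in>J. b k))
         \<le> acc P I x (\<lambda>j. sl l j + b j) (x j)"
        by (intro acc_increment[OF sl0 b signal_measurable signal_bound J(1)]) auto
      moreover have "(\<lambda>j. sl l j + b j) = sl (Suc l)" by (auto simp: sl_def algebra_simps)
      moreover have "(\<Sum>k\<in>J. b k * ecov P I x (sl l) (x j) (x k)) = (\<Sum>k\<in>J. B * ecov P I x (sl l) (x j) (x k))"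
        using bJ by (intro sum.cong) auto
      moreover have "(\<Sum>k\<in>J. b k) = B * m" using bJ by (simp add: m_def)
      ultimately show ?thesis by simp
    qed
    hence "(\<Sum>j\<in>J. acc P I x (sl l) (x j) + (\<Sum>k\<in>J. B * ecov P I x (sl l) (x j) (x k)) / (1 + B * m)) / m
      \<le> (\<Sum>j\<in>J. acc P I x (sl (Suc l)) (x j)) / m"
      using m by (intro divide_right_mono sum_mono) auto
    moreover have "(\<Sum>j\<in>J. acc P I x (sl l) (x j) + (\<Sum>k\<in>J. B * ecov P I x (sl l) (x j) (x k)) / (1 + B * m)) / m
       = al l + B * m / (1 + B * m) * ka l"
      using m by (simp add: al_def ka_def sum.distrib sum_divide_distrib[symmetric] sum_distrib_left[symmetric]
          add_divide_distrib power2_eq_square)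
    ultimately show ?thesis by (simp add: al_def)
  qed
  have "B * m / (1 + B * m) * (\<Sum>l<L. ka l) \<le> (\<Sum>l<L. al (Suc l) - al l)"
    unfolding sum_distrib_left by (intro sum_mono step)
  also have "\<dots> = al L - al 0" by (rule sum_lessThan_telescope)
  also have "\<dots> \<le> 1"
  proof -
    have "(\<Sum>j\<in>J. acc P I x (sl L) (x j)) \<le> (\<Sum>j\<in>J. 1)"
      using J by (intro sum_mono acc_signal_bounds(2)[OF sl0]) auto
    hence "al L \<le> 1" using m by (simp add: al_def m_def)
    moreover have "0 \<le> al 0" unfolding al_def
      using J m by (intro divide_nonneg_nonneg sum_nonneg acc_signal_bounds(1)[OF sl0]) auto
    ultimately show ?thesis by simp
  qed
  finally have "B * m / (1 + B * m) * (\<Sum>l<L. ka l) \<le> 1" .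
  moreover have "0 < 1 + B * m" using m B by (simp add: add_pos_pos)
  ultimately have "(\<Sum>l<L. ka l) \<le> 1 + 1 / (B * m)" using m B by (simp add: field_simps)
  thus ?thesis by (simp add: ka_def sl_def[abs_def] m_def)
qed

section \<open>Overlaps of two independent replicas\<close>

definition overlap :: "'u \<Rightarrow> 'u \<Rightarrow> real"
  where "overlap u u' = (\<Sum>j\<in>I. x j u * x j u') / real (card I)"

lemma integral_sum_product:
  fixes g h :: "'k \<Rightarrow> 'u \<Rightarrow> real"
  assumes "\<And>i. i \<in> K \<Longrightarrow> integrable P (g i)" "\<And>i. i \<in> K \<Longrightarrow> integrable P (h i)"
  shows "(\<integral>u. \<integral>u'. (\<Sum>i\<in>K. g i u * h i u') \<partial>P \<partial>P) = (\<Sum>i\<in>K. (\<integral>u. g i u \<partial>P) * (\<integral>u. h i u \<partial>P))"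
    and "integrable P (\<lambda>u. \<integral>u'. (\<Sum>i\<in>K. g i u * h i u') \<partial>P)"
proof -
  have e: "(\<integral>u'. (\<Sum>i\<in>K. g i u * h i u') \<partial>P) = (\<Sum>i\<in>K. g i u * (\<integral>u'. h i u' \<partial>P))" for u
    using assms by (subst Bochner_Integration.integral_sum) auto
  show "integrable P (\<lambda>u. \<integral>u'. (\<Sum>i\<in>K. g i u * h i u') \<partial>P)"
    unfolding e using assms by (intro Bochner_Integration.integrable_sum) auto
  show "(\<integral>u. \<integral>u'. (\<Sum>i\<in>K. g i u * h i u') \<partial>P \<partial>P) = (\<Sum>i\<in>K. (\<integral>u. g i u \<partial>P) * (\<integral>u. h i u \<partial>P))"
    unfolding e using assms by (subst Bochner_Integration.integral_sum) auto
qed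

lemma overlap_measurable [measurable]: "(\<lambda>(u, u'). overlap u u') \<in> borel_measurable (P \<Otimes>\<^sub>M P)"
proof -
  have [measurable]: "j \<in> I \<Longrightarrow> (\<lambda>p. x j (fst p)) \<in> borel_measurable (P \<Otimes>\<^sub>M P)"
    "j \<in> I \<Longrightarrow> (\<lambda>p. x j (snd p)) \<in> borel_measurable (P \<Otimes>\<^sub>M P)" for j
    using signal_measurable by measurable
  show ?thesis unfolding overlap_def split_beta by measurable
qed

lemma overlap_measurable2: "overlap u \<in> borel_measurable P"
  unfolding overlap_def[abs_def] using signal_measurable by measurable

lemma overlap_bound: "\<bar>overlap u u'\<bar> \<le> 1"
proof (cases "I = {}")
  case False
  have "\<bar>\<Sum>j\<in>I. x j u * x j u'\<bar> \<le> (\<Sum>j\<in>I. 1 * 1)"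
    by (rule order_trans[OF sum_abs]) (intro sum_mono, simp only: abs_mult, intro mult_mono signal_bound, auto)
  thus ?thesis using False finite_I by (simp add: overlap_def divide_le_eq_1 card_gt_0_iff)
next
  case True
  show ?thesis unfolding overlap_def by (simp add: True)
qed

lemma integrable_signal_mult: "j \<in> I \<Longrightarrow> k \<in> I \<Longrightarrow> integrable P (\<lambda>u. x j u * x k u)"
proof (rule integrable_bounded[where K="1 * 1"])
  assume jk: "j \<in> I" "k \<in> I"
  show "(\<lambda>u. x j u * x k u) \<in> borel_measurable P" using signal_measurable jk by measurable
  show "\<bar>x j u * x k u\<bar> \<le> 1 * 1" for u
    unfolding abs_mult by (intro mult_mono signal_bound jk) auto
qed

text \<open>Independence of the replicas turns each product into a squared mean. Under a posterior
  law this identifies the average of the squared posterior means with the mean overlap, so pointwise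
  inequalities between overlaps become inequalities between values of \<open>acc\<close>.\<close>

lemma overlap_mean:
  "(\<integral>u. \<integral>u'. overlap u u' \<partial>P \<partial>P) = (\<Sum>j\<in>I. (\<integral>u. x j u \<partial>P)\<^sup>2) / real (card I)"
  "integrable P (\<lambda>u. \<integral>u'. overlap u u' \<partial>P)"
  using integral_sum_product[of I x x] signal_integrable
  by (simp_all add: overlap_def power2_eq_square)

lemma overlap_power2:
  "(overlap u u')\<^sup>2 = (\<Sum>jk\<in>I\<times>I. (x (fst jk) u * x (snd jk) u) * (x (fst jk) u' * x (snd jk) u')) / (real (card I))\<^sup>2"
  unfolding overlap_def power_divide
  by (simp add: power2_eq_square sum_product sum.cartesian_product split_beta mult_ac)

lemma overlap_second_moment:
  "(\<integral>u. \<integral>u'. (overlap u u')\<^sup>2 \<partial>P \<partial>P) = (\<Sum>j\<in>I. \<Sum>k\<in>I. (\<integral>u. x j u * x k u \<partial>P)\<^sup>2) / (real (card I))\<^sup>2"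
  "integrable P (\<lambda>u. \<integral>u'. (overlap u u')\<^sup>2 \<partial>P)"
  using integral_sum_product[of "I \<times> I" "\<lambda>jk u. x (fst jk) u * x (snd jk) u" "\<lambda>jk u. x (fst jk) u * x (snd jk) u"]
    integrable_signal_mult
  by (simp_all add: overlap_power2 sum.cartesian_product split_beta power2_eq_square[of "integral\<^sup>L P _"] mem_Times_iff)

lemma integrable_overlap: "integrable P (overlap u)"
  by (rule integrable_bounded[OF overlap_measurable2 overlap_bound])

lemma integrable_overlap_abs:
  "integrable P (\<lambda>u'. \<bar>overlap u u'\<bar>)" "integrable P (\<lambda>u. \<integral>u'. \<bar>overlap u u'\<bar> \<partial>P)"
proof -
  show i3: "integrable P (\<lambda>u'. \<bar>overlap u u'\<bar>)" for u using integrable_overlap by simp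
  show "integrable P (\<lambda>u. \<integral>u'. \<bar>overlap u u'\<bar> \<partial>P)"
  proof (rule integrable_bounded[where K=1])
    show "(\<lambda>u. \<integral>u'. \<bar>overlap u u'\<bar> \<partial>P) \<in> borel_measurable P" by measurable
    show "\<bar>\<integral>u'. \<bar>overlap u u'\<bar> \<partial>P\<bar> \<le> 1" for u
      using i3[of u] overlap_bound by (subst abs_of_nonneg) (auto intro!: integral_le_const)
  qed
qed

text \<open>The mean q of the overlap R is nonnegative, hence |R| \<le> R + 2 * |R - q|, and 2 * |R
  - q| \<le> \<epsilon> + (R - q)^2 / \<epsilon>. The variance of R is estimated by the covariances
  of the signals. This bounds the absolute overlap by the signed one up to fluctuations.\<close>

lemma overlap_abs_mean:
  assumes \<epsilon>: "0 < \<epsilon>" "\<epsilon> \<le> 1"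
  shows "(\<integral>u. \<integral>u'. \<bar>overlap u u'\<bar> \<partial>P \<partial>P) \<le> (\<Sum>j\<in>I. (\<integral>u. x j u \<partial>P)\<^sup>2) / real (card I)
    + 2 * \<epsilon> + 2 / \<epsilon> ^ 3 * ((\<Sum>j\<in>I. \<Sum>k\<in>I. (cov P (x j) (x k))\<^sup>2) / (real (card I))\<^sup>2)"
proof -
  define m where "m = real (card I)"
  define q where "q = (\<Sum>j\<in>I. (\<integral>u. x j u \<partial>P)\<^sup>2) / m"
  define q2 where "q2 = (\<Sum>j\<in>I. \<Sum>k\<in>I. (\<integral>u. x j u * x k u \<partial>P)\<^sup>2) / m\<^sup>2"
  define \<kappa> where "\<kappa> = (\<Sum>j\<in>I. \<Sum>k\<in>I. (cov P (x j) (x k))\<^sup>2) / m\<^sup>2"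
  have q0: "0 \<le> q" unfolding q_def m_def by (intro divide_nonneg_nonneg sum_nonneg) auto
  have pt: "\<bar>R\<bar> \<le> (1 - 2 * q / \<epsilon>) * R + R\<^sup>2 / \<epsilon> + (\<epsilon> + q\<^sup>2 / \<epsilon>)" for R
  proof -
    have "2 * \<bar>R - q\<bar> \<le> \<epsilon> + (R - q)\<^sup>2 / \<epsilon>"
    proof -
      have "0 \<le> (\<bar>R - q\<bar> - \<epsilon>)\<^sup>2" by simp
      hence "2 * \<bar>R - q\<bar> * \<epsilon> \<le> (R - q)\<^sup>2 + \<epsilon>\<^sup>2" by (simp add: power2_diff)
      hence "2 * \<bar>R - q\<bar> * \<epsilon> / \<epsilon> \<le> ((R - q)\<^sup>2 + \<epsilon>\<^sup>2) / \<epsilon>" using \<epsilon> by (intro divide_right_mono) auto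
      thus ?thesis using \<epsilon> by (simp add: add_divide_distrib power2_eq_square)
    qed
    moreover have "\<bar>R\<bar> \<le> R + 2 * \<bar>R - q\<bar>" using q0 by (auto simp: abs_if)
    moreover have "R + (\<epsilon> + (R - q)\<^sup>2 / \<epsilon>) = (1 - 2 * q / \<epsilon>) * R + R\<^sup>2 / \<epsilon> + (\<epsilon> + q\<^sup>2 / \<epsilon>)"
      using \<epsilon> by (simp add: power2_diff field_simps)
    ultimately show ?thesis by linarith
  qed
  note i1 = integrable_overlap
  have i2: "integrable P (\<lambda>u'. (overlap u u')\<^sup>2)" for u
    using overlap_bound by (intro integrable_bounded[where K=1]) (use overlap_measurable2[of u] in \<open>auto simp: abs_square_le_1\<close>)
  note i3 = integrable_overlap_abs(1) and i4 = integrable_overlap_abs(2)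
  have e5: "(\<integral>u'. (1 - 2 * q / \<epsilon>) * overlap u u' + (overlap u u')\<^sup>2 / \<epsilon> + (\<epsilon> + q\<^sup>2 / \<epsilon>) \<partial>P)
    = (1 - 2 * q / \<epsilon>) * (\<integral>u'. overlap u u' \<partial>P) + (\<integral>u'. (overlap u u')\<^sup>2 \<partial>P) / \<epsilon> + (\<epsilon> + q\<^sup>2 / \<epsilon>)" for u
    using i1[of u] i2[of u] by (simp add: prob_space)
  have "(\<integral>u. \<integral>u'. \<bar>overlap u u'\<bar> \<partial>P \<partial>P) \<le>
     (\<integral>u. (1 - 2 * q / \<epsilon>) * (\<integral>u'. overlap u u' \<partial>P) + (\<integral>u'. (overlap u u')\<^sup>2 \<partial>P) / \<epsilon> + (\<epsilon> + q\<^sup>2 / \<epsilon>) \<partial>P)"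
  proof (rule integral_mono[OF i4])
    show "integrable P (\<lambda>u. (1 - 2 * q / \<epsilon>) * (\<integral>u'. overlap u u' \<partial>P) + (\<integral>u'. (overlap u u')\<^sup>2 \<partial>P) / \<epsilon> + (\<epsilon> + q\<^sup>2 / \<epsilon>))"
      using overlap_mean(2) overlap_second_moment(2) by simp
    show "(\<integral>u'. \<bar>overlap u u'\<bar> \<partial>P) \<le> (1 - 2 * q / \<epsilon>) * (\<integral>u'. overlap u u' \<partial>P) + (\<integral>u'. (overlap u u')\<^sup>2 \<partial>P) / \<epsilon> + (\<epsilon> + q\<^sup>2 / \<epsilon>)" for u
      unfolding e5[symmetric] using i1[of u] i2[of u] i3[of u] pt by (intro integral_mono) auto
  qed
  also have "\<dots> = (1 - 2 * q / \<epsilon>) * q + q2 / \<epsilon> + (\<epsilon> + q\<^sup>2 / \<epsilon>)"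
    using overlap_mean overlap_second_moment by (simp add: prob_space q_def q2_def m_def)
  also have "\<dots> = q + \<epsilon> + (q2 - q\<^sup>2) / \<epsilon>" using \<epsilon> by (simp add: field_simps power2_eq_square)
  also have "\<dots> \<le> q + 2 * \<epsilon> + 2 / \<epsilon> ^ 3 * \<kappa>"
  proof -
    \<comment> \<open>With covariance C and product of means b the second moment is (C + b)^2, and
      |b| \<le> 1. The cross term 2 C b is at most C^2 / \<epsilon>^2 + \<epsilon>^2, and \<epsilon>
      \<le> 1 absorbs C^2 into C^2 / \<epsilon>^2.\<close>
    have pw: "(\<integral>u. x j u * x k u \<partial>P)\<^sup>2 - (\<integral>u. x j u \<partial>P)\<^sup>2 * (\<integral>u. x k u \<partial>P)\<^sup>2
        \<le> (2 / \<epsilon>\<^sup>2) * (cov P (x j) (x k))\<^sup>2 + \<epsilon>\<^sup>2" if jk: "j \<in> I" "k \<in> I" for j k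
    proof -
      define C where "C = cov P (x j) (x k)"
      define b where "b = (\<integral>u. x j u \<partial>P) * (\<integral>u. x k u \<partial>P)"
      have b1: "\<bar>b\<bar> \<le> 1" unfolding b_def abs_mult
        using mult_mono[OF integral_signal_bound[OF jk(1)] integral_signal_bound[OF jk(2)]] by simp
      have "2 * C * b \<le> 2 * (\<bar>C\<bar> * \<bar>b\<bar>)" using abs_ge_self[of "C * b"] by (simp add: abs_mult)
      also have "\<dots> \<le> 2 * \<bar>C\<bar>" using mult_left_mono[OF b1, of "\<bar>C\<bar>"] by simp
      also have "\<dots> \<le> C\<^sup>2 / \<epsilon>\<^sup>2 + \<epsilon>\<^sup>2"
      proof -
        have "0 \<le> (\<bar>C\<bar> / \<epsilon> - \<epsilon>)\<^sup>2" by simp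
        thus ?thesis using \<epsilon> by (simp add: power2_diff power_divide)
      qed
      finally have 1: "2 * C * b \<le> C\<^sup>2 / \<epsilon>\<^sup>2 + \<epsilon>\<^sup>2" .
      have "C\<^sup>2 \<le> C\<^sup>2 / \<epsilon>\<^sup>2"
        using \<epsilon> by (simp add: le_divide_eq mult_left_le power_le_one)
      with 1 have "C\<^sup>2 + 2 * C * b \<le> (2 / \<epsilon>\<^sup>2) * C\<^sup>2 + \<epsilon>\<^sup>2" by simp
      moreover have "(\<integral>u. x j u * x k u \<partial>P) = C + b" by (simp add: C_def b_def cov_def)
      hence "(\<integral>u. x j u * x k u \<partial>P)\<^sup>2 - (\<integral>u. x j u \<partial>P)\<^sup>2 * (\<integral>u. x k u \<partial>P)\<^sup>2 = C\<^sup>2 + 2 * C * b"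
        by (simp add: power2_sum b_def power_mult_distrib)
      ultimately show ?thesis by (simp add: C_def)
    qed
    have "q2 - q\<^sup>2 = (\<Sum>j\<in>I. \<Sum>k\<in>I. (\<integral>u. x j u * x k u \<partial>P)\<^sup>2 - (\<integral>u. x j u \<partial>P)\<^sup>2 * (\<integral>u. x k u \<partial>P)\<^sup>2) / m\<^sup>2"
      by (simp add: q2_def q_def power_divide power2_eq_square[of "sum _ _"] sum_product sum_subtractf diff_divide_distrib)
    also have "\<dots> \<le> (\<Sum>j\<in>I. \<Sum>k\<in>I. (2 / \<epsilon>\<^sup>2) * (cov P (x j) (x k))\<^sup>2 + \<epsilon>\<^sup>2) / m\<^sup>2"
      by (intro divide_right_mono sum_mono pw) auto
    also have "\<dots> = (2 / \<epsilon>\<^sup>2) * \<kappa> + (m\<^sup>2 * \<epsilon>\<^sup>2) / m\<^sup>2"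
    proof -
      have "(\<Sum>j\<in>I. \<Sum>k\<in>I. A * (cov P (x j) (x k))\<^sup>2 + e) = A * (\<Sum>j\<in>I. \<Sum>k\<in>I. (cov P (x j) (x k))\<^sup>2) + m\<^sup>2 * e" for A e
        by (simp add: sum.distrib sum_distrib_left m_def power2_eq_square)
      from this[of "2 / \<epsilon>\<^sup>2" "\<epsilon>\<^sup>2"] show ?thesis
        by (simp only: \<kappa>_def add_divide_distrib times_divide_eq_right)
    qed
    also have "\<dots> \<le> (2 / \<epsilon>\<^sup>2) * \<kappa> + \<epsilon>\<^sup>2" by simp
    finally have "(q2 - q\<^sup>2) / \<epsilon> \<le> ((2 / \<epsilon>\<^sup>2) * \<kappa> + \<epsilon>\<^sup>2) / \<epsilon>" using \<epsilon> by (intro divide_right_mono) auto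
    also have "\<dots> = 2 / \<epsilon> ^ 3 * \<kappa> + \<epsilon>" using \<epsilon> by (simp add: field_simps power2_eq_square power3_eq_cube)
    finally show ?thesis by simp
  qed
  finally show ?thesis by (simp add: q_def \<kappa>_def m_def)
qed

text \<open>From (C + b)^2 \<le> 2 C^2 + 2 b^2, where the product b of two means is at most one of
  them in absolute value. The two terms on the right become \<open>ecov\<close> and
  \<open>acc\<close> after averaging over observations.\<close>

lemma overlap_second_moment_le:
  "(\<integral>u. \<integral>u'. (overlap u u')\<^sup>2 \<partial>P \<partial>P) \<le> 2 * ((\<Sum>j\<in>I. \<Sum>k\<in>I. (cov P (x j) (x k))\<^sup>2) / (real (card I))\<^sup>2)
    + 2 * ((\<Sum>j\<in>I. (\<integral>u. x j u \<partial>P)\<^sup>2) / real (card I))"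
proof (cases "I = {}")
  case False
  define m where "m = real (card I)"
  have m: "0 < m" using False finite_I by (simp add: m_def card_gt_0_iff)
  have pw: "(\<integral>u. x j u * x k u \<partial>P)\<^sup>2 \<le> 2 * (cov P (x j) (x k))\<^sup>2 + 2 * (\<integral>u. x j u \<partial>P)\<^sup>2" if jk: "j \<in> I" "k \<in> I" for j k
  proof -
    define C where "C = cov P (x j) (x k)"
    define b where "b = (\<integral>u. x j u \<partial>P) * (\<integral>u. x k u \<partial>P)"
    have "b\<^sup>2 \<le> (\<integral>u. x j u \<partial>P)\<^sup>2 * 1" unfolding b_def power_mult_distrib
      using integral_signal_bound[OF jk(2)] by (intro mult_left_mono) (auto simp: abs_square_le_1)
    moreover have "0 \<le> (C - b)\<^sup>2" by simp
    hence "(C + b)\<^sup>2 \<le> 2 * C\<^sup>2 + 2 * b\<^sup>2" by (simp add: power2_sum power2_diff)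
    moreover have "(\<integral>u. x j u * x k u \<partial>P) = C + b" by (simp add: C_def b_def cov_def)
    ultimately show ?thesis by (simp add: C_def)
  qed
  have "(\<integral>u. \<integral>u'. (overlap u u')\<^sup>2 \<partial>P \<partial>P) \<le> (\<Sum>j\<in>I. \<Sum>k\<in>I. 2 * (cov P (x j) (x k))\<^sup>2 + 2 * (\<integral>u. x j u \<partial>P)\<^sup>2) / m\<^sup>2"
    unfolding overlap_second_moment m_def by (intro divide_right_mono sum_mono pw) auto
  also have "\<dots> = 2 * ((\<Sum>j\<in>I. \<Sum>k\<in>I. (cov P (x j) (x k))\<^sup>2) / m\<^sup>2) + 2 * ((\<Sum>j\<in>I. (\<integral>u. x j u \<partial>P)\<^sup>2) / m)"
    using m by (simp add: sum.distrib sum_distrib_left[symmetric] add_divide_distrib power2_eq_square m_def)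
  finally show ?thesis by (simp add: m_def)
next
  case True
  show ?thesis unfolding overlap_def by (simp add: True)
qed

text \<open>Both overlap estimates bound a posterior quantity by a combination of squared means, a
  constant and squared covariances. This averages such a combination over the observation; the free
  coefficients cover both uses.\<close>

lemma integral_evid_overlap:
  assumes s: "\<forall>j. 0 \<le> s j" and J: "J \<subseteq> I"
  shows "(\<integral>y. evid P I x s y * (c * (\<Sum>j\<in>J. (\<integral>u. x j u \<partial>post P I x s y)\<^sup>2) + d
      + e * (\<Sum>j\<in>J. \<Sum>k\<in>J. (cov (post P I x s y) (x j) (x k))\<^sup>2)) \<partial>gaussian I)
    = c * (\<Sum>j\<in>J. acc P I x s (x j)) + d + e * (\<Sum>j\<in>J. \<Sum>k\<in>J. ecov P I x s (x j) (x k))"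
    and "integrable (gaussian I) (\<lambda>y. evid P I x s y * (c * (\<Sum>j\<in>J. (\<integral>u. x j u \<partial>post P I x s y)\<^sup>2) + d
      + e * (\<Sum>j\<in>J. \<Sum>k\<in>J. (cov (post P I x s y) (x j) (x k))\<^sup>2)))"
proof -
  note ev = exp_bounded_evid[OF s]
  have jI: "j \<in> I" if "j \<in> J" for j using that J by blast
  have b1: "integrable (gaussian I) (\<lambda>y. evid P I x s y * (\<integral>u. x j u \<partial>post P I x s y)\<^sup>2)" if "j \<in> J" for j
    by (intro exp_bounded_integrable' exp_bounded_mult exp_bounded_power exp_bounded_post[OF s, where K=1] ev
        signal_measurable[OF jI[OF that]] signal_bound[OF jI[OF that]])
  have b2: "integrable (gaussian I) (\<lambda>y. evid P I x s y * (cov (post P I x s y) (x j) (x k))\<^sup>2)" if "j \<in> J" "k \<in> J" for j k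
    by (intro exp_bounded_integrable' exp_bounded_mult exp_bounded_power ev exp_bounded_cov_post[OF s, where L=1 and K=1]
        signal_measurable[OF jI[OF that(1)]] signal_bound[OF jI[OF that(1)]]
        signal_measurable[OF jI[OF that(2)]] signal_bound[OF jI[OF that(2)]])
  have b0: "integrable (gaussian I) (evid P I x s)" by (rule exp_bounded_integrable'[OF ev])
  have eq: "evid P I x s y * (c * (\<Sum>j\<in>J. (\<integral>u. x j u \<partial>post P I x s y)\<^sup>2) + d
      + e * (\<Sum>j\<in>J. \<Sum>k\<in>J. (cov (post P I x s y) (x j) (x k))\<^sup>2))
    = c * (\<Sum>j\<in>J. evid P I x s y * (\<integral>u. x j u \<partial>post P I x s y)\<^sup>2) + d * evid P I x s y
      + e * (\<Sum>j\<in>J. \<Sum>k\<in>J. evid P I x s y * (cov (post P I x s y) (x j) (x k))\<^sup>2)" for y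
    by (simp add: distrib_left sum_distrib_left[symmetric] mult_ac)
  have c2: "integrable (gaussian I) (\<lambda>y. \<Sum>j\<in>J. \<Sum>k\<in>J. evid P I x s y * (cov (post P I x s y) (x j) (x k))\<^sup>2)"
    using b2 by (intro Bochner_Integration.integrable_sum) auto
  show "integrable (gaussian I) (\<lambda>y. evid P I x s y * (c * (\<Sum>j\<in>J. (\<integral>u. x j u \<partial>post P I x s y)\<^sup>2) + d
      + e * (\<Sum>j\<in>J. \<Sum>k\<in>J. (cov (post P I x s y) (x j) (x k))\<^sup>2)))"
    unfolding eq using b0 b1 b2 by (auto intro!: Bochner_Integration.integrable_add integrable_mult_right Bochner_Integration.integrable_sum)
  show "(\<integral>y. evid P I x s y * (c * (\<Sum>j\<in>J. (\<integral>u. x j u \<partial>post P I x s y)\<^sup>2) + d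
      + e * (\<Sum>j\<in>J. \<Sum>k\<in>J. (cov (post P I x s y) (x j) (x k))\<^sup>2)) \<partial>gaussian I)
    = c * (\<Sum>j\<in>J. acc P I x s (x j)) + d + e * (\<Sum>j\<in>J. \<Sum>k\<in>J. ecov P I x s (x j) (x k))"
    unfolding eq using b0 b1 b2 c2 by (simp add: Bochner_Integration.integral_sum acc_def ecov_def integral_evid[OF s])
qed

end

section \<open>Rank-one tensors with independent entries\<close>

definition lists_in :: "nat \<Rightarrow> 'a set \<Rightarrow> 'a list set"
  where "lists_in p B = {xs. length xs = p \<and> set xs \<subseteq> B}"

text \<open>The entry with index list xs of the p-fold tensor power of the vector f (u i). Keeping f
  apart from u lets the same prior serve for the rescaled entries and, with \<open>sgn\<close> in
  place of f, for sign vectors.\<close>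

definition monomial :: "('a \<Rightarrow> real) \<Rightarrow> nat list \<Rightarrow> (nat \<Rightarrow> 'a) \<Rightarrow> real"
  where "monomial f xs u = (\<Prod>i\<leftarrow>xs. f (u i))"

lemma tidx_lists_in: "tidx p N = lists_in p {..<N}"
  by (simp add: tidx_def lists_in_def)

lemma lists_in_0 [simp]: "lists_in 0 B = {[]}"
  by (auto simp: lists_in_def)

lemma lists_in_Suc: "lists_in (Suc p) B = (\<lambda>(i, xs). i # xs) ` (B \<times> lists_in p B)"
  by (auto simp: lists_in_def length_Suc_conv image_iff)

lemma finite_lists_in: "finite B \<Longrightarrow> finite (lists_in p B)"
  by (induction p) (auto simp: lists_in_Suc)

lemma lists_in_mono: "A \<subseteq> B \<Longrightarrow> lists_in p A \<subseteq> lists_in p B"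
  by (auto simp: lists_in_def)

lemma sum_prod_list:
  fixes g :: "'a \<Rightarrow> 'b::comm_semiring_1"
  assumes "finite B"
  shows "(\<Sum>xs\<in>lists_in p B. \<Prod>i\<leftarrow>xs. g i) = (\<Sum>i\<in>B. g i) ^ p"
proof (induction p)
  case (Suc p)
  have "inj_on (\<lambda>(i, xs). i # xs) (B \<times> lists_in p B)" by (auto simp: inj_on_def)
  hence "(\<Sum>xs\<in>lists_in (Suc p) B. \<Prod>i\<leftarrow>xs. g i) = (\<Sum>(i, xs)\<in>B \<times> lists_in p B. g i * (\<Prod>i\<leftarrow>xs. g i))"
    unfolding lists_in_Suc by (subst sum.reindex) (auto simp: split_beta)
  thus ?case by (simp add: sum.cartesian_product[symmetric] sum_product[symmetric] Suc)
qed simp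

lemma card_lists_in: "finite B \<Longrightarrow> card (lists_in p B) = card B ^ p"
  using sum_prod_list[where B=B and p=p and g="\<lambda>_. 1 :: nat"] by (simp add: map_replicate_const)

lemma power_mean:
  fixes t :: "'a \<Rightarrow> real"
  assumes "finite S" "S \<noteq> {}" "\<And>b. b \<in> S \<Longrightarrow> 0 \<le> t b"
  shows "((\<Sum>b\<in>S. t b) / real (card S)) ^ p \<le> (\<Sum>b\<in>S. t b ^ p) / real (card S)"
proof -
  have c: "convex_on {0::real..} (\<lambda>x. x ^ p)"
    by (cases "even p") (auto intro: convex_power_odd convex_on_subset[OF convex_power_even])
  have "(\<Sum>b\<in>S. (1 / real (card S)) *\<^sub>R t b) ^ p \<le> (\<Sum>b\<in>S. 1 / real (card S) * t b ^ p)"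
    using assms by (intro convex_on_sum[OF _ _ c]) (auto simp: card_gt_0_iff)
  thus ?thesis by (simp add: sum_divide_distrib)
qed

lemma lik_cong:
  "(\<And>j. j \<in> I \<Longrightarrow> s j = s' j) \<Longrightarrow> lik I x s = lik I x s'"
  by (auto simp: lik_def tilt_def fun_eq_iff intro!: sum.cong)

lemma KL_cong: "(\<And>j. j \<in> I \<Longrightarrow> s j = s' j) \<Longrightarrow> KL P I x s = KL P I x s'"
  unfolding KL_def evid_def using lik_cong[of I s s' x] by simp

lemma integral_PiM_reindex:
  fixes g :: "_ \<Rightarrow> real"
  assumes M: "prob_space M" and \<phi>: "inj_on \<phi> I" "\<phi> \<in> I \<rightarrow> K" and g: "g \<in> borel_measurable (PiM I (\<lambda>_. M))"
  shows "(\<integral>w. g (\<lambda>n\<in>I. w (\<phi> n)) \<partial>PiM K (\<lambda>_. M)) = (\<integral>v. g v \<partial>PiM I (\<lambda>_. M))"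
proof -
  have d: "distr (PiM K (\<lambda>_. M)) (PiM I (\<lambda>_. M)) (\<lambda>\<omega>. \<lambda>n\<in>I. \<omega> (\<phi> n)) = PiM I (\<lambda>_. M)"
    using distr_PiM_reindex[of K "\<lambda>_. M" \<phi> I] M \<phi> by simp
  have m: "(\<lambda>\<omega>. \<lambda>n\<in>I. \<omega> (\<phi> n)) \<in> PiM K (\<lambda>_. M) \<rightarrow>\<^sub>M PiM I (\<lambda>_. M)"
    using \<phi>(2) by (intro measurable_restrict measurable_component_singleton) auto
  have "(\<integral>w. g (\<lambda>n\<in>I. w (\<phi> n)) \<partial>PiM K (\<lambda>_. M)) = integral\<^sup>L (distr (PiM K (\<lambda>_. M)) (PiM I (\<lambda>_. M)) (\<lambda>\<omega>. \<lambda>n\<in>I. \<omega> (\<phi> n))) g"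
    by (rule integral_distr[OF m g, symmetric])
  thus ?thesis by (simp only: d)
qed

text \<open>Independence of functions of disjoint sets of coordinates. Dependence on a set is
  expressed as invariance under changes elsewhere, so that splitting the product measure by
  \<open>merge\<close> suffices.\<close>

lemma integral_PiM_indep:
  fixes g h :: "('i \<Rightarrow> 'a) \<Rightarrow> real"
  assumes M: "prob_space M" and K: "finite K" and U: "U \<subseteq> K"
    and g: "g \<in> borel_measurable (PiM K (\<lambda>_. M))" "\<And>u. \<bar>g u\<bar> \<le> C"
    and h: "h \<in> borel_measurable (PiM K (\<lambda>_. M))" "\<And>u. \<bar>h u\<bar> \<le> D"
    and dg: "\<And>u u'. (\<And>i. i \<in> U \<Longrightarrow> u i = u' i) \<Longrightarrow> g u = g u'"
    and dh: "\<And>u u'. (\<And>i. i \<in> K - U \<Longrightarrow> u i = u' i) \<Longrightarrow> h u = h u'"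
  shows "(\<integral>u. g u * h u \<partial>PiM K (\<lambda>_. M)) = (\<integral>u. g u \<partial>PiM K (\<lambda>_. M)) * (\<integral>u. h u \<partial>PiM K (\<lambda>_. M))"
proof -
  interpret M: prob_space M by (rule M)
  interpret S: product_sigma_finite "\<lambda>_. M" by unfold_locales
  interpret PK: prob_space "PiM K (\<lambda>_. M)" by (intro prob_space_PiM M)
  interpret PU: prob_space "PiM U (\<lambda>_. M)" by (intro prob_space_PiM M)
  interpret PV: prob_space "PiM (K - U) (\<lambda>_. M)" by (intro prob_space_PiM M)
  have KU: "U \<union> (K - U) = K" using U by blast
  have fin: "finite U" "finite (K - U)" using K U finite_subset by auto
  have mg: "g (merge U (K - U) (v, w)) = g v" for v w by (rule dg) simp
  have mh: "h (merge U (K - U) (v, w)) = h w" for v w by (rule dh) simp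
  have fold: "(\<integral>u. F u \<partial>PiM K (\<lambda>_. M)) = (\<integral>v. \<integral>w. F (merge U (K - U) (v, w)) \<partial>PiM (K - U) (\<lambda>_. M) \<partial>PiM U (\<lambda>_. M))"
    if "integrable (PiM K (\<lambda>_. M)) F" for F :: "_ \<Rightarrow> real"
    using S.product_integral_fold[of U "K - U" F, unfolded KU] that fin by blast
  have ig: "integrable (PiM K (\<lambda>_. M)) g" using g by (intro PK.integrable_const_bound[of _ C]) auto
  have ih: "integrable (PiM K (\<lambda>_. M)) h" using h by (intro PK.integrable_const_bound[of _ D]) auto
  have igh: "integrable (PiM K (\<lambda>_. M)) (\<lambda>u. g u * h u)"
  proof (rule PK.integrable_const_bound[of _ "C * D"])
    have "\<bar>g u * h u\<bar> \<le> C * D" for u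
      unfolding abs_mult using g(2)[of u] h(2)[of u] by (intro mult_mono) auto
    thus "AE u in PiM K (\<lambda>_. M). norm (g u * h u) \<le> C * D" by simp
  qed (use g(1) h(1) in measurable)
  show ?thesis
    unfolding fold[OF igh] fold[OF ig] fold[OF ih]
    by (simp add: mg mh PU.prob_space[simplified] PV.prob_space[simplified] PU.prob_space PV.prob_space)
qed

section \<open>The tensor channel and its relative entropy\<close>

locale tensor_model = prob_space \<nu> for \<nu> :: "real measure" +
  fixes f :: "real \<Rightarrow> real" and p :: nat
  assumes sets_nu: "sets \<nu> = sets borel"
    and f_measurable: "f \<in> borel_measurable borel"
    and f_bound: "\<bar>f a\<bar> \<le> 1"
    and p_pos: "1 \<le> p"
begin

abbreviation prior :: "nat \<Rightarrow> (nat \<Rightarrow> real) measure"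
  where "prior N \<equiv> PiM {..<N} (\<lambda>_. \<nu>)"

text \<open>The quantity called K N \<lambda> in the overview. The ratios of all N^p entries add up
  to l * N, which is why N is the natural scale of \<open>TK N l\<close>.\<close>

definition TK :: "nat \<Rightarrow> real \<Rightarrow> real"
  where "TK N l = KL (prior N) (lists_in p {..<N}) (monomial f) (\<lambda>_. l / real N ^ (p - 1))"

lemma prob_space_prior: "prob_space (prior N)"
  by (intro prob_space_PiM prob_space_axioms)

lemma f_measurable_nu [measurable]: "f \<in> borel_measurable \<nu>"
  using f_measurable by (simp add: measurable_cong_sets[OF sets_nu refl])

lemma monomial_measurable: 
  assumes "xs \<in> lists_in p B" shows "monomial f xs \<in> borel_measurable (PiM B (\<lambda>_. \<nu>))"
proof -
  have "(\<lambda>u. \<Prod>i\<leftarrow>xs. f (u i)) \<in> borel_measurable (PiM B (\<lambda>_. \<nu>))" if "set xs \<subseteq> B" for xs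
    using that
  proof (induction xs)
    case (Cons i xs)
    have [measurable]: "(\<lambda>u. u i) \<in> PiM B (\<lambda>_. \<nu>) \<rightarrow>\<^sub>M \<nu>"
      using Cons.prems by (intro measurable_component_singleton) auto
    have [measurable]: "(\<lambda>u. \<Prod>i\<leftarrow>xs. f (u i)) \<in> borel_measurable (PiM B (\<lambda>_. \<nu>))" using Cons by simp
    show ?case by simp
  qed simp
  thus ?thesis using assms by (simp add: monomial_def[abs_def] lists_in_def)
qed

lemma monomial_bound: "\<bar>monomial f xs u\<bar> \<le> 1"
  unfolding monomial_def
proof (induction xs)
  case (Cons i xs)
  thus ?case using f_bound[of "u i"] by (simp add: abs_mult mult_le_one)
qed simp

lemma channel_prior: "finite B \<Longrightarrow> B \<subseteq> {..<N} \<Longrightarrow> channel (prior N) (lists_in p B) (monomial f)"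
  using monomial_measurable[OF subsetD[OF lists_in_mono]] monomial_bound
  by (intro channel.intro channel_axioms.intro prob_space_prior finite_lists_in) auto

lemma channel_prior': "channel (prior N) (lists_in p {..<N}) (monomial f)"
  by (rule channel_prior) auto

lemma lik_monomial_measurable:
  "finite B \<Longrightarrow> B \<subseteq> {..<N} \<Longrightarrow> y \<in> space (PiM (lists_in p B) (\<lambda>_. borel)) \<Longrightarrow> lik (lists_in p B) (monomial f) s y \<in> borel_measurable (prior N)"
  using channel.lik_measurable[OF channel_prior] by blast

text \<open>Entries with ratio zero contribute a factor 1 to the likelihood, so only the coordinates
  in the range of \<phi> matter, and their joint law is the prior of size n. The injection \<phi>
  serves both for initial segments and for shifted blocks.\<close>

lemma KL_embed:
  assumes \<phi>: "inj_on \<phi> {..<n}" "\<phi> ` {..<n} \<subseteq> {..<N}"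
    and s0: "\<And>xs. xs \<in> lists_in p {..<N} \<Longrightarrow> \<not> set xs \<subseteq> \<phi> ` {..<n} \<Longrightarrow> s xs = 0"
  shows "KL (prior N) (lists_in p {..<N}) (monomial f) s = KL (prior n) (lists_in p {..<n}) (monomial f) (\<lambda>xs. s (map \<phi> xs))"
proof -
  let ?I = "lists_in p {..<N}" and ?J = "lists_in p {..<n}"
  interpret C: channel "prior n" ?J "monomial f" by (rule channel_prior')
  have img: "map \<phi> ` ?J = lists_in p (\<phi> ` {..<n})"
  proof (intro equalityI subsetI)
    fix xs assume "xs \<in> lists_in p (\<phi> ` {..<n})"
    hence l: "length xs = p" and "\<forall>i\<in>set xs. \<exists>k. k < n \<and> i = \<phi> k" by (auto simp: lists_in_def)
    then obtain g where g: "\<And>i. i \<in> set xs \<Longrightarrow> g i < n \<and> i = \<phi> (g i)" by metis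
    hence "xs = map \<phi> (map g xs)" by (simp add: map_idI)
    thus "xs \<in> map \<phi> ` ?J" using l g by (intro image_eqI[of _ _ "map g xs"]) (auto simp: lists_in_def)
  qed (auto simp: lists_in_def subset_iff)
  have inj: "inj_on (map \<phi>) ?J"
    using \<phi>(1) by (intro inj_onI) (auto simp: lists_in_def intro: map_inj_on inj_on_subset elim!: inj_on_subset)
  have sub: "map \<phi> ` ?J \<subseteq> ?I" unfolding img using \<phi>(2) by (rule lists_in_mono)
  have fin: "finite ?I" by (intro finite_lists_in) simp
  have lik: "lik ?I (monomial f) s y u = lik ?J (monomial f) (\<lambda>xs. s (map \<phi> xs)) (\<lambda>xs\<in>?J. y (map \<phi> xs)) (\<lambda>i\<in>{..<n}. u (\<phi> i))" for y u
  proof -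
    define G where "G xs = sqrt (s xs) * monomial f xs u * y xs - (sqrt (s xs) * monomial f xs u)\<^sup>2 / 2" for xs
    have "(\<Sum>xs\<in>?I. G xs) = (\<Sum>xs\<in>map \<phi> ` ?J. G xs)"
    proof (rule sum.mono_neutral_right[OF fin sub], rule ballI)
      fix xs assume "xs \<in> ?I - map \<phi> ` ?J"
      hence "xs \<in> ?I" "\<not> set xs \<subseteq> \<phi> ` {..<n}" unfolding img by (auto simp: lists_in_def)
      thus "G xs = 0" using s0 by (simp add: G_def)
    qed
    also have "\<dots> = (\<Sum>xs\<in>?J. G (map \<phi> xs))" by (rule sum.reindex[OF inj, unfolded comp_def])
    also have "\<dots> = (\<Sum>xs\<in>?J. sqrt (s (map \<phi> xs)) * monomial f xs (\<lambda>i\<in>{..<n}. u (\<phi> i)) * (\<lambda>xs\<in>?J. y (map \<phi> xs)) xs -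
        (sqrt (s (map \<phi> xs)) * monomial f xs (\<lambda>i\<in>{..<n}. u (\<phi> i)))\<^sup>2 / 2)"
    proof (intro sum.cong refl)
      fix xs assume xs: "xs \<in> ?J"
      have "monomial f (map \<phi> xs) u = monomial f xs (\<lambda>i\<in>{..<n}. u (\<phi> i))"
        unfolding monomial_def map_map comp_def using xs
        by (intro arg_cong[where f=prod_list] map_cong refl) (auto simp: lists_in_def)
      thus "G (map \<phi> xs) = sqrt (s (map \<phi> xs)) * monomial f xs (\<lambda>i\<in>{..<n}. u (\<phi> i)) * (\<lambda>xs\<in>?J. y (map \<phi> xs)) xs -
        (sqrt (s (map \<phi> xs)) * monomial f xs (\<lambda>i\<in>{..<n}. u (\<phi> i)))\<^sup>2 / 2"
        using xs by (simp add: G_def)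
    qed
    finally show ?thesis by (simp add: lik_def tilt_def G_def)
  qed
  have ev: "evid (prior N) ?I (monomial f) s y = evid (prior n) ?J (monomial f) (\<lambda>xs. s (map \<phi> xs)) (\<lambda>xs\<in>?J. y (map \<phi> xs))" for y
    unfolding evid_def lik
    by (rule integral_PiM_reindex[OF prob_space_axioms \<phi>(1)])
       (use \<phi>(2) in \<open>auto intro!: lik_monomial_measurable simp: space_PiM\<close>)
  show ?thesis unfolding KL_def ev
  proof (rule integral_PiM_reindex[OF prob_space_gauss inj])
    show "map \<phi> \<in> ?J \<rightarrow> ?I" using sub by auto
    show "(\<lambda>y. evid (prior n) ?J (monomial f) (\<lambda>xs. s (map \<phi> xs)) y * ln (evid (prior n) ?J (monomial f) (\<lambda>xs. s (map \<phi> xs)) y)) \<in> borel_measurable (gaussian ?J)"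
      by measurable
  qed
qed

lemma KL_restrict:
  assumes "n \<le> N"
    and s0: "\<And>xs. xs \<in> lists_in p {..<N} \<Longrightarrow> \<not> set xs \<subseteq> {..<n} \<Longrightarrow> s xs = 0"
  shows "KL (prior N) (lists_in p {..<N}) (monomial f) s = KL (prior n) (lists_in p {..<n}) (monomial f) s"
  using KL_embed[of id n N s] assms by auto

lemma TK_mono: "0 \<le> l \<Longrightarrow> l \<le> l' \<Longrightarrow> TK N l \<le> TK N l'"
  unfolding TK_def by (intro channel.KL_mono[OF channel_prior']) (auto intro!: divide_right_mono)

lemma TK_nonneg:
  assumes "0 \<le> l" shows "0 \<le> TK N l"
proof -
  interpret C: channel "prior N" "lists_in p {..<N}" "monomial f" by (rule channel_prior')
  have "0 \<le> (\<Sum>j\<in>lists_in p {..<N}. l / real N ^ (p - 1) * (\<integral>u. monomial f j u \<partial>prior N)\<^sup>2) / 2"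
    using assms by (intro divide_nonneg_nonneg sum_nonneg mult_nonneg_nonneg) auto
  also have "\<dots> \<le> TK N l" unfolding TK_def using assms by (intro C.KL_lower) auto
  finally show ?thesis .
qed

text \<open>Discarding all entries with an index outside {..<n} leaves a tensor of size n; the power
  of N / n keeps the ratio per entry equal to l / n^(p - 1).\<close>

lemma TK_mono_size:
  assumes "n \<le> N" "0 < n" "0 \<le> l"
  shows "TK n l \<le> TK N (l * (real N / real n) ^ (p - 1))"
proof -
  define s where "s xs = (if set xs \<subseteq> {..<n} then l / real n ^ (p - 1) else 0)" for xs
  have N: "0 < N" using assms by simp
  have "TK n l = KL (prior n) (lists_in p {..<n}) (monomial f) s"
    unfolding TK_def by (rule KL_cong) (auto simp: s_def lists_in_def)
  also have "\<dots> = KL (prior N) (lists_in p {..<N}) (monomial f) s"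
    using assms by (intro KL_restrict[symmetric]) (auto simp: s_def)
  also have "\<dots> \<le> TK N (l * (real N / real n) ^ (p - 1))"
    unfolding TK_def using assms N by (intro channel.KL_mono[OF channel_prior']) (auto simp: s_def power_divide)
  finally show ?thesis .
qed

section \<open>Independent blocks of coordinates\<close>

definition block :: "nat \<Rightarrow> nat \<Rightarrow> nat set"
  where "block n b = {b * n..<b * n + n}"

text \<open>Only entries whose indices all lie in one of the first k blocks are observed. Written as
  a sum over blocks, so that one more block is one more summand, as the chain rule in
  \<open>KL_blocks\<close> requires.\<close>

definition block_snr :: "nat \<Rightarrow> real \<Rightarrow> nat \<Rightarrow> nat list \<Rightarrow> real"
  where "block_snr n c k xs = (\<Sum>b<k. if set xs \<subseteq> block n b then c else 0)"

lemma lik_depends: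
  assumes "\<And>xs. xs \<in> lists_in p {..<N} \<Longrightarrow> \<not> set xs \<subseteq> U \<Longrightarrow> s xs = 0" and "\<And>i. i \<in> U \<Longrightarrow> u i = u' i"
  shows "lik (lists_in p {..<N}) (monomial f) s y u = lik (lists_in p {..<N}) (monomial f) s y u'"
proof -
  have "sqrt (s xs) * monomial f xs u = sqrt (s xs) * monomial f xs u'" if xs: "xs \<in> lists_in p {..<N}" for xs
  proof (cases "set xs \<subseteq> U")
    case True
    hence "map (\<lambda>i. f (u i)) xs = map (\<lambda>i. f (u' i)) xs" using assms(2) by (intro map_cong refl) auto
    thus ?thesis by (simp only: monomial_def)
  qed (use assms(1)[OF xs] in simp)
  thus ?thesis unfolding lik_def tilt_def by (intro arg_cong[where f=exp] sum.cong refl) (simp only:)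
qed

text \<open>Blocks involve disjoint coordinates of u, so \<open>KL_indep\<close> adds their relative
  entropies one by one; each block is a translate of {..<n} and \<open>KL_embed\<close> identifies
  its contribution.\<close>

lemma KL_blocks:
  assumes c: "0 \<le> c" and m: "m * n \<le> N"
  shows "KL (prior N) (lists_in p {..<N}) (monomial f) (block_snr n c m)
       = real m * KL (prior n) (lists_in p {..<n}) (monomial f) (\<lambda>_. c)"
  using m
proof (induction m)
  case 0
  have "lik (lists_in p {..<N}) (monomial f) (block_snr n c 0) = (\<lambda>_ _. 1)"
    by (auto simp: lik_def tilt_def block_snr_def fun_eq_iff)
  thus ?case using prob_space.prob_space[OF prob_space_prior, of N] by (simp add: KL_def evid_def)
next
  case (Suc m)
  interpret C: channel "prior N" "lists_in p {..<N}" "monomial f" by (rule channel_prior')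
  define h where "h xs = (if set xs \<subseteq> block n m then c else 0)" for xs
  have h0: "\<forall>j. 0 \<le> h j" and s0: "\<forall>j. 0 \<le> block_snr n c m j"
    using c by (auto simp: h_def block_snr_def intro!: sum_nonneg)
  have split: "block_snr n c (Suc m) = (\<lambda>j. block_snr n c m j + h j)"
    by (auto simp: block_snr_def h_def)
  have mn: "m * n + n \<le> N" using Suc.prems by simp
  have sup_s: "block_snr n c m xs = 0" if "\<not> set xs \<subseteq> {..<m * n}" for xs
    unfolding block_snr_def
  proof (intro sum.neutral ballI)
    fix b assume "b \<in> {..<m}"
    hence "Suc b * n \<le> m * n" by (intro mult_le_mono1) simp
    hence "block n b \<subseteq> {..<m * n}" by (auto simp: block_def)
    thus "(if set xs \<subseteq> block n b then c else 0) = 0" using that by auto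
  qed
  have ind: "(\<integral>u. lik (lists_in p {..<N}) (monomial f) h y' u * lik (lists_in p {..<N}) (monomial f) (block_snr n c m) y u \<partial>prior N)
     = evid (prior N) (lists_in p {..<N}) (monomial f) h y' * evid (prior N) (lists_in p {..<N}) (monomial f) (block_snr n c m) y"
    if y: "y \<in> space (PiM (lists_in p {..<N}) (\<lambda>_. borel))" "y' \<in> space (PiM (lists_in p {..<N}) (\<lambda>_. borel))" for y y'
    unfolding evid_def
  proof (rule integral_PiM_indep[where U="block n m"])
    show "block n m \<subseteq> {..<N}" using mn by (auto simp: block_def)
    show "lik (lists_in p {..<N}) (monomial f) h y' u = lik (lists_in p {..<N}) (monomial f) h y' u'"
      if "\<And>i. i \<in> block n m \<Longrightarrow> u i = u' i" for u u'
      using that by (rule lik_depends[rotated]) (auto simp: h_def)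
    show "lik (lists_in p {..<N}) (monomial f) (block_snr n c m) y u = lik (lists_in p {..<N}) (monomial f) (block_snr n c m) y u'"
      if "\<And>i. i \<in> {..<N} - block n m \<Longrightarrow> u i = u' i" for u u'
    proof (rule lik_depends[where U="{..<m * n}"])
      show "u i = u' i" if "i \<in> {..<m * n}" for i
        using that mn \<open>\<And>i. i \<in> {..<N} - block n m \<Longrightarrow> u i = u' i\<close>[of i] by (auto simp: block_def)
    qed (rule sup_s)
    show "\<bar>lik (lists_in p {..<N}) (monomial f) h y' u\<bar> \<le> exp (lbound (lists_in p {..<N}) h y')" for u
      using C.lik_le[OF h0] C.lik_nonneg by simp
    show "\<bar>lik (lists_in p {..<N}) (monomial f) (block_snr n c m) y u\<bar> \<le> exp (lbound (lists_in p {..<N}) (block_snr n c m) y)" for u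
      using C.lik_le[OF s0] C.lik_nonneg by simp
  qed (use C.lik_measurable y prob_space_axioms in auto)
  have "KL (prior N) (lists_in p {..<N}) (monomial f) h = KL (prior n) (lists_in p {..<n}) (monomial f) (\<lambda>xs. h (map (\<lambda>i. m * n + i) xs))"
  proof (rule KL_embed)
    have im: "(\<lambda>i. m * n + i) ` {..<n} = block n m"
      by (simp add: block_def lessThan_atLeast0 add.commute)
    show "h xs = 0" if "\<not> set xs \<subseteq> (\<lambda>i. m * n + i) ` {..<n}" for xs using that by (simp add: im h_def)
  qed (use mn in \<open>auto simp: inj_on_def\<close>)
  also have "\<dots> = KL (prior n) (lists_in p {..<n}) (monomial f) (\<lambda>_. c)"
    by (rule KL_cong) (auto simp: h_def block_def lists_in_def)
  finally have "KL (prior N) (lists_in p {..<N}) (monomial f) h = KL (prior n) (lists_in p {..<n}) (monomial f) (\<lambda>_. c)" .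
  thus ?case
    unfolding split using Suc by (subst C.KL_indep[OF s0 h0 ind]) (auto simp: algebra_simps)
qed

text \<open>Summing a product over all index lists is expanding a p-th power. The overlap of the
  tensors is thus the p-th power of the overlap of the underlying vectors.\<close>

lemma overlap_power:
  assumes B: "B \<subseteq> {..<N}"
  shows "channel.overlap (lists_in p B) (monomial f) u u' = ((\<Sum>i\<in>B. f (u i) * f (u' i)) / real (card B)) ^ p"
proof -
  have fin: "finite B" using B finite_subset by blast
  have "monomial f xs u * monomial f xs u' = (\<Prod>i\<leftarrow>xs. f (u i) * f (u' i))" for xs
    unfolding monomial_def by (induction xs) auto
  hence "(\<Sum>xs\<in>lists_in p B. monomial f xs u * monomial f xs u') = (\<Sum>i\<in>B. f (u i) * f (u' i)) ^ p"
    by (simp add: sum_prod_list fin)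
  thus ?thesis unfolding channel.overlap_def[OF channel_prior[OF fin B]]
    by (simp add: power_divide card_lists_in fin)
qed

end

section \<open>Comparison of different sizes\<close>

context tensor_model
begin

text \<open>For two posterior replicas the overlap of the whole vectors is the average of the block
  overlaps, so convexity of the p-th power on nonnegative numbers bounds the large tensor overlap by
  the average of the absolute block overlaps. \<open>overlap_abs_mean\<close> then removes the
  absolute values at the cost of the \<epsilon> and covariance terms.\<close>

lemma acc_blocks:
  fixes k n :: nat
  assumes k: "0 < k" and n: "0 < n" and s: "\<forall>j. 0 \<le> s j" and \<epsilon>: "0 < \<epsilon>" "\<epsilon> \<le> 1"
  defines "N \<equiv> k * n"
  defines "I \<equiv> lists_in p {..<N}" and "J \<equiv> \<lambda>b. lists_in p (block n b)"
  shows "(\<Sum>xs\<in>I. acc (prior N) I (monomial f) s (monomial f xs)) / real N ^ p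
    \<le> (\<Sum>b<k. (\<Sum>xs\<in>J b. acc (prior N) I (monomial f) s (monomial f xs)) / real n ^ p + 2 * \<epsilon>
        + 2 / \<epsilon> ^ 3 * ((\<Sum>xs\<in>J b. \<Sum>zs\<in>J b. ecov (prior N) I (monomial f) s (monomial f xs) (monomial f zs)) / (real n ^ p)\<^sup>2)) / real k"
proof -
  interpret C: channel "prior N" I "monomial f" unfolding I_def by (rule channel_prior')
  have N: "0 < N" using k n by (simp add: N_def)
  have blk: "block n b \<subseteq> {..<N}" if "b < k" for b
  proof -
    have "Suc b * n \<le> k * n" using that by (intro mult_le_mono1) simp
    thus ?thesis by (auto simp: block_def N_def)
  qed
  have JI: "J b \<subseteq> I" if "b < k" for b unfolding J_def I_def by (intro lists_in_mono blk that)
  have cardI: "real (card I) = real N ^ p" by (simp add: I_def card_lists_in)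
  have cardJ: "real (card (J b)) = real n ^ p" for b by (simp add: J_def card_lists_in block_def)
  define A where "A y = 1 / real N ^ p * (\<Sum>xs\<in>I. (\<integral>u. monomial f xs u \<partial>post (prior N) I (monomial f) s y)\<^sup>2) + 0
      + 0 * (\<Sum>xs\<in>I. \<Sum>zs\<in>I. (cov (post (prior N) I (monomial f) s y) (monomial f xs) (monomial f zs))\<^sup>2)" for y
  define T where "T b y = 1 / real n ^ p * (\<Sum>xs\<in>J b. (\<integral>u. monomial f xs u \<partial>post (prior N) I (monomial f) s y)\<^sup>2) + 2 * \<epsilon>
      + (2 / \<epsilon> ^ 3 / (real n ^ p)\<^sup>2) * (\<Sum>xs\<in>J b. \<Sum>zs\<in>J b. (cov (post (prior N) I (monomial f) s y) (monomial f xs) (monomial f zs))\<^sup>2)" for b y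
  have ov: "channel.overlap I (monomial f) u u' \<le> (\<Sum>b<k. \<bar>channel.overlap (J b) (monomial f) u u'\<bar>) / real k" for u u'
  proof -
    define g where "g i = f (u i) * f (u' i)" for i
    define r where "r b = (\<Sum>i\<in>block n b. g i) / real n" for b
    have "(\<Sum>i<N. g i) / real N = (\<Sum>b<k. r b) / real k"
      unfolding N_def r_def block_def sum.nat_group[symmetric] by (simp add: sum_divide_distrib[symmetric])
    moreover have "channel.overlap I (monomial f) u u' = ((\<Sum>i<N. g i) / real N) ^ p"
      unfolding I_def g_def by (subst overlap_power[of _ N]) auto
    moreover have "\<bar>channel.overlap (J b) (monomial f) u u'\<bar> = \<bar>r b\<bar> ^ p" if "b < k" for b
      unfolding J_def r_def g_def by (subst overlap_power[OF blk[OF that]]) (simp add: power_abs block_def)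
    moreover have "((\<Sum>b<k. r b) / real k) ^ p \<le> (\<Sum>b<k. \<bar>r b\<bar> ^ p) / real k"
    proof -
      have "((\<Sum>b<k. r b) / real k) ^ p \<le> \<bar>(\<Sum>b<k. r b) / real k\<bar> ^ p" by (metis abs_ge_self power_abs)
      also have "\<dots> \<le> ((\<Sum>b<k. \<bar>r b\<bar>) / real k) ^ p"
        by (intro power_mono) (auto simp: divide_right_mono)
      also have "\<dots> \<le> (\<Sum>b<k. \<bar>r b\<bar> ^ p) / real k"
        using power_mean[of "{..<k}" "\<lambda>b. \<bar>r b\<bar>" p] k by (auto simp: lessThan_empty_iff)
      finally show ?thesis .
    qed
    ultimately show ?thesis by simp
  qed
  have AT: "A y \<le> (\<Sum>b<k. T b y) / real k" if y: "y \<in> space (PiM I (\<lambda>_. borel))" for y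
  proof -
    interpret Q: channel "post (prior N) I (monomial f) s y" I "monomial f" by (rule C.channel_post[OF s y])
    define Q where "Q = post (prior N) I (monomial f) s y"
    have QJ: "channel Q (J b) (monomial f)" if "b < k" for b
      unfolding Q_def by (rule Q.channel_subset[OF JI[OF that]])
    have "A y = (\<integral>u. \<integral>u'. channel.overlap I (monomial f) u u' \<partial>Q \<partial>Q)"
      unfolding A_def Q_def Q.overlap_mean(1) by (simp add: cardI)
    also have "\<dots> \<le> (\<integral>u. (\<Sum>b<k. \<integral>u'. \<bar>channel.overlap (J b) (monomial f) u u'\<bar> \<partial>Q) / real k \<partial>Q)"
    proof (rule integral_mono)
      show "integrable Q (\<lambda>u. \<integral>u'. channel.overlap I (monomial f) u u' \<partial>Q)"
        unfolding Q_def by (rule Q.overlap_mean(2))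
      show "integrable Q (\<lambda>u. (\<Sum>b<k. \<integral>u'. \<bar>channel.overlap (J b) (monomial f) u u'\<bar> \<partial>Q) / real k)"
        using channel.integrable_overlap_abs(2)[OF QJ] by (intro integrable_divide_zero Bochner_Integration.integrable_sum) auto
      fix u
      have "(\<integral>u'. channel.overlap I (monomial f) u u' \<partial>Q) \<le> (\<integral>u'. (\<Sum>b<k. \<bar>channel.overlap (J b) (monomial f) u u'\<bar>) / real k \<partial>Q)"
      proof (rule integral_mono)
        show "integrable Q (\<lambda>u'. channel.overlap I (monomial f) u u')"
          unfolding Q_def by (rule Q.integrable_overlap)
        show "integrable Q (\<lambda>u'. (\<Sum>b<k. \<bar>channel.overlap (J b) (monomial f) u u'\<bar>) / real k)"
          using channel.integrable_overlap_abs(1)[OF QJ] by (intro integrable_divide_zero Bochner_Integration.integrable_sum) auto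
      qed (rule ov)
      also have "\<dots> = (\<Sum>b<k. \<integral>u'. \<bar>channel.overlap (J b) (monomial f) u u'\<bar> \<partial>Q) / real k"
        using channel.integrable_overlap_abs(1)[OF QJ] by (simp add: Bochner_Integration.integral_sum)
      finally show "(\<integral>u'. channel.overlap I (monomial f) u u' \<partial>Q) \<le> (\<Sum>b<k. \<integral>u'. \<bar>channel.overlap (J b) (monomial f) u u'\<bar> \<partial>Q) / real k" .
    qed
    also have "\<dots> = (\<Sum>b<k. \<integral>u. \<integral>u'. \<bar>channel.overlap (J b) (monomial f) u u'\<bar> \<partial>Q \<partial>Q) / real k"
      using channel.integrable_overlap_abs(2)[OF QJ] by (simp add: Bochner_Integration.integral_sum)
    also have "\<dots> \<le> (\<Sum>b<k. T b y) / real k"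
    proof (intro divide_right_mono sum_mono)
      fix b assume "b \<in> {..<k}"
      thus "(\<integral>u. \<integral>u'. \<bar>channel.overlap (J b) (monomial f) u u'\<bar> \<partial>Q \<partial>Q) \<le> T b y"
        using channel.overlap_abs_mean[OF QJ \<epsilon>, of b] by (simp add: T_def cardJ Q_def)
    qed simp
    finally show ?thesis .
  qed
  note iA = C.integral_evid_overlap[OF s order_refl, of "1 / real N ^ p" 0 0, folded A_def]
  have iT: "(\<integral>y. evid (prior N) I (monomial f) s y * T b y \<partial>gaussian I)
      = 1 / real n ^ p * (\<Sum>xs\<in>J b. acc (prior N) I (monomial f) s (monomial f xs)) + 2 * \<epsilon>
        + (2 / \<epsilon> ^ 3 / (real n ^ p)\<^sup>2) * (\<Sum>xs\<in>J b. \<Sum>zs\<in>J b. ecov (prior N) I (monomial f) s (monomial f xs) (monomial f zs))"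
    "integrable (gaussian I) (\<lambda>y. evid (prior N) I (monomial f) s y * T b y)" if "b < k" for b
    unfolding T_def by (rule C.integral_evid_overlap[OF s JI[OF that]])+
  have "(\<integral>y. evid (prior N) I (monomial f) s y * A y \<partial>gaussian I)
      \<le> (\<integral>y. (\<Sum>b<k. evid (prior N) I (monomial f) s y * T b y) / real k \<partial>gaussian I)"
  proof (rule integral_mono[OF iA(2)])
    show "integrable (gaussian I) (\<lambda>y. (\<Sum>b<k. evid (prior N) I (monomial f) s y * T b y) / real k)"
      using iT(2) by (intro integrable_divide_zero Bochner_Integration.integrable_sum) auto
    fix y assume "y \<in> space (gaussian I)"
    hence y: "y \<in> space (PiM I (\<lambda>_. borel))" by (simp add: space_PiM)
    show "evid (prior N) I (monomial f) s y * A y \<le> (\<Sum>b<k. evid (prior N) I (monomial f) s y * T b y) / real k"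
      using mult_left_mono[OF AT[OF y] less_imp_le[OF C.evid_pos[OF s y]]] by (simp add: sum_distrib_left)
  qed
  also have "\<dots> = (\<Sum>b<k. (\<integral>y. evid (prior N) I (monomial f) s y * T b y \<partial>gaussian I)) / real k"
    using iT(2) by (simp add: Bochner_Integration.integral_sum)
  finally show ?thesis using iA(1) iT(1) by simp
qed

text \<open>A list with p \<ge> 1 entries is nonempty, and the quotient of any of its entries by n
  determines the block, so exactly one summand is nonzero.\<close>

lemma block_snr_in:
  assumes "b < k" "xs \<in> lists_in p (block n b)" shows "block_snr n c k xs = c"
proof -
  have "xs \<noteq> []" using assms(2) p_pos by (auto simp: lists_in_def)
  then obtain i where i: "i \<in> set xs" by (cases xs) auto
  have ib: "i \<in> block n b" using assms(2) i by (auto simp: lists_in_def)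
  have "b' = b" if "set xs \<subseteq> block n b'" for b'
  proof -
    have "i div n = d" if "i \<in> block n d" for d
      using that by (intro div_nat_eqI) (auto simp: block_def algebra_simps)
    thus ?thesis using ib i that by blast
  qed
  moreover have "set xs \<subseteq> block n b" using assms(2) by (simp add: lists_in_def)
  ultimately have "set xs \<subseteq> block n b' \<longleftrightarrow> b' = b" for b' by blast
  hence "block_snr n c k xs = (\<Sum>b'<k. if b' = b then c else 0)"
    unfolding block_snr_def by simp
  thus ?thesis using assms(1) by simp
qed

text \<open>Guerra--Toninelli interpolation between one tensor of size \<open>k * n\<close> and \<open>k\<close> independent tensors of size \<open>n\<close>.
  For odd \<open>p\<close> convexity needs nonnegative overlaps; up to an error of order \<open>1 / n\<close> this is enforced by
  averaging over small additional observations of the \<open>k\<close> tensors.\<close>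

lemma TK_subadditive:
  assumes k: "0 < k" and n: "0 < n" and l: "0 < l" and \<delta>: "0 < \<delta>" and \<epsilon>: "0 < \<epsilon>" "\<epsilon> \<le> 1"
  shows "TK (k * n) l \<le> real k * TK n ((1 + \<delta>) * l)
    + l * real (k * n) * (\<epsilon> + (1 + 1 / (\<delta> * l)) / (\<epsilon> ^ 3 * real n))"
proof -
  define N where "N = k * n"
  define I where "I = lists_in p {..<N}"
  define J where "J b = lists_in p (block n b)" for b
  define c where "c = l / real n ^ (p - 1)"
  define a where "a xs = l / real N ^ (p - 1)" for xs :: "nat list"
  define b where "b = block_snr n c k"
  \<comment> \<open>The perturbation number t adds observations of the blocks at t * \<delta> / n
    times their ratio. Consecutive perturbations form the ladder of \<open>ecov_telescope\<close>,
    and since t < n the total addition stays below \<delta> times the block ratio.\<close>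
  define e where "e t xs = real t * ((\<delta> / real n) * b xs)" for t :: nat and xs
  define AC where "AC s xs = acc (prior N) I (monomial f) s (monomial f xs)" for s xs
  define KA where "KA s d = (\<Sum>xs\<in>J d. \<Sum>zs\<in>J d. ecov (prior N) I (monomial f) s (monomial f xs) (monomial f zs)) / (real n ^ p)\<^sup>2" for s d
  interpret C: channel "prior N" I "monomial f" unfolding I_def by (rule channel_prior')
  have N: "0 < N" using k n by (simp add: N_def)
  have c0: "0 < c" using l n by (simp add: c_def)
  have b0: "\<forall>j. 0 \<le> b j" using c0 by (auto simp: b_def block_snr_def intro!: sum_nonneg)
  have a0: "\<forall>j. 0 \<le> a j" using l by (simp add: a_def)
  have e0: "\<forall>j. 0 \<le> e t j" for t using b0 \<delta> by (simp add: e_def)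
  have blk: "block n d \<subseteq> {..<N}" if "d < k" for d
  proof -
    have "Suc d * n \<le> k * n" using that by (intro mult_le_mono1) simp
    thus ?thesis by (auto simp: block_def N_def)
  qed
  have JI: "J d \<subseteq> I" if "d < k" for d unfolding J_def I_def by (intro lists_in_mono blk that)
  have cardJ: "real (card (J d)) = real n ^ p" for d by (simp add: J_def card_lists_in block_def)
  have Jne: "J d \<noteq> {}" for d using cardJ[of d] n by (metis card.empty of_nat_0 of_nat_0_less_iff power_eq_0_iff less_irrefl)
  have pw: "real m ^ p = real m * real m ^ (p - 1)" for m
    using p_pos by (metis One_nat_def Suc_pred less_eq_Suc_le power_Suc)
  have sumb: "(\<Sum>xs\<in>I. b xs * F xs) = (\<Sum>d<k. c * (\<Sum>xs\<in>J d. F xs))" for F :: "nat list \<Rightarrow> real"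
  proof -
    have "(\<Sum>xs\<in>I. b xs * F xs) = (\<Sum>xs\<in>I. \<Sum>d<k. if set xs \<subseteq> block n d then c * F xs else 0)"
      unfolding b_def block_snr_def sum_distrib_right by (intro sum.cong refl) auto
    also have "\<dots> = (\<Sum>d<k. \<Sum>xs\<in>I. if set xs \<subseteq> block n d then c * F xs else 0)" by (rule sum.swap)
    also have "\<dots> = (\<Sum>d<k. \<Sum>xs\<in>J d. c * F xs)"
    proof (rule sum.cong[OF refl])
      fix d assume "d \<in> {..<k}"
      hence "{xs \<in> I. set xs \<subseteq> block n d} = J d" using JI[of d] by (auto simp: I_def J_def lists_in_def)
      thus "(\<Sum>xs\<in>I. if set xs \<subseteq> block n d then c * F xs else 0) = (\<Sum>xs\<in>J d. c * F xs)"
        using C.finite_I by (simp add: sum.inter_filter[symmetric])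
    qed
    finally show ?thesis by (simp add: sum_distrib_left)
  qed
  \<comment> \<open>The slope of the interpolation at one base point, from
    \<open>acc_blocks\<close>. The average over entries of size N and the averages over blocks match
    because l / N^(p - 1) times N^p is k times l / n^(p - 1) times n^p.\<close>
  have one: "(\<Sum>xs\<in>I. (a xs - b xs) * AC s xs) \<le> l * real n * (\<Sum>d<k. 2 * \<epsilon> + 2 / \<epsilon> ^ 3 * KA s d)"
    if s: "\<forall>j. 0 \<le> s j" for s
  proof -
    have "(\<Sum>xs\<in>I. AC s xs) / real N ^ p \<le> (\<Sum>d<k. (\<Sum>xs\<in>J d. AC s xs) / real n ^ p + 2 * \<epsilon> + 2 / \<epsilon> ^ 3 * KA s d) / real k"
      using acc_blocks[OF k n s \<epsilon>] by (simp add: AC_def KA_def I_def J_def N_def)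
    hence "l * real N * ((\<Sum>xs\<in>I. AC s xs) / real N ^ p)
      \<le> l * real N * ((\<Sum>d<k. (\<Sum>xs\<in>J d. AC s xs) / real n ^ p + 2 * \<epsilon> + 2 / \<epsilon> ^ 3 * KA s d) / real k)"
      using l by (intro mult_left_mono) auto
    also have "\<dots> = l * real n * (\<Sum>d<k. (\<Sum>xs\<in>J d. AC s xs) / real n ^ p + 2 * \<epsilon> + 2 / \<epsilon> ^ 3 * KA s d)"
      using k by (simp add: N_def)
    also have "\<dots> = (\<Sum>d<k. c * (\<Sum>xs\<in>J d. AC s xs)) + l * real n * (\<Sum>d<k. 2 * \<epsilon> + 2 / \<epsilon> ^ 3 * KA s d)"
    proof -
      have "l * real n * (\<Sum>d<k. (\<Sum>xs\<in>J d. AC s xs) / real n ^ p) = (\<Sum>d<k. c * (\<Sum>xs\<in>J d. AC s xs))"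
        unfolding sum_distrib_left[of "l * real n"] using n by (intro sum.cong refl) (simp add: c_def pw)
      thus ?thesis by (simp add: sum.distrib distrib_left add.assoc)
    qed
    finally have "l * real N * ((\<Sum>xs\<in>I. AC s xs) / real N ^ p) \<le> (\<Sum>xs\<in>I. b xs * AC s xs) + l * real n * (\<Sum>d<k. 2 * \<epsilon> + 2 / \<epsilon> ^ 3 * KA s d)"
      by (simp only: sumb)
    moreover have "l * real N * ((\<Sum>xs\<in>I. AC s xs) / real N ^ p) = (\<Sum>xs\<in>I. a xs * AC s xs)"
      using N by (simp add: a_def pw sum_distrib_left sum_divide_distrib)
    ultimately show ?thesis by (simp add: left_diff_distrib sum_subtractf)
  qed
  define \<eta> where "\<eta> = 2 * l * real N * (real n * \<epsilon> + (1 + 1 / (\<delta> * l)) / \<epsilon> ^ 3)"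
  have "(\<Sum>t<n. KL (prior N) I (monomial f) (\<lambda>j. e t j + a j) - KL (prior N) I (monomial f) (\<lambda>j. e t j + b j)) \<le> \<eta> / 2"
  proof (rule C.KL_interpolation[OF e0 a0 b0])
    fix \<tau> r :: real assume tr: "0 \<le> \<tau>" "0 \<le> r"
    define s where "s j = \<tau> * a j + r * b j" for j
    have s0: "\<forall>j. 0 \<le> s j" using a0 b0 tr by (simp add: s_def)
    have st0: "\<forall>j. 0 \<le> e t j + s j" for t using e0[of t] s0 by simp
    \<comment> \<open>Each rung has total ratio \<delta> * l / n^(p - 1) / n * n^p = \<delta> * l on
      a block, so the bound does not grow with the number n of rungs; averaging over t yields the
      factor 1 / n.\<close>
    have tele: "(\<Sum>t<n. KA (\<lambda>j. e t j + s j) d) \<le> 1 + 1 / (\<delta> * l)" if d: "d < k" for d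
    proof -
      have "(\<Sum>t<n. (\<Sum>xs\<in>J d. \<Sum>zs\<in>J d. ecov (prior N) I (monomial f) (\<lambda>j. s j + real t * ((\<delta> / real n) * b j)) (monomial f xs) (monomial f zs)) / (real (card (J d)))\<^sup>2)
        \<le> 1 + 1 / ((\<delta> / real n * c) * real (card (J d)))"
      proof (rule C.ecov_telescope[OF s0])
        show "\<forall>j. 0 \<le> \<delta> / real n * b j" using b0 \<delta> by simp
        show "\<delta> / real n * b j = \<delta> / real n * c" if "j \<in> J d" for j
          using block_snr_in[OF d, of j n c] that by (simp add: b_def J_def)
        show "0 < \<delta> / real n * c" using \<delta> n c0 by simp
      qed (use JI[OF d] Jne in auto)
      moreover have "(\<delta> / real n * c) * real (card (J d)) = \<delta> * l" using n by (simp add: cardJ c_def pw)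
      moreover have "(\<lambda>j. s j + real t * ((\<delta> / real n) * b j)) = (\<lambda>j. e t j + s j)" for t
        by (simp add: e_def add.commute)
      ultimately show ?thesis by (simp only: KA_def cardJ)
    qed
    have "(\<Sum>t<n. \<Sum>j\<in>I. (a j - b j) * AC (\<lambda>j. e t j + s j) j)
      \<le> (\<Sum>t<n. l * real n * (\<Sum>d<k. 2 * \<epsilon> + 2 / \<epsilon> ^ 3 * KA (\<lambda>j. e t j + s j) d))"
      by (intro sum_mono one st0)
    also have "\<dots> = l * real n * (\<Sum>d<k. 2 * \<epsilon> * real n + 2 / \<epsilon> ^ 3 * (\<Sum>t<n. KA (\<lambda>j. e t j + s j) d))"
      unfolding sum_distrib_left[symmetric, of "l * real n"]
      by (subst sum.swap) (simp add: sum.distrib sum_distrib_left mult_ac)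
    also have "\<dots> \<le> l * real n * (\<Sum>d<k. 2 * \<epsilon> * real n + 2 / \<epsilon> ^ 3 * (1 + 1 / (\<delta> * l)))"
      using l \<epsilon> tele by (intro mult_left_mono sum_mono add_left_mono) auto
    also have "\<dots> = \<eta>" by (simp add: \<eta>_def N_def algebra_simps)
    finally show "(\<Sum>t<n. \<Sum>j\<in>I. (a j - b j) * acc (prior N) I (monomial f) (\<lambda>j. e t j + (\<tau> * a j + r * b j)) (monomial f j)) \<le> \<eta>"
      by (simp add: AC_def s_def)
  qed
  \<comment> \<open>The perturbation only raises the entropy of the large tensor, and on the block
    side it raises the ratio from c to at most (1 + \<delta>) * c.\<close>
  moreover have "TK N l - real k * TK n ((1 + \<delta>) * l)
     \<le> KL (prior N) I (monomial f) (\<lambda>j. e t j + a j) - KL (prior N) I (monomial f) (\<lambda>j. e t j + b j)" if t: "t < n" for t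
  proof -
    have 1: "TK N l \<le> KL (prior N) I (monomial f) (\<lambda>j. e t j + a j)"
      unfolding TK_def I_def[symmetric] using e0[of t] l by (intro C.KL_mono) (auto simp: a_def)
    have "KL (prior N) I (monomial f) (\<lambda>j. e t j + b j) \<le> KL (prior N) I (monomial f) (block_snr n ((1 + \<delta>) * c) k)"
    proof (rule C.KL_mono)
      show "\<forall>j. 0 \<le> e t j + b j" using e0[of t] b0 by simp
      show "\<forall>j. e t j + b j \<le> block_snr n ((1 + \<delta>) * c) k j"
      proof
        fix j
        have "real t / real n \<le> 1" using t by simp
        hence "(real t / real n) * (\<delta> * b j) \<le> 1 * (\<delta> * b j)" using b0 \<delta> by (intro mult_right_mono) auto
        moreover have "block_snr n ((1 + \<delta>) * c) k j = (1 + \<delta>) * b j"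
          by (simp add: b_def block_snr_def sum_distrib_left if_distrib cong: if_cong)
        ultimately show "e t j + b j \<le> block_snr n ((1 + \<delta>) * c) k j"
          by (simp add: e_def algebra_simps)
      qed
    qed
    also have "\<dots> = real k * KL (prior n) (lists_in p {..<n}) (monomial f) (\<lambda>_. (1 + \<delta>) * c)"
      unfolding I_def using c0 \<delta> by (intro KL_blocks) (auto simp: N_def)
    also have "KL (prior n) (lists_in p {..<n}) (monomial f) (\<lambda>_. (1 + \<delta>) * c) = TK n ((1 + \<delta>) * l)"
      by (simp add: TK_def c_def)
    finally show ?thesis using 1 by linarith
  qed
  hence "(\<Sum>t<n. TK N l - real k * TK n ((1 + \<delta>) * l))
     \<le> (\<Sum>t<n. KL (prior N) I (monomial f) (\<lambda>j. e t j + a j) - KL (prior N) I (monomial f) (\<lambda>j. e t j + b j))"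
    by (intro sum_mono) auto
  ultimately have "real n * (TK N l - real k * TK n ((1 + \<delta>) * l)) \<le> \<eta> / 2" by simp
  hence "TK N l - real k * TK n ((1 + \<delta>) * l) \<le> \<eta> / 2 / real n"
    using n by (simp add: le_divide_eq mult.commute)
  also have "\<eta> / 2 / real n = l * real N * (\<epsilon> + (1 + 1 / (\<delta> * l)) / (\<epsilon> ^ 3 * real n))"
    using n \<epsilon> unfolding \<eta>_def by (simp add: add_divide_distrib distrib_left)
  finally show ?thesis by (simp add: N_def)
qed

text \<open>The hypothesis is that \<open>TK n l / n\<close> has lower limit zero. A single good n
  suffices: \<open>TK_subadditive\<close> carries its smallness to all multiples k * n, and
  \<open>TK_mono_size\<close> to the sizes N just below a multiple. Both transfers are paid for by
  passing from l to l'.\<close>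

lemma TK_limit:
  assumes l: "0 < l'" "l' < l"
    and sub: "\<And>\<theta> n0. 0 < \<theta> \<Longrightarrow> \<exists>n\<ge>n0. TK n l \<le> \<theta> * real n"
  shows "(\<lambda>N. TK N l' / real N) \<longlonglongrightarrow> 0"
proof (rule LIMSEQ_I)
  fix \<theta> :: real assume \<theta>: "0 < \<theta>"
  \<comment> \<open>The gap between l' and l is split into two equal factors 1 + \<delta>: one pays
    for rounding N up to a multiple of n, the other is the loss in
    \<open>TK_subadditive\<close>.\<close>
  define \<delta> where "\<delta> = sqrt (l / l') - 1"
  have l0: "0 < l" using l by simp
  have \<delta>: "0 < \<delta>" using l by (simp add: \<delta>_def)
  have dd: "(1 + \<delta>) * ((1 + \<delta>) * l') = l"
    using l by (simp add: \<delta>_def mult.assoc[symmetric] real_sqrt_mult_self)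
  define l1 where "l1 = (1 + \<delta>) * l'"
  have l1: "0 < l1" "l1 \<le> l"
  proof -
    show "0 < l1" using \<delta> l by (simp add: l1_def)
    hence "1 * l1 \<le> (1 + \<delta>) * l1" using \<delta> by (intro mult_right_mono) auto
    thus "l1 \<le> l" using dd by (simp add: l1_def)
  qed
  define \<epsilon> where "\<epsilon> = min 1 (\<theta> / (8 * l))"
  have \<epsilon>: "0 < \<epsilon>" "\<epsilon> \<le> 1" "\<epsilon> \<le> \<theta> / (8 * l)" using \<theta> l0 by (auto simp: \<epsilon>_def)
  define D where "D = (1 + 1 / (\<delta> * l1)) / \<epsilon> ^ 3"
  obtain n0 :: nat where n0: "D / (\<theta> / (8 * l)) \<le> real n0" using real_arch_simple by blast
  obtain n where n: "max 1 n0 \<le> n" "TK n l \<le> \<theta> / 8 * real n" using sub[of "\<theta> / 8" "max 1 n0"] \<theta> by auto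
  have n1: "0 < n" using n by simp
  have Dn: "D / real n \<le> \<theta> / (8 * l)"
  proof -
    have "D / (\<theta> / (8 * l)) \<le> real n" using n0 n(1) by linarith
    moreover have "0 < \<theta> / (8 * l)" using \<theta> l0 by simp
    ultimately have "D \<le> real n * (\<theta> / (8 * l))" by (simp only: pos_divide_le_eq)
    thus ?thesis using n1 by (simp add: pos_divide_le_eq mult.commute)
  qed
  have "(\<lambda>N. (1 + real n * inverse (real N)) ^ (p - 1)) \<longlonglongrightarrow> (1 + real n * 0) ^ (p - 1)"
    by (intro tendsto_intros lim_inverse_n)
  hence "eventually (\<lambda>N. (1 + real n * inverse (real N)) ^ (p - 1) < 1 + \<delta>) sequentially"
    using \<delta> by (intro order_tendstoD(2)) auto
  then obtain N1 where N1: "\<And>N. N \<ge> N1 \<Longrightarrow> (1 + real n * inverse (real N)) ^ (p - 1) < 1 + \<delta>"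
    by (auto simp: eventually_sequentially)
  show "\<exists>no. \<forall>N\<ge>no. norm (TK N l' / real N - 0) < \<theta>"
  proof (intro exI allI impI)
    fix N assume N: "N \<ge> max n N1"
    have N0: "0 < N" using N n1 by simp
    \<comment> \<open>One more than the quotient, even if n divides N; this gives N \<le> k * n
      \<le> N + n in all cases.\<close>
    define k where "k = Suc (N div n)"
    have kn: "N \<le> k * n" "k * n \<le> N + n"
    proof -
      have "N div n * n + N mod n = N" by simp
      moreover have "N mod n < n" using n1 by simp
      moreover have "k * n = N div n * n + n" by (simp add: k_def)
      ultimately show "N \<le> k * n" "k * n \<le> N + n" by linarith+
    qed
    have k2: "real (k * n) \<le> 2 * real N" using kn(2) N by linarith
    have "real (k * n) / real N \<le> 1 + real n * inverse (real N)"
    proof -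
      have "real (k * n) / real N \<le> (real N + real n) / real N" using kn(2) by (intro divide_right_mono) linarith+
      also have "\<dots> = 1 + real n * inverse (real N)" using N0 by (simp add: field_simps)
      finally show ?thesis .
    qed
    hence "(real (k * n) / real N) ^ (p - 1) \<le> (1 + real n * inverse (real N)) ^ (p - 1)"
      by (intro power_mono) auto
    also have "\<dots> \<le> 1 + \<delta>" using N1[of N] N by simp
    finally have snr: "l' * (real (k * n) / real N) ^ (p - 1) \<le> l1"
      using l by (simp add: l1_def mult.commute)
    have "TK N l' \<le> TK (k * n) (l' * (real (k * n) / real N) ^ (p - 1))"
      using l by (intro TK_mono_size kn(1) N0) auto
    also have "\<dots> \<le> TK (k * n) l1" using snr l by (intro TK_mono) auto
    also have "\<dots> \<le> real k * TK n ((1 + \<delta>) * l1) + l1 * real (k * n) * (\<epsilon> + (1 + 1 / (\<delta> * l1)) / (\<epsilon> ^ 3 * real n))"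
      using l1 \<delta> \<epsilon> n1 by (intro TK_subadditive) (auto simp: k_def)
    also have "\<dots> \<le> real k * (\<theta> / 8 * real n) + l1 * real (k * n) * (\<theta> / (8 * l) + \<theta> / (8 * l))"
    proof (intro add_mono mult_left_mono)
      show "TK n ((1 + \<delta>) * l1) \<le> \<theta> / 8 * real n" using n(2) dd by (simp add: l1_def)
      show "(1 + 1 / (\<delta> * l1)) / (\<epsilon> ^ 3 * real n) \<le> \<theta> / (8 * l)" using Dn by (simp add: D_def)
    qed (use \<epsilon> l1 in auto)
    also have "\<dots> = real (k * n) * (\<theta> / 8 + (l1 / l) * (\<theta> / 4))" using l0 by (simp add: field_simps)
    also have "\<dots> \<le> real (k * n) * (\<theta> / 8 + 1 * (\<theta> / 4))"
      using l1 l0 \<theta> by (intro mult_left_mono add_left_mono mult_right_mono) auto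
    also have "\<dots> \<le> (2 * real N) * (\<theta> / 8 + 1 * (\<theta> / 4))" using \<theta> by (intro mult_right_mono k2) auto
    also have "\<dots> < real N * \<theta>" using N0 \<theta> by (simp add: field_simps)
    finally show "norm (TK N l' / real N - 0) < \<theta>"
      using N0 TK_nonneg[of l' N] l by (simp add: pos_divide_less_eq mult.commute)
  qed
qed

end

section \<open>The truncated second moment\<close>

context channel
begin

text \<open>\<open>channel_swap\<close> covers kernels of the form f u * lik * g y. The restricted
  evidence below leads to a kernel that is not of this form.\<close>

lemma fubini_exp_bounded:
  fixes K :: "('i \<Rightarrow> real) \<Rightarrow> 'u \<Rightarrow> real"
  assumes K: "case_prod K \<in> borel_measurable (PiM I (\<lambda>_. borel) \<Otimes>\<^sub>M P)"
    and g: "exp_bounded I g" and b: "\<And>y u. y \<in> space (PiM I (\<lambda>_. borel)) \<Longrightarrow> \<bar>K y u\<bar> \<le> g y"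
  shows "(\<integral>y. \<integral>u. K y u \<partial>P \<partial>gaussian I) = (\<integral>u. \<integral>y. K y u \<partial>gaussian I \<partial>P)"
    and "integrable P (\<lambda>u. \<integral>y. K y u \<partial>gaussian I)"
proof -
  interpret G: prob_space "gaussian I" by (rule prob_space_gaussian)
  interpret GP: pair_sigma_finite "gaussian I" P by unfold_locales
  note [measurable] = K exp_bounded_measurable[OF g]
  have "integrable (gaussian I \<Otimes>\<^sub>M P) (\<lambda>p. g (fst p) * 1)"
    using exp_bounded_integrable'[OF g] by (intro GP.Fubini_integrable) auto
  hence int: "integrable (gaussian I \<Otimes>\<^sub>M P) (case_prod K)"
  proof (rule Bochner_Integration.integrable_bound)
    show "AE p in gaussian I \<Otimes>\<^sub>M P. norm (case_prod K p) \<le> norm (g (fst p) * 1)"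
    proof (rule AE_I2)
      fix p assume "p \<in> space (gaussian I \<Otimes>\<^sub>M P)"
      hence "fst p \<in> space (PiM I (\<lambda>_. borel))" by (auto simp: space_pair_measure space_PiM)
      thus "norm (case_prod K p) \<le> norm (g (fst p) * 1)" using b[of "fst p" "snd p"] by (simp add: split_beta)
    qed
  qed measurable
  show "(\<integral>y. \<integral>u. K y u \<partial>P \<partial>gaussian I) = (\<integral>u. \<integral>y. K y u \<partial>gaussian I \<partial>P)"
    by (rule GP.Fubini_integral[OF int, symmetric])
  show "integrable P (\<lambda>u. \<integral>y. K y u \<partial>gaussian I)" by (rule GP.integrable_snd[OF int])
qed

lemma integral_lik_lik:
  assumes s: "\<forall>j. 0 \<le> s j"
  shows "(\<integral>y. lik I x s y u' * lik I x s y u \<partial>gaussian I) = exp (\<Sum>j\<in>I. s j * (x j u * x j u'))"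
proof -
  have "lik I x s y u' * lik I x s y u = exp (\<Sum>j\<in>I. s j * (x j u * x j u')) *
      tilt I (\<lambda>j. sqrt (s j) * x j u' + sqrt (s j) * x j u) y" for y
  proof -
    have e: "(sqrt (s j) * x j u') * (sqrt (s j) * x j u) = s j * (x j u * x j u')" for j
    proof -
      have "(sqrt (s j) * x j u') * (sqrt (s j) * x j u) = (sqrt (s j) * sqrt (s j)) * (x j u * x j u')"
        by (simp only: mult_ac)
      thus ?thesis using s[rule_format, of j] by simp
    qed
    show ?thesis using tilt_product[of "\<lambda>j. sqrt (s j) * x j u'" y "\<lambda>j. sqrt (s j) * x j u" "\<lambda>_. 0"]
      by (simp add: lik_def e)
  qed
  thus ?thesis by (simp add: integral_tilt finite_I)
qed

text \<open>Replacing the evidence by its restriction \<open>W\<close> to pairs of replicas with small overlap makes its second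
  moment bounded and, when posterior overlaps are small, changes it little.\<close>

lemma evid_L1_bound:
  assumes s: "\<forall>j. 0 \<le> s j" and \<sigma>: "0 < \<sigma>" and \<tau>: "0 < \<tau>"
    and B: "\<And>u. (\<integral>u'. (if \<bar>overlap u u'\<bar> \<le> \<sigma> then exp (\<Sum>j\<in>I. s j * (x j u * x j u')) else 0) \<partial>P) \<le> B"
    and D: "2 * (\<Sum>j\<in>I. \<Sum>k\<in>I. ecov P I x s (x j) (x k)) / (real (card I))\<^sup>2
      + 2 * (\<Sum>j\<in>I. acc P I x s (x j)) / real (card I) \<le> D"
  shows "(\<integral>y. \<bar>evid P I x s y - 1\<bar> \<partial>gaussian I) \<le> D / \<sigma>\<^sup>2 + \<tau> + (B - 1 + 2 * (D / \<sigma>\<^sup>2)) / \<tau>"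
proof -
  define V :: "'u \<Rightarrow> 'u \<Rightarrow> real" where "V u u' = (if \<bar>overlap u u'\<bar> \<le> \<sigma> then 1 else 0)" for u u'
  have V01: "0 \<le> V u u'" "V u u' \<le> 1" "\<bar>V u u'\<bar> \<le> 1" for u u' by (auto simp: V_def)
  have V_meas[measurable]: "(\<lambda>(u, u'). V u u') \<in> borel_measurable (P \<Otimes>\<^sub>M P)"
    unfolding V_def split_beta by measurable
  have V_meas2[measurable]: "V u \<in> borel_measurable P" for u
    unfolding V_def using overlap_measurable2[of u] by measurable
  define E where "E y = evid P I x s y" for y
  \<comment> \<open>k y u is E y times the posterior probability that a replica has small overlap
    with u.\<close>
  define k where "k y u = (\<integral>u'. V u u' * lik I x s y u' \<partial>P)" for y u
  \<comment> \<open>W y / E y is the posterior probability that two independent replicas have small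
    overlap; in particular 0 \<le> W \<le> E.\<close>
  define W where "W y = (\<integral>u. lik I x s y u * k y u \<partial>P) / E y" for y
  define b where "b y = exp (lbound I s y)" for y
  have sp: "y \<in> space (PiM I (\<lambda>_. borel))" if "y \<in> space (gaussian I)" for y using that by (simp add: space_PiM)
  have k0: "0 \<le> k y u" for y u
    unfolding k_def using V01 lik_nonneg by (intro Bochner_Integration.integral_nonneg) auto
  have kE: "k y u \<le> E y" if y: "y \<in> space (PiM I (\<lambda>_. borel))" for y u
    unfolding k_def E_def evid_def
  proof (rule integral_mono[OF integrable_lik_mult[OF s y V_meas2 V01(3)] integrable_lik[OF s y]])
    show "V u u' * lik I x s y u' \<le> lik I x s y u'" for u'
      using V01(2)[of u u'] lik_nonneg by (simp add: mult_left_le_one_le V01(1))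
  qed
  have Eb: "E y \<le> b y" if "y \<in> space (PiM I (\<lambda>_. borel))" for y unfolding E_def b_def by (rule evid_le[OF s that])
  have Ep: "0 < E y" if "y \<in> space (PiM I (\<lambda>_. borel))" for y unfolding E_def by (rule evid_pos[OF s that])
  have k_meas[measurable]: "case_prod k \<in> borel_measurable (PiM I (\<lambda>_. borel) \<Otimes>\<^sub>M P)"
  proof -
    have "(\<lambda>((y, u), u'). V u u' * lik I x s y u') \<in> borel_measurable ((PiM I (\<lambda>_. borel) \<Otimes>\<^sub>M P) \<Otimes>\<^sub>M P)"
    proof -
      have "(\<lambda>q. V (snd (fst q)) (snd q)) \<in> borel_measurable ((PiM I (\<lambda>_. borel) \<Otimes>\<^sub>M P) \<Otimes>\<^sub>M P)"
        by (rule measurable_compose[OF _ V_meas, of "\<lambda>q. (snd (fst q), snd q)", simplified]) measurable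
      moreover have "(\<lambda>q. lik I x s (fst (fst q)) (snd q)) \<in> borel_measurable ((PiM I (\<lambda>_. borel) \<Otimes>\<^sub>M P) \<Otimes>\<^sub>M P)"
        by (rule measurable_compose[OF _ lik_measurable_pair, of "\<lambda>q. (fst (fst q), snd q)", simplified]) measurable
      ultimately show ?thesis unfolding split_beta by measurable
    qed
    thus ?thesis unfolding k_def split_beta by (intro borel_measurable_lebesgue_integral) (simp add: split_beta)
  qed
  have E_meas[measurable]: "E \<in> borel_measurable (PiM I (\<lambda>_. borel))" unfolding E_def[abs_def] by measurable
  have lk_meas: "case_prod (\<lambda>y u. lik I x s y u * k y u) \<in> borel_measurable (PiM I (\<lambda>_. borel) \<Otimes>\<^sub>M P)"
    using lik_measurable_pair[of s] k_meas by (simp add: split_beta)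
  have W_meas[measurable]: "W \<in> borel_measurable (PiM I (\<lambda>_. borel))"
    unfolding W_def[abs_def] using lk_meas
    by (intro borel_measurable_divide E_meas borel_measurable_lebesgue_integral)
  have bE: "exp_bounded I E" unfolding E_def[abs_def] by (rule exp_bounded_evid[OF s])
  have bb: "exp_bounded I b" unfolding b_def[abs_def] by (rule exp_bounded_exp_lbound)
  have klik_int: "integrable P (\<lambda>u. lik I x s y u * k y u)" if y: "y \<in> space (PiM I (\<lambda>_. borel))" for y
  proof (rule integrable_bounded[where K="b y * b y"])
    show "(\<lambda>u. lik I x s y u * k y u) \<in> borel_measurable P"
      using measurable_Pair2[OF lk_meas y] by simp
    show "\<bar>lik I x s y u * k y u\<bar> \<le> b y * b y" for u
      unfolding abs_mult using lik_le[OF s, of y u] lik_nonneg[of s y u] k0[of y u] kE[OF y, of u] Eb[OF y]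
      by (intro mult_mono) (auto simp: b_def)
  qed
  have W0: "0 \<le> W y" if "y \<in> space (PiM I (\<lambda>_. borel))" for y
    unfolding W_def using k0 lik_nonneg less_imp_le[OF Ep[OF that]]
    by (intro divide_nonneg_nonneg Bochner_Integration.integral_nonneg) auto
  have WE: "W y \<le> E y" if y: "y \<in> space (PiM I (\<lambda>_. borel))" for y
  proof -
    have "(\<integral>u. lik I x s y u * k y u \<partial>P) \<le> (\<integral>u. lik I x s y u * E y \<partial>P)"
      using integrable_lik[OF s y] lik_nonneg kE[OF y]
      by (intro integral_mono klik_int[OF y]) (auto intro: mult_left_mono)
    also have "\<dots> = E y * E y" by (simp add: E_def evid_def)
    finally show ?thesis unfolding W_def using Ep[OF y] by (simp add: divide_le_eq)
  qed
  have bW: "exp_bounded I W"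
    by (rule exp_bounded_mono[OF W_meas bE]) (use W0 WE Ep in \<open>auto simp: less_imp_le\<close>)
  note int = exp_bounded_integrable'
  \<comment> \<open>Multiplying by E y cancels the normalisation in W, leaving the average over two
    replicas of the product of their likelihoods on the small-overlap event. Integrating out the
    noise first gives the exponential in the hypothesis on B.\<close>
  have M2: "(\<integral>y. W y * E y \<partial>gaussian I) \<le> B"
  proof -
    have "(\<integral>y. W y * E y \<partial>gaussian I) = (\<integral>y. \<integral>u. lik I x s y u * k y u \<partial>P \<partial>gaussian I)"
    proof (rule Bochner_Integration.integral_cong[OF refl])
      fix y assume "y \<in> space (gaussian I)"
      from Ep[OF sp[OF this]] show "W y * E y = (\<integral>u. lik I x s y u * k y u \<partial>P)" by (simp add: W_def)
    qed
    also have "\<dots> = (\<integral>u. \<integral>y. lik I x s y u * k y u \<partial>gaussian I \<partial>P)"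
    proof (rule fubini_exp_bounded(1)[OF lk_meas, where g="\<lambda>y. b y * b y"])
      show "exp_bounded I (\<lambda>y. b y * b y)" by (intro exp_bounded_mult bb)
      show "\<bar>lik I x s y u * k y u\<bar> \<le> b y * b y" if y: "y \<in> space (PiM I (\<lambda>_. borel))" for y u
        unfolding abs_mult using lik_le[OF s, of y u] lik_nonneg[of s y u] k0[of y u] kE[OF y, of u] Eb[OF y]
        by (intro mult_mono) (auto simp: b_def)
    qed
    also have "\<dots> \<le> B"
    proof (rule integral_le_const)
      show "integrable P (\<lambda>u. \<integral>y. lik I x s y u * k y u \<partial>gaussian I)"
      proof (rule fubini_exp_bounded(2)[OF lk_meas, where g="\<lambda>y. b y * b y"])
        show "exp_bounded I (\<lambda>y. b y * b y)" by (intro exp_bounded_mult bb)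
        show "\<bar>lik I x s y u * k y u\<bar> \<le> b y * b y" if y: "y \<in> space (PiM I (\<lambda>_. borel))" for y u
          unfolding abs_mult using lik_le[OF s, of y u] lik_nonneg[of s y u] k0[of y u] kE[OF y, of u] Eb[OF y]
          by (intro mult_mono) (auto simp: b_def)
      qed
      have "(\<integral>y. lik I x s y u * k y u \<partial>gaussian I) \<le> B" for u
      proof -
        have "(\<integral>y. lik I x s y u * k y u \<partial>gaussian I) = (\<integral>y. (\<integral>u'. V u u' * lik I x s y u' \<partial>P) * lik I x s y u \<partial>gaussian I)"
          by (simp add: k_def mult.commute)
        also have "\<dots> = (\<integral>u'. V u u' * (\<integral>y. lik I x s y u' * lik I x s y u \<partial>gaussian I) \<partial>P)"
          by (rule channel_swap(1)[OF s V_meas2 V01(3) exp_bounded_lik])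
        also have "\<dots> = (\<integral>u'. (if \<bar>overlap u u'\<bar> \<le> \<sigma> then exp (\<Sum>j\<in>I. s j * (x j u * x j u')) else 0) \<partial>P)"
          unfolding integral_lik_lik[OF s] by (intro Bochner_Integration.integral_cong) (auto simp: V_def)
        finally show ?thesis using B[of u] by simp
      qed
      thus "AE u in P. (\<integral>y. lik I x s y u * k y u \<partial>gaussian I) \<le> B" by simp
    qed
    finally show ?thesis .
  qed
  define c :: real where "c = 1 / real (card I)"
  define O2 where "O2 y = 2 * c * (\<Sum>j\<in>I. (\<integral>u. x j u \<partial>post P I x s y)\<^sup>2) + 0
      + 2 * c\<^sup>2 * (\<Sum>j\<in>I. \<Sum>k\<in>I. (cov (post P I x s y) (x j) (x k))\<^sup>2)" for y
  note O2 = integral_evid_overlap[OF s order_refl, of "2 * c" 0 "2 * c\<^sup>2", folded O2_def E_def]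
  \<comment> \<open>Chebyshev's inequality under the posterior: 1 - V is at most the squared overlap
    divided by \<sigma>^2, whose mean \<open>overlap_second_moment_le\<close> controls.\<close>
  have d0: "(\<integral>y. E y - W y \<partial>gaussian I) \<le> D / \<sigma>\<^sup>2"
  proof -
    have "(\<integral>y. E y - W y \<partial>gaussian I) \<le> (\<integral>y. E y * O2 y / \<sigma>\<^sup>2 \<partial>gaussian I)"
    proof (rule integral_mono)
      show "integrable (gaussian I) (\<lambda>y. E y - W y)" by (intro int exp_bounded_diff bE bW)
      show "integrable (gaussian I) (\<lambda>y. E y * O2 y / \<sigma>\<^sup>2)" by (intro integrable_divide_zero O2(2))
      fix y assume "y \<in> space (gaussian I)"
      hence y: "y \<in> space (PiM I (\<lambda>_. borel))" by (rule sp)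
      define Q where "Q = post P I x s y"
      interpret Q: channel Q I x unfolding Q_def by (rule channel_post[OF s y])
      have sQ[measurable_cong]: "sets Q = sets P" by (simp add: Q_def)
      have V_Q: "V u \<in> borel_measurable Q" for u
        using V_meas2[of u] by (simp add: measurable_cong_sets[OF sQ refl])
      have Vint: "integrable Q (V u)" for u by (rule Q.integrable_bounded[OF V_Q V01(3)])
      have kEQ: "k y u = E y * (\<integral>u'. V u u' \<partial>Q)" for u
        unfolding k_def E_def Q_def by (rule evid_mult_post[OF s y V_meas2, symmetric])
      have k_meas_y: "k y \<in> borel_measurable P" using measurable_Pair2[OF k_meas y] by simp
      hence VV_meas: "(\<lambda>u. \<integral>u'. V u u' \<partial>Q) \<in> borel_measurable P"
      proof -
        have "(\<lambda>u. k y u / E y) \<in> borel_measurable P" using k_meas_y by simp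
        thus ?thesis using Ep[OF y] by (simp add: kEQ)
      qed
      have VV_int: "integrable Q (\<lambda>u. \<integral>u'. V u u' \<partial>Q)"
      proof (rule Q.integrable_bounded[where K=1])
        show "(\<lambda>u. \<integral>u'. V u u' \<partial>Q) \<in> borel_measurable Q"
          using VV_meas by (simp add: measurable_cong_sets[OF sQ refl])
        show "\<bar>\<integral>u'. V u u' \<partial>Q\<bar> \<le> 1" for u
          using Vint[of u] V01 by (subst abs_of_nonneg) (auto intro!: Q.integral_le_const Bochner_Integration.integral_nonneg)
      qed
      have "W y = (\<integral>u. (\<integral>u'. V u u' \<partial>Q) * lik I x s y u \<partial>P)"
        unfolding W_def kEQ using Ep[OF y] by (simp add: mult_ac)
      also have "\<dots> = E y * (\<integral>u. \<integral>u'. V u u' \<partial>Q \<partial>Q)"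
        unfolding E_def Q_def by (rule evid_mult_post[OF s y VV_meas[unfolded Q_def], symmetric])
      finally have WQ: "W y = E y * (\<integral>u. \<integral>u'. V u u' \<partial>Q \<partial>Q)" .
      have ovint: "integrable Q (\<lambda>u'. (overlap u u')\<^sup>2)" for u
      proof (rule Q.integrable_bounded[where K=1])
        show "(\<lambda>u'. (overlap u u')\<^sup>2) \<in> borel_measurable Q"
          using overlap_measurable2[of u] by (simp add: measurable_cong_sets[OF sQ refl])
        show "\<bar>(overlap u u')\<^sup>2\<bar> \<le> 1" for u' using overlap_bound[of u u'] by (simp add: abs_square_le_1)
      qed
      have "1 - (\<integral>u. \<integral>u'. (overlap u u')\<^sup>2 \<partial>Q \<partial>Q) / \<sigma>\<^sup>2 = (\<integral>u. 1 - (\<integral>u'. (overlap u u')\<^sup>2 \<partial>Q) / \<sigma>\<^sup>2 \<partial>Q)"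
        using Q.overlap_second_moment(2) by (simp add: Q.prob_space)
      also have "\<dots> \<le> (\<integral>u. \<integral>u'. V u u' \<partial>Q \<partial>Q)"
      proof (rule integral_mono[OF _ VV_int])
        show "integrable Q (\<lambda>u. 1 - (\<integral>u'. (overlap u u')\<^sup>2 \<partial>Q) / \<sigma>\<^sup>2)"
          using Q.overlap_second_moment(2) by simp
        fix u
        have "1 - (\<integral>u'. (overlap u u')\<^sup>2 \<partial>Q) / \<sigma>\<^sup>2 = (\<integral>u'. 1 - (overlap u u')\<^sup>2 / \<sigma>\<^sup>2 \<partial>Q)"
          using ovint[of u] by (simp add: Q.prob_space)
        also have "\<dots> \<le> (\<integral>u'. V u u' \<partial>Q)"
        proof (rule integral_mono[OF _ Vint])
          show "integrable Q (\<lambda>u'. 1 - (overlap u u')\<^sup>2 / \<sigma>\<^sup>2)" using ovint[of u] by simp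
          show "1 - (overlap u u')\<^sup>2 / \<sigma>\<^sup>2 \<le> V u u'" for u'
          proof (cases "\<bar>overlap u u'\<bar> \<le> \<sigma>")
            case False
            hence "\<sigma>\<^sup>2 \<le> \<bar>overlap u u'\<bar>\<^sup>2" using \<sigma> by (intro power_mono) auto
            thus ?thesis using \<sigma> False by (simp add: V_def)
          qed (use \<sigma> in \<open>simp add: V_def\<close>)
        qed
        finally show "1 - (\<integral>u'. (overlap u u')\<^sup>2 \<partial>Q) / \<sigma>\<^sup>2 \<le> (\<integral>u'. V u u' \<partial>Q)" .
      qed
      finally have "1 - (\<integral>u. \<integral>u'. V u u' \<partial>Q \<partial>Q) \<le> (\<integral>u. \<integral>u'. (overlap u u')\<^sup>2 \<partial>Q \<partial>Q) / \<sigma>\<^sup>2" by simp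
      also have "\<dots> \<le> O2 y / \<sigma>\<^sup>2"
        using Q.overlap_second_moment_le by (intro divide_right_mono) (auto simp: O2_def c_def Q_def power_divide)
      finally have "E y * (1 - (\<integral>u. \<integral>u'. V u u' \<partial>Q \<partial>Q)) \<le> E y * (O2 y / \<sigma>\<^sup>2)"
        using Ep[OF y] by (intro mult_left_mono) auto
      thus "E y - W y \<le> E y * O2 y / \<sigma>\<^sup>2" by (simp add: WQ algebra_simps)
    qed
    also have "\<dots> \<le> D / \<sigma>\<^sup>2"
      using O2(1) D \<sigma> by (simp add: c_def power_divide divide_right_mono add.commute)
    finally show ?thesis .
  qed
  have EI: "(\<integral>y. E y \<partial>gaussian I) = 1" unfolding E_def by (rule integral_evid[OF s])
  define w where "w = (\<integral>y. W y \<partial>gaussian I)"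
  have iE: "integrable (gaussian I) E" and iW: "integrable (gaussian I) W" by (intro int bE bW)+
  have iWE: "integrable (gaussian I) (\<lambda>y. W y * E y)" by (intro int exp_bounded_mult bE bW)
  interpret G: prob_space "gaussian I" by (rule prob_space_gaussian)
  have w1: "1 - w \<le> D / \<sigma>\<^sup>2" using d0 iE iW by (simp add: w_def EI)
  \<comment> \<open>Here |E - 1| \<le> (E - W) + |W - 1| and |W - 1| \<le> \<tau> + (W - 1)^2 /
    \<tau>. Since 0 \<le> W \<le> E, the square W^2 is at most W * E, whose integral is bounded
    although that of E^2 is not controlled.\<close>
  have "(\<integral>y. \<bar>E y - 1\<bar> \<partial>gaussian I) \<le> (\<integral>y. (E y - W y) + (\<tau> + (W y * E y - 2 * W y + 1) / \<tau>) \<partial>gaussian I)"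
  proof (rule integral_mono)
    show "integrable (gaussian I) (\<lambda>y. \<bar>E y - 1\<bar>)" using iE by simp
    show "integrable (gaussian I) (\<lambda>y. (E y - W y) + (\<tau> + (W y * E y - 2 * W y + 1) / \<tau>))"
      using iE iW iWE by simp
    fix y assume "y \<in> space (gaussian I)"
    hence y: "y \<in> space (PiM I (\<lambda>_. borel))" by (rule sp)
    have "\<bar>W y - 1\<bar> \<le> \<tau> + (W y - 1)\<^sup>2 / \<tau>"
    proof -
      have "0 \<le> (\<bar>W y - 1\<bar> - \<tau>)\<^sup>2" by simp
      hence "2 * (\<bar>W y - 1\<bar> * \<tau>) \<le> (W y - 1)\<^sup>2 + \<tau>\<^sup>2" by (simp add: power2_diff)
      moreover have "0 \<le> \<bar>W y - 1\<bar> * \<tau>" using \<tau> by simp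
      ultimately have "\<bar>W y - 1\<bar> * \<tau> \<le> (W y - 1)\<^sup>2 + \<tau>\<^sup>2" by linarith
      hence "\<bar>W y - 1\<bar> * \<tau> / \<tau> \<le> ((W y - 1)\<^sup>2 + \<tau>\<^sup>2) / \<tau>" using \<tau> by (intro divide_right_mono) auto
      thus ?thesis using \<tau> by (simp add: add_divide_distrib power2_eq_square)
    qed
    also have "(W y - 1)\<^sup>2 \<le> W y * E y - 2 * W y + 1"
      using mult_left_mono[OF WE[OF y] W0[OF y]] by (simp add: power2_eq_square algebra_simps)
    finally have "\<bar>W y - 1\<bar> \<le> \<tau> + (W y * E y - 2 * W y + 1) / \<tau>"
      using \<tau> by (simp add: divide_right_mono)
    thus "\<bar>E y - 1\<bar> \<le> (E y - W y) + (\<tau> + (W y * E y - 2 * W y + 1) / \<tau>)"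
      using WE[OF y] by linarith
  qed
  also have "\<dots> = (1 - w) + (\<tau> + ((\<integral>y. W y * E y \<partial>gaussian I) - 2 * w + 1) / \<tau>)"
    using iE iW iWE by (simp add: EI w_def G.prob_space)
  also have "\<dots> \<le> D / \<sigma>\<^sup>2 + (\<tau> + (B - 1 + 2 * (D / \<sigma>\<^sup>2)) / \<tau>)"
  proof -
    have "(\<integral>y. W y * E y \<partial>gaussian I) - 2 * w + 1 \<le> B - 1 + 2 * (D / \<sigma>\<^sup>2)" using w1 M2 by linarith
    from add_mono[OF w1 add_mono[OF order_refl divide_right_mono[OF this]]] show ?thesis
      using \<tau> by simp
  qed
  finally show ?thesis by (simp add: E_def)
qed

text \<open>ln z \<le> z - 1 bounds relative entropy by the chi-square divergence, and the second
  moment of the evidence is an average over two replicas.\<close>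

lemma KL_le_second_moment:
  assumes s: "\<forall>j. 0 \<le> s j"
    and B: "\<And>u. (\<integral>u'. exp (\<Sum>j\<in>I. s j * (x j u * x j u')) \<partial>P) \<le> B"
  shows "KL P I x s \<le> B - 1"
proof -
  note ev = exp_bounded_evid[OF s] exp_bounded_ln_evid[OF s]
  have inner: "(\<integral>y. lik I x s y u * evid P I x s y \<partial>gaussian I) = (\<integral>u'. exp (\<Sum>j\<in>I. s j * (x j u * x j u')) \<partial>P)" for u
  proof -
    have "(\<integral>y. lik I x s y u * evid P I x s y \<partial>gaussian I) = (\<integral>y. evid P I x s y * lik I x s y u \<partial>gaussian I)"
      by (simp add: mult.commute)
    thus ?thesis by (simp add: evid_swap[OF s exp_bounded_lik] integral_lik_lik[OF s])
  qed
  have "KL P I x s \<le> (\<integral>y. evid P I x s y * evid P I x s y - evid P I x s y \<partial>gaussian I)"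
    unfolding KL_def
  proof (rule integral_mono)
    fix y assume "y \<in> space (gaussian I)"
    hence p: "0 < evid P I x s y" by (intro evid_pos s) (simp add: space_PiM)
    have "evid P I x s y * ln (evid P I x s y) \<le> evid P I x s y * (evid P I x s y - 1)"
      using p by (intro mult_left_mono ln_le_minus_one) auto
    thus "evid P I x s y * ln (evid P I x s y) \<le> evid P I x s y * evid P I x s y - evid P I x s y"
      by (simp add: algebra_simps)
  qed (intro exp_bounded_integrable' exp_bounded_intros ev)+
  also have "\<dots> = (\<integral>y. evid P I x s y * evid P I x s y \<partial>gaussian I) - 1"
    by (subst Bochner_Integration.integral_diff)
       (auto intro!: exp_bounded_integrable' exp_bounded_intros ev simp: integral_evid[OF s])
  also have "(\<integral>y. evid P I x s y * evid P I x s y \<partial>gaussian I) \<le> B"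
    unfolding evid_swap[OF s ev(1)]
    using channel_swap(2)[OF s, of "\<lambda>_. 1" 1, OF _ _ ev(1)] B by (intro integral_le_const) (auto simp: inner)
  finally show ?thesis by simp
qed

end

section \<open>Exponential moments of the overlap for a centered prior\<close>

lemma nn_integral_gauss_exp: "(\<integral>\<^sup>+z. exp (t * z) \<partial>gauss) = exp (t\<^sup>2 / 2)"
proof -
  have "(\<integral>z. exp (t * z - t\<^sup>2 / 2) \<partial>gauss) = 1" "integrable gauss (\<lambda>z. exp (t * z - t\<^sup>2 / 2))"
    using gauss_tilt_0[of t] by (auto simp: has_bochner_integral_iff)
  hence 1: "(\<integral>\<^sup>+z. exp (t * z - t\<^sup>2 / 2) \<partial>gauss) = 1"
    by (subst nn_integral_eq_integral) auto
  have "(\<integral>\<^sup>+z. exp (t * z) \<partial>gauss) = (\<integral>\<^sup>+z. ennreal (exp (t\<^sup>2 / 2)) * exp (t * z - t\<^sup>2 / 2) \<partial>gauss)"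
    by (intro nn_integral_cong) (simp add: ennreal_mult[symmetric] exp_add[symmetric])
  also have "\<dots> = exp (t\<^sup>2 / 2)" by (subst nn_integral_cmult) (auto simp: 1 measurable_cong_sets[OF sets_gauss refl])
  finally show ?thesis .
qed

lemma nn_integral_gauss_exp_square: "(\<integral>\<^sup>+z. exp (z\<^sup>2 / 4) \<partial>gauss) = ennreal (sqrt 2)"
proof -
  have eq: "std_normal_density z * exp (z\<^sup>2 / 4) = sqrt 2 * normal_density 0 (sqrt 2) z" for z
  proof -
    have "exp (- z\<^sup>2 / 2) * exp (z\<^sup>2 / 4) = exp (- z\<^sup>2 / 4)" by (simp add: exp_add[symmetric])
    thus ?thesis by (simp add: normal_density_def std_normal_density_def real_sqrt_mult field_simps)
  qed
  interpret N: prob_space "density lborel (normal_density 0 (sqrt 2))" by (rule prob_space_normal_density) simp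
  have 1: "(\<integral>\<^sup>+z. ennreal (normal_density 0 (sqrt 2) z) \<partial>lborel) = 1"
    using N.emeasure_space_1 by (simp add: emeasure_density)
  have "(\<integral>\<^sup>+z. exp (z\<^sup>2 / 4) \<partial>gauss) = (\<integral>\<^sup>+z. ennreal (sqrt 2) * ennreal (normal_density 0 (sqrt 2) z) \<partial>lborel)"
    by (subst nn_integral_gauss) (auto simp: ennreal_mult[symmetric] eq)
  also have "\<dots> = ennreal (sqrt 2)" by (subst nn_integral_cmult) (auto simp: 1)
  finally show ?thesis .
qed

locale centered_model = tensor_model +
  assumes p3: "3 \<le> p" and centered: "(\<integral>a. f a \<partial>\<nu>) = 0"
begin

text \<open>Hoeffding's lemma for a centered variable in an interval of length 2, where (2 c)^2 / 8
  = c^2 / 2. It is stated for positive exponents, so negative c is handled through - f.\<close>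

lemma hoeffding: "(\<integral>\<^sup>+a. exp (c * f a) \<partial>\<nu>) \<le> ennreal (exp (c\<^sup>2 / 2))"
proof -
  have b: "f a \<in> {-1..1}" "- f a \<in> {-1..1}" for a using f_bound[of a] by auto
  interpret A: interval_bounded_random_variable \<nu> f "-1" 1
    by unfold_locales (use b in auto)
  interpret B: interval_bounded_random_variable \<nu> "\<lambda>a. - f a" "-1" 1
    by unfold_locales (use b in auto)
  consider "c = 0" | "c > 0" | "c < 0" by linarith
  thus ?thesis
  proof cases
    case 1 thus ?thesis by (simp add: emeasure_space_1)
  next
    case 2 thus ?thesis using A.Hoeffdings_lemma_nn_integral_0[of c] centered by (simp add: power2_eq_square)
  next
    case 3 thus ?thesis using B.Hoeffdings_lemma_nn_integral_0[of "- c"] centered by (simp add: power2_eq_square)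
  qed
qed

text \<open>The Gaussian variable \<open>z\<close> linearises the square.\<close>

lemma exp_square_moment:
  assumes N: "0 < N" and a: "\<And>i. \<bar>a i\<bar> \<le> 1"
  shows "(\<integral>\<^sup>+u. exp ((\<Sum>i<N. a i * f (u i))\<^sup>2 / (4 * real N)) \<partial>prior N) \<le> ennreal (sqrt 2)"
proof -
  interpret S: product_sigma_finite "\<lambda>_. \<nu>" by unfold_locales
  interpret PN: prob_space "prior N" by (rule prob_space_prior)
  interpret GP: pair_sigma_finite gauss "prior N" by unfold_locales
  \<comment> \<open>Chosen so that (\<theta> * S)^2 / 2 = S^2 / (4 N). After linearisation
    Hoeffding's bound is at most exp (z^2 / (4 N)) per coordinate, hence exp (z^2 / 4) in total,
    which the Gaussian law of z integrates.\<close>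
  define \<theta> where "\<theta> = 1 / sqrt (2 * real N)"
  have \<theta>2: "\<theta>\<^sup>2 = 1 / (2 * real N)" using N by (simp add: \<theta>_def power_divide)
  have [measurable]: "i < N \<Longrightarrow> (\<lambda>u. f (u i)) \<in> borel_measurable (prior N)" for i
    by (rule measurable_compose[OF _ f_measurable_nu]) (rule measurable_component_singleton, simp)
  have [measurable]: "i < N \<Longrightarrow> (\<lambda>q. f (snd q i)) \<in> borel_measurable (borel \<Otimes>\<^sub>M prior N)" for i
    by (rule measurable_compose[OF measurable_snd]) measurable
  define S where "S u = (\<Sum>i<N. a i * f (u i))" for u
  have "(\<integral>\<^sup>+u. exp ((S u)\<^sup>2 / (4 * real N)) \<partial>prior N) = (\<integral>\<^sup>+u. \<integral>\<^sup>+z. exp (\<theta> * S u * z) \<partial>gauss \<partial>prior N)"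
  proof (rule nn_integral_cong)
    fix u
    have "(\<theta> * S u)\<^sup>2 / 2 = (S u)\<^sup>2 / (4 * real N)" by (simp add: power_mult_distrib \<theta>2)
    thus "ennreal (exp ((S u)\<^sup>2 / (4 * real N))) = (\<integral>\<^sup>+z. exp (\<theta> * S u * z) \<partial>gauss)"
      unfolding nn_integral_gauss_exp by simp
  qed
  also have "\<dots> = (\<integral>\<^sup>+z. \<integral>\<^sup>+u. exp (\<theta> * S u * z) \<partial>prior N \<partial>gauss)"
    by (rule GP.Fubini') (simp add: S_def split_beta)
  also have "\<dots> \<le> (\<integral>\<^sup>+z. exp (z\<^sup>2 / 4) \<partial>gauss)"
  proof (rule nn_integral_mono)
    fix z
    have "(\<integral>\<^sup>+u. exp (\<theta> * S u * z) \<partial>prior N) = (\<integral>\<^sup>+u. (\<Prod>i<N. ennreal (exp ((\<theta> * z * a i) * f (u i)))) \<partial>prior N)"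
      by (intro nn_integral_cong) (simp add: S_def prod_ennreal exp_sum[symmetric] sum_distrib_left sum_distrib_right mult_ac)
    also have "\<dots> = (\<Prod>i<N. \<integral>\<^sup>+b. exp ((\<theta> * z * a i) * f b) \<partial>\<nu>)"
      by (rule S.product_nn_integral_prod) auto
    also have "\<dots> \<le> (\<Prod>i<N. ennreal (exp (z\<^sup>2 / (4 * real N))))"
    proof (intro prod_mono_ennreal)
      fix i
      have "(\<theta> * z * a i)\<^sup>2 \<le> (\<theta> * z)\<^sup>2 * 1"
        unfolding power_mult_distrib[of _ "a i"] using a[of i] by (intro mult_left_mono) (auto simp: abs_square_le_1)
      hence "(\<theta> * z * a i)\<^sup>2 / 2 \<le> z\<^sup>2 / (4 * real N)" using \<theta>2 by (simp add: power_mult_distrib)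
      thus "(\<integral>\<^sup>+b. exp ((\<theta> * z * a i) * f b) \<partial>\<nu>) \<le> ennreal (exp (z\<^sup>2 / (4 * real N)))"
        by (intro order_trans[OF hoeffding]) simp
    qed
    also have "\<dots> = ennreal (exp (z\<^sup>2 / 4))"
      using N by (simp add: ennreal_power exp_of_nat_mult[symmetric])
    finally show "(\<integral>\<^sup>+u. exp (\<theta> * S u * z) \<partial>prior N) \<le> ennreal (exp (z\<^sup>2 / 4))" .
  qed
  finally show ?thesis by (simp add: S_def nn_integral_gauss_exp_square)
qed

text \<open>Convexity of exp interpolates between the exponents 0 and w, and sqrt 2 - 1 \<le> 1 / 2.
  The point is that the bound tends to 1 as c tends to 0.\<close>

lemma exp_square_moment_small:
  assumes N: "0 < N" and a: "\<And>i. \<bar>a i\<bar> \<le> 1" and c: "0 \<le> c" "c \<le> 1 / 4"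
  shows "integrable (prior N) (\<lambda>u. exp (c * ((\<Sum>i<N. a i * f (u i))\<^sup>2 / real N)))"
    and "(\<integral>u. exp (c * ((\<Sum>i<N. a i * f (u i))\<^sup>2 / real N)) \<partial>prior N) \<le> 1 + 2 * c"
proof -
  interpret PN: prob_space "prior N" by (rule prob_space_prior)
  define w where "w u = (\<Sum>i<N. a i * f (u i))\<^sup>2 / (4 * real N)" for u
  have [measurable]: "i < N \<Longrightarrow> (\<lambda>u. f (u i)) \<in> borel_measurable (prior N)" for i
    by (rule measurable_compose[OF _ f_measurable_nu]) (rule measurable_component_singleton, simp)
  have [measurable]: "w \<in> borel_measurable (prior N)" unfolding w_def[abs_def] by measurable
  have w0: "0 \<le> w u" for u by (simp add: w_def)
  have le: "(\<integral>\<^sup>+u. exp (w u) \<partial>prior N) \<le> ennreal (sqrt 2)" unfolding w_def by (rule exp_square_moment[OF N a])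
  have iw: "integrable (prior N) (\<lambda>u. exp (w u))"
  proof (rule integrableI_bounded)
    show "(\<integral>\<^sup>+u. ennreal (norm (exp (w u))) \<partial>prior N) < \<infinity>"
      using le by (simp add: le_less_trans[OF _ ennreal_less_top])
  qed measurable
  have Iw: "(\<integral>u. exp (w u) \<partial>prior N) \<le> sqrt 2"
    using le nn_integral_eq_integral[OF iw] by simp
  have pt: "exp (c * ((\<Sum>i<N. a i * f (u i))\<^sup>2 / real N)) \<le> (1 - 4 * c) + 4 * c * exp (w u)" for u
  proof -
    have "exp ((1 - 4 * c) *\<^sub>R 0 + (4 * c) *\<^sub>R w u) \<le> (1 - 4 * c) * exp 0 + (4 * c) * exp (w u)"
      using c by (intro convex_onD[OF exp_convex]) auto
    moreover have "4 * c * w u = c * ((\<Sum>i<N. a i * f (u i))\<^sup>2 / real N)" by (simp add: w_def)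
    ultimately show ?thesis by simp
  qed
  show ii: "integrable (prior N) (\<lambda>u. exp (c * ((\<Sum>i<N. a i * f (u i))\<^sup>2 / real N)))"
  proof (rule Bochner_Integration.integrable_bound)
    show "integrable (prior N) (\<lambda>u. (1 - 4 * c) + 4 * c * exp (w u))" using iw by simp
    show "AE u in prior N. norm (exp (c * ((\<Sum>i<N. a i * f (u i))\<^sup>2 / real N))) \<le> norm ((1 - 4 * c) + 4 * c * exp (w u))"
      using pt by (intro AE_I2) (auto intro: order_trans[OF _ abs_ge_self])
  qed measurable
  have "(\<integral>u. exp (c * ((\<Sum>i<N. a i * f (u i))\<^sup>2 / real N)) \<partial>prior N) \<le> (\<integral>u. (1 - 4 * c) + 4 * c * exp (w u) \<partial>prior N)"
    using iw pt by (intro integral_mono ii) auto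
  also have "\<dots> = 1 + 4 * c * ((\<integral>u. exp (w u) \<partial>prior N) - 1)"
    using iw by (simp add: PN.prob_space algebra_simps)
  also have "\<dots> \<le> 1 + 4 * c * (1 / 2)"
  proof -
    have "sqrt 2 \<le> 3 / 2" by (rule real_le_lsqrt) (auto simp: power2_eq_square)
    hence "(\<integral>u. exp (w u) \<partial>prior N) - 1 \<le> 1 / 2" using Iw by linarith
    thus ?thesis using c by (intro add_left_mono mult_left_mono) auto
  qed
  finally show "(\<integral>u. exp (c * ((\<Sum>i<N. a i * f (u i))\<^sup>2 / real N)) \<partial>prior N) \<le> 1 + 2 * c" by simp
qed

text \<open>The cutoff \<rho>^p for tensors is the cutoff \<rho> for the vector overlap R, and the
  exponent equals l * N * R^p. The hypothesis p \<ge> 3 enters here: |R| \<le> \<rho> \<le> 1 gives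
  R^p \<le> \<rho> * R^2, so a small cutoff makes the coefficient of N * R^2 small.\<close>

lemma truncated_exp_moment:
  assumes N: "0 < N" and l: "0 \<le> l" and \<rho>: "0 < \<rho>" "\<rho> \<le> 1" "l * \<rho> \<le> 1 / 4"
  defines "I \<equiv> lists_in p {..<N}"
  shows "(\<integral>u'. (if \<bar>channel.overlap I (monomial f) u u'\<bar> \<le> \<rho> ^ p
      then exp (\<Sum>xs\<in>I. l / real N ^ (p - 1) * (monomial f xs u * monomial f xs u')) else 0) \<partial>prior N) \<le> 1 + 2 * (l * \<rho>)"
proof -
  interpret C: channel "prior N" I "monomial f" unfolding I_def by (rule channel_prior')
  define S where "S u' = (\<Sum>i<N. f (u i) * f (u' i))" for u'
  have ov: "C.overlap u u' = (S u' / real N) ^ p" for u'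
    unfolding I_def S_def by (subst overlap_power[of _ N]) auto
  have pt: "(if \<bar>C.overlap u u'\<bar> \<le> \<rho> ^ p then exp (\<Sum>xs\<in>I. l / real N ^ (p - 1) * (monomial f xs u * monomial f xs u')) else 0)
     \<le> exp ((l * \<rho>) * ((S u')\<^sup>2 / real N))" for u'
  proof (cases "\<bar>C.overlap u u'\<bar> \<le> \<rho> ^ p")
    case True
    define R where "R = S u' / real N"
    have "\<bar>R\<bar> ^ p \<le> \<rho> ^ p" using True by (simp add: ov R_def power_abs)
    hence R: "\<bar>R\<bar> \<le> \<rho>" using \<rho> p_pos by (subst (asm) power_mono_iff) auto
    have cI: "real (card I) = real N ^ p" by (simp add: I_def card_lists_in)
    have pw: "real N ^ p = real N * real N ^ (p - 1)" using p_pos by (metis One_nat_def Suc_pred less_eq_Suc_le power_Suc)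
    have "(\<Sum>xs\<in>I. l / real N ^ (p - 1) * (monomial f xs u * monomial f xs u')) = l / real N ^ (p - 1) * (real N ^ p * C.overlap u u')"
      unfolding sum_distrib_left[symmetric] C.overlap_def cI using N by simp
    also have "\<dots> = l * real N * R ^ p" using N by (simp add: ov R_def pw)
    also have "\<dots> \<le> l * real N * (\<rho> * R\<^sup>2)"
    proof (intro mult_left_mono)
      have "p = Suc (Suc (Suc (p - 3)))" using p3 by simp
      hence "R ^ p = R ^ Suc (Suc (Suc (p - 3)))" by metis
      also have "\<dots> \<le> \<bar>R ^ Suc (Suc (Suc (p - 3)))\<bar>" by (rule abs_ge_self)
      also have "\<dots> = \<bar>R\<bar> ^ (p - 3) * \<bar>R\<bar> * R\<^sup>2" by (simp add: abs_mult power_abs power2_eq_square mult_ac)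
      also have "\<dots> \<le> 1 * \<rho> * R\<^sup>2" using R \<rho> by (intro mult_mono power_le_one) auto
      finally show "R ^ p \<le> \<rho> * R\<^sup>2" by simp
    qed (use l N in auto)
    also have "\<dots> = (l * \<rho>) * ((S u')\<^sup>2 / real N)" using N by (simp add: R_def power_divide power2_eq_square)
    finally show ?thesis using True by simp
  qed simp
  have b: "\<bar>f (u i)\<bar> \<le> 1" for i by (rule f_bound)
  have c: "0 \<le> l * \<rho>" using l \<rho> by simp
  note sm = exp_square_moment_small[where a="\<lambda>i. f (u i)", OF N b c \<rho>(3), folded S_def]
  have "(\<integral>u'. (if \<bar>C.overlap u u'\<bar> \<le> \<rho> ^ p then exp (\<Sum>xs\<in>I. l / real N ^ (p - 1) * (monomial f xs u * monomial f xs u')) else 0) \<partial>prior N)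
    \<le> (\<integral>u'. exp ((l * \<rho>) * ((S u')\<^sup>2 / real N)) \<partial>prior N)"
  proof (rule integral_mono[OF _ sm(1) pt])
    show "integrable (prior N) (\<lambda>u'. if \<bar>C.overlap u u'\<bar> \<le> \<rho> ^ p then exp (\<Sum>xs\<in>I. l / real N ^ (p - 1) * (monomial f xs u * monomial f xs u')) else 0)"
    proof (rule Bochner_Integration.integrable_bound[OF sm(1)])
      show "(\<lambda>u'. if \<bar>C.overlap u u'\<bar> \<le> \<rho> ^ p then exp (\<Sum>xs\<in>I. l / real N ^ (p - 1) * (monomial f xs u * monomial f xs u')) else 0) \<in> borel_measurable (prior N)"
        using C.overlap_measurable2[of u] C.signal_measurable by measurable
      show "AE u' in prior N. norm (if \<bar>C.overlap u u'\<bar> \<le> \<rho> ^ p then exp (\<Sum>xs\<in>I. l / real N ^ (p - 1) * (monomial f xs u * monomial f xs u')) else 0)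
          \<le> norm (exp ((l * \<rho>) * ((S u')\<^sup>2 / real N)))"
        using pt by (intro AE_I2) (simp split: if_splits)
    qed
  qed
  also have "\<dots> \<le> 1 + 2 * (l * \<rho>)" by (rule sm(2))
  finally show ?thesis .
qed

text \<open>At cutoff \<rho> = 1 the truncation is void, so the second moment itself is bounded and
  \<open>KL_le_second_moment\<close> applies.\<close>

lemma TK_small:
  assumes N: "0 < N" and l: "0 \<le> l" "l \<le> 1 / 4"
  shows "TK N l \<le> 2 * l"
proof -
  interpret C: channel "prior N" "lists_in p {..<N}" "monomial f" by (rule channel_prior')
  have "TK N l \<le> (1 + 2 * (l * 1)) - 1"
    unfolding TK_def
  proof (rule C.KL_le_second_moment)
    show "(\<integral>u'. exp (\<Sum>xs\<in>lists_in p {..<N}. l / real N ^ (p - 1) * (monomial f xs u * monomial f xs u')) \<partial>prior N) \<le> 1 + 2 * (l * 1)" for u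
      using truncated_exp_moment[OF N l(1), of 1 u] l C.overlap_bound[of u] by simp
  qed (use l in simp)
  thus ?thesis by simp
qed

text \<open>Two gaps are spent. Between l1 and l the entropy increment is at least half of (l - l1)
  * N times the mean overlap at l1. Between l' and l1 the accuracy increment bounds the squared
  covariances at l' by that same mean overlap at l1. Both are therefore small when
  \<open>TK N l / N\<close> is.\<close>

lemma overlap_energy:
  assumes N: "0 < N" and l: "0 < l'" "l' < l1" "l1 < l"
  defines "I \<equiv> lists_in p {..<N}"
  defines "s \<equiv> \<lambda>_ :: nat list. l' / real N ^ (p - 1)"
  shows "2 * (\<Sum>xs\<in>I. \<Sum>zs\<in>I. ecov (prior N) I (monomial f) s (monomial f xs) (monomial f zs)) / (real (card I))\<^sup>2
      + 2 * (\<Sum>xs\<in>I. acc (prior N) I (monomial f) s (monomial f xs)) / real (card I)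
    \<le> 4 * (2 + 1 / (l1 - l')) / (l - l1) * (TK N l / real N)"
proof -
  interpret C: channel "prior N" I "monomial f" unfolding I_def by (rule channel_prior')
  define d where "d = real N ^ (p - 1)"
  have d: "0 < d" using N by (simp add: d_def)
  have "real N ^ p = real N * d"
    unfolding d_def using p_pos by (metis One_nat_def Suc_pred less_eq_Suc_le power_Suc)
  hence cI: "real (card I) = real N * d" by (simp add: I_def card_lists_in)
  define m where "m = real (card I)"
  have m: "0 < m" using N d by (simp add: m_def cI)
  define s1 where "s1 = (\<lambda>_ :: nat list. l1 / d)"
  define Q where "Q s = (\<Sum>xs\<in>I. acc (prior N) I (monomial f) s (monomial f xs)) / m" for s
  define Ka where "Ka = (\<Sum>xs\<in>I. \<Sum>zs\<in>I. ecov (prior N) I (monomial f) s (monomial f xs) (monomial f zs)) / m\<^sup>2"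
  have s0: "\<forall>j. 0 \<le> s j" using l d by (simp add: s_def d_def)
  have s10: "\<forall>j. 0 \<le> s1 j" using l d by (simp add: s1_def)
  have Q1: "Q s1 \<le> 2 / (l - l1) * (TK N l / real N)"
  proof -
    have "KL (prior N) I (monomial f) s1 + (\<Sum>xs\<in>I. (l - l1) / d * acc (prior N) I (monomial f) s1 (monomial f xs)) / 2
       \<le> KL (prior N) I (monomial f) (\<lambda>j. s1 j + (l - l1) / d)"
      using l d by (intro C.KL_increment(1) s10) auto
    moreover have "KL (prior N) I (monomial f) (\<lambda>j. s1 j + (l - l1) / d) = TK N l"
      unfolding TK_def I_def s1_def d_def by (simp add: add_divide_distrib[symmetric])
    moreover have "0 \<le> KL (prior N) I (monomial f) s1"
      using TK_nonneg[of l1 N] l by (simp add: TK_def I_def s1_def d_def)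
    moreover have "(\<Sum>xs\<in>I. (l - l1) / d * acc (prior N) I (monomial f) s1 (monomial f xs)) = (l - l1) * (real N * Q s1)"
      unfolding sum_distrib_left[symmetric] using d N by (simp add: Q_def m_def cI)
    ultimately have "(l - l1) * (real N * Q s1) / 2 \<le> TK N l" by linarith
    hence "real N * Q s1 \<le> 2 / (l - l1) * TK N l" using l by (simp add: pos_le_divide_eq mult_ac)
    hence "real N * Q s1 / real N \<le> 2 / (l - l1) * TK N l / real N" by (rule divide_right_mono) simp
    thus ?thesis using N by simp
  qed
  have Qinc: "Q s + ((l1 - l') * real N) / (1 + (l1 - l') * real N) * Ka \<le> Q s1"
  proof -
    define G where "G = (l1 - l') * real N"
    have "acc (prior N) I (monomial f) s (monomial f xs)
      + (\<Sum>zs\<in>I. (l1 - l') / d * ecov (prior N) I (monomial f) s (monomial f xs) (monomial f zs)) / (1 + G)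
      \<le> acc (prior N) I (monomial f) s1 (monomial f xs)" if xs: "xs \<in> I" for xs
    proof -
      have "acc (prior N) I (monomial f) s (monomial f xs)
        + (\<Sum>zs\<in>I. (l1 - l') / d * ecov (prior N) I (monomial f) s (monomial f xs) (monomial f zs)) / (1 + (\<Sum>zs\<in>I. (l1 - l') / d))
        \<le> acc (prior N) I (monomial f) (\<lambda>j. s j + (l1 - l') / d) (monomial f xs)"
        using l d by (intro C.acc_increment[OF s0 _ C.signal_measurable[OF xs] C.signal_bound[OF xs] order_refl]) auto
      moreover have "(\<Sum>zs\<in>I. (l1 - l') / d) = G" using d by (simp add: cI G_def)
      moreover have "(\<lambda>j. s j + (l1 - l') / d) = s1" by (simp add: s_def s1_def d_def add_divide_distrib[symmetric])
      ultimately show ?thesis by simp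
    qed
    hence "(\<Sum>xs\<in>I. acc (prior N) I (monomial f) s (monomial f xs)
      + (\<Sum>zs\<in>I. (l1 - l') / d * ecov (prior N) I (monomial f) s (monomial f xs) (monomial f zs)) / (1 + G)) / m
      \<le> (\<Sum>xs\<in>I. acc (prior N) I (monomial f) s1 (monomial f xs)) / m"
      using m by (intro divide_right_mono sum_mono) auto
    moreover have "(\<Sum>xs\<in>I. acc (prior N) I (monomial f) s (monomial f xs)
      + (\<Sum>zs\<in>I. (l1 - l') / d * ecov (prior N) I (monomial f) s (monomial f xs) (monomial f zs)) / (1 + G)) / m
      = Q s + G / (1 + G) * Ka"
    proof -
      have "(\<Sum>xs\<in>I. (\<Sum>zs\<in>I. (l1 - l') / d * ecov (prior N) I (monomial f) s (monomial f xs) (monomial f zs)) / (1 + G))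
        = (l1 - l') / d / (1 + G) * (m\<^sup>2 * Ka)"
        using m unfolding Ka_def sum_distrib_left[symmetric] sum_divide_distrib[symmetric] by simp
      moreover have "(l1 - l') / d / (1 + G) * (m\<^sup>2 * Ka) / m = G / (1 + G) * Ka"
      proof -
        have "(l1 - l') / d * m = G" using d by (simp add: m_def cI G_def)
        moreover have "(l1 - l') / d / (1 + G) * (m\<^sup>2 * Ka) / m = ((l1 - l') / d * m) / (1 + G) * Ka"
          using m by (simp add: power2_eq_square)
        ultimately show ?thesis by simp
      qed
      ultimately show ?thesis by (simp only: sum.distrib add_divide_distrib Q_def)
    qed
    ultimately show ?thesis by (simp add: Q_def G_def)
  qed
  have Ka0: "0 \<le> Ka"
    unfolding Ka_def ecov_def using m
    by (intro divide_nonneg_nonneg sum_nonneg Bochner_Integration.integral_nonneg_AE AE_I2 mult_nonneg_nonneg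
        less_imp_le[OF C.evid_pos[OF s0]]) (auto simp: space_PiM)
  have Q0: "0 \<le> Q s" unfolding Q_def using m
    by (intro divide_nonneg_nonneg sum_nonneg C.acc_signal_bounds(1)[OF s0]) auto
  define G where "G = (l1 - l') * real N"
  have G: "0 < G" "l1 - l' \<le> G" using l N mult_left_mono[of 1 "real N" "l1 - l'"] by (auto simp: G_def)
  have KQ: "Ka \<le> (1 + 1 / (l1 - l')) * Q s1"
  proof -
    have "G / (1 + G) * Ka \<le> Q s1" using Qinc Q0 by (simp add: G_def)
    hence "Ka \<le> (1 + 1 / G) * Q s1" using G by (simp add: field_simps)
    also have "\<dots> \<le> (1 + 1 / (l1 - l')) * Q s1"
    proof (rule mult_right_mono)
      show "1 + 1 / G \<le> 1 + 1 / (l1 - l')" using G l by (intro add_left_mono divide_left_mono) auto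
      have "0 \<le> G / (1 + G) * Ka" using G Ka0 by simp
      thus "0 \<le> Q s1" using Qinc Q0 by (simp add: G_def)
    qed
    finally show ?thesis .
  qed
  have Qs: "Q s \<le> Q s1"
  proof -
    have "0 \<le> G / (1 + G) * Ka" using G Ka0 by simp
    thus ?thesis using Qinc by (simp add: G_def)
  qed
  have "2 * Ka + 2 * Q s \<le> 2 * (2 + 1 / (l1 - l')) * Q s1"
  proof -
    have "2 * ((1 + 1 / (l1 - l')) * Q s1) + 2 * Q s1 = 2 * (2 + 1 / (l1 - l')) * Q s1" by (simp only: algebra_simps)
    thus ?thesis using KQ Qs by linarith
  qed
  also have "\<dots> \<le> 2 * (2 + 1 / (l1 - l')) * (2 / (l - l1) * (TK N l / real N))"
    using l Q1 by (intro mult_left_mono) auto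
  also have "\<dots> = 4 * (2 + 1 / (l1 - l')) / (l - l1) * (TK N l / real N)"
  proof -
    have "2 * A * (2 / E * K) = 4 * A / E * K" for A E K :: real by simp
    thus ?thesis .
  qed
  finally show ?thesis by (simp only: Ka_def Q_def m_def times_divide_eq_right)
qed

lemma evid_L1_limit:
  assumes l: "0 < l'" "l' < l" and lim: "(\<lambda>N. TK N l / real N) \<longlonglongrightarrow> 0"
  shows "(\<lambda>N. \<integral>y. \<bar>evid (prior N) (lists_in p {..<N}) (monomial f) (\<lambda>_. l' / real N ^ (p - 1)) y - 1\<bar>
      \<partial>gaussian (lists_in p {..<N})) \<longlonglongrightarrow> 0"
proof (rule LIMSEQ_I)
  fix \<theta> :: real assume \<theta>: "0 < \<theta>"
  define l1 where "l1 = (l + l') / 2"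
  have l1: "l' < l1" "l1 < l" using l by (auto simp: l1_def)
  define C where "C = 4 * (2 + 1 / (l1 - l')) / (l - l1)"
  define \<tau> where "\<tau> = \<theta> / 4"
  have \<tau>: "0 < \<tau>" using \<theta> by (simp add: \<tau>_def)
  \<comment> \<open>The bound l' * \<rho> \<le> 1 / 4 is needed for
    \<open>truncated_exp_moment\<close>; the other makes its contribution 2 * (l' * \<rho>) / \<tau>
    at most \<theta> / 4. \<rho> is fixed before N, so \<sigma> does not depend on N and the overlap
    terms divided by \<sigma>^2 tend to 0.\<close>
  define \<rho> where "\<rho> = min 1 (min (1 / 4) (\<tau> * \<theta> / 8) / l')"
  have \<rho>: "0 < \<rho>" "\<rho> \<le> 1" using \<tau> \<theta> l by (auto simp: \<rho>_def)
  have "\<rho> \<le> min (1 / 4) (\<tau> * \<theta> / 8) / l'" by (simp add: \<rho>_def)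
  hence "l' * \<rho> \<le> min (1 / 4) (\<tau> * \<theta> / 8)" using l by (simp add: pos_le_divide_eq mult.commute)
  hence lr: "l' * \<rho> \<le> 1 / 4" "l' * \<rho> \<le> \<tau> * \<theta> / 8" by auto
  define \<sigma> where "\<sigma> = \<rho> ^ p"
  have \<sigma>: "0 < \<sigma>" using \<rho> by (simp add: \<sigma>_def)
  have "(\<lambda>N. C * (TK N l / real N) / \<sigma>\<^sup>2) \<longlonglongrightarrow> C * 0 / \<sigma>\<^sup>2"
    using \<sigma> by (intro tendsto_intros lim) simp
  moreover have "0 < min (\<theta> / 8) (\<tau> * \<theta> / 16)" using \<theta> \<tau> by simp
  ultimately have "eventually (\<lambda>N. C * (TK N l / real N) / \<sigma>\<^sup>2 < min (\<theta> / 8) (\<tau> * \<theta> / 16)) sequentially"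
    by (intro order_tendstoD(2)) auto
  then obtain N0 where N0: "\<And>N. N \<ge> N0 \<Longrightarrow> C * (TK N l / real N) / \<sigma>\<^sup>2 < min (\<theta> / 8) (\<tau> * \<theta> / 16)"
    by (auto simp: eventually_sequentially)
  show "\<exists>no. \<forall>N\<ge>no. norm ((\<integral>y. \<bar>evid (prior N) (lists_in p {..<N}) (monomial f) (\<lambda>_. l' / real N ^ (p - 1)) y - 1\<bar>
      \<partial>gaussian (lists_in p {..<N})) - 0) < \<theta>"
  proof (intro exI allI impI)
    fix N assume N: "max 1 N0 \<le> N"
    have Np: "0 < N" using N by simp
    interpret C: channel "prior N" "lists_in p {..<N}" "monomial f" by (rule channel_prior')
    define X where "X = (\<integral>y. \<bar>evid (prior N) (lists_in p {..<N}) (monomial f) (\<lambda>_. l' / real N ^ (p - 1)) y - 1\<bar>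
      \<partial>gaussian (lists_in p {..<N}))"
    define D where "D = C * (TK N l / real N)"
    have D: "D / \<sigma>\<^sup>2 < \<theta> / 8" "D / \<sigma>\<^sup>2 < \<tau> * \<theta> / 16" using N0[of N] N by (auto simp: D_def)
    have "X \<le> D / \<sigma>\<^sup>2 + \<tau> + (1 + 2 * (l' * \<rho>) - 1 + 2 * (D / \<sigma>\<^sup>2)) / \<tau>"
      unfolding X_def
    proof (rule C.evid_L1_bound[OF _ \<sigma> \<tau>])
      show "\<forall>j. 0 \<le> l' / real N ^ (p - 1)" using l by simp
      show "(\<integral>u'. (if \<bar>C.overlap u u'\<bar> \<le> \<sigma> then exp (\<Sum>j\<in>lists_in p {..<N}. l' / real N ^ (p - 1) *
          (monomial f j u * monomial f j u')) else 0) \<partial>prior N) \<le> 1 + 2 * (l' * \<rho>)" for u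
        unfolding \<sigma>_def using l \<rho> lr by (intro truncated_exp_moment Np) auto
    qed (use overlap_energy[OF Np l(1) l1] in \<open>simp add: D_def C_def\<close>)
    also have "\<dots> \<le> \<theta> / 8 + \<theta> / 4 + (2 * (\<tau> * \<theta> / 8) + 2 * (\<tau> * \<theta> / 16)) / \<tau>"
    proof -
      have "1 + 2 * (l' * \<rho>) - 1 + 2 * (D / \<sigma>\<^sup>2) \<le> 2 * (\<tau> * \<theta> / 8) + 2 * (\<tau> * \<theta> / 16)" using D lr by linarith
      from divide_right_mono[OF this, of \<tau>] show ?thesis using D(1) \<tau> \<tau>_def by linarith
    qed
    also have "\<dots> < \<theta>" using \<tau> \<theta> by (simp add: add_divide_distrib)
    finally have "X < \<theta>" .
    moreover have "0 \<le> X" unfolding X_def by simp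
    ultimately show "norm ((\<integral>y. \<bar>evid (prior N) (lists_in p {..<N}) (monomial f) (\<lambda>_. l' / real N ^ (p - 1)) y - 1\<bar>
      \<partial>gaussian (lists_in p {..<N})) - 0) < \<theta>" by (simp add: X_def)
  qed
qed

end

section \<open>Concentration of the log-likelihood ratio\<close>

text \<open>Twice the variance is the mean squared difference of two independent copies. The modulus
  D, normalised to second moment at most 2, covers both Lipschitz functions of a Gaussian (D a t =
  |a - t|) and bounded differences (D = 1).\<close>

lemma variance_one:
  fixes h :: "'a \<Rightarrow> real"
  assumes M: "prob_space M" and h: "h \<in> borel_measurable M" "\<And>a. \<bar>h a\<bar> \<le> B" and r: "0 \<le> r"
    and D: "(\<lambda>(a, t). D a t) \<in> borel_measurable (M \<Otimes>\<^sub>M M)" "(\<integral>\<^sup>+a. \<integral>\<^sup>+t. ennreal ((D a t)\<^sup>2) \<partial>M \<partial>M) \<le> 2"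
    and lip: "\<And>a t. a \<in> space M \<Longrightarrow> t \<in> space M \<Longrightarrow> \<bar>h a - h t\<bar> \<le> r * D a t"
  shows "(\<integral>a. (h a)\<^sup>2 \<partial>M) \<le> (\<integral>a. h a \<partial>M)\<^sup>2 + r\<^sup>2"
proof -
  interpret prob_space M by (rule M)
  note [measurable] = h(1) D(1)
  have i1: "integrable M h" using h by (intro integrable_const_bound[of _ B]) auto
  have i2: "integrable M (\<lambda>a. (h a)\<^sup>2)"
    using power_mono[OF h(2), where n=2] by (intro integrable_const_bound[of _ "B\<^sup>2"]) auto
  define V where "V = (\<integral>a. (h a)\<^sup>2 \<partial>M) - (\<integral>a. h a \<partial>M)\<^sup>2"
  have e1: "(\<integral>t. (h a - h t)\<^sup>2 \<partial>M) = (h a)\<^sup>2 - 2 * (h a * (\<integral>t. h t \<partial>M)) + (\<integral>t. (h t)\<^sup>2 \<partial>M)" for a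
    using i1 i2 by (simp add: power2_diff prob_space mult.assoc)
  have "(\<integral>\<^sup>+a. \<integral>\<^sup>+t. ennreal ((h a - h t)\<^sup>2) \<partial>M \<partial>M) = (\<integral>\<^sup>+a. ennreal (\<integral>t. (h a - h t)\<^sup>2 \<partial>M) \<partial>M)"
  proof (rule nn_integral_cong)
    fix a
    have "integrable M (\<lambda>t. (h a - h t)\<^sup>2)" using i1 i2 by (simp add: power2_diff)
    thus "(\<integral>\<^sup>+t. ennreal ((h a - h t)\<^sup>2) \<partial>M) = ennreal (\<integral>t. (h a - h t)\<^sup>2 \<partial>M)"
      by (intro nn_integral_eq_integral) auto
  qed
  also have "\<dots> = ennreal (\<integral>a. \<integral>t. (h a - h t)\<^sup>2 \<partial>M \<partial>M)"
  proof (rule nn_integral_eq_integral)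
    show "integrable M (\<lambda>a. \<integral>t. (h a - h t)\<^sup>2 \<partial>M)" unfolding e1 using i1 i2 by simp
  qed simp
  also have "(\<integral>a. \<integral>t. (h a - h t)\<^sup>2 \<partial>M \<partial>M) = 2 * V"
    unfolding e1 using i1 i2 by (simp add: prob_space V_def power2_eq_square)
  finally have "ennreal (2 * V) = (\<integral>\<^sup>+a. \<integral>\<^sup>+t. ennreal ((h a - h t)\<^sup>2) \<partial>M \<partial>M)" ..
  also have "\<dots> \<le> (\<integral>\<^sup>+a. \<integral>\<^sup>+t. ennreal (r\<^sup>2) * ennreal ((D a t)\<^sup>2) \<partial>M \<partial>M)"
  proof (intro nn_integral_mono)
    fix a t assume "a \<in> space M" "t \<in> space M"
    hence "\<bar>h a - h t\<bar>\<^sup>2 \<le> (r * D a t)\<^sup>2" by (intro power_mono lip) auto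
    thus "ennreal ((h a - h t)\<^sup>2) \<le> ennreal (r\<^sup>2) * ennreal ((D a t)\<^sup>2)"
      by (simp add: ennreal_mult[symmetric] power_mult_distrib)
  qed
  also have "\<dots> = ennreal (r\<^sup>2) * (\<integral>\<^sup>+a. \<integral>\<^sup>+t. ennreal ((D a t)\<^sup>2) \<partial>M \<partial>M)"
  proof -
    have "(\<integral>\<^sup>+t. ennreal (r\<^sup>2) * ennreal ((D a t)\<^sup>2) \<partial>M) = ennreal (r\<^sup>2) * (\<integral>\<^sup>+t. ennreal ((D a t)\<^sup>2) \<partial>M)" if "a \<in> space M" for a
      using measurable_Pair2[OF D(1) that] by (intro nn_integral_cmult) simp
    hence "(\<integral>\<^sup>+a. \<integral>\<^sup>+t. ennreal (r\<^sup>2) * ennreal ((D a t)\<^sup>2) \<partial>M \<partial>M) = (\<integral>\<^sup>+a. ennreal (r\<^sup>2) * (\<integral>\<^sup>+t. ennreal ((D a t)\<^sup>2) \<partial>M) \<partial>M)"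
      by (intro nn_integral_cong)
    also have "\<dots> = ennreal (r\<^sup>2) * (\<integral>\<^sup>+a. \<integral>\<^sup>+t. ennreal ((D a t)\<^sup>2) \<partial>M \<partial>M)"
      by (rule nn_integral_cmult) measurable
    finally show ?thesis .
  qed
  also have "\<dots> \<le> ennreal (r\<^sup>2) * 2" by (intro mult_left_mono D(2)) simp
  also have "\<dots> = ennreal (r\<^sup>2 * 2)" by (simp add: ennreal_mult)
  finally have "2 * V \<le> r\<^sup>2 * 2" by (subst (asm) ennreal_le_iff) auto
  thus ?thesis by (simp add: V_def)
qed

text \<open>One coordinate is integrated out at a time. \<open>variance_one\<close> bounds the
  conditional variance, and the averaged function G inherits the moduli of F in the remaining
  coordinates.\<close>

lemma efron_stein:
  fixes F :: "('i \<Rightarrow> 'a) \<Rightarrow> real"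
  assumes M: "prob_space M" and I: "finite I"
    and F: "F \<in> borel_measurable (PiM I (\<lambda>_. M))" "\<And>x. \<bar>F x\<bar> \<le> B" and r: "\<And>i. i \<in> I \<Longrightarrow> 0 \<le> r i"
    and D: "(\<lambda>(a, t). D a t) \<in> borel_measurable (M \<Otimes>\<^sub>M M)" "(\<integral>\<^sup>+a. \<integral>\<^sup>+t. ennreal ((D a t)\<^sup>2) \<partial>M \<partial>M) \<le> 2"
    and lip: "\<And>i x t. i \<in> I \<Longrightarrow> x \<in> space (PiM I (\<lambda>_. M)) \<Longrightarrow> t \<in> space M \<Longrightarrow> \<bar>F x - F (x(i := t))\<bar> \<le> r i * D (x i) t"
  shows "(\<integral>x. (F x)\<^sup>2 \<partial>PiM I (\<lambda>_. M)) \<le> (\<integral>x. F x \<partial>PiM I (\<lambda>_. M))\<^sup>2 + (\<Sum>i\<in>I. (r i)\<^sup>2)"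
  using I F r lip
proof (induction I arbitrary: F rule: finite_induct)
  case empty
  interpret E: prob_space "PiM ({} :: 'i set) (\<lambda>_. M)" by (intro prob_space_PiM M)
  have "(\<integral>x. (F x)\<^sup>2 \<partial>PiM {} (\<lambda>_. M)) = (\<integral>x. (F (\<lambda>_. undefined))\<^sup>2 \<partial>PiM ({} :: 'i set) (\<lambda>_. M))"
    by (intro Bochner_Integration.integral_cong refl) (simp add: space_PiM)
  moreover have "(\<integral>x. F x \<partial>PiM {} (\<lambda>_. M)) = (\<integral>x. F (\<lambda>_. undefined) \<partial>PiM ({} :: 'i set) (\<lambda>_. M))"
    by (intro Bochner_Integration.integral_cong refl) (simp add: space_PiM)
  ultimately show ?case by (simp add: E.prob_space)
next
  case (insert i I)
  interpret MM: prob_space M by (rule M)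
  interpret P: product_sigma_finite "\<lambda>_. M" by unfold_locales
  interpret PI: prob_space "PiM I (\<lambda>_. M)" by (intro prob_space_PiM M)
  interpret PJ: prob_space "PiM (insert i I) (\<lambda>_. M)" by (intro prob_space_PiM M)
  note F[measurable] = insert.prems(1) and Fb = insert.prems(2) and r = insert.prems(3) and lip = insert.prems(4)
  define G where "G x = (\<integral>t. F (x(i := t)) \<partial>M)" for x
  have Fu[measurable]: "(\<lambda>(x, t). F (x(i := t))) \<in> borel_measurable (PiM I (\<lambda>_. M) \<Otimes>\<^sub>M M)"
    using measurable_compose[OF measurable_add_dim F] by (simp add: split_beta')
  have Fx: "(\<lambda>t. F (x(i := t))) \<in> borel_measurable M" if "x \<in> space (PiM I (\<lambda>_. M))" for x
    using measurable_Pair2[OF Fu that] by simp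
  have Fi: "integrable M (\<lambda>t. F (x(i := t)))" if "x \<in> space (PiM I (\<lambda>_. M))" for x
    using Fb Fx[OF that] by (intro MM.integrable_const_bound[of _ B]) auto
  have Gm: "G \<in> borel_measurable (PiM I (\<lambda>_. M))" unfolding G_def[abs_def]
    by (intro MM.borel_measurable_lebesgue_integral) measurable
  have B0: "0 \<le> B" using Fb[of undefined] by linarith
  have Gb: "\<bar>G x\<bar> \<le> B" for x
  proof (cases "integrable M (\<lambda>t. F (x(i := t)))")
    case True
    have "\<bar>G x\<bar> \<le> (\<integral>t. \<bar>F (x(i := t))\<bar> \<partial>M)" unfolding G_def by (rule integral_abs_bound)
    also have "\<dots> \<le> B" using True Fb by (intro MM.integral_le_const) auto
    finally show ?thesis .
  qed (simp add: G_def not_integrable_integral_eq B0)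
  have IF: "integrable (PiM (insert i I) (\<lambda>_. M)) F" using Fb by (intro PJ.integrable_const_bound[of _ B]) auto
  have IF2: "integrable (PiM (insert i I) (\<lambda>_. M)) (\<lambda>x. (F x)\<^sup>2)"
    using power_mono[OF Fb, where n=2] by (intro PJ.integrable_const_bound[of _ "B\<^sup>2"]) auto
  have upd: "x(i := t) \<in> space (PiM (insert i I) (\<lambda>_. M))" if "x \<in> space (PiM I (\<lambda>_. M))" "t \<in> space M" for x t
    using that insert.hyps by (auto simp: space_PiM PiE_def extensional_def)
  have inner: "(\<integral>t. (F (x(i := t)))\<^sup>2 \<partial>M) \<le> (G x)\<^sup>2 + (r i)\<^sup>2" if x: "x \<in> space (PiM I (\<lambda>_. M))" for x
    unfolding G_def
  proof (rule variance_one[OF M Fx[OF x] Fb _ D])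
    show "0 \<le> r i" using r by simp
    fix a t assume "a \<in> space M" "t \<in> space M"
    hence "\<bar>F (x(i := a)) - F ((x(i := a))(i := t))\<bar> \<le> r i * D ((x(i := a)) i) t"
      by (intro lip insertI1 upd[OF x])
    thus "\<bar>F (x(i := a)) - F (x(i := t))\<bar> \<le> r i * D a t" by (simp only: fun_upd_upd fun_upd_same)
  qed
  have "(\<integral>x. (F x)\<^sup>2 \<partial>PiM (insert i I) (\<lambda>_. M)) = (\<integral>x. \<integral>t. (F (x(i := t)))\<^sup>2 \<partial>M \<partial>PiM I (\<lambda>_. M))"
    by (rule P.product_integral_insert[OF insert.hyps IF2])
  also have "\<dots> \<le> (\<integral>x. (G x)\<^sup>2 + (r i)\<^sup>2 \<partial>PiM I (\<lambda>_. M))"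
  proof (rule integral_mono[OF _ _ inner])
    have m: "(\<lambda>x. \<integral>t. (F (x(i := t)))\<^sup>2 \<partial>M) \<in> borel_measurable (PiM I (\<lambda>_. M))"
      by (intro MM.borel_measurable_lebesgue_integral) measurable
    have "0 \<le> (\<integral>t. (F (x(i := t)))\<^sup>2 \<partial>M)" for x by simp
    moreover have "(\<integral>t. (F (x(i := t)))\<^sup>2 \<partial>M) \<le> B\<^sup>2 + (r i)\<^sup>2" if "x \<in> space (PiM I (\<lambda>_. M))" for x
      using inner[OF that] power_mono[OF Gb[of x], where n=2] by simp
    ultimately show "integrable (PiM I (\<lambda>_. M)) (\<lambda>x. \<integral>t. (F (x(i := t)))\<^sup>2 \<partial>M)"
      using m by (intro PI.integrable_const_bound[of _ "B\<^sup>2 + (r i)\<^sup>2"]) auto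
    show "integrable (PiM I (\<lambda>_. M)) (\<lambda>x. (G x)\<^sup>2 + (r i)\<^sup>2)"
      using Gm power_mono[OF Gb, where n=2] by (intro Bochner_Integration.integrable_add PI.integrable_const_bound[of "\<lambda>x. (G x)\<^sup>2" "B\<^sup>2"]) auto
  qed
  also have "\<dots> = (\<integral>x. (G x)\<^sup>2 \<partial>PiM I (\<lambda>_. M)) + (r i)\<^sup>2"
  proof -
    have "integrable (PiM I (\<lambda>_. M)) (\<lambda>x. (G x)\<^sup>2)"
      using Gm power_mono[OF Gb, where n=2] by (intro PI.integrable_const_bound[of _ "B\<^sup>2"]) auto
    thus ?thesis by (simp add: PI.prob_space)
  qed
  also have "(\<integral>x. (G x)\<^sup>2 \<partial>PiM I (\<lambda>_. M)) \<le> (\<integral>x. G x \<partial>PiM I (\<lambda>_. M))\<^sup>2 + (\<Sum>i\<in>I. (r i)\<^sup>2)"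
  proof (rule insert.IH[OF Gm Gb])
    show "0 \<le> r j" if "j \<in> I" for j using r that by simp
    fix j x t assume j: "j \<in> I" and x: "x \<in> space (PiM I (\<lambda>_. M))" and t: "t \<in> space M"
    have ij: "i \<noteq> j" using j insert.hyps by auto
    have x': "x(j := t) \<in> space (PiM I (\<lambda>_. M))" using x t j by (auto simp: space_PiM PiE_def extensional_def)
    have "\<bar>G x - G (x(j := t))\<bar> = \<bar>\<integral>a. F (x(i := a)) - F (x(j := t, i := a)) \<partial>M\<bar>"
      unfolding G_def using Fi[OF x] Fi[OF x'] by simp
    also have "\<dots> \<le> (\<integral>a. \<bar>F (x(i := a)) - F (x(j := t, i := a))\<bar> \<partial>M)" by (rule integral_abs_bound)
    also have "\<dots> \<le> r j * D (x j) t"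
    proof (rule MM.integral_le_const)
      show "integrable M (\<lambda>a. \<bar>F (x(i := a)) - F (x(j := t, i := a))\<bar>)" using Fi[OF x] Fi[OF x'] by simp
      show "AE a in M. \<bar>F (x(i := a)) - F (x(j := t, i := a))\<bar> \<le> r j * D (x j) t"
      proof (rule AE_I2)
        fix a assume "a \<in> space M"
        hence "\<bar>F (x(i := a)) - F ((x(i := a))(j := t))\<bar> \<le> r j * D ((x(i := a)) j) t"
          using j t by (intro lip insertI2 upd[OF x])
        thus "\<bar>F (x(i := a)) - F (x(j := t, i := a))\<bar> \<le> r j * D (x j) t"
          using ij by (simp only: fun_upd_twist[OF ij] fun_upd_other[OF ij[symmetric]])
      qed
    qed
    finally show "\<bar>G x - G (x(j := t))\<bar> \<le> r j * D (x j) t" .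
  qed
  also have "(\<integral>x. G x \<partial>PiM I (\<lambda>_. M)) = (\<integral>x. F x \<partial>PiM (insert i I) (\<lambda>_. M))"
    unfolding G_def by (rule P.product_integral_insert[OF insert.hyps IF, symmetric])
  finally show ?case using insert.hyps by simp
qed

lemma gauss_diff_square: "(\<integral>\<^sup>+a. \<integral>\<^sup>+t. ennreal (\<bar>a - t\<bar>\<^sup>2) \<partial>gauss \<partial>gauss) \<le> 2"
proof -
  have 1: "integrable gauss (\<lambda>y. y)" "(\<integral>y. y \<partial>gauss) = 0" using gauss_tilt_1[of 0] by (auto simp: has_bochner_integral_iff)
  have 2: "integrable gauss (\<lambda>y. y\<^sup>2)" "(\<integral>y. y\<^sup>2 \<partial>gauss) = 1" using gauss_tilt_2[of 0] by (auto simp: has_bochner_integral_iff)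
  have e: "(\<integral>t. (a - t)\<^sup>2 \<partial>gauss) = a\<^sup>2 + 1" for a
    using 1 2 by (simp add: power2_diff gauss.prob_space[simplified])
  have "(\<integral>\<^sup>+a. \<integral>\<^sup>+t. ennreal (\<bar>a - t\<bar>\<^sup>2) \<partial>gauss \<partial>gauss) = (\<integral>\<^sup>+a. ennreal (a\<^sup>2 + 1) \<partial>gauss)"
  proof (rule nn_integral_cong)
    fix a
    have "integrable gauss (\<lambda>t. (a - t)\<^sup>2)" using 1 2 by (simp add: power2_diff)
    thus "(\<integral>\<^sup>+t. ennreal (\<bar>a - t\<bar>\<^sup>2) \<partial>gauss) = ennreal (a\<^sup>2 + 1)"
      by (simp add: nn_integral_eq_integral e)
  qed
  also have "\<dots> = ennreal (\<integral>a. a\<^sup>2 + 1 \<partial>gauss)" using 2 by (intro nn_integral_eq_integral) auto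
  also have "(\<integral>a. a\<^sup>2 + 1 \<partial>gauss) = 2" using 2 by (simp add: gauss.prob_space[simplified])
  finally show ?thesis by simp
qed

section \<open>Sensitivity of the evidence to noise and to signal\<close>

lemma distr_gaussian_shift:
  assumes I: "finite I"
  shows "distr (gaussian I) (gaussian I) (\<lambda>y. \<lambda>j\<in>I. y j + t j) = density (gaussian I) (\<lambda>y. ennreal (tilt I t y))"
proof (rule measure_eqI)
  fix A assume "A \<in> sets (distr (gaussian I) (gaussian I) (\<lambda>y. \<lambda>j\<in>I. y j + t j))"
  hence A[measurable]: "A \<in> sets (gaussian I)" by simp
  hence A': "A \<in> sets (PiM I (\<lambda>_. borel))" by (simp add: sets_gaussian)
  have m: "(\<lambda>y. \<lambda>j\<in>I. y j + t j) \<in> gaussian I \<rightarrow>\<^sub>M gaussian I"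
    by (subst measurable_cong_sets[OF refl sets_gaussian]) measurable
  have [measurable]: "tilt I t \<in> borel_measurable (gaussian I)"
    using exp_bounded_measurable[OF exp_bounded_tilt[OF I]] by (simp add: measurable_cong_sets[OF sets_gaussian refl])
  have "emeasure (distr (gaussian I) (gaussian I) (\<lambda>y. \<lambda>j\<in>I. y j + t j)) A
     = (\<integral>\<^sup>+y. indicator A (\<lambda>j\<in>I. y j + t j) \<partial>gaussian I)"
    by (subst nn_integral_indicator[symmetric], simp, subst nn_integral_distr[OF m]) auto
  also have "\<dots> = (\<integral>\<^sup>+y. ennreal (tilt I t y) * indicator A y \<partial>gaussian I)"
    unfolding tilt_def using A' by (intro cameron_martin I) simp
  also have "\<dots> = emeasure (density (gaussian I) (\<lambda>y. ennreal (tilt I t y))) A"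
    by (subst emeasure_density) auto
  finally show "emeasure (distr (gaussian I) (gaussian I) (\<lambda>y. \<lambda>j\<in>I. y j + t j)) A
    = emeasure (density (gaussian I) (\<lambda>y. ennreal (tilt I t y))) A" .
qed simp

lemma integral_gaussian_shift:
  fixes G :: "('i \<Rightarrow> real) \<Rightarrow> real"
  assumes I: "finite I" and G: "G \<in> borel_measurable (PiM I (\<lambda>_. borel))"
  shows "(\<integral>y. G (\<lambda>j\<in>I. y j + t j) \<partial>gaussian I) = (\<integral>y. tilt I t y * G y \<partial>gaussian I)"
proof -
  have m: "(\<lambda>y. \<lambda>j\<in>I. y j + t j) \<in> gaussian I \<rightarrow>\<^sub>M gaussian I"
    by (subst measurable_cong_sets[OF refl sets_gaussian]) measurable
  have G': "G \<in> borel_measurable (gaussian I)" using G by (simp add: measurable_cong_sets[OF sets_gaussian refl])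
  have T: "tilt I t \<in> borel_measurable (gaussian I)"
    using exp_bounded_measurable[OF exp_bounded_tilt[OF I]] by (simp add: measurable_cong_sets[OF sets_gaussian refl])
  have "(\<integral>y. G (\<lambda>j\<in>I. y j + t j) \<partial>gaussian I) = integral\<^sup>L (density (gaussian I) (\<lambda>y. ennreal (tilt I t y))) G"
    unfolding distr_gaussian_shift[OF I, symmetric] by (rule integral_distr[OF m G', symmetric])
  also have "\<dots> = (\<integral>y. tilt I t y *\<^sub>R G y \<partial>gaussian I)"
    using G' T less_imp_le[OF tilt_pos] by (intro integral_density) auto
  finally show ?thesis by simp
qed

lemma abs_power_diff_le:
  fixes a b :: real
  assumes "\<bar>a\<bar> \<le> K" "\<bar>b\<bar> \<le> K"
  shows "\<bar>a ^ p - b ^ p\<bar> \<le> real p * K ^ (p - 1) * \<bar>a - b\<bar>"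
proof (induction p)
  case (Suc p)
  have K: "0 \<le> K" using assms by linarith
  have "a ^ Suc p - b ^ Suc p = a * (a ^ p - b ^ p) + b ^ p * (a - b)" by (simp add: algebra_simps)
  hence "\<bar>a ^ Suc p - b ^ Suc p\<bar> \<le> \<bar>a\<bar> * \<bar>a ^ p - b ^ p\<bar> + \<bar>b\<bar> ^ p * \<bar>a - b\<bar>"
    by (metis abs_mult abs_triangle_ineq power_abs)
  also have "\<dots> \<le> K * (real p * K ^ (p - 1) * \<bar>a - b\<bar>) + K ^ p * \<bar>a - b\<bar>"
    using assms K Suc by (intro add_mono mult_mono power_mono) auto
  also have "\<dots> = real (Suc p) * K ^ (Suc p - 1) * \<bar>a - b\<bar>"
    by (cases p) (simp_all add: algebra_simps)
  finally show ?case .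
qed simp

context channel
begin

text \<open>For each u the ratio of the likelihoods of y and y' is the exponential of the given
  linear form, hence at most exp \<delta>. A bound uniform in u passes to the mixture.\<close>

lemma ln_evid_lipschitz:
  assumes s: "\<forall>j. 0 \<le> s j" and y: "y \<in> space (PiM I (\<lambda>_. borel))" "y' \<in> space (PiM I (\<lambda>_. borel))"
    and \<delta>: "\<And>u. \<bar>\<Sum>j\<in>I. sqrt (s j) * x j u * (y j - y' j)\<bar> \<le> \<delta>"
  shows "\<bar>ln (evid P I x s y) - ln (evid P I x s y')\<bar> \<le> \<delta>"
proof -
  have one: "ln (evid P I x s y) \<le> \<delta> + ln (evid P I x s y')"
    if y: "y \<in> space (PiM I (\<lambda>_. borel))" "y' \<in> space (PiM I (\<lambda>_. borel))"
      and \<delta>: "\<And>u. (\<Sum>j\<in>I. sqrt (s j) * x j u * (y j - y' j)) \<le> \<delta>" for y y'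
  proof -
    have "lik I x s y u \<le> exp \<delta> * lik I x s y' u" for u
    proof -
      have "(\<Sum>j\<in>I. sqrt (s j) * x j u * y j - (sqrt (s j) * x j u)\<^sup>2 / 2)
         = (\<Sum>j\<in>I. sqrt (s j) * x j u * (y j - y' j)) + (\<Sum>j\<in>I. sqrt (s j) * x j u * y' j - (sqrt (s j) * x j u)\<^sup>2 / 2)"
        by (simp add: sum.distrib[symmetric] algebra_simps)
      thus ?thesis using \<delta>[of u] by (simp add: lik_def tilt_def exp_add[symmetric])
    qed
    hence "evid P I x s y \<le> (\<integral>u. exp \<delta> * lik I x s y' u \<partial>P)"
      unfolding evid_def using integrable_lik[OF s y(1)] integrable_lik[OF s y(2)] by (intro integral_mono) auto
    also have "\<dots> = exp \<delta> * evid P I x s y'" by (simp add: evid_def)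
    finally have "ln (evid P I x s y) \<le> ln (exp \<delta> * evid P I x s y')"
      using evid_pos[OF s y(1)] evid_pos[OF s y(2)] by (subst ln_le_cancel_iff) auto
    thus ?thesis using evid_pos[OF s y(2)] by (simp add: ln_mult)
  qed
  have "ln (evid P I x s y) \<le> \<delta> + ln (evid P I x s y')"
    using \<delta> by (intro one y) (auto intro: order_trans[OF abs_ge_self])
  moreover have "ln (evid P I x s y') \<le> \<delta> + ln (evid P I x s y)"
  proof (rule one[OF y(2,1)])
    fix u
    have "(\<Sum>j\<in>I. sqrt (s j) * x j u * (y' j - y j)) = - (\<Sum>j\<in>I. sqrt (s j) * x j u * (y j - y' j))"
      by (simp add: sum_negf[symmetric] algebra_simps)
    thus "(\<Sum>j\<in>I. sqrt (s j) * x j u * (y' j - y j)) \<le> \<delta>" using \<delta>[of u] by linarith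
  qed
  ultimately show ?thesis by linarith
qed

lemma evid_second_moment_le:
  assumes s: "\<forall>j. 0 \<le> s j" shows "(\<integral>y. evid P I x s y * evid P I x s y \<partial>gaussian I) \<le> exp (\<Sum>j\<in>I. s j)"
proof -
  note ev = exp_bounded_evid[OF s]
  have "(\<integral>y. lik I x s y u * evid P I x s y \<partial>gaussian I) \<le> exp (\<Sum>j\<in>I. s j)" for u
  proof -
    have le: "(\<Sum>j\<in>I. s j * (x j u * x j u')) \<le> (\<Sum>j\<in>I. s j)" for u'
    proof (rule sum_mono)
      fix j assume j: "j \<in> I"
      have "x j u * x j u' \<le> \<bar>x j u\<bar> * \<bar>x j u'\<bar>" by (metis abs_ge_self abs_mult)
      also have "\<dots> \<le> 1" using signal_bound[OF j] by (intro mult_le_one) auto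
      finally have "s j * (x j u * x j u') \<le> s j * 1" using s by (intro mult_left_mono) auto
      thus "s j * (x j u * x j u') \<le> s j" by simp
    qed
    have "(\<integral>y. lik I x s y u * evid P I x s y \<partial>gaussian I) = (\<integral>y. evid P I x s y * lik I x s y u \<partial>gaussian I)"
      by (simp add: mult.commute)
    also have "\<dots> = (\<integral>u'. exp (\<Sum>j\<in>I. s j * (x j u * x j u')) \<partial>P)"
      by (simp add: evid_swap[OF s exp_bounded_lik] integral_lik_lik[OF s])
    also have "\<dots> \<le> exp (\<Sum>j\<in>I. s j)"
    proof (rule integral_le_const)
      show "integrable P (\<lambda>u'. exp (\<Sum>j\<in>I. s j * (x j u * x j u')))"
        using le signal_measurable by (intro integrable_bounded[where K="exp (\<Sum>j\<in>I. s j)"]) auto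
    qed (use le in simp)
    finally show ?thesis .
  qed
  thus ?thesis unfolding evid_swap[OF s ev]
    using channel_swap(2)[OF s, of "\<lambda>_. 1" 1, OF _ _ ev] by (intro integral_le_const) auto
qed

end

lemma clamp_lipschitz:
  fixes a b B :: real
  shows "\<bar>max (- B) (min B a) - max (- B) (min B b)\<bar> \<le> \<bar>a - b\<bar>"
  by (simp add: max_def min_def abs_if)

context tensor_model
begin

lemma pow_pred: "real N ^ p = real N * real N ^ (p - 1)"
  using p_pos by (metis One_nat_def Suc_pred less_eq_Suc_le power_Suc)

lemma sum_monomial_product:
  "finite B \<Longrightarrow> (\<Sum>xs\<in>lists_in p B. monomial g xs u * monomial h xs v) = (\<Sum>i\<in>B. g (u i) * h (v i)) ^ p"
proof -
  have "monomial g xs u * monomial h xs v = (\<Prod>i\<leftarrow>xs. g (u i) * h (v i))" for xs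
    unfolding monomial_def by (induction xs) auto
  thus "finite B \<Longrightarrow> ?thesis" by (simp add: sum_prod_list)
qed

text \<open>The sum over N^p entries is a difference a^p - b^p of powers of scalar products of size
  at most N that differ by at most 2. This saves a power of N over an entrywise bound on the
  affected entries only up to constants, but needs no count of those entries.\<close>

lemma monomial_sum_lipschitz:
  assumes i: "i < N"
  shows "\<bar>\<Sum>xs\<in>lists_in p {..<N}. monomial f xs v * (monomial f xs u - monomial f xs (u(i := t)))\<bar>
    \<le> 2 * real p * real N ^ (p - 1)"
proof -
  define a where "a = (\<Sum>k<N. f (v k) * f (u k))"
  define b where "b = (\<Sum>k<N. f (v k) * f ((u(i := t)) k))"
  have fb: "\<bar>f s * f t\<bar> \<le> 1" for s t unfolding abs_mult using f_bound by (intro mult_le_one) auto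
  have ab: "\<bar>a\<bar> \<le> real N" "\<bar>b\<bar> \<le> real N"
  proof -
    have "\<bar>\<Sum>k<N. f (v k) * f (w k)\<bar> \<le> (\<Sum>k<N. 1)" for w
      by (rule order_trans[OF sum_abs]) (intro sum_mono fb)
    thus "\<bar>a\<bar> \<le> real N" "\<bar>b\<bar> \<le> real N" by (simp_all add: a_def b_def)
  qed
  have "a - b = (\<Sum>k<N. f (v k) * f (u k) - f (v k) * f ((u(i := t)) k))" by (simp add: a_def b_def sum_subtractf)
  also have "\<dots> = (\<Sum>k<N. if k = i then f (v i) * f (u i) - f (v i) * f t else 0)" by (intro sum.cong) auto
  also have "\<dots> = f (v i) * f (u i) - f (v i) * f t" using i by simp
  finally have d: "\<bar>a - b\<bar> \<le> 2" using fb[of "v i" "u i"] fb[of "v i" t] by linarith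
  have "(\<Sum>xs\<in>lists_in p {..<N}. monomial f xs v * (monomial f xs u - monomial f xs (u(i := t)))) = a ^ p - b ^ p"
    by (simp add: right_diff_distrib sum_subtractf sum_monomial_product a_def b_def)
  also have "\<bar>a ^ p - b ^ p\<bar> \<le> real p * real N ^ (p - 1) * \<bar>a - b\<bar>" by (rule abs_power_diff_le[OF ab])
  also have "\<dots> \<le> real p * real N ^ (p - 1) * 2" using d by (intro mult_left_mono) auto
  finally show ?thesis by (simp add: mult_ac)
qed

text \<open>Under the alternative the observation is a function of independent noise and signal, and
  Efron--Stein is applied to each. The N^p noise coordinates have modulus sqrt (l / N^(p - 1)) and
  contribute l * N; each of the N signal coordinates has modulus 2 p l. Clamping provides the
  boundedness that \<open>efron_stein\<close> assumes and does not increase the moduli.\<close>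

lemma clamped_variance:
  assumes N: "0 < N" and l: "0 < l" and B: "0 < B"
  defines "I \<equiv> lists_in p {..<N}"
  defines "E \<equiv> evid (prior N) I (monomial f) (\<lambda>_. l / real N ^ (p - 1))"
  defines "F \<equiv> \<lambda>y. max (- B) (min B (ln (E y)))"
  shows "(\<integral>y. E y * (F y)\<^sup>2 \<partial>gaussian I) \<le> (\<integral>y. E y * F y \<partial>gaussian I)\<^sup>2 + real N * (l + (2 * real p * l)\<^sup>2)"
proof -
  interpret C: channel "prior N" I "monomial f" unfolding I_def by (rule channel_prior')
  interpret G: prob_space "gaussian I" by (rule prob_space_gaussian)
  define d where "d = real N ^ (p - 1)"
  have d: "0 < d" using N by (simp add: d_def)
  define s where "s = (\<lambda>_ :: nat list. l / d)"
  have s0: "\<forall>j. 0 \<le> s j" using l d by (simp add: s_def)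
  have Es: "E = evid (prior N) I (monomial f) s" by (simp add: E_def s_def d_def)
  have cI: "real (card I) = real N * d" by (simp add: I_def card_lists_in d_def pow_pred)
  define w where "w u j = sqrt (s j) * monomial f j u" for u j
  \<comment> \<open>The observation produced by the noise Y and the signal u.\<close>
  define sh where "sh u Y = (\<lambda>j\<in>I. Y j + w u j)" for u Y
  have E_meas[measurable]: "E \<in> borel_measurable (PiM I (\<lambda>_. borel))" unfolding Es by measurable
  have F_meas[measurable]: "F \<in> borel_measurable (PiM I (\<lambda>_. borel))" unfolding F_def by measurable
  have Fb: "\<bar>F y\<bar> \<le> B" for y using B by (auto simp: F_def)
  have sh_space: "sh u Y \<in> space (PiM I (\<lambda>_. borel))" for u Y by (simp add: sh_def space_PiM)
  have sh_meas: "sh u \<in> gaussian I \<rightarrow>\<^sub>M PiM I (\<lambda>_. borel)" for u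
    unfolding sh_def by measurable
  have bF: "exp_bounded I F" by (rule exp_boundedI[where C=B and c=0]) (use Fb in auto)
  have shift: "(\<integral>Y. H (sh u Y) \<partial>gaussian I) = (\<integral>y. lik I (monomial f) s y u * H y \<partial>gaussian I)"
    if "H \<in> borel_measurable (PiM I (\<lambda>_. borel))" for H :: "_ \<Rightarrow> real" and u
    unfolding sh_def lik_def w_def[symmetric] by (rule integral_gaussian_shift[OF C.finite_I that])
  have Flip: "\<bar>F y - F y'\<bar> \<le> \<delta>"
    if "y \<in> space (PiM I (\<lambda>_. borel))" "y' \<in> space (PiM I (\<lambda>_. borel))"
      "\<And>v. \<bar>\<Sum>j\<in>I. sqrt (s j) * monomial f j v * (y j - y' j)\<bar> \<le> \<delta>" for y y' \<delta>
    using C.ln_evid_lipschitz[OF s0 that] clamp_lipschitz[of B "ln (E y)" "ln (E y')"] by (simp add: F_def Es)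
  define g where "g u = (\<integral>Y. F (sh u Y) \<partial>gaussian I)" for u
  have Fsh_int: "integrable (gaussian I) (\<lambda>Y. F (sh u Y))" for u
    using Fb measurable_compose[OF sh_meas F_meas] by (intro G.integrable_const_bound[of _ B]) auto
  have g_eq: "g u = (\<integral>y. lik I (monomial f) s y u * F y \<partial>gaussian I)" for u
    unfolding g_def by (rule shift) measurable
  have gb: "\<bar>g u\<bar> \<le> B" for u
  proof -
    have "\<bar>g u\<bar> \<le> (\<integral>Y. \<bar>F (sh u Y)\<bar> \<partial>gaussian I)" unfolding g_def by (rule integral_abs_bound)
    also have "\<dots> \<le> B" using Fsh_int Fb by (intro G.integral_le_const) auto
    finally show ?thesis .
  qed
  have g_int: "integrable (prior N) g"
    using C.channel_swap(2)[OF s0, of "\<lambda>_. 1" 1 F] bF by (simp add: g_eq[abs_def])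
  have VY: "(\<integral>y. lik I (monomial f) s y u * (F y)\<^sup>2 \<partial>gaussian I) \<le> (g u)\<^sup>2 + real N * l" for u
  proof -
    have "(\<integral>Y. (F (sh u Y))\<^sup>2 \<partial>gaussian I) \<le> (\<integral>Y. F (sh u Y) \<partial>gaussian I)\<^sup>2 + (\<Sum>j\<in>I. (sqrt (l / d))\<^sup>2)"
    proof (rule efron_stein[OF prob_space_gauss C.finite_I _ Fb, where D="\<lambda>a t. \<bar>a - t\<bar>"])
      show "(\<lambda>Y. F (sh u Y)) \<in> borel_measurable (gaussian I)" by (rule measurable_compose[OF sh_meas F_meas])
      show "(\<lambda>(a, t). \<bar>a - t\<bar>) \<in> borel_measurable (gauss \<Otimes>\<^sub>M gauss)" by measurable
      show "(\<integral>\<^sup>+a. \<integral>\<^sup>+t. ennreal (\<bar>a - t\<bar>\<^sup>2) \<partial>gauss \<partial>gauss) \<le> 2" by (rule gauss_diff_square)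
      show "0 \<le> sqrt (l / d)" using l d by simp
      fix i Y t assume i: "i \<in> I"
      show "\<bar>F (sh u Y) - F (sh u (Y(i := t)))\<bar> \<le> sqrt (l / d) * \<bar>Y i - t\<bar>"
      proof (rule Flip[OF sh_space sh_space])
        fix v
        have "(\<Sum>j\<in>I. sqrt (s j) * monomial f j v * (sh u Y j - sh u (Y(i := t)) j))
          = (\<Sum>j\<in>I. if j = i then sqrt (l / d) * monomial f i v * (Y i - t) else 0)"
          by (intro sum.cong) (auto simp: sh_def s_def)
        also have "\<dots> = sqrt (l / d) * (monomial f i v * (Y i - t))" using i C.finite_I by simp
        also have "\<bar>\<dots>\<bar> \<le> sqrt (l / d) * (1 * \<bar>Y i - t\<bar>)"
          unfolding abs_mult using l d monomial_bound by (intro mult_mono) auto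
        finally show "\<bar>\<Sum>j\<in>I. sqrt (s j) * monomial f j v * (sh u Y j - sh u (Y(i := t)) j)\<bar> \<le> sqrt (l / d) * \<bar>Y i - t\<bar>"
          by simp
      qed
    qed
    moreover have "(\<Sum>j\<in>I. (sqrt (l / d))\<^sup>2) = real N * l" using l d by (simp add: cI)
    moreover have "(\<integral>Y. (F (sh u Y))\<^sup>2 \<partial>gaussian I) = (\<integral>y. lik I (monomial f) s y u * (F y)\<^sup>2 \<partial>gaussian I)"
      by (rule shift) measurable
    ultimately show ?thesis by (simp add: g_def)
  qed
  have Vu: "(\<integral>u. (g u)\<^sup>2 \<partial>prior N) \<le> (\<integral>u. g u \<partial>prior N)\<^sup>2 + (\<Sum>i<N. (2 * real p * l)\<^sup>2)"
  proof (rule efron_stein[OF prob_space_axioms _ _ gb, where D="\<lambda>_ _. 1"])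
    show "g \<in> borel_measurable (prior N)" using g_int by simp
    show "(\<integral>\<^sup>+a. \<integral>\<^sup>+t. ennreal (1\<^sup>2) \<partial>\<nu> \<partial>\<nu>) \<le> 2" by (simp add: emeasure_space_1)
    fix i u t assume i: "i \<in> {..<N}"
    have "\<bar>g u - g (u(i := t))\<bar> = \<bar>\<integral>Y. F (sh u Y) - F (sh (u(i := t)) Y) \<partial>gaussian I\<bar>"
      unfolding g_def using Fsh_int by simp
    also have "\<dots> \<le> (\<integral>Y. \<bar>F (sh u Y) - F (sh (u(i := t)) Y)\<bar> \<partial>gaussian I)" by (rule integral_abs_bound)
    also have "\<dots> \<le> 2 * real p * l"
    proof (rule G.integral_le_const)
      show "integrable (gaussian I) (\<lambda>Y. \<bar>F (sh u Y) - F (sh (u(i := t)) Y)\<bar>)" using Fsh_int by simp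
      have "\<bar>F (sh u Y) - F (sh (u(i := t)) Y)\<bar> \<le> 2 * real p * l" for Y
      proof (rule Flip[OF sh_space sh_space])
        fix v
        have "(\<Sum>j\<in>I. sqrt (s j) * monomial f j v * (sh u Y j - sh (u(i := t)) Y j))
          = (\<Sum>j\<in>I. (l / d) * (monomial f j v * (monomial f j u - monomial f j (u(i := t)))))"
        proof (intro sum.cong refl)
          fix j assume j: "j \<in> I"
          have "sqrt (s j) * monomial f j v * (sh u Y j - sh (u(i := t)) Y j)
            = (sqrt (l / d) * sqrt (l / d)) * (monomial f j v * (monomial f j u - monomial f j (u(i := t))))"
          proof -
            have "q * m * (q * a - q * b) = (q * q) * (m * (a - b))" for q m a b :: real by algebra
            moreover have "sh u Y j - sh (u(i := t)) Y j = sqrt (l / d) * monomial f j u - sqrt (l / d) * monomial f j (u(i := t))"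
              using j by (simp add: sh_def w_def s_def)
            ultimately show ?thesis by (simp only: s_def)
          qed
          thus "sqrt (s j) * monomial f j v * (sh u Y j - sh (u(i := t)) Y j)
            = (l / d) * (monomial f j v * (monomial f j u - monomial f j (u(i := t))))"
            using l d by simp
        qed
        also have "\<dots> = (l / d) * (\<Sum>j\<in>I. monomial f j v * (monomial f j u - monomial f j (u(i := t))))"
          by (simp add: sum_distrib_left)
        also have "\<bar>\<dots>\<bar> \<le> (l / d) * (2 * real p * d)"
          unfolding abs_mult using l d monomial_sum_lipschitz[of i N v u t] i
          by (intro mult_mono) (auto simp: I_def d_def)
        also have "\<dots> = 2 * real p * l" using d by simp
        finally show "\<bar>\<Sum>j\<in>I. sqrt (s j) * monomial f j v * (sh u Y j - sh (u(i := t)) Y j)\<bar> \<le> 2 * real p * l" .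
      qed
      thus "AE Y in gaussian I. \<bar>F (sh u Y) - F (sh (u(i := t)) Y)\<bar> \<le> 2 * real p * l" by simp
    qed
    finally show "\<bar>g u - g (u(i := t))\<bar> \<le> 2 * real p * l * 1" by simp
  qed (use l in auto)
  have bF2: "exp_bounded I (\<lambda>y. (F y)\<^sup>2)" by (intro exp_bounded_power bF)
  have g2_int: "integrable (prior N) (\<lambda>u. (g u)\<^sup>2)"
    using g_int power_mono[OF gb, where n=2] by (intro C.integrable_const_bound[of _ "B\<^sup>2"]) auto
  have "(\<integral>y. E y * (F y)\<^sup>2 \<partial>gaussian I) = (\<integral>u. \<integral>y. lik I (monomial f) s y u * (F y)\<^sup>2 \<partial>gaussian I \<partial>prior N)"
    unfolding Es by (rule C.evid_swap[OF s0 bF2])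
  also have "\<dots> \<le> (\<integral>u. (g u)\<^sup>2 + real N * l \<partial>prior N)"
    using C.channel_swap(2)[OF s0, of "\<lambda>_. 1" 1, OF _ _ bF2] g2_int VY by (intro integral_mono) auto
  also have "\<dots> = (\<integral>u. (g u)\<^sup>2 \<partial>prior N) + real N * l" using g2_int by (simp add: C.prob_space)
  also have "\<dots> \<le> (\<integral>u. g u \<partial>prior N)\<^sup>2 + real N * (l + (2 * real p * l)\<^sup>2)"
    using Vu by (simp add: distrib_left)
  also have "(\<integral>u. g u \<partial>prior N) = (\<integral>y. E y * F y \<partial>gaussian I)"
    unfolding Es g_eq by (rule C.evid_swap[OF s0 bF, symmetric])
  finally show ?thesis .
qed

text \<open>The test compares the log-likelihood ratio with half of g * N. Under pure noise Markov's
  inequality for E, of mean 1, applies. Under the alternative the mean of the log-likelihood ratio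
  is \<open>TK N l\<close>, at least g * N, and Chebyshev's inequality applies with a variance of
  order N.\<close>

lemma likelihood_ratio_test:
  assumes N: "0 < N" and l: "0 < l" and g: "0 < g" "4 \<le> g * real N" "g * real N \<le> TK N l"
  defines "I \<equiv> lists_in p {..<N}"
  defines "E \<equiv> evid (prior N) I (monomial f) (\<lambda>_. l / real N ^ (p - 1))"
  shows "(\<integral>y. (if g * real N / 2 \<le> ln (E y) then 1 else 0) \<partial>gaussian I) \<le> exp (- (g * real N / 2))"
    and "(\<integral>y. E y * (if g * real N / 2 \<le> ln (E y) then 0 else 1) \<partial>gaussian I)
      \<le> 16 * (l + (2 * real p * l)\<^sup>2) / (g\<^sup>2 * real N)"
proof -
  interpret C: channel "prior N" I "monomial f" unfolding I_def by (rule channel_prior')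
  interpret G: prob_space "gaussian I" by (rule prob_space_gaussian)
  define s where "s = (\<lambda>_ :: nat list. l / real N ^ (p - 1))"
  have s0: "\<forall>j. 0 \<le> s j" using l by (simp add: s_def)
  have Es: "E = evid (prior N) I (monomial f) s" by (simp add: E_def s_def)
  have sp: "y \<in> space (PiM I (\<lambda>_. borel))" if "y \<in> space (gaussian I)" for y using that by (simp add: space_PiM)
  have E0: "0 < E y" if "y \<in> space (gaussian I)" for y unfolding Es by (rule C.evid_pos[OF s0 sp[OF that]])
  have bE: "exp_bounded I E" unfolding Es by (rule C.exp_bounded_evid[OF s0])
  have bL: "exp_bounded I (\<lambda>y. ln (E y))" unfolding Es by (rule C.exp_bounded_ln_evid[OF s0])
  note [measurable] = exp_bounded_measurable[OF bE]
  have EI: "(\<integral>y. E y \<partial>gaussian I) = 1" unfolding Es by (rule C.integral_evid[OF s0])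
  have iE: "integrable (gaussian I) E" by (rule C.exp_bounded_integrable'[OF bE])
  define A where "A = g * real N"
  have A4: "4 \<le> A" using g by (simp add: A_def)
  have bi: "exp_bounded I (\<lambda>y. if A / 2 \<le> ln (E y) then a else b)" for a b :: real
    by (rule exp_boundedI[where C="\<bar>a\<bar> + \<bar>b\<bar>" and c=0]) auto
  have "(\<integral>y. (if A / 2 \<le> ln (E y) then 1 else 0) \<partial>gaussian I) \<le> (\<integral>y. exp (- (A / 2)) * E y \<partial>gaussian I)"
  proof (rule integral_mono)
    show "integrable (gaussian I) (\<lambda>y. if A / 2 \<le> ln (E y) then 1 else 0 :: real)" by (rule C.exp_bounded_integrable'[OF bi])
    show "integrable (gaussian I) (\<lambda>y. exp (- (A / 2)) * E y)" using iE by simp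
    fix y assume y: "y \<in> space (gaussian I)"
    show "(if A / 2 \<le> ln (E y) then 1 else 0) \<le> exp (- (A / 2)) * E y"
    proof (cases "A / 2 \<le> ln (E y)")
      case True
      hence "exp (A / 2) \<le> E y" using ln_ge_iff[OF E0[OF y], of "A / 2"] by blast
      hence "exp (- (A / 2)) * exp (A / 2) \<le> exp (- (A / 2)) * E y" by (intro mult_left_mono) auto
      thus ?thesis using True by (simp add: exp_minus)
    qed (use E0[OF y] in simp)
  qed
  thus "(\<integral>y. (if g * real N / 2 \<le> ln (E y) then 1 else 0) \<partial>gaussian I) \<le> exp (- (g * real N / 2))"
    by (simp add: EI A_def)
  \<comment> \<open>The total ratio of all entries. The second moment of the evidence is at most exp
    B, so clamping at B lowers the mean of the log-likelihood ratio by at most exp (- B) * exp B =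
    1.\<close>
  define B where "B = l * real N"
  have B: "0 < B" using l N by (simp add: B_def)
  define F where "F y = max (- B) (min B (ln (E y)))" for y
  have F_meas[measurable]: "F \<in> borel_measurable (PiM I (\<lambda>_. borel))" unfolding F_def by measurable
  have bF: "exp_bounded I F" by (rule exp_boundedI[where C=B and c=0]) (use B in \<open>auto simp: F_def\<close>)
  define m where "m = (\<integral>y. E y * F y \<partial>gaussian I)"
  have iEF: "integrable (gaussian I) (\<lambda>y. E y * F y)" by (intro C.exp_bounded_integrable' exp_bounded_mult bE bF)
  have iEF2: "integrable (gaussian I) (\<lambda>y. E y * (F y)\<^sup>2)" by (intro C.exp_bounded_integrable' exp_bounded_mult exp_bounded_power bE bF)
  have iEE: "integrable (gaussian I) (\<lambda>y. E y * E y)" by (intro C.exp_bounded_integrable' exp_bounded_mult bE)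
  have iEL: "integrable (gaussian I) (\<lambda>y. E y * ln (E y))" by (intro C.exp_bounded_integrable' exp_bounded_mult bE bL)
  have m: "A - 1 \<le> m"
  proof -
    have "(\<integral>y. E y * ln (E y) \<partial>gaussian I) - m = (\<integral>y. E y * ln (E y) - E y * F y \<partial>gaussian I)"
      using iEL iEF by (simp add: m_def)
    also have "\<dots> \<le> (\<integral>y. exp (- B) * (E y * E y) \<partial>gaussian I)"
    proof (rule integral_mono)
      show "integrable (gaussian I) (\<lambda>y. E y * ln (E y) - E y * F y)" using iEL iEF by simp
      show "integrable (gaussian I) (\<lambda>y. exp (- B) * (E y * E y))" using iEE by simp
      fix y assume y: "y \<in> space (gaussian I)"
      have "ln (E y) - B \<le> exp (ln (E y) - B)" using exp_ge_add_one_self[of "ln (E y) - B"] by linarith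
      moreover have "B \<le> F y \<or> ln (E y) \<le> F y" by (auto simp: F_def)
      moreover have "0 < exp (ln (E y) - B)" by (rule exp_gt_zero)
      ultimately have "ln (E y) - F y \<le> exp (ln (E y) - B)" by linarith
      also have "\<dots> = exp (- B) * E y" using E0[OF y] by (simp add: exp_diff exp_minus field_simps)
      finally have "E y * (ln (E y) - F y) \<le> E y * (exp (- B) * E y)" using E0[OF y] by (intro mult_left_mono) auto
      thus "E y * ln (E y) - E y * F y \<le> exp (- B) * (E y * E y)" by (simp add: algebra_simps)
    qed
    also have "\<dots> = exp (- B) * (\<integral>y. E y * E y \<partial>gaussian I)" by simp
    also have "\<dots> \<le> exp (- B) * exp (\<Sum>j\<in>I. s j)"
      unfolding Es by (intro mult_left_mono C.evid_second_moment_le s0) simp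
    also have "(\<Sum>j\<in>I. s j) = B" using N by (simp add: s_def I_def card_lists_in B_def pow_pred)
    finally have "(\<integral>y. E y * ln (E y) \<partial>gaussian I) - m \<le> 1" by (simp add: exp_minus)
    moreover have "(\<integral>y. E y * ln (E y) \<partial>gaussian I) = TK N l" by (simp add: TK_def KL_def E_def I_def)
    ultimately show ?thesis using g(3) by (simp add: A_def)
  qed
  have var: "(\<integral>y. E y * (F y - m)\<^sup>2 \<partial>gaussian I) \<le> real N * (l + (2 * real p * l)\<^sup>2)"
  proof -
    have "(\<integral>y. E y * (F y - m)\<^sup>2 \<partial>gaussian I) = (\<integral>y. E y * (F y)\<^sup>2 - (2 * m) * (E y * F y) + m\<^sup>2 * E y \<partial>gaussian I)"
      by (intro Bochner_Integration.integral_cong refl) (simp add: power2_diff algebra_simps)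
    also have "\<dots> = (\<integral>y. E y * (F y)\<^sup>2 \<partial>gaussian I) - m\<^sup>2"
      using iE iEF iEF2 by (simp add: EI m_def[symmetric] power2_eq_square)
    also have "\<dots> \<le> real N * (l + (2 * real p * l)\<^sup>2)"
      using clamped_variance[OF N l B] by (simp add: m_def F_def E_def I_def)
    finally show ?thesis .
  qed
  have "(\<integral>y. E y * (if A / 2 \<le> ln (E y) then 0 else 1) \<partial>gaussian I) \<le> (\<integral>y. (16 / A\<^sup>2) * (E y * (F y - m)\<^sup>2) \<partial>gaussian I)"
  proof (rule integral_mono)
    show "integrable (gaussian I) (\<lambda>y. E y * (if A / 2 \<le> ln (E y) then 0 else 1))"
      by (intro C.exp_bounded_integrable' exp_bounded_mult bE bi)
    show "integrable (gaussian I) (\<lambda>y. (16 / A\<^sup>2) * (E y * (F y - m)\<^sup>2))"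
      by (intro C.exp_bounded_integrable' exp_bounded_intros bE bF)
    fix y assume y: "y \<in> space (gaussian I)"
    show "E y * (if A / 2 \<le> ln (E y) then 0 else 1) \<le> (16 / A\<^sup>2) * (E y * (F y - m)\<^sup>2)"
    proof (cases "A / 2 \<le> ln (E y)")
      case False
      have "F y \<le> A / 2" using False B A4 by (auto simp: F_def)
      \<comment> \<open>The mean is at least A - 1 and the test level is A / 2; by A \<ge> 4 the
        distance A / 2 - 1 is at least A / 4.\<close>
      hence "A / 4 \<le> m - F y" using m A4 by linarith
      hence "(A / 4)\<^sup>2 \<le> (m - F y)\<^sup>2" using A4 by (intro power_mono) auto
      hence "(16 / A\<^sup>2) * (A / 4)\<^sup>2 \<le> (16 / A\<^sup>2) * (F y - m)\<^sup>2"
        by (intro mult_left_mono) (auto simp: power2_commute)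
      moreover have "(16 / A\<^sup>2) * (A / 4)\<^sup>2 = 1" using A4 by (simp add: power_divide)
      ultimately have "E y * 1 \<le> E y * ((16 / A\<^sup>2) * (F y - m)\<^sup>2)" using E0[OF y] by (intro mult_left_mono) auto
      thus ?thesis using False by (simp add: mult_ac)
    qed (use E0[OF y] in simp)
  qed
  also have "\<dots> = (16 / A\<^sup>2) * (\<integral>y. E y * (F y - m)\<^sup>2 \<partial>gaussian I)" by simp
  also have "\<dots> \<le> (16 / A\<^sup>2) * (real N * (l + (2 * real p * l)\<^sup>2))" by (intro mult_left_mono var) simp
  also have "\<dots> = 16 * (l + (2 * real p * l)\<^sup>2) / (g\<^sup>2 * real N)"
    using N g by (simp add: A_def power_mult_distrib power2_eq_square[of "real N"])
  finally show "(\<integral>y. E y * (if g * real N / 2 \<le> ln (E y) then 0 else 1) \<partial>gaussian I)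
      \<le> 16 * (l + (2 * real p * l)\<^sup>2) / (g\<^sup>2 * real N)" by (simp add: A_def)
qed

text \<open>Gibbs' inequality with the mixture of the shifts of the noise by multiples of \<open>v\<^sup>\<otimes>\<^sup>p\<close>, \<open>v \<in> {-1, 1}\<^sup>N\<close>.\<close>

lemma TK_lower:
  assumes N: "0 < N" and l: "0 < l" and m1: "m1 = (\<integral>a. \<bar>f a\<bar> \<partial>\<nu>)" "0 < m1"
  shows "real N * (l * m1 ^ (2 * p) / 2 - ln 2) \<le> TK N l"
proof -
  define I where "I = lists_in p {..<N}"
  interpret C: channel "prior N" I "monomial f" unfolding I_def by (rule channel_prior')
  interpret T: tensor_model \<nu> sgn p
    using sets_nu p_pos by unfold_locales (auto simp: sgn_if)
  interpret S: channel "prior N" I "monomial sgn" unfolding I_def by (rule T.channel_prior')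
  define d where "d = real N ^ (p - 1)"
  have d: "0 < d" using N by (simp add: d_def)
  have cI: "real (card I) = real N * d" by (simp add: I_def card_lists_in d_def pow_pred)
  \<comment> \<open>The amplitude of the sign tensors. This value maximises \<alpha> * sqrt l * m1^p
    - \<alpha>^2 / 2, the gain per coordinate in Gibbs' inequality.\<close>
  define \<alpha> where "\<alpha> = sqrt l * m1 ^ p"
  have \<alpha>: "0 < \<alpha>" using l m1 by (simp add: \<alpha>_def)
  define s where "s = (\<lambda>_ :: nat list. l / d)"
  define r where "r = (\<lambda>_ :: nat list. \<alpha>\<^sup>2 / d)"
  have s0: "\<forall>j. 0 \<le> s j" and r0: "\<forall>j. 0 \<le> r j" using l d by (auto simp: s_def r_def)
  define V :: "(nat \<Rightarrow> real) set" where "V = PiE {..<N} (\<lambda>_. {-1, 1})"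
  have V: "finite V" "card V = 2 ^ N" by (simp_all add: V_def finite_PiE card_PiE numeral_2_eq_2)
  have Vne: "V \<noteq> {}" using V by auto
  \<comment> \<open>The uniform mixture over the 2^N sign vectors of the noise densities shifted by
    multiples of their tensor powers.\<close>
  define q where "q y = (\<Sum>v\<in>V. (1 / 2 ^ N) * lik I (monomial sgn) r y v)" for y
  have bq: "exp_bounded I q" unfolding q_def[abs_def] by (intro exp_bounded_intros S.exp_bounded_lik)
  have av: "(\<Sum>v\<in>V. (1 / 2 ^ N) * c) = c" for c :: real using V by simp
  have q_le: "q y \<le> exp (lbound I r y)" for y
  proof -
    have "q y \<le> (\<Sum>v\<in>V. (1 / 2 ^ N) * exp (lbound I r y))" unfolding q_def
      by (intro sum_mono mult_left_mono S.lik_le[OF r0]) auto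
    thus ?thesis by (simp only: av)
  qed
  have q_ge: "exp (- lbound I r y) \<le> q y" for y
  proof -
    have "(\<Sum>v\<in>V. (1 / 2 ^ N) * exp (- lbound I r y)) \<le> q y" unfolding q_def
      by (intro sum_mono mult_left_mono S.lik_ge[OF r0]) auto
    thus ?thesis by (simp only: av)
  qed
  have q0: "0 < q y" for y using q_ge[of y] exp_gt_zero less_le_trans by blast
  have bl: "exp_bounded I (\<lambda>y. ln (q y))"
  proof (rule exp_bounded_mono[OF _ S.exp_bounded_lbound[of r]])
    show "(\<lambda>y. ln (q y)) \<in> borel_measurable (PiM I (\<lambda>_. borel))" using exp_bounded_measurable[OF bq] by measurable
    show "\<bar>ln (q y)\<bar> \<le> \<bar>lbound I r y\<bar>" for y
    proof -
      have "ln (q y) \<le> ln (exp (lbound I r y))" using q_le q0 by (subst ln_le_cancel_iff) auto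
      moreover have "ln (exp (- lbound I r y)) \<le> ln (q y)" using q_ge q0 by (subst ln_le_cancel_iff) auto
      ultimately show ?thesis by simp
    qed
  qed
  have Iq: "(\<integral>y. q y \<partial>gaussian I) = 1"
  proof -
    have "(\<integral>y. q y \<partial>gaussian I) = (\<Sum>v\<in>V. (1 / 2 ^ N) * (\<integral>y. lik I (monomial sgn) r y v \<partial>gaussian I))"
      unfolding q_def using C.exp_bounded_integrable'[OF S.exp_bounded_lik]
      by (subst Bochner_Integration.integral_sum) auto
    also have "\<dots> = 1" using av[of 1] by (simp only: S.integral_lik)
    finally show ?thesis .
  qed
  have gibbs: "(\<integral>y. evid (prior N) I (monomial f) s y * ln (q y) \<partial>gaussian I) \<le> TK N l"
  proof -
    have "(\<integral>y. evid (prior N) I (monomial f) s y * ln (q y) \<partial>gaussian I) \<le> KL (prior N) I (monomial f) s"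
      by (rule C.gibbs_inequality[OF s0 bl]) (use bq q0 in \<open>simp_all add: Iq\<close>)
    thus ?thesis by (simp add: TK_def I_def s_def d_def)
  qed
  define S where "S u = (\<Sum>i<N. \<bar>f (u i)\<bar>) / real N" for u
  have inner: "real N * (\<alpha> * sqrt l * (S u) ^ p - \<alpha>\<^sup>2 / 2 - ln 2) \<le> (\<integral>y. lik I (monomial f) s y u * ln (q y) \<partial>gaussian I)" for u
  proof -
    \<comment> \<open>The sign vector of f (u i), with sign 1 at zeros so that v belongs to V. It
      turns the scalar product with f (u i) into the sum of the absolute values.\<close>
    define v where "v = (\<lambda>i\<in>{..<N}. if 0 \<le> f (u i) then 1 else - 1 :: real)"
    have vV: "v \<in> V" by (auto simp: v_def V_def)
    define c where "c j = sqrt (\<alpha>\<^sup>2 / d) * monomial sgn j v" for j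
    have c2: "(c j)\<^sup>2 = \<alpha>\<^sup>2 / d" if "j \<in> I" for j
    proof -
      have "(monomial sgn xs v)\<^sup>2 = 1" if "set xs \<subseteq> {..<N}" for xs
        using that unfolding monomial_def by (induction xs) (auto simp: v_def power_mult_distrib)
      thus ?thesis using that d by (simp add: c_def I_def lists_in_def power_mult_distrib)
    qed
    have Lv: "ln (lik I (monomial sgn) r y v) = - (\<Sum>j\<in>I. (c j)\<^sup>2 / 2) + (\<Sum>j\<in>I. c j * y j)" for y
      by (simp add: lik_def ln_tilt r_def c_def sum_subtractf)
    \<comment> \<open>Only the component v of the mixture is kept; its weight costs N * ln
      2.\<close>
    have lnq: "- real N * ln 2 + (- (\<Sum>j\<in>I. (c j)\<^sup>2 / 2) + (\<Sum>j\<in>I. c j * y j)) \<le> ln (q y)" for y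
    proof -
      have "(1 / 2 ^ N) * lik I (monomial sgn) r y v \<le> q y"
        unfolding q_def using V vV S.lik_nonneg by (intro member_le_sum) auto
      hence "ln ((1 / 2 ^ N) * lik I (monomial sgn) r y v) \<le> ln (q y)"
        using S.lik_pos q0 by (subst ln_le_cancel_iff) auto
      moreover have "ln ((1 / 2 ^ N) * lik I (monomial sgn) r y v) = - real N * ln 2 + ln (lik I (monomial sgn) r y v)"
        using S.lik_pos[of r y v] by (simp add: ln_mult ln_div ln_realpow)
      ultimately show ?thesis by (simp only: Lv)
    qed
    define D where "D = - real N * ln 2 - (\<Sum>j\<in>I. (c j)\<^sup>2 / 2)"
    have "(\<integral>y. lik I (monomial f) s y u * (D + (\<Sum>j\<in>I. c j * y j)) \<partial>gaussian I) \<le> (\<integral>y. lik I (monomial f) s y u * ln (q y) \<partial>gaussian I)"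
    proof (rule integral_mono)
      show "integrable (gaussian I) (\<lambda>y. lik I (monomial f) s y u * (D + (\<Sum>j\<in>I. c j * y j)))"
        by (intro C.exp_bounded_integrable' exp_bounded_mult C.exp_bounded_lik C.exp_bounded_linear)
      show "integrable (gaussian I) (\<lambda>y. lik I (monomial f) s y u * ln (q y))"
        by (intro C.exp_bounded_integrable' exp_bounded_mult C.exp_bounded_lik bl)
      show "lik I (monomial f) s y u * (D + (\<Sum>j\<in>I. c j * y j)) \<le> lik I (monomial f) s y u * ln (q y)" for y
        using lnq[of y] by (intro mult_left_mono C.lik_nonneg) (simp add: D_def)
    qed
    also have "(\<integral>y. lik I (monomial f) s y u * (D + (\<Sum>j\<in>I. c j * y j)) \<partial>gaussian I)
       = D + (\<Sum>j\<in>I. c j * (sqrt (s j) * monomial f j u))" by (rule C.integral_lik_linear)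
    also have "(\<Sum>j\<in>I. c j * (sqrt (s j) * monomial f j u)) = real N * (\<alpha> * sqrt l * (S u) ^ p)"
    proof -
      have "sqrt (\<alpha>\<^sup>2 / d) * sqrt (l / d) = \<alpha> * sqrt l / d"
        using \<alpha> d l by (simp add: real_sqrt_divide)
      hence "(\<Sum>j\<in>I. c j * (sqrt (s j) * monomial f j u)) = (\<alpha> * sqrt l / d) * (\<Sum>j\<in>I. monomial sgn j v * monomial f j u)"
      proof -
        assume eq: "sqrt (\<alpha>\<^sup>2 / d) * sqrt (l / d) = \<alpha> * sqrt l / d"
        have "c j * (sqrt (s j) * monomial f j u) = (sqrt (\<alpha>\<^sup>2 / d) * sqrt (l / d)) * (monomial sgn j v * monomial f j u)" for j
          by (simp only: c_def s_def mult_ac)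
        thus ?thesis by (simp only: eq sum_distrib_left)
      qed
      also have "(\<Sum>j\<in>I. monomial sgn j v * monomial f j u) = (\<Sum>i<N. sgn (v i) * f (u i)) ^ p"
        unfolding I_def by (simp add: sum_monomial_product)
      also have "(\<Sum>i<N. sgn (v i) * f (u i)) = real N * S u"
        using N by (simp add: S_def v_def) (intro sum.cong, auto)
      also have "(real N * S u) ^ p = real N * d * (S u) ^ p" by (simp only: power_mult_distrib pow_pred d_def)
      finally show ?thesis using d by simp
    qed
    also have "D = - real N * ln 2 - real N * (\<alpha>\<^sup>2 / 2)"
    proof -
      have "(\<Sum>j\<in>I. (c j)\<^sup>2 / 2) = (\<Sum>j\<in>I. \<alpha>\<^sup>2 / d / 2)" by (intro sum.cong refl) (simp add: c2)
      also have "\<dots> = real N * (\<alpha>\<^sup>2 / 2)" using d by (simp add: cI)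
      finally show ?thesis by (simp add: D_def)
    qed
    finally show ?thesis by (simp add: algebra_simps)
  qed
  have comp[measurable]: "i < N \<Longrightarrow> (\<lambda>u. f (u i)) \<in> borel_measurable (prior N)" for i
    by (rule measurable_compose[OF _ f_measurable_nu]) (rule measurable_component_singleton, simp)
  have S01: "0 \<le> S u" "S u \<le> 1" for u
  proof -
    show "0 \<le> S u" by (simp add: S_def sum_nonneg)
    have "(\<Sum>i<N. \<bar>f (u i)\<bar>) \<le> (\<Sum>i<N. 1)" by (intro sum_mono f_bound)
    thus "S u \<le> 1" using N by (simp add: S_def)
  qed
  have S_meas[measurable]: "S \<in> borel_measurable (prior N)" unfolding S_def[abs_def] by measurable
  have iS: "integrable (prior N) S" using S01 by (intro C.integrable_const_bound[of _ 1]) auto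
  have iSp: "integrable (prior N) (\<lambda>u. (S u) ^ p)"
    using S01 by (intro C.integrable_const_bound[of _ 1]) (auto simp: power_le_one)
  have ES: "(\<integral>u. S u \<partial>prior N) = m1"
  proof -
    have fi: "integrable (prior N) (\<lambda>u. \<bar>f (u i)\<bar>)" if "i < N" for i
      using that f_bound by (intro C.integrable_const_bound[of _ 1]) auto
    have "(\<integral>u. \<bar>f (u i)\<bar> \<partial>prior N) = m1" if "i < N" for i
    proof -
      interpret PP: product_prob_space "\<lambda>_. \<nu>" "{..<N}" by unfold_locales
      have "distr (prior N) \<nu> (\<lambda>u. u i) = \<nu>" using that by (intro PP.PiM_component) simp
      hence "(\<integral>a. \<bar>f a\<bar> \<partial>\<nu>) = (\<integral>a. \<bar>f a\<bar> \<partial>distr (prior N) \<nu> (\<lambda>u. u i))" by simp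
      also have "\<dots> = (\<integral>u. \<bar>f (u i)\<bar> \<partial>prior N)"
        using that by (intro integral_distr) auto
      finally show ?thesis by (simp add: m1)
    qed
    thus ?thesis using N fi by (simp add: S_def Bochner_Integration.integral_sum)
  qed
  \<comment> \<open>Jensen's inequality for the p-th power, with Bernoulli's inequality as the
    tangent at m1.\<close>
  have ESp: "m1 ^ p \<le> (\<integral>u. (S u) ^ p \<partial>prior N)"
  proof -
    have "m1 ^ p * (1 + real p * (S u / m1 - 1)) \<le> (S u) ^ p" for u
    proof -
      have "1 + real p * (S u / m1 - 1) \<le> (1 + (S u / m1 - 1)) ^ p"
        using S01[of u] m1 by (intro Bernoulli_inequality) simp
      hence "m1 ^ p * (1 + real p * (S u / m1 - 1)) \<le> m1 ^ p * (S u / m1) ^ p" using m1 by (intro mult_left_mono) auto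
      also have "\<dots> = (S u) ^ p" using m1(2) by (simp add: power_divide)
      finally show ?thesis .
    qed
    hence "(\<integral>u. m1 ^ p * (1 + real p * (S u / m1 - 1)) \<partial>prior N) \<le> (\<integral>u. (S u) ^ p \<partial>prior N)"
      using iS iSp by (intro integral_mono) auto
    moreover have "(\<integral>u. m1 ^ p * (1 + real p * (S u / m1 - 1)) \<partial>prior N) = m1 ^ p"
      using iS m1(2) by (simp add: C.prob_space ES)
    ultimately show ?thesis by (simp only:)
  qed
  have "real N * (\<alpha> * sqrt l * m1 ^ p - \<alpha>\<^sup>2 / 2 - ln 2) \<le> real N * (\<alpha> * sqrt l * (\<integral>u. (S u) ^ p \<partial>prior N) - \<alpha>\<^sup>2 / 2 - ln 2)"
    using ESp \<alpha> l by (intro mult_left_mono diff_right_mono) auto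
  also have "\<dots> = (\<integral>u. real N * (\<alpha> * sqrt l * (S u) ^ p - \<alpha>\<^sup>2 / 2 - ln 2) \<partial>prior N)"
    using iSp by (simp add: C.prob_space)
  also have "\<dots> \<le> (\<integral>u. \<integral>y. lik I (monomial f) s y u * ln (q y) \<partial>gaussian I \<partial>prior N)"
    using iSp inner C.channel_swap(2)[OF s0, of "\<lambda>_. 1" 1, OF _ _ bl] by (intro integral_mono) auto
  also have "\<dots> = (\<integral>y. evid (prior N) I (monomial f) s y * ln (q y) \<partial>gaussian I)"
    by (rule C.evid_swap[OF s0 bl, symmetric])
  also note gibbs
  also have "\<alpha> * sqrt l * m1 ^ p - \<alpha>\<^sup>2 / 2 - ln 2 = l * m1 ^ (2 * p) / 2 - ln 2"
  proof -
    have "\<alpha> * sqrt l * m1 ^ p = \<alpha>\<^sup>2" by (simp add: \<alpha>_def power2_eq_square)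
    moreover have "\<alpha>\<^sup>2 = l * m1 ^ (2 * p)" using l by (simp add: \<alpha>_def power_mult_distrib power_mult[symmetric] mult.commute)
    ultimately show ?thesis by simp
  qed
  finally show ?thesis .
qed

end

section \<open>Symmetrisation\<close>

lemma tperm_in:
  assumes \<pi>: "\<pi> permutes {..<p}" and xs: "xs \<in> lists_in p B"
  shows "tperm p \<pi> xs \<in> lists_in p B"
proof -
  have "xs ! \<pi> k \<in> B" if "k < p" for k
  proof -
    have "\<pi> k < p" using permutes_in_image[OF \<pi>, of k] that by simp
    thus ?thesis using xs nth_mem[of "\<pi> k" xs] by (auto simp: lists_in_def)
  qed
  thus ?thesis by (auto simp: lists_in_def tperm_def)
qed

lemma tperm_tperm:
  assumes \<pi>: "\<pi> permutes {..<p}"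
  shows "tperm p \<pi> (tperm p \<sigma> xs) = tperm p (\<sigma> \<circ> \<pi>) xs"
proof -
  have "\<pi> k < p" if "k < p" for k using permutes_in_image[OF \<pi>, of k] that by simp
  thus ?thesis by (simp add: tperm_def)
qed

lemma tperm_id: "length xs = p \<Longrightarrow> tperm p id xs = xs"
  using map_nth[of xs] by (simp add: tperm_def)

lemma bij_betw_tperm:
  assumes \<pi>: "\<pi> permutes {..<p}"
  shows "bij_betw (tperm p \<pi>) (lists_in p B) (lists_in p B)"
proof (rule bij_betw_byWitness[where f'="tperm p (inv \<pi>)"])
  have i: "inv \<pi> permutes {..<p}" by (rule permutes_inv[OF \<pi>])
  show "\<forall>xs\<in>lists_in p B. tperm p (inv \<pi>) (tperm p \<pi> xs) = xs"
    by (auto simp: tperm_tperm[OF i] permutes_inv_o[OF \<pi>] tperm_id lists_in_def)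
  show "\<forall>xs\<in>lists_in p B. tperm p \<pi> (tperm p (inv \<pi>) xs) = xs"
    by (auto simp: tperm_tperm[OF \<pi>] permutes_inv_o[OF \<pi>] tperm_id lists_in_def)
  show "tperm p \<pi> ` lists_in p B \<subseteq> lists_in p B" using tperm_in[OF \<pi>] by blast
  show "tperm p (inv \<pi>) ` lists_in p B \<subseteq> lists_in p B" using tperm_in[OF i] by blast
qed

lemma monomial_tperm:
  assumes \<pi>: "\<pi> permutes {..<p}" and xs: "length xs = p"
  shows "monomial f (tperm p \<pi> xs) u = monomial f xs u"
proof -
  have "monomial f xs u = (\<Prod>k<p. f (u (xs ! k)))"
    using xs by (simp add: monomial_def prod.list_conv_set_nth atLeast0LessThan)
  also have "\<dots> = (\<Prod>k<p. f (u (xs ! \<pi> k)))"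
    by (rule prod.permute[OF \<pi>, unfolded comp_def])
  also have "\<dots> = monomial f (tperm p \<pi> xs) u"
    by (simp add: monomial_def prod.list_conv_set_nth atLeast0LessThan tperm_def)
  finally show ?thesis ..
qed

text \<open>Symmetrisation is linear and fixes a symmetric w, so adding the spike before or after
  symmetrising the noise gives the same tensor.\<close>

lemma symmetrize_shift:
  assumes w: "\<And>\<pi> xs. \<pi> permutes {..<p} \<Longrightarrow> xs \<in> tidx p N \<Longrightarrow> w (tperm p \<pi> xs) = w xs"
  shows "symmetrize p N (\<lambda>j\<in>tidx p N. Y j + w j) = (\<lambda>xs\<in>tidx p N. symmetrize p N Y xs + w xs)"
proof (rule ext)
  fix xs show "symmetrize p N (\<lambda>j\<in>tidx p N. Y j + w j) xs = (\<lambda>xs\<in>tidx p N. symmetrize p N Y xs + w xs) xs"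
  proof (cases "xs \<in> tidx p N")
    case True
    define Z where "Z = (\<lambda>j\<in>tidx p N. Y j + w j)"
    have "(\<Sum>\<pi>\<in>{\<pi>. \<pi> permutes {..<p}}. Z (tperm p \<pi> xs))
      = (\<Sum>\<pi>\<in>{\<pi>. \<pi> permutes {..<p}}. Y (tperm p \<pi> xs) + w xs)"
      using True w tperm_in[of _ p xs "{..<N}"] by (intro sum.cong) (auto simp: tidx_lists_in Z_def)
    also have "\<dots> = (\<Sum>\<pi>\<in>{\<pi>. \<pi> permutes {..<p}}. Y (tperm p \<pi> xs)) + fact p * w xs"
      by (simp add: sum.distrib card_permutations[of "{..<p}" p])
    finally show ?thesis using True unfolding Z_def[symmetric] by (simp add: symmetrize_def add_divide_distrib)
  qed (simp add: symmetrize_def)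
qed

text \<open>Each permutation of the index positions is a bijection of the index set that leaves w
  invariant, so all terms of the average have the same scalar product with w.\<close>

lemma symmetrize_inner:
  assumes w: "\<And>\<pi> xs. \<pi> permutes {..<p} \<Longrightarrow> xs \<in> tidx p N \<Longrightarrow> w (tperm p \<pi> xs) = w xs"
  shows "(\<Sum>xs\<in>tidx p N. w xs * symmetrize p N Y xs) = (\<Sum>xs\<in>tidx p N. w xs * Y xs)"
proof -
  let ?P = "{\<pi>. \<pi> permutes {..<p}}"
  have "(\<Sum>xs\<in>tidx p N. w xs * symmetrize p N Y xs) = (\<Sum>xs\<in>tidx p N. \<Sum>\<pi>\<in>?P. (1 / fact p) * (w xs * Y (tperm p \<pi> xs)))"
    by (intro sum.cong refl) (simp add: symmetrize_def sum_distrib_left mult_ac)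
  also have "\<dots> = (\<Sum>\<pi>\<in>?P. \<Sum>xs\<in>tidx p N. (1 / fact p) * (w xs * Y (tperm p \<pi> xs)))" by (rule sum.swap)
  also have "\<dots> = (\<Sum>\<pi>\<in>?P. (1 / fact p) * (\<Sum>xs\<in>tidx p N. w xs * Y xs))"
  proof (rule sum.cong[OF refl])
    fix \<pi> assume "\<pi> \<in> ?P"
    hence \<pi>: "\<pi> permutes {..<p}" by simp
    have "(\<Sum>xs\<in>tidx p N. w xs * Y (tperm p \<pi> xs)) = (\<Sum>xs\<in>tidx p N. w (tperm p \<pi> xs) * Y (tperm p \<pi> xs))"
      using w[OF \<pi>] by (intro sum.cong) auto
    also have "\<dots> = (\<Sum>xs\<in>tidx p N. w xs * Y xs)"
      unfolding tidx_lists_in by (rule sum.reindex_bij_betw[OF bij_betw_tperm[OF \<pi>]])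
    finally show "(\<Sum>xs\<in>tidx p N. (1 / fact p) * (w xs * Y (tperm p \<pi> xs))) = (1 / fact p) * (\<Sum>xs\<in>tidx p N. w xs * Y xs)"
      by (simp only: sum_distrib_left[symmetric])
  qed
  also have "\<dots> = (\<Sum>xs\<in>tidx p N. w xs * Y xs)" by (simp add: card_permutations[of "{..<p}" p])
  finally show ?thesis .
qed

lemma symmetrize_measurable [measurable]:
  "symmetrize p N \<in> PiM (tidx p N) (\<lambda>_. borel) \<rightarrow>\<^sub>M PiM (tidx p N) (\<lambda>_. borel)"
  unfolding symmetrize_def
proof (rule measurable_restrict)
  fix xs assume xs: "xs \<in> tidx p N"
  have "(\<lambda>Y. Y (tperm p \<pi> xs)) \<in> borel_measurable (PiM (tidx p N) (\<lambda>_. borel :: real measure))" if "\<pi> permutes {..<p}" for \<pi>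
    using tperm_in[OF that, of xs "{..<N}"] xs by (intro measurable_component_singleton) (simp add: tidx_lists_in)
  thus "(\<lambda>Y. 1 / fact p * (\<Sum>\<pi>\<in>{\<pi>. \<pi> permutes {..<p}}. Y (tperm p \<pi> xs))) \<in> borel_measurable (PiM (tidx p N) (\<lambda>_. borel :: real measure))"
    by (intro borel_measurable_times borel_measurable_const borel_measurable_sum) simp
qed

text \<open>With a constant ratio the likelihood depends on y only through scalar products with
  symmetric tensors. The likelihood ratio is therefore a function of the symmetrised
  observation.\<close>

lemma evid_symmetrize:
  "evid P (lists_in p {..<N}) (monomial f) (\<lambda>_. c) (symmetrize p N y) = evid P (lists_in p {..<N}) (monomial f) (\<lambda>_. c) y"
proof -
  have "lik (lists_in p {..<N}) (monomial f) (\<lambda>_. c) (symmetrize p N y) u = lik (lists_in p {..<N}) (monomial f) (\<lambda>_. c) y u" for u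
  proof -
    have "(\<Sum>xs\<in>lists_in p {..<N}. sqrt c * monomial f xs u * symmetrize p N y xs) = (\<Sum>xs\<in>lists_in p {..<N}. sqrt c * monomial f xs u * y xs)"
      unfolding tidx_lists_in[symmetric]
      by (rule symmetrize_inner[where w="\<lambda>xs. sqrt c * monomial f xs u"]) (simp add: monomial_tperm tidx_def)
    thus ?thesis by (simp add: lik_def tilt_def sum_subtractf)
  qed
  thus ?thesis by (simp add: evid_def)
qed

section \<open>Total variation\<close>

lemma dTV_le:
  assumes P: "prob_space P" and b: "\<And>A. A \<in> sets P \<Longrightarrow> \<bar>measure P A - measure Q A\<bar> \<le> c"
  shows "dTV P Q \<le> c"
  unfolding dTV_def using b by (intro cSUP_least) auto

lemma dTV_ge:
  assumes P: "prob_space P" and Q: "prob_space Q" and A: "A \<in> sets P"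
  shows "\<bar>measure P A - measure Q A\<bar> \<le> dTV P Q"
  unfolding dTV_def
proof (rule cSUP_upper[OF A])
  interpret P: prob_space P by (rule P)
  interpret Q: prob_space Q by (rule Q)
  have "\<bar>measure P B - measure Q B\<bar> \<le> 1" for B
    using P.prob_le_1[of B] Q.prob_le_1[of B] measure_nonneg[of P B] measure_nonneg[of Q B] by linarith
  thus "bdd_above ((\<lambda>A. \<bar>measure P A - measure Q A\<bar>) ` sets P)" by (auto intro!: bdd_aboveI2)
qed

lemma dTV_bounds:
  assumes P: "prob_space P" and Q: "prob_space Q"
  shows "0 \<le> dTV P Q" "dTV P Q \<le> 1"
proof -
  interpret P: prob_space P by (rule P)
  interpret Q: prob_space Q by (rule Q)
  show "0 \<le> dTV P Q" using dTV_ge[OF P Q sets.empty_sets] by simp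
  have "\<bar>measure P B - measure Q B\<bar> \<le> 1" for B
    using P.prob_le_1[of B] Q.prob_le_1[of B] measure_nonneg[of P B] measure_nonneg[of Q B] by linarith
  thus "dTV P Q \<le> 1" by (intro dTV_le P)
qed

context tensor_model
begin

text \<open>The identity is required only almost surely, because f has to be bounded everywhere
  while the entries lie in the bounded set only almost surely.\<close>

definition scaled :: "real \<Rightarrow> bool"
  where "scaled C \<longleftrightarrow> 0 < C \<and> (AE a in \<nu>. f a = a / C)"

section \<open>The laws of the two tensors expressed through the channel\<close>

lemma law_W_alt: "law_W p N = distr (gaussian (lists_in p {..<N})) (PiM (lists_in p {..<N}) (\<lambda>_. borel)) (symmetrize p N)"
  by (simp add: law_W_def tensor_space_def tidx_lists_in)

lemma symmetrize_gaussian: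
  "symmetrize p N \<in> gaussian (lists_in p {..<N}) \<rightarrow>\<^sub>M PiM (lists_in p {..<N}) (\<lambda>_. borel)"
  using symmetrize_measurable[of p N] by (simp add: tidx_lists_in measurable_cong_sets[OF sets_gaussian refl])

lemma prob_space_law_W: "prob_space (law_W p N)"
  unfolding law_W_alt by (intro prob_space.prob_space_distr prob_space_gaussian symmetrize_gaussian)

lemma sets_law: "sets (law_W p N) = sets (PiM (lists_in p {..<N}) (\<lambda>_. borel))"
  by (simp add: law_W_alt)

lemma measure_law_W:
  assumes A: "A \<in> sets (PiM (lists_in p {..<N}) (\<lambda>_. borel))"
  shows "measure (law_W p N) A = (\<integral>y. indicator A (symmetrize p N y) \<partial>gaussian (lists_in p {..<N}))"
proof -
  interpret W: prob_space "law_W p N" by (rule prob_space_law_W)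
  have "measure (law_W p N) A = (\<integral>z. indicator A z \<partial>law_W p N)" using A by (simp add: sets_law)
  also have "\<dots> = (\<integral>y. indicator A (symmetrize p N y) \<partial>gaussian (lists_in p {..<N}))"
    unfolding law_W_alt using A by (intro integral_distr symmetrize_gaussian) auto
  finally show ?thesis .
qed

lemma law_T_map_measurable:
  "(\<lambda>(Y, u). \<lambda>xs\<in>tidx p N. symmetrize p N Y xs + b * (\<Prod>k<p. u (xs ! k)))
    \<in> gaussian (lists_in p {..<N}) \<Otimes>\<^sub>M prior N \<rightarrow>\<^sub>M PiM (lists_in p {..<N}) (\<lambda>_. borel)"
  unfolding split_beta tidx_lists_in
proof (rule measurable_restrict)
  fix xs assume xs: "xs \<in> lists_in p {..<N}"
  have "(\<lambda>y. y xs) \<in> borel_measurable (PiM (lists_in p {..<N}) (\<lambda>_. borel :: real measure))"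
    using xs by (rule measurable_component_singleton)
  note 1 = measurable_compose[OF measurable_compose[OF measurable_fst symmetrize_gaussian] this]
  have "(\<lambda>u. u (xs ! k)) \<in> borel_measurable (prior N)" if "k < p" for k
  proof -
    have "xs ! k \<in> set xs" using xs that by (simp add: lists_in_def)
    hence "xs ! k \<in> {..<N}" using xs by (auto simp: lists_in_def)
    hence "(\<lambda>u. u (xs ! k)) \<in> prior N \<rightarrow>\<^sub>M \<nu>" by (rule measurable_component_singleton)
    thus ?thesis by (simp add: measurable_cong_sets[OF refl sets_nu])
  qed
  note 2 = measurable_compose[OF measurable_snd this]
  show "(\<lambda>q. symmetrize p N (fst q) xs + b * (\<Prod>k<p. snd q (xs ! k))) \<in> borel_measurable (gaussian (lists_in p {..<N}) \<Otimes>\<^sub>M prior N)"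
    by (intro borel_measurable_add borel_measurable_times borel_measurable_const borel_measurable_prod 1 2) simp_all
qed

lemma law_T_alt:
  "law_T p \<nu> \<beta> N = distr (gaussian (lists_in p {..<N}) \<Otimes>\<^sub>M prior N) (PiM (lists_in p {..<N}) (\<lambda>_. borel))
    (\<lambda>(Y, u). \<lambda>xs\<in>tidx p N. symmetrize p N Y xs + \<beta> / real N powr ((real p - 1) / 2) * (\<Prod>k<p. u (xs ! k)))"
  by (simp add: law_T_def tensor_space_def tidx_lists_in)

lemma prob_space_law_T: "prob_space (law_T p \<nu> \<beta> N)"
proof -
  interpret G: prob_space "gaussian (lists_in p {..<N})" by (rule prob_space_gaussian)
  interpret PN: prob_space "prior N" by (rule prob_space_prior)
  interpret GP: pair_prob_space "gaussian (lists_in p {..<N})" "prior N" by unfold_locales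
  show ?thesis unfolding law_T_alt by (intro GP.prob_space_distr law_T_map_measurable)
qed

text \<open>The spiked tensor is the symmetrisation of unsymmetrised noise plus the symmetric spike.
  Given u, the shift formula converts the spike into the factor \<open>lik\<close>, and averaging
  over u gives the evidence.\<close>

lemma measure_law_T:
  assumes C: "scaled C" and \<beta>: "0 < \<beta>" and N: "0 < N" and A: "A \<in> sets (PiM (lists_in p {..<N}) (\<lambda>_. borel))"
  shows "measure (law_T p \<nu> \<beta> N) A = (\<integral>y. evid (prior N) (lists_in p {..<N}) (monomial f)
      (\<lambda>_. (\<beta> * C ^ p)\<^sup>2 / real N ^ (p - 1)) y * indicator A (symmetrize p N y) \<partial>gaussian (lists_in p {..<N}))"
proof -
  define I where "I = lists_in p {..<N}"
  define s where "s = (\<lambda>_ :: nat list. (\<beta> * C ^ p)\<^sup>2 / real N ^ (p - 1))"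
  interpret Ch: channel "prior N" I "monomial f" unfolding I_def by (rule channel_prior')
  interpret G: prob_space "gaussian I" by (rule prob_space_gaussian)
  interpret PN: prob_space "prior N" by (rule prob_space_prior)
  interpret GP: pair_prob_space "gaussian I" "prior N" by unfold_locales
  interpret T: prob_space "law_T p \<nu> \<beta> N" by (rule prob_space_law_T)
  have s0: "\<forall>j. 0 \<le> s j" by (simp add: s_def)
  have C0: "0 < C" using C by (simp add: scaled_def)
  define b where "b = \<beta> / real N powr ((real p - 1) / 2)"
  \<comment> \<open>With u = C * f (u), the amplitude of the spike in terms of f is b * C^p, the
    square root of the ratio (\<beta> * C^p)^2 / N^(p - 1).\<close>
  have bs: "b * C ^ p = sqrt (s xs)" for xs
  proof -
    have "real N powr ((real p - 1) / 2) = sqrt (real N powr (real p - 1))"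
      using N by (simp add: powr_half_sqrt[symmetric] powr_powr)
    also have "real N powr (real p - 1) = real N ^ (p - 1)"
      using N p_pos by (simp add: powr_realpow[symmetric] of_nat_diff)
    finally show ?thesis using \<beta> C0 by (simp add: b_def s_def real_sqrt_divide)
  qed
  define w where "w u xs = sqrt (s xs) * monomial f xs u" for u xs
  define \<Phi> where "\<Phi> = (\<lambda>(Y, u). \<lambda>xs\<in>tidx p N. symmetrize p N Y xs + b * (\<Prod>k<p. u (xs ! k)))"
  have \<Phi>m: "\<Phi> \<in> gaussian I \<Otimes>\<^sub>M prior N \<rightarrow>\<^sub>M PiM I (\<lambda>_. borel)"
    unfolding \<Phi>_def I_def by (rule law_T_map_measurable)
  have A': "A \<in> sets (PiM I (\<lambda>_. borel))" using A by (simp add: I_def)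
  have sym: "symmetrize p N \<in> PiM I (\<lambda>_. borel) \<rightarrow>\<^sub>M PiM I (\<lambda>_. borel)"
    using symmetrize_measurable[of p N] by (simp add: tidx_lists_in I_def)
  have iA: "(\<lambda>y. indicator A (symmetrize p N y) :: real) \<in> borel_measurable (PiM I (\<lambda>_. borel))"
    by (rule measurable_compose[OF sym borel_measurable_indicator[OF A']])
  have bA: "exp_bounded I (\<lambda>y. indicator A (symmetrize p N y))"
    by (rule exp_boundedI[OF iA, where C=1 and c=0]) (simp add: indicator_def)
  have good: "AE u in prior N. \<forall>i\<in>{..<N}. f (u i) = u i / C"
  proof (rule AE_finite_allI)
    fix i assume "i \<in> {..<N}"
    thus "AE u in prior N. f (u i) = u i / C"
      using C by (intro AE_PiM_component prob_space_axioms) (auto simp: scaled_def)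
  qed simp
  have \<Phi>eq: "\<Phi> (Y, u) = symmetrize p N (\<lambda>j\<in>I. Y j + w u j)" if u: "\<forall>i\<in>{..<N}. f (u i) = u i / C" for Y u
  proof -
    have "b * (\<Prod>k<p. u (xs ! k)) = w u xs" if xs: "xs \<in> tidx p N" for xs
    proof -
      have l: "length xs = p" "set xs \<subseteq> {..<N}" using xs by (auto simp: tidx_def)
      have "monomial f xs u = (\<Prod>k<p. f (u (xs ! k)))"
        using l by (simp add: monomial_def prod.list_conv_set_nth atLeast0LessThan)
      also have "\<dots> = (\<Prod>k<p. u (xs ! k) / C)"
        using u l by (intro prod.cong refl) (metis lessThan_iff nth_mem subsetD)
      also have "\<dots> = (\<Prod>k<p. u (xs ! k)) / C ^ p" by (simp add: prod_dividef)
      finally have "(\<Prod>k<p. u (xs ! k)) = C ^ p * monomial f xs u" using C0 by simp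
      thus ?thesis by (simp add: w_def bs[of xs, symmetric])
    qed
    hence "\<Phi> (Y, u) = (\<lambda>xs\<in>tidx p N. symmetrize p N Y xs + w u xs)"
      by (auto simp: \<Phi>_def)
    also have "\<dots> = symmetrize p N (\<lambda>j\<in>tidx p N. Y j + w u j)"
      by (rule symmetrize_shift[symmetric]) (simp add: w_def s_def monomial_tperm tidx_def)
    finally show ?thesis by (simp add: I_def tidx_lists_in)
  qed
  have m: "(\<lambda>q. indicator A (\<Phi> q) :: real) \<in> borel_measurable (gaussian I \<Otimes>\<^sub>M prior N)"
    by (rule measurable_compose[OF \<Phi>m borel_measurable_indicator[OF A']])
  have int: "integrable (gaussian I \<Otimes>\<^sub>M prior N) (\<lambda>q. indicator A (\<Phi> q) :: real)"
    using m by (intro GP.integrable_const_bound[of _ 1]) (auto simp: indicator_def)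
  have int': "integrable (gaussian I \<Otimes>\<^sub>M prior N) (case_prod (\<lambda>Y u. indicator A (\<Phi> (Y, u)) :: real))"
    using int by (simp add: split_beta')
  have "measure (law_T p \<nu> \<beta> N) A = (\<integral>z. indicator A z \<partial>law_T p \<nu> \<beta> N)" using A by (simp add: law_T_alt)
  also have "\<dots> = (\<integral>q. indicator A (\<Phi> q) \<partial>(gaussian I \<Otimes>\<^sub>M prior N))"
    unfolding law_T_alt \<Phi>_def[symmetric, unfolded b_def] I_def[symmetric]
    using A' by (intro integral_distr \<Phi>m) auto
  also have "\<dots> = (\<integral>u. \<integral>Y. indicator A (\<Phi> (Y, u)) \<partial>gaussian I \<partial>prior N)"
    using GP.integral_snd[OF int'] by (simp add: split_beta')
  also have "\<dots> = (\<integral>u. \<integral>y. lik I (monomial f) s y u * indicator A (symmetrize p N y) \<partial>gaussian I \<partial>prior N)"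
  proof (rule integral_cong_AE)
    show "(\<lambda>u. \<integral>Y. (indicator A (\<Phi> (Y, u)) :: real) \<partial>gaussian I) \<in> borel_measurable (prior N)"
      using GP.integrable_snd[OF int'] by simp
    show "(\<lambda>u. \<integral>y. lik I (monomial f) s y u * indicator A (symmetrize p N y) \<partial>gaussian I) \<in> borel_measurable (prior N)"
      using Ch.channel_swap(2)[OF s0, of "\<lambda>_. 1" 1, OF _ _ bA] by simp
    show "AE u in prior N. (\<integral>Y. indicator A (\<Phi> (Y, u)) \<partial>gaussian I)
        = (\<integral>y. lik I (monomial f) s y u * indicator A (symmetrize p N y) \<partial>gaussian I)"
      using good
    proof eventually_elim
      case (elim u)
      show ?case unfolding \<Phi>eq[OF elim] lik_def w_def[symmetric]
        by (rule integral_gaussian_shift[OF Ch.finite_I iA])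
    qed
  qed
  also have "\<dots> = (\<integral>y. evid (prior N) I (monomial f) s y * indicator A (symmetrize p N y) \<partial>gaussian I)"
    by (rule Ch.evid_swap[OF s0 bA, symmetric])
  finally show ?thesis by (simp add: I_def s_def)
qed

lemma dTV_le_L1:
  assumes C: "scaled C" and \<beta>: "0 < \<beta>" and N: "0 < N"
  shows "dTV (law_W p N) (law_T p \<nu> \<beta> N) \<le> (\<integral>y. \<bar>evid (prior N) (lists_in p {..<N}) (monomial f)
      (\<lambda>_. (\<beta> * C ^ p)\<^sup>2 / real N ^ (p - 1)) y - 1\<bar> \<partial>gaussian (lists_in p {..<N}))"
proof (rule dTV_le[OF prob_space_law_W])
  define I where "I = lists_in p {..<N}"
  define E where "E = evid (prior N) I (monomial f) (\<lambda>_. (\<beta> * C ^ p)\<^sup>2 / real N ^ (p - 1))"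
  interpret Ch: channel "prior N" I "monomial f" unfolding I_def by (rule channel_prior')
  interpret G: prob_space "gaussian I" by (rule prob_space_gaussian)
  fix A assume "A \<in> sets (law_W p N)"
  hence A: "A \<in> sets (PiM (lists_in p {..<N}) (\<lambda>_. borel))" by (simp add: sets_law)
  define h where "h y = (indicator A (symmetrize p N y) :: real)" for y
  have "h \<in> borel_measurable (PiM I (\<lambda>_. borel))"
    unfolding h_def I_def using symmetrize_measurable[of p N] A
    by (intro measurable_compose[OF _ borel_measurable_indicator[OF A]]) (simp add: tidx_lists_in)
  hence bh: "exp_bounded I h" by (rule exp_boundedI[where C=1 and c=0]) (simp add: h_def indicator_def)
  have bE: "exp_bounded I E" unfolding E_def by (rule Ch.exp_bounded_evid) simp
  have iE: "integrable (gaussian I) E" and ih: "integrable (gaussian I) h" and iEh: "integrable (gaussian I) (\<lambda>y. E y * h y)"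
    by (intro Ch.exp_bounded_integrable' exp_bounded_mult bE bh)+
  have "measure (law_W p N) A = (\<integral>y. h y \<partial>gaussian I)"
    unfolding measure_law_W[OF A] by (simp add: h_def I_def)
  moreover have "measure (law_T p \<nu> \<beta> N) A = (\<integral>y. E y * h y \<partial>gaussian I)"
    unfolding measure_law_T[OF C \<beta> N A] by (simp add: h_def E_def I_def)
  ultimately have "measure (law_W p N) A - measure (law_T p \<nu> \<beta> N) A = (\<integral>y. h y - E y * h y \<partial>gaussian I)"
    using ih iEh by simp
  also have "\<bar>\<dots>\<bar> \<le> (\<integral>y. \<bar>h y - E y * h y\<bar> \<partial>gaussian I)" by (rule integral_abs_bound)
  also have "\<dots> \<le> (\<integral>y. \<bar>E y - 1\<bar> \<partial>gaussian I)"
  proof (rule integral_mono)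
    show "integrable (gaussian I) (\<lambda>y. \<bar>h y - E y * h y\<bar>)" using ih iEh by simp
    show "integrable (gaussian I) (\<lambda>y. \<bar>E y - 1\<bar>)" using iE by simp
    show "\<bar>h y - E y * h y\<bar> \<le> \<bar>E y - 1\<bar>" for y by (simp add: h_def indicator_def abs_minus_commute)
  qed
  finally show "\<bar>measure (law_W p N) A - measure (law_T p \<nu> \<beta> N) A\<bar> \<le> (\<integral>y. \<bar>evid (prior N) (lists_in p {..<N}) (monomial f)
      (\<lambda>_. (\<beta> * C ^ p)\<^sup>2 / real N ^ (p - 1)) y - 1\<bar> \<partial>gaussian (lists_in p {..<N}))"
    by (simp add: E_def I_def)
qed

lemma dTV_ge_test:
  assumes C: "scaled C" and \<beta>: "0 < \<beta>" and N: "0 < N" and l: "l = (\<beta> * C ^ p)\<^sup>2"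
    and g: "0 < g" "4 \<le> g * real N" "g * real N \<le> TK N l"
  shows "1 - 16 * (l + (2 * real p * l)\<^sup>2) / (g\<^sup>2 * real N) - exp (- (g * real N / 2)) \<le> dTV (law_W p N) (law_T p \<nu> \<beta> N)"
proof -
  define I where "I = lists_in p {..<N}"
  define E where "E = evid (prior N) I (monomial f) (\<lambda>_. l / real N ^ (p - 1))"
  have l0: "0 < l" using C \<beta> by (simp add: l scaled_def)
  interpret Ch: channel "prior N" I "monomial f" unfolding I_def by (rule channel_prior')
  have s0: "\<forall>j :: nat list. 0 \<le> l / real N ^ (p - 1)" using l0 by simp
  have bE: "exp_bounded I E" unfolding E_def by (rule Ch.exp_bounded_evid[OF s0])
  note [measurable] = exp_bounded_measurable[OF bE]
  \<comment> \<open>The rejection region of the likelihood ratio test. By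
    \<open>evid_symmetrize\<close> it may be evaluated on y in place of its symmetrisation.\<close>
  define A where "A = {y \<in> space (PiM I (\<lambda>_. borel)). g * real N / 2 \<le> ln (E y)}"
  have A: "A \<in> sets (PiM (lists_in p {..<N}) (\<lambda>_. borel))" unfolding A_def I_def[symmetric] by measurable
  have ind: "indicator A (symmetrize p N y) = (if g * real N / 2 \<le> ln (E y) then 1 else 0 :: real)" for y
  proof -
    have "symmetrize p N y \<in> space (PiM I (\<lambda>_. borel))"
      by (auto simp: symmetrize_def space_PiM I_def tidx_lists_in PiE_def extensional_def)
    moreover have "E (symmetrize p N y) = E y" unfolding E_def I_def by (rule evid_symmetrize)
    ultimately show ?thesis by (simp add: A_def)
  qed
  have W: "measure (law_W p N) A \<le> exp (- (g * real N / 2))"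
    unfolding measure_law_W[OF A] ind using likelihood_ratio_test(1)[OF N l0 g] by (simp add: E_def I_def)
  have bi: "exp_bounded I (\<lambda>y. if g * real N / 2 \<le> ln (E y) then a else b)" for a b :: real
    by (rule exp_boundedI[where C="\<bar>a\<bar> + \<bar>b\<bar>" and c=0]) auto
  have i: "integrable (gaussian I) (\<lambda>y. E y * (if g * real N / 2 \<le> ln (E y) then a else b))" for a b :: real
    by (intro Ch.exp_bounded_integrable' exp_bounded_mult bE bi)
  have "1 = (\<integral>y. E y \<partial>gaussian I)" unfolding E_def by (rule Ch.integral_evid[OF s0, symmetric])
  also have "\<dots> = (\<integral>y. E y * (if g * real N / 2 \<le> ln (E y) then 1 else 0) + E y * (if g * real N / 2 \<le> ln (E y) then 0 else 1) \<partial>gaussian I)"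
    by (intro Bochner_Integration.integral_cong refl) simp
  also have "\<dots> = (\<integral>y. E y * (if g * real N / 2 \<le> ln (E y) then 1 else 0) \<partial>gaussian I)
      + (\<integral>y. E y * (if g * real N / 2 \<le> ln (E y) then 0 else 1) \<partial>gaussian I)"
    by (rule Bochner_Integration.integral_add[OF i i])
  also have "(\<integral>y. E y * (if g * real N / 2 \<le> ln (E y) then 1 else 0) \<partial>gaussian I) = measure (law_T p \<nu> \<beta> N) A"
    unfolding measure_law_T[OF C \<beta> N A] ind by (simp add: E_def I_def l)
  finally have T: "1 - 16 * (l + (2 * real p * l)\<^sup>2) / (g\<^sup>2 * real N) \<le> measure (law_T p \<nu> \<beta> N) A"
    using likelihood_ratio_test(2)[OF N l0 g] by (simp add: E_def I_def)
  have "A \<in> sets (law_W p N)" using A by (simp add: sets_law)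
  from dTV_ge[OF prob_space_law_W prob_space_law_T[of \<beta> N] this] show ?thesis using W T by linarith
qed

end

section \<open>The threshold\<close>

context centered_model
begin

lemma undetectable:
  assumes C: "scaled C" and \<beta>: "0 < \<beta>" and l: "(\<beta> * C ^ p)\<^sup>2 < l"
    and lim: "(\<lambda>N. TK N l / real N) \<longlonglongrightarrow> 0"
  shows "(\<lambda>N. dTV (law_W p N) (law_T p \<nu> \<beta> N)) \<longlonglongrightarrow> 0"
proof (rule tendsto_sandwich[OF _ _ tendsto_const])
  have "0 < (\<beta> * C ^ p)\<^sup>2" using C \<beta> by (simp add: scaled_def)
  from evid_L1_limit[OF this l lim]
  show "(\<lambda>N. \<integral>y. \<bar>evid (prior N) (lists_in p {..<N}) (monomial f) (\<lambda>_. (\<beta> * C ^ p)\<^sup>2 / real N ^ (p - 1)) y - 1\<bar>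
      \<partial>gaussian (lists_in p {..<N})) \<longlonglongrightarrow> 0" .
  show "eventually (\<lambda>N. 0 \<le> dTV (law_W p N) (law_T p \<nu> \<beta> N)) sequentially"
    using dTV_bounds(1)[OF prob_space_law_W prob_space_law_T] by simp
  show "eventually (\<lambda>N. dTV (law_W p N) (law_T p \<nu> \<beta> N) \<le> (\<integral>y. \<bar>evid (prior N) (lists_in p {..<N}) (monomial f)
      (\<lambda>_. (\<beta> * C ^ p)\<^sup>2 / real N ^ (p - 1)) y - 1\<bar> \<partial>gaussian (lists_in p {..<N}))) sequentially"
    using eventually_gt_at_top[of 0] by eventually_elim (rule dTV_le_L1[OF C \<beta>])
qed

text \<open>Failure of convergence at l' concerns only a subsequence. \<open>TK_limit\<close>, read
  contrapositively, upgrades it to linear growth at the larger value (\<beta> * C^p)^2 for all large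
  N, as the test requires.\<close>

lemma detectable:
  assumes C: "scaled C" and \<beta>: "0 < \<beta>" and l: "0 < l'" "l' < (\<beta> * C ^ p)\<^sup>2"
    and nolim: "\<not> (\<lambda>N. TK N l' / real N) \<longlonglongrightarrow> 0"
  shows "(\<lambda>N. dTV (law_W p N) (law_T p \<nu> \<beta> N)) \<longlonglongrightarrow> 1"
proof -
  define l where "l = (\<beta> * C ^ p)\<^sup>2"
  have "\<not> (\<forall>\<theta>>0. \<forall>n0. \<exists>n\<ge>n0. TK n l \<le> \<theta> * real n)"
    using TK_limit[of l' l] l nolim by (auto simp: l_def)
  then obtain g n0 where g: "0 < g" and n0: "\<And>n. n \<ge> n0 \<Longrightarrow> g * real n < TK n l" by (metis not_le)
  show ?thesis
  proof (rule tendsto_sandwich[OF _ _ _ tendsto_const])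
    define K where "K = 16 * (l + (2 * real p * l)\<^sup>2) / g\<^sup>2"
    have "(\<lambda>N. 1 - K * inverse (real N) - exp (- (g / 2 * real N))) \<longlonglongrightarrow> 1 - K * 0 - 0"
    proof (intro tendsto_intros lim_inverse_n)
      have "filterlim (\<lambda>N. g / 2 * real N) at_top sequentially"
        using g by (intro filterlim_tendsto_pos_mult_at_top[OF tendsto_const] filterlim_real_sequentially) simp
      hence "filterlim (\<lambda>N. - (g / 2 * real N)) at_bot sequentially" by (simp add: filterlim_uminus_at_top)
      thus "(\<lambda>N. exp (- (g / 2 * real N))) \<longlonglongrightarrow> 0" by (rule filterlim_compose[OF exp_at_bot])
    qed
    thus "(\<lambda>N. 1 - K * inverse (real N) - exp (- (g / 2 * real N))) \<longlonglongrightarrow> 1" by simp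
    obtain n1 :: nat where n1: "4 / g \<le> real n1" using real_arch_simple by blast
    show "eventually (\<lambda>N. 1 - K * inverse (real N) - exp (- (g / 2 * real N)) \<le> dTV (law_W p N) (law_T p \<nu> \<beta> N)) sequentially"
      using eventually_ge_at_top[of "max 1 (max n0 n1)"]
    proof eventually_elim
      case (elim N)
      have "4 / g \<le> real N" using n1 elim by linarith
      hence "4 \<le> g * real N" using g by (simp add: pos_divide_le_eq mult.commute)
      moreover have "g * real N \<le> TK N l" using n0[of N] elim by simp
      ultimately have "1 - 16 * (l + (2 * real p * l)\<^sup>2) / (g\<^sup>2 * real N) - exp (- (g * real N / 2)) \<le> dTV (law_W p N) (law_T p \<nu> \<beta> N)"
        using elim by (intro dTV_ge_test[OF C \<beta> _ l_def g]) auto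
      moreover have "16 * (l + (2 * real p * l)\<^sup>2) / (g\<^sup>2 * real N) = K * inverse (real N)" by (simp add: K_def divide_inverse)
      moreover have "g * real N / 2 = g / 2 * real N" by simp
      ultimately show ?case by (simp only:)
    qed
    show "eventually (\<lambda>N. dTV (law_W p N) (law_T p \<nu> \<beta> N) \<le> 1) sequentially"
      using dTV_bounds(2)[OF prob_space_law_W prob_space_law_T] by simp
  qed
qed

lemma threshold:
  assumes C: "scaled C" and f: "0 < (\<integral>a. \<bar>f a\<bar> \<partial>\<nu>)"
  shows "\<exists>\<beta>c>0.
    (\<forall>\<beta>. 0 < \<beta> \<and> \<beta> < \<beta>c \<longrightarrow> (\<lambda>N. dTV (law_W p N) (law_T p \<nu> \<beta> N)) \<longlonglongrightarrow> 0) \<and>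
    (\<forall>\<beta>. \<beta> > \<beta>c \<longrightarrow> (\<lambda>N. dTV (law_W p N) (law_T p \<nu> \<beta> N)) \<longlonglongrightarrow> 1)"
proof -
  define S where "S = {l. 0 < l \<and> (\<lambda>N. TK N l / real N) \<longlonglongrightarrow> 0}"
  define m1 where "m1 = (\<integral>a. \<bar>f a\<bar> \<partial>\<nu>)"
  have C0: "0 < C" using C by (simp add: scaled_def)
  have small: "1 / 4 \<in> S"
  proof -
    have "(\<lambda>N. TK N (1 / 4) / real N) \<longlonglongrightarrow> 0"
    proof (rule tendsto_sandwich[OF _ _ tendsto_const])
      have "(\<lambda>N. (1 / 2) * inverse (real N)) \<longlonglongrightarrow> (1 / 2) * 0" by (intro tendsto_intros lim_inverse_n)
      thus "(\<lambda>N. (1 / 2) * inverse (real N)) \<longlonglongrightarrow> 0" by simp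
      show "eventually (\<lambda>N. 0 \<le> TK N (1 / 4) / real N) sequentially" by (simp add: TK_nonneg)
      show "eventually (\<lambda>N. TK N (1 / 4) / real N \<le> (1 / 2) * inverse (real N)) sequentially"
        using eventually_gt_at_top[of 0]
      proof eventually_elim
        case (elim N)
        thus ?case using TK_small[of N "1 / 4"] by (simp add: field_simps)
      qed
    qed
    thus ?thesis by (simp add: S_def)
  qed
  \<comment> \<open>Beyond this value \<open>TK_lower\<close> gives \<open>TK N l\<close> at least
    N, which excludes convergence of the quotient to 0.\<close>
  define b where "b = 2 * (1 + ln 2) / m1 ^ (2 * p)"
  have large: "l \<le> b" if "l \<in> S" for l
  proof (rule ccontr)
    assume "\<not> l \<le> b"
    hence "b < l" by simp
    have m: "0 < m1 ^ (2 * p)" using f by (simp add: m1_def)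
    have l: "0 < l" "(\<lambda>N. TK N l / real N) \<longlonglongrightarrow> 0" using that by (auto simp: S_def)
    have "2 * (1 + ln 2) < l * m1 ^ (2 * p)" using \<open>b < l\<close> m by (simp add: b_def pos_divide_less_eq)
    hence "1 \<le> l * m1 ^ (2 * p) / 2 - ln 2" by simp
    hence "1 \<le> TK N l / real N" if "0 < N" for N
    proof -
      have "real N * 1 \<le> real N * (l * m1 ^ (2 * p) / 2 - ln 2)" using \<open>1 \<le> _\<close> by (intro mult_left_mono) auto
      also have "\<dots> \<le> TK N l" by (rule TK_lower[OF that l(1) m1_def]) (use f in \<open>simp add: m1_def\<close>)
      finally show ?thesis using that by simp
    qed
    hence "\<forall>N\<ge>1. 1 \<le> TK N l / real N" by simp
    with l(2) have "1 \<le> (0 :: real)" by (blast intro: LIMSEQ_le_const)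
    thus False by simp
  qed
  have bdd: "bdd_above S" using large by (rule bdd_aboveI)
  define lc where "lc = Sup S"
  have lc: "1 / 4 \<le> lc" unfolding lc_def by (rule cSup_upper[OF small bdd])
  \<comment> \<open>Solves (\<beta>c * C^p)^2 = lc, translating the threshold from ratios for the
    rescaled entries back to \<beta>.\<close>
  define \<beta>c where "\<beta>c = sqrt lc / C ^ p"
  have \<beta>c: "0 < \<beta>c" using lc C0 by (simp add: \<beta>c_def)
  have lc_eq: "(\<beta>c * C ^ p)\<^sup>2 = lc" using lc C0 by (simp add: \<beta>c_def)
  show ?thesis
  proof (intro exI[of _ \<beta>c] conjI allI impI \<beta>c)
    fix \<beta> assume \<beta>: "0 < \<beta> \<and> \<beta> < \<beta>c"
    have "(\<beta> * C ^ p)\<^sup>2 < (\<beta>c * C ^ p)\<^sup>2" using \<beta> C0 by (intro power_strict_mono mult_strict_right_mono) auto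
    then obtain l where l: "l \<in> S" "(\<beta> * C ^ p)\<^sup>2 < l"
      using less_cSupE[of "(\<beta> * C ^ p)\<^sup>2" S] small unfolding lc_eq lc_def by blast
    thus "(\<lambda>N. dTV (law_W p N) (law_T p \<nu> \<beta> N)) \<longlonglongrightarrow> 0"
      using \<beta> by (intro undetectable[OF C]) (auto simp: S_def)
  next
    fix \<beta> assume \<beta>: "\<beta>c < \<beta>"
    have "(\<beta>c * C ^ p)\<^sup>2 < (\<beta> * C ^ p)\<^sup>2" using \<beta> \<beta>c C0 by (intro power_strict_mono mult_strict_right_mono) auto
    hence lt: "lc < (\<beta> * C ^ p)\<^sup>2" by (simp only: lc_eq)
    define l' where "l' = (lc + (\<beta> * C ^ p)\<^sup>2) / 2"
    have l': "lc < l'" "l' < (\<beta> * C ^ p)\<^sup>2" using lt by (auto simp: l'_def)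
    have "l' \<notin> S" using cSup_upper[OF _ bdd, of l'] l' by (auto simp: lc_def)
    moreover have "0 < l'" using l' lc by linarith
    ultimately have "\<not> (\<lambda>N. TK N l' / real N) \<longlonglongrightarrow> 0" by (simp add: S_def)
    thus "(\<lambda>N. dTV (law_W p N) (law_T p \<nu> \<beta> N)) \<longlonglongrightarrow> 1"
      using \<beta> \<beta>c l' \<open>0 < l'\<close> by (intro detectable[OF C]) auto
  qed
qed

end

section \<open>Reduction to entries in [-1, 1]\<close>

theorem theorem1:
  fixes p :: nat and \<mu> :: "real measure" and \<Lambda> :: "real set"
  assumes "p \<ge> 3"
    and "prob_space \<mu>"
    and "sets \<mu> = sets borel"
    and "bounded \<Lambda>"
    and "AE a in \<mu>. a \<in> \<Lambda>"
    and "(\<integral>a. a \<partial>\<mu>) = 0"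
    and "\<mu> \<noteq> return borel 0"
  shows "\<exists>\<beta>c>0.
    (\<forall>\<beta>. 0 < \<beta> \<and> \<beta> < \<beta>c \<longrightarrow> (\<lambda>N. dTV (law_W p N) (law_T p \<mu> \<beta> N)) \<longlonglongrightarrow> 0) \<and>
    (\<forall>\<beta>. \<beta> > \<beta>c \<longrightarrow> (\<lambda>N. dTV (law_W p N) (law_T p \<mu> \<beta> N)) \<longlonglongrightarrow> 1)"
proof -
  interpret prob_space \<mu> by (rule assms(2))
  note [measurable_cong] = assms(3)
  obtain C where C: "0 < C" "\<And>a. a \<in> \<Lambda> \<Longrightarrow> \<bar>a\<bar> \<le> C"
    using assms(4) by (auto simp: bounded_pos)
  \<comment> \<open>Clamping changes a / C only on a null set and makes the bound by 1 hold
    everywhere, as the locale demands.\<close>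
  define f where "f a = max (- 1) (min 1 (a / C))" for a
  have f_AE: "AE a in \<mu>. f a = a / C"
    using assms(5)
  proof eventually_elim
    case (elim a)
    hence "\<bar>a\<bar> \<le> C" by (rule C(2))
    hence "- 1 \<le> a / C" "a / C \<le> 1" using C(1) by (auto simp: pos_le_divide_eq)
    thus ?case by (simp add: f_def)
  qed
  have f_meas: "f \<in> borel_measurable borel" unfolding f_def[abs_def] by measurable
  have f_meas': "f \<in> borel_measurable \<mu>" using f_meas by measurable
  have f_bound: "\<bar>f a\<bar> \<le> 1" for a by (auto simp: f_def)
  have "(\<integral>a. f a \<partial>\<mu>) = (\<integral>a. a / C \<partial>\<mu>)"
    by (rule integral_cong_AE[OF f_meas' _ f_AE]) measurable
  hence centered: "(\<integral>a. f a \<partial>\<mu>) = 0" using assms(6) by simp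
  interpret centered_model \<mu> f p
    using assms(1,3) f_meas f_bound centered by unfold_locales auto
  \<comment> \<open>If the first absolute moment of f vanished, a would be 0 almost surely and \<mu>
    would be the point mass at 0.\<close>
  have "0 < (\<integral>a. \<bar>f a\<bar> \<partial>\<mu>)"
  proof (rule ccontr)
    assume "\<not> 0 < (\<integral>a. \<bar>f a\<bar> \<partial>\<mu>)"
    moreover have "0 \<le> (\<integral>a. \<bar>f a\<bar> \<partial>\<mu>)" by simp
    ultimately have "(\<integral>a. \<bar>f a\<bar> \<partial>\<mu>) = 0" by linarith
    moreover have "integrable \<mu> (\<lambda>a. \<bar>f a\<bar>)"
      using f_bound f_meas' by (intro integrable_const_bound[of _ 1]) auto
    ultimately have "AE a in \<mu>. \<bar>f a\<bar> = 0" by (subst (asm) integral_nonneg_eq_0_iff_AE) auto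
    with f_AE have zero: "AE a in \<mu>. a = 0"
    proof eventually_elim
      case (elim a)
      thus ?case using C by simp
    qed
    have "\<mu> = return borel 0"
    proof (rule measure_eqI)
      fix A assume A: "A \<in> sets \<mu>"
      hence A': "A \<in> sets borel" by (simp add: assms(3))
      have "emeasure \<mu> A = (\<integral>\<^sup>+a. indicator A a \<partial>\<mu>)" using A by simp
      also have "\<dots> = (\<integral>\<^sup>+a. indicator A 0 \<partial>\<mu>)"
        by (rule nn_integral_cong_AE) (use zero in eventually_elim, simp)
      also have "\<dots> = indicator A 0" by (simp add: emeasure_space_1)
      finally show "emeasure \<mu> A = emeasure (return borel 0) A" using A' by simp
    qed (simp add: assms(3))
    with assms(7) show False by simp
  qed
  moreover have "scaled C" using C f_AE by (simp add: scaled_def)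
  ultimately show ?thesis by (intro threshold)
qed

end
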